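(* Let $(\lambda_1,\lambda_2)$ be in the unstable regime. Let $v\in H\setminus\{0\}$ be a real positive minimizer of the functional $$J(w)=\frac{\|\nabla w\|_2^3\,\|w\|_2}{-\lambda_1\|w\|_4^4-\lambda_2\int_{\mathbb{R}^3}(K\star|w|^2)|w|^2dx}$$ over all $w\in H$ for which the denominator is positive, and suppose that $v$ solves, for some $\mu>0$, $$-\tfrac12\Delta v+\lambda_1|v|^2v+\lambda_2(K\star|v|^2)v+\mu v=0 .$$ Then, setting $c=\|v\|_2^2$, we have $E(v)=\gamma(c)$.
   Context: $H=H^1(\mathbb{R}^3,\mathbb{C})$. $f\mapsto K\star f$ is the Fourier multiplier with symbol $\hat K(\xi)=\frac43\pi\,\frac{2\xi_3^2-\xi_1^2-\xi_2^2}{|\xi|^2}$ (convolution with the dipolar kernel $K(x)=\frac{1-3\cos^2\theta}{|x|^3}$, $\theta$ the angle between $x$ and $(0,0,1)$). The pair $(\lambda_1,\lambda_2)\in\mathbb{R}^2$ with $\lambda_2\ne0$ is in the unstable regime if $\lambda_1-\frac43\pi\lambda_2<0$ when $\lambda_2>0$, and $\lambda_1+\frac83\pi\lambda_2<0$ when $\lambda_2<0$. $E(u)=\frac12\|\nabla u\|_2^2+\frac{\lambda_1}{2}\|u\|_4^4+\frac{\lambda_2}{2}\int_{\mathbb{R}^3}(K\star|u|^2)|u|^2dx$ and $S(c)=\{u\in H:\|u\|_2^2=c\}$. The mountain pass level is $\gamma(c)=\inf_{g\in\Gamma(c)}\max_{t\in[0,1]}E(g(t))$, where $\Gamma(c)=\{g\in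 C([0,1],S(c)): g(0)\in A_k,\ E(g(1))<0\}$, $A_k=\{u\in S(c):\|\nabla u\|_2^2\le k\}$, and $k=k(c)>0$ is a fixed number such that $\gamma(c)>\max\{\sup_{g\in\Gamma(c)}E(g(0)),\sup_{g\in\Gamma(c)}E(g(1))\}$ (such a $k$ exists in the unstable regime). *)

theory Defs
  imports "HOL-Analysis.Analysis"
begin

text \<open>
  Elements of Lebesgue and Sobolev spaces are represented by Borel functions
  \<open>real^3 \<Rightarrow> complex\<close>, with respect to \<^const>\<open>lborel\<close>; every
  almost-everywhere class of Lebesgue measurable functions has such a representative.
  Objects that are only determined almost everywhere (weak derivatives, Fourier multipliers)
  are picked with Hilbert's choice, and enter the sequel only below integrals.
\<close>

section \<open>Lebesgue norms and the Sobolev space\<close>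

definition Lp_norm :: "nat \<Rightarrow> (real^3 \<Rightarrow> complex) \<Rightarrow> real" where
  "Lp_norm p u = root p (\<integral>x. cmod (u x) ^ p \<partial>lborel)"

definition memL2 :: "(real^3 \<Rightarrow> complex) \<Rightarrow> bool" where
  "memL2 u \<longleftrightarrow> u \<in> borel_measurable lborel \<and> integrable lborel (\<lambda>x. (cmod (u x))\<^sup>2)"

definition partial_deriv :: "3 \<Rightarrow> (real^3 \<Rightarrow> real) \<Rightarrow> real^3 \<Rightarrow> real" where
  "partial_deriv i f x = frechet_derivative f (at x) (axis i 1)"

text \<open>
  All iterated partial derivatives are (totally) differentiable, hence continuous;
  this is the usual class of infinitely differentiable functions.
\<close>

definition smooth :: "(real^3 \<Rightarrow> real) \<Rightarrow> bool" where
  "smooth f \<longleftrightarrow> (\<forall>js. foldr partial_deriv js f differentiable_on UNIV)"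

definition test_function :: "(real^3 \<Rightarrow> real) \<Rightarrow> bool" where
  "test_function \<phi> \<longleftrightarrow> smooth \<phi> \<and> compact (closure {x. \<phi> x \<noteq> 0})"

definition locally_integrable :: "(real^3 \<Rightarrow> complex) \<Rightarrow> bool" where
  "locally_integrable u \<longleftrightarrow> (\<forall>C. compact C \<longrightarrow> set_integrable lborel C u)"

definition has_weak_partial :: "3 \<Rightarrow> (real^3 \<Rightarrow> complex) \<Rightarrow> (real^3 \<Rightarrow> complex) \<Rightarrow> bool" where
  "has_weak_partial i u g \<longleftrightarrow> locally_integrable u \<and> locally_integrable g \<and>
     (\<forall>\<phi>. test_function \<phi> \<longrightarrow>
        (\<integral>x. partial_deriv i \<phi> x *\<^sub>R u x \<partial>lborel) = - (\<integral>x. \<phi> x *\<^sub>R g x \<partial>lborel))"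

definition weak_partial :: "3 \<Rightarrow> (real^3 \<Rightarrow> complex) \<Rightarrow> real^3 \<Rightarrow> complex" where
  "weak_partial i u = (SOME g. has_weak_partial i u g)"

definition H1 :: "(real^3 \<Rightarrow> complex) set" where
  "H1 = {u. memL2 u \<and> (\<forall>i. \<exists>g. memL2 g \<and> has_weak_partial i u g)}"

definition grad_norm :: "(real^3 \<Rightarrow> complex) \<Rightarrow> real" where
  "grad_norm u = sqrt (\<Sum>i\<in>UNIV. (Lp_norm 2 (weak_partial i u))\<^sup>2)"

definition H1_norm :: "(real^3 \<Rightarrow> complex) \<Rightarrow> real" where
  "H1_norm u = sqrt ((Lp_norm 2 u)\<^sup>2 + (grad_norm u)\<^sup>2)"


section \<open>Fourier multipliers and the dipolar interaction\<close>

definition fourier :: "(real^3 \<Rightarrow> complex) \<Rightarrow> real^3 \<Rightarrow> complex" where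
  "fourier f \<xi> = (\<integral>x. exp (- \<i> * complex_of_real (x \<bullet> \<xi>)) * f x \<partial>lborel)"

text \<open>
  The Fourier transform on square integrable functions, as the continuous extension of
  \<^const>\<open>fourier\<close> from the integrable ones.
\<close>

definition has_L2_fourier :: "(real^3 \<Rightarrow> complex) \<Rightarrow> (real^3 \<Rightarrow> complex) \<Rightarrow> bool" where
  "has_L2_fourier f g \<longleftrightarrow> memL2 f \<and> memL2 g \<and>
     (\<exists>F :: nat \<Rightarrow> real^3 \<Rightarrow> complex. (\<forall>n. integrable lborel (F n) \<and> memL2 (F n)) \<and>
        (\<lambda>n. \<integral>\<^sup>+x. ennreal ((cmod (F n x - f x))\<^sup>2) \<partial>lborel) \<longlonglongrightarrow> 0 \<and>
        (\<lambda>n. \<integral>\<^sup>+\<xi>. ennreal ((cmod (fourier (F n) \<xi> - g \<xi>))\<^sup>2) \<partial>lborel) \<longlonglongrightarrow> 0)"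

definition fourier_multiplier ::
    "(real^3 \<Rightarrow> real) \<Rightarrow> (real^3 \<Rightarrow> complex) \<Rightarrow> real^3 \<Rightarrow> complex" where
  "fourier_multiplier m f =
     (SOME h. \<exists>g. has_L2_fourier f g \<and> has_L2_fourier h (\<lambda>\<xi>. complex_of_real (m \<xi>) * g \<xi>))"

definition dipole_symbol :: "real^3 \<Rightarrow> real" where
  "dipole_symbol \<xi> =
     4 / 3 * pi * ((2 * (\<xi> $ 3)\<^sup>2 - (\<xi> $ 1)\<^sup>2 - (\<xi> $ 2)\<^sup>2) / (norm \<xi>)\<^sup>2)"

abbreviation dipole_conv :: "(real^3 \<Rightarrow> complex) \<Rightarrow> real^3 \<Rightarrow> complex" where
  "dipole_conv \<equiv> fourier_multiplier dipole_symbol"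

definition sq_mod :: "(real^3 \<Rightarrow> complex) \<Rightarrow> real^3 \<Rightarrow> complex" where
  "sq_mod u x = complex_of_real ((cmod (u x))\<^sup>2)"

text \<open>The symbol is real, so the integral is a real number and \<^const>\<open>Re\<close> is only a coercion.\<close>

definition dipole_energy :: "(real^3 \<Rightarrow> complex) \<Rightarrow> real" where
  "dipole_energy u = Re (\<integral>x. dipole_conv (sq_mod u) x * sq_mod u x \<partial>lborel)"


section \<open>The variational problem\<close>

definition unstable_regime :: "real \<Rightarrow> real \<Rightarrow> bool" where
  "unstable_regime lam1 lam2 \<longleftrightarrow> lam2 \<noteq> 0 \<and>
     (lam2 > 0 \<longrightarrow> lam1 - 4 / 3 * pi * lam2 < 0) \<and>
     (lam2 < 0 \<longrightarrow> lam1 + 8 / 3 * pi * lam2 < 0)"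

definition energy :: "real \<Rightarrow> real \<Rightarrow> (real^3 \<Rightarrow> complex) \<Rightarrow> real" where
  "energy lam1 lam2 u =
     1 / 2 * (grad_norm u)\<^sup>2 + lam1 / 2 * Lp_norm 4 u ^ 4 + lam2 / 2 * dipole_energy u"

definition sphere_H1 :: "real \<Rightarrow> (real^3 \<Rightarrow> complex) set" where
  "sphere_H1 c = {u \<in> H1. (Lp_norm 2 u)\<^sup>2 = c}"

definition small_grad :: "real \<Rightarrow> real \<Rightarrow> (real^3 \<Rightarrow> complex) set" where
  "small_grad k c = {u \<in> sphere_H1 c. (grad_norm u)\<^sup>2 \<le> k}"

definition H1_path :: "(real \<Rightarrow> real^3 \<Rightarrow> complex) \<Rightarrow> bool" where
  "H1_path g \<longleftrightarrow> (\<forall>t\<in>{0..1}. g t \<in> H1 \<and>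
     ((\<lambda>s. H1_norm (\<lambda>x. g s x - g t x)) \<longlongrightarrow> 0) (at t within {0..1}))"

definition mp_paths ::
    "real \<Rightarrow> real \<Rightarrow> real \<Rightarrow> real \<Rightarrow> (real \<Rightarrow> real^3 \<Rightarrow> complex) set" where
  "mp_paths lam1 lam2 k c = {g. H1_path g \<and> (\<forall>t\<in>{0..1}. g t \<in> sphere_H1 c) \<and>
     g 0 \<in> small_grad k c \<and> energy lam1 lam2 (g 1) < 0}"

text \<open>
  The energy is continuous along paths, so the inner supremum is a maximum. Extended reals keep
  the infima and suprema meaningful independently of boundedness and nonemptiness.
\<close>

definition mp_level :: "real \<Rightarrow> real \<Rightarrow> real \<Rightarrow> real \<Rightarrow> ereal" where
  "mp_level lam1 lam2 k c =
     (INF g\<in>mp_paths lam1 lam2 k c. SUP t\<in>{0..1}. ereal (energy lam1 lam2 (g t)))"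

definition mp_geometry :: "real \<Rightarrow> real \<Rightarrow> real \<Rightarrow> real \<Rightarrow> bool" where
  "mp_geometry lam1 lam2 k c \<longleftrightarrow>
     mp_level lam1 lam2 k c >
       max (SUP g\<in>mp_paths lam1 lam2 k c. ereal (energy lam1 lam2 (g 0)))
           (SUP g\<in>mp_paths lam1 lam2 k c. ereal (energy lam1 lam2 (g 1)))"

definition J_denom :: "real \<Rightarrow> real \<Rightarrow> (real^3 \<Rightarrow> complex) \<Rightarrow> real" where
  "J_denom lam1 lam2 w = - lam1 * Lp_norm 4 w ^ 4 - lam2 * dipole_energy w"

definition J :: "real \<Rightarrow> real \<Rightarrow> (real^3 \<Rightarrow> complex) \<Rightarrow> real" where
  "J lam1 lam2 w = grad_norm w ^ 3 * Lp_norm 2 w / J_denom lam1 lam2 w"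

text \<open>
  Weak form of \<open>- 1/2 \<Delta> v + lam1 |v|\<^sup>2 v + lam2 (K \<star> |v|\<^sup>2) v + \<mu> v = 0\<close>.
  Real test functions suffice, as both sides are complex linear in the test function.
\<close>

definition weak_solution :: "real \<Rightarrow> real \<Rightarrow> real \<Rightarrow> (real^3 \<Rightarrow> complex) \<Rightarrow> bool" where
  "weak_solution lam1 lam2 \<mu> v \<longleftrightarrow> v \<in> H1 \<and> (\<forall>\<phi>. test_function \<phi> \<longrightarrow>
     1 / 2 * (\<Sum>i\<in>UNIV. \<integral>x. partial_deriv i \<phi> x *\<^sub>R weak_partial i v x \<partial>lborel) +
     (\<integral>x. \<phi> x *\<^sub>R (complex_of_real lam1 * sq_mod v x * v x +
        complex_of_real lam2 * dipole_conv (sq_mod v) x * v x +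
        complex_of_real \<mu> * v x) \<partial>lborel) = 0)"

end

theory Submission
  imports Defs "HOL-Probability.Probability"
begin

text \<open>
  Let \<open>A = \<parallel>\<nabla>u\<parallel>\<^sup>2\<close>, let \<open>V\<close> be the denominator of \<open>J\<close> at \<open>u\<close>, and let \<open>u\<^sup>t(x) = t\<^bsup>3/2\<^esup> u(t x)\<close>
  be the mass preserving dilation. Since the dipolar symbol is homogeneous of degree 0,
  \<open>E(u\<^sup>t) = (t\<^sup>2 A - t\<^sup>3 V) / 2\<close>, with its maximum at \<open>t = 1\<close> if the virial identity \<open>2 A = 3 V\<close> holds.

  The virial identity holds at \<open>v\<close>. Subtracting the Euler-Lagrange equation of \<open>J\<close> from a multiple of
  the given equation leaves \<open>- \<alpha> \<Delta>v = \<beta> v\<close>, with \<open>\<alpha> = 0\<close> exactly if \<open>2 A = 3 V\<close>. A positive function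
  in \<open>H\<^sup>1\<close> is not an eigenfunction of the Laplacian, so \<open>\<alpha> = 0\<close>. No regularity or decay of \<open>v\<close> is
  needed for this.

  The dilations of \<open>v\<close> form an admissible path whose energy is at most \<open>E(v)\<close>. Conversely every
  admissible path \<open>g\<close> meets the set \<open>2 A = 3 V\<close>: at its end \<open>E < 0\<close> forces \<open>2 A < 3 V\<close>, and if
  \<open>2 A < 3 V\<close> held at its start, then \<open>E(u\<^sup>t)\<close> would decrease for \<open>t \<ge> 1\<close> from \<open>u = g(0)\<close>, and this path
  would contradict the mountain pass geometry. On the set \<open>2 A = 3 V\<close> one has
  \<open>J(u) = (3/2) \<parallel>\<nabla>u\<parallel> \<parallel>u\<parallel>\<close> and \<open>E(u) = A / 6\<close>, so the minimality of \<open>v\<close> for \<open>J\<close> gives \<open>E(v) \<le> E(u)\<close>.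
\<close>

section \<open>Square integrable functions\<close>

text \<open>\<open>J\<close> is invariant under scalar multiples and under dilations, so its
  minimality alone cannot fix the ratio of A and V; the given equation has to supply the
  normalization. Both equations are tested with the same function, and their nonlinear terms are
  then the same linear functional of it, which is why a linear equation for v remains. The equations
  hold against test functions only, so comparing v with its dilates requires density of test
  functions in H1.

  The bulk of the text makes the functionals computable. The convolution is a chosen representative
  of a Fourier multiplier: Plancherel's theorem, with surjectivity, shows that one exists and turns
  the dipolar energy into a quadratic form in the transform of |u|^2, where homogeneity of the
  symbol can be used. This form needs |u|^2 in L2, which is the Ladyzhenskaya inequality, bounding
  the integral of |u|^4 by ||u|| ||grad u||^3. The same inequality makes the energy continuous along
  paths, so that a path cannot jump over the set 2 A = 3 V. Weak derivatives are chosen too; their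
  uniqueness almost everywhere makes the gradient norm independent of the choice.\<close>

lemma Lp_norm_2: "Lp_norm 2 u = sqrt (\<integral>x. (cmod (u x))\<^sup>2 \<partial>lborel)"
  by (simp add: Lp_norm_def sqrt_def)

lemma Lp_norm_2_square: "(Lp_norm 2 u)\<^sup>2 = (\<integral>x. (cmod (u x))\<^sup>2 \<partial>lborel)"
  by (simp add: Lp_norm_2)

lemma Lp_norm_4_power: "Lp_norm 4 u ^ 4 = (\<integral>x. cmod (u x) ^ 4 \<partial>lborel)"
  by (simp add: Lp_norm_def real_root_pow_pos2)

lemma Lp_norm_2_nonneg [simp]: "0 \<le> Lp_norm 2 u"
  by (simp add: Lp_norm_2)

lemma integrable_dominated:
  fixes f :: "_ \<Rightarrow> 'b::{banach, second_countable_topology}" and g :: "_ \<Rightarrow> real"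
  assumes "integrable M g" "f \<in> borel_measurable M" "\<And>x. norm (f x) \<le> g x"
  shows "integrable M f"
  by (rule Bochner_Integration.integrable_bound[OF assms(1,2)])
     (auto intro!: AE_I2 order_trans[OF assms(3)])

lemma memL2_measurable [measurable_dest]: "memL2 u \<Longrightarrow> u \<in> borel_measurable borel"
  by (simp add: memL2_def)

lemma memL2_integrable: "memL2 u \<Longrightarrow> integrable lborel (\<lambda>x. (cmod (u x))\<^sup>2)"
  by (simp add: memL2_def)

lemma memL2_bound:
  assumes "memL2 g" "f \<in> borel_measurable borel" "AE x in lborel. cmod (f x) \<le> C * cmod (g x)"
  shows "memL2 f"
proof -
  have "integrable lborel (\<lambda>x. C\<^sup>2 * (cmod (g x))\<^sup>2)"
    using assms(1) by (simp add: memL2_def)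
  moreover have "AE x in lborel. norm ((cmod (f x))\<^sup>2) \<le> norm (C\<^sup>2 * (cmod (g x))\<^sup>2)"
    using assms(3)
  proof eventually_elim
    case (elim x)
    then have "(cmod (f x))\<^sup>2 \<le> (C * cmod (g x))\<^sup>2" by (intro power_mono) auto
    then show ?case by (simp add: power_mult_distrib)
  qed
  ultimately have "integrable lborel (\<lambda>x. (cmod (f x))\<^sup>2)"
    using assms(2) by (intro Bochner_Integration.integrable_bound[where g="\<lambda>x. (cmod (f x))\<^sup>2" and f="\<lambda>x. C\<^sup>2 * (cmod (g x))\<^sup>2"]) auto
  then show ?thesis using assms(2) by (simp add: memL2_def)
qed

lemma memL2_zero [simp]: "memL2 (\<lambda>x. 0)"
  by (simp add: memL2_def)

lemma memL2_cmult [intro]: "memL2 f \<Longrightarrow> memL2 (\<lambda>x. c * f x)"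
  by (rule memL2_bound[of f _ "cmod c"]) (auto simp: norm_mult intro!: borel_measurable_times memL2_measurable)

lemma memL2_cnj [intro]:
  assumes "memL2 f" shows "memL2 (\<lambda>x. cnj (f x))"
proof (rule memL2_bound[OF assms, where C=1])
  show "(\<lambda>x. cnj (f x)) \<in> borel_measurable borel"
    by (rule measurable_compose[OF memL2_measurable[OF assms]], rule borel_measurable_continuous_onI)
       (rule continuous_on_cnj, rule continuous_on_id)
qed simp

lemma memL2_minus [intro]: "memL2 f \<Longrightarrow> memL2 (\<lambda>x. - f x)"
  using memL2_cmult[of f "-1"] by simp

lemma memL2_add [intro]:
  assumes "memL2 f" "memL2 g" shows "memL2 (\<lambda>x. f x + g x)"
proof -
  have [measurable]: "f \<in> borel_measurable borel" "g \<in> borel_measurable borel"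
    using assms by (auto simp: memL2_def)
  have "integrable lborel (\<lambda>x. 2 * (cmod (f x))\<^sup>2 + 2 * (cmod (g x))\<^sup>2)"
    using assms by (simp add: memL2_def)
  moreover have "(cmod (f x + g x))\<^sup>2 \<le> 2 * (cmod (f x))\<^sup>2 + 2 * (cmod (g x))\<^sup>2" for x
  proof -
    have "(cmod (f x + g x))\<^sup>2 \<le> (cmod (f x) + cmod (g x))\<^sup>2"
      by (intro power_mono norm_triangle_ineq) auto
    also have "\<dots> \<le> 2 * (cmod (f x))\<^sup>2 + 2 * (cmod (g x))\<^sup>2"
      using sum_squares_bound[of "cmod (f x)" "cmod (g x)"] by (simp add: power2_sum)
    finally show ?thesis .
  qed
  ultimately have "integrable lborel (\<lambda>x. (cmod (f x + g x))\<^sup>2)"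
    by (intro integrable_dominated[where f="\<lambda>x. (cmod (f x + g x))\<^sup>2"]) auto
  then show ?thesis by (simp add: memL2_def)
qed

lemma memL2_diff [intro]: "memL2 f \<Longrightarrow> memL2 g \<Longrightarrow> memL2 (\<lambda>x. f x - g x)"
  using memL2_add[of f "\<lambda>x. - g x"] by auto

lemma memL2_cong_AE:
  assumes "memL2 f" "g \<in> borel_measurable borel" "AE x in lborel. f x = g x" shows "memL2 g"
  by (rule memL2_bound[OF assms(1,2), of 1]) (use assms(3) in auto)

lemma Lp_norm_2_cong_AE:
  assumes "f \<in> borel_measurable borel" "g \<in> borel_measurable borel" "AE x in lborel. f x = g x"
  shows "Lp_norm 2 f = Lp_norm 2 g"
  unfolding Lp_norm_2 using assms by (intro arg_cong[where f=sqrt] integral_cong_AE) auto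

lemma Lp_norm_2_cmult: "Lp_norm 2 (\<lambda>x. c * f x) = cmod c * Lp_norm 2 f"
  by (simp add: Lp_norm_2 norm_mult power_mult_distrib real_sqrt_mult)

lemma Lp_norm_2_minus_commute: "Lp_norm 2 (\<lambda>x. f x - g x) = Lp_norm 2 (\<lambda>x. g x - f x)"
  by (simp add: Lp_norm_2 norm_minus_commute)

lemma nn_integral_cmod_square:
  assumes "memL2 f"
  shows "(\<integral>\<^sup>+x. ennreal ((cmod (f x))\<^sup>2) \<partial>lborel) = ennreal ((Lp_norm 2 f)\<^sup>2)"
  using assms by (subst nn_integral_eq_integral) (auto simp: memL2_def Lp_norm_2_square)

lemma memL2_integrable_mult:
  assumes "memL2 f" "memL2 g" shows "integrable lborel (\<lambda>x. f x * g x)"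
proof -
  have [measurable]: "f \<in> borel_measurable borel" "g \<in> borel_measurable borel"
    using assms by (auto simp: memL2_def)
  have "integrable lborel (\<lambda>x. (cmod (f x))\<^sup>2 + (cmod (g x))\<^sup>2)"
    using assms by (simp add: memL2_def)
  moreover have "cmod (f x * g x) \<le> (cmod (f x))\<^sup>2 + (cmod (g x))\<^sup>2" for x
  proof -
    have "cmod (f x) * cmod (g x) * 2 \<le> (cmod (f x))\<^sup>2 + (cmod (g x))\<^sup>2"
      using sum_squares_bound[of "cmod (f x)" "cmod (g x)"] by simp
    moreover have "0 \<le> cmod (f x) * cmod (g x)" by simp
    ultimately show ?thesis unfolding norm_mult by linarith
  qed
  ultimately show ?thesis
    by (intro integrable_dominated[where f="\<lambda>x. f x * g x"]) auto
qed

section \<open>The Cauchy-Schwarz and triangle inequalities in L2\<close>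

lemma memL2_Cauchy_Schwarz_norm:
  assumes "memL2 f" "memL2 g"
  shows "(\<integral>x. cmod (f x) * cmod (g x) \<partial>lborel) \<le> Lp_norm 2 f * Lp_norm 2 g"
proof -
  have [measurable]: "f \<in> borel_measurable borel" "g \<in> borel_measurable borel"
    using assms by (auto simp: memL2_def)
  have int: "integrable lborel (\<lambda>x. cmod (f x) * cmod (g x))"
    using memL2_integrable_mult[OF assms, THEN integrable_norm] by (simp add: norm_mult)
  have "(\<integral>\<^sup>+x. ennreal (cmod (f x)) * ennreal (cmod (g x)) \<partial>lborel)\<^sup>2
      \<le> (\<integral>\<^sup>+x. ennreal (cmod (f x)) ^ 2 \<partial>lborel) * (\<integral>\<^sup>+x. ennreal (cmod (g x)) ^ 2 \<partial>lborel)"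
    by (rule Cauchy_Schwarz_nn_integral) auto
  also have "\<dots> = ennreal ((Lp_norm 2 f)\<^sup>2 * (Lp_norm 2 g)\<^sup>2)"
    by (simp add: ennreal_power nn_integral_cmod_square assms ennreal_mult)
  also have "(\<integral>\<^sup>+x. ennreal (cmod (f x)) * ennreal (cmod (g x)) \<partial>lborel)
      = ennreal (\<integral>x. cmod (f x) * cmod (g x) \<partial>lborel)"
    using int by (subst nn_integral_eq_integral[symmetric]) (auto simp: ennreal_mult)
  finally have "(\<integral>x. cmod (f x) * cmod (g x) \<partial>lborel)\<^sup>2 \<le> (Lp_norm 2 f * Lp_norm 2 g)\<^sup>2"
    by (simp add: ennreal_power power_mult_distrib)
  then show ?thesis by (rule power2_le_imp_le) auto
qed

lemma memL2_Cauchy_Schwarz: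
  assumes "memL2 f" "memL2 g"
  shows "cmod (\<integral>x. f x * g x \<partial>lborel) \<le> Lp_norm 2 f * Lp_norm 2 g"
proof -
  have "cmod (\<integral>x. f x * g x \<partial>lborel) \<le> (\<integral>x. cmod (f x * g x) \<partial>lborel)"
    by (rule integral_norm_bound)
  then show ?thesis
    using memL2_Cauchy_Schwarz_norm[OF assms] by (simp add: norm_mult)
qed

lemma Lp_norm_2_triangle:
  assumes "memL2 f" "memL2 g"
  shows "Lp_norm 2 (\<lambda>x. f x + g x) \<le> Lp_norm 2 f + Lp_norm 2 g"
proof (rule power2_le_imp_le)
  have int: "integrable lborel (\<lambda>x. cmod (f x) * cmod (g x))"
    using memL2_integrable_mult[OF assms, THEN integrable_norm] by (simp add: norm_mult)
  have i2: "integrable lborel (\<lambda>x. (cmod (f x))\<^sup>2)" "integrable lborel (\<lambda>x. (cmod (g x))\<^sup>2)"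
    using assms by (auto simp: memL2_def)
  have "(Lp_norm 2 (\<lambda>x. f x + g x))\<^sup>2
      \<le> (\<integral>x. (cmod (f x))\<^sup>2 + (cmod (g x))\<^sup>2 + 2 * (cmod (f x) * cmod (g x)) \<partial>lborel)"
    unfolding Lp_norm_2_square
  proof (rule integral_mono)
    show "integrable lborel (\<lambda>x. (cmod (f x + g x))\<^sup>2)"
      using memL2_add[OF assms] by (simp add: memL2_def)
    show "(cmod (f x + g x))\<^sup>2 \<le> (cmod (f x))\<^sup>2 + (cmod (g x))\<^sup>2 + 2 * (cmod (f x) * cmod (g x))" for x
      using power_mono[OF norm_triangle_ineq[of "f x" "g x"], of 2] by (simp add: power2_sum)
  qed (use int i2 in auto)
  also have "\<dots> = (Lp_norm 2 f)\<^sup>2 + (Lp_norm 2 g)\<^sup>2 + 2 * (\<integral>x. cmod (f x) * cmod (g x) \<partial>lborel)"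
    using int i2 by (simp add: Lp_norm_2_square)
  also have "\<dots> \<le> (Lp_norm 2 f + Lp_norm 2 g)\<^sup>2"
    using memL2_Cauchy_Schwarz_norm[OF assms] by (simp add: power2_sum)
  finally show "(Lp_norm 2 (\<lambda>x. f x + g x))\<^sup>2 \<le> (Lp_norm 2 f + Lp_norm 2 g)\<^sup>2" .
qed auto

lemma Lp_norm_2_triangle_diff:
  assumes "memL2 f" "memL2 g" "memL2 h"
  shows "Lp_norm 2 (\<lambda>x. f x - h x) \<le> Lp_norm 2 (\<lambda>x. f x - g x) + Lp_norm 2 (\<lambda>x. g x - h x)"
  using Lp_norm_2_triangle[OF memL2_diff[OF assms(1,2)] memL2_diff[OF assms(2,3)]] by simp

lemma Lp_norm_2_reverse_triangle:
  assumes "memL2 f" "memL2 g"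
  shows "\<bar>Lp_norm 2 f - Lp_norm 2 g\<bar> \<le> Lp_norm 2 (\<lambda>x. f x - g x)"
  using Lp_norm_2_triangle[OF memL2_diff[OF assms] assms(2)]
    Lp_norm_2_triangle[OF memL2_diff[OF assms(2,1)] assms(1)]
  by (simp add: Lp_norm_2_minus_commute[of f g])

lemma Lp_norm_2_eq_0_iff:
  assumes "memL2 f" shows "Lp_norm 2 f = 0 \<longleftrightarrow> (AE x in lborel. f x = 0)"
  using assms integral_nonneg_eq_0_iff_AE[OF memL2_integrable[OF assms]] by (simp add: Lp_norm_2)

text \<open>Membership of all terms and of the limit is part of the notion, so that a convergence
  fact alone discharges the integrability conditions of everything applied to it.\<close>

definition L2_tendsto ::
    "(nat \<Rightarrow> real^3 \<Rightarrow> complex) \<Rightarrow> (real^3 \<Rightarrow> complex) \<Rightarrow> bool" where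
  "L2_tendsto F f \<longleftrightarrow> (\<forall>n. memL2 (F n)) \<and> memL2 f \<and> (\<lambda>n. Lp_norm 2 (\<lambda>x. F n x - f x)) \<longlonglongrightarrow> 0"

text \<open>\<open>has_L2_fourier\<close> speaks of extended nonnegative integrals, the rest of the
  proof of real norms; for members of L2 the two kinds of convergence agree.\<close>

lemma L2_tendsto_nn_integral:
  assumes "\<And>n. memL2 (F n)" "memL2 f"
  shows "(\<lambda>n. \<integral>\<^sup>+x. ennreal ((cmod (F n x - f x))\<^sup>2) \<partial>lborel) \<longlonglongrightarrow> 0 \<longleftrightarrow> L2_tendsto F f"
proof -
  have "(\<lambda>n. \<integral>\<^sup>+x. ennreal ((cmod (F n x - f x))\<^sup>2) \<partial>lborel) \<longlonglongrightarrow> 0 \<longleftrightarrow>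
     (\<lambda>n. (Lp_norm 2 (\<lambda>x. F n x - f x))\<^sup>2) \<longlonglongrightarrow> 0"
    unfolding nn_integral_cmod_square[OF memL2_diff[OF assms(1) assms(2)]] ennreal_0[symmetric]
    by (rule tendsto_ennreal_iff) simp_all
  also have "\<dots> \<longleftrightarrow> (\<lambda>n. Lp_norm 2 (\<lambda>x. F n x - f x)) \<longlonglongrightarrow> 0"
  proof
    assume "(\<lambda>n. (Lp_norm 2 (\<lambda>x. F n x - f x))\<^sup>2) \<longlonglongrightarrow> 0"
    from tendsto_real_sqrt[OF this] show "(\<lambda>n. Lp_norm 2 (\<lambda>x. F n x - f x)) \<longlonglongrightarrow> 0" by simp
  next
    assume "(\<lambda>n. Lp_norm 2 (\<lambda>x. F n x - f x)) \<longlonglongrightarrow> 0"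
    from tendsto_power[OF this, of 2] show "(\<lambda>n. (Lp_norm 2 (\<lambda>x. F n x - f x))\<^sup>2) \<longlonglongrightarrow> 0" by simp
  qed
  finally show ?thesis using assms by (simp add: L2_tendsto_def)
qed

lemma L2_tendsto_const: "memL2 f \<Longrightarrow> L2_tendsto (\<lambda>n. f) f"
  by (simp add: L2_tendsto_def Lp_norm_2)

lemma L2_tendsto_add:
  assumes F: "L2_tendsto F f" and G: "L2_tendsto G g"
  shows "L2_tendsto (\<lambda>n x. F n x + G n x) (\<lambda>x. f x + g x)"
proof -
  have m: "memL2 (F n)" "memL2 (G n)" "memL2 f" "memL2 g" for n
    using F G by (simp_all add: L2_tendsto_def)
  have "(\<lambda>n. Lp_norm 2 (\<lambda>x. F n x - f x) + Lp_norm 2 (\<lambda>x. G n x - g x)) \<longlonglongrightarrow> 0 + 0"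
    using F G unfolding L2_tendsto_def by (intro tendsto_add) simp_all
  then have lim: "(\<lambda>n. Lp_norm 2 (\<lambda>x. F n x - f x) + Lp_norm 2 (\<lambda>x. G n x - g x)) \<longlonglongrightarrow> 0"
    by (simp only: add_0_left)
  have "norm (Lp_norm 2 (\<lambda>x. (F n x + G n x) - (f x + g x)))
      \<le> Lp_norm 2 (\<lambda>x. F n x - f x) + Lp_norm 2 (\<lambda>x. G n x - g x)" for n
    using Lp_norm_2_triangle[OF memL2_diff[OF m(1) m(3)] memL2_diff[OF m(2) m(4)], of n n]
    by (simp only: add_diff_add real_norm_def abs_of_nonneg[OF Lp_norm_2_nonneg])
  then have "(\<lambda>n. Lp_norm 2 (\<lambda>x. (F n x + G n x) - (f x + g x))) \<longlonglongrightarrow> 0"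
    by (rule Lim_null_comparison[OF always_eventually[OF allI] lim])
  then show ?thesis
    unfolding L2_tendsto_def using memL2_add[OF m(1) m(2)] memL2_add[OF m(3) m(4)] by blast
qed

lemma L2_tendsto_cmult:
  assumes "L2_tendsto F f" shows "L2_tendsto (\<lambda>n x. c * F n x) (\<lambda>x. c * f x)"
  unfolding L2_tendsto_def
proof (intro conjI allI)
  have "(\<lambda>n. cmod c * Lp_norm 2 (\<lambda>x. F n x - f x)) \<longlonglongrightarrow> cmod c * 0"
    using assms unfolding L2_tendsto_def by (intro tendsto_mult) auto
  then show "(\<lambda>n. Lp_norm 2 (\<lambda>x. c * F n x - c * f x)) \<longlonglongrightarrow> 0"
    by (simp only: right_diff_distrib[symmetric] Lp_norm_2_cmult mult_zero_right)
qed (use assms in \<open>auto simp: L2_tendsto_def\<close>)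

lemma L2_tendsto_diff:
  assumes "L2_tendsto F f" "L2_tendsto G g" shows "L2_tendsto (\<lambda>n x. F n x - G n x) (\<lambda>x. f x - g x)"
  using L2_tendsto_add[OF assms(1) L2_tendsto_cmult[OF assms(2), of "-1"]] by simp

lemma L2_tendsto_Lp_norm:
  assumes "L2_tendsto F f" shows "(\<lambda>n. Lp_norm 2 (F n)) \<longlonglongrightarrow> Lp_norm 2 f"
proof (rule LIM_zero_cancel, rule Lim_null_comparison)
  show "(\<lambda>n. Lp_norm 2 (\<lambda>x. F n x - f x)) \<longlonglongrightarrow> 0"
    using assms by (simp add: L2_tendsto_def)
  show "\<forall>\<^sub>F n in sequentially. norm (Lp_norm 2 (F n) - Lp_norm 2 f) \<le> Lp_norm 2 (\<lambda>x. F n x - f x)"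
    using assms by (intro always_eventually allI) (simp add: L2_tendsto_def Lp_norm_2_reverse_triangle)
qed

lemma L2_tendsto_integral_mult:
  assumes "L2_tendsto F f" "L2_tendsto G g"
  shows "(\<lambda>n. \<integral>x. F n x * G n x \<partial>lborel) \<longlonglongrightarrow> (\<integral>x. f x * g x \<partial>lborel)"
proof (rule LIM_zero_cancel, rule Lim_null_comparison)
  let ?b = "\<lambda>n. Lp_norm 2 (\<lambda>x. F n x - f x) * Lp_norm 2 (G n) + Lp_norm 2 f * Lp_norm 2 (\<lambda>x. G n x - g x)"
  have m: "memL2 (F n)" "memL2 (G n)" "memL2 f" "memL2 g" for n
    using assms by (auto simp: L2_tendsto_def)
  have "?b \<longlonglongrightarrow> 0 * Lp_norm 2 g + Lp_norm 2 f * 0"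
    using assms L2_tendsto_Lp_norm[OF assms(2)] unfolding L2_tendsto_def
    by (intro tendsto_intros) auto
  then show "?b \<longlonglongrightarrow> 0" by simp
  show "\<forall>\<^sub>F n in sequentially. norm ((\<integral>x. F n x * G n x \<partial>lborel) - (\<integral>x. f x * g x \<partial>lborel)) \<le> ?b n"
  proof (intro always_eventually allI)
    fix n
    have i: "integrable lborel (\<lambda>x. (F n x - f x) * G n x)" "integrable lborel (\<lambda>x. f x * (G n x - g x))"
      "integrable lborel (\<lambda>x. F n x * G n x)" "integrable lborel (\<lambda>x. f x * g x)"
      using m by (auto intro!: memL2_integrable_mult)
    have "(\<integral>x. F n x * G n x \<partial>lborel) - (\<integral>x. f x * g x \<partial>lborel)
       = (\<integral>x. (F n x - f x) * G n x \<partial>lborel) + (\<integral>x. f x * (G n x - g x) \<partial>lborel)"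
      by (subst Bochner_Integration.integral_add[symmetric], fact, fact,
          subst Bochner_Integration.integral_diff[symmetric], fact, fact) (simp add: algebra_simps)
    also have "norm \<dots> \<le> ?b n"
      using m by (intro order_trans[OF norm_triangle_ineq] add_mono memL2_Cauchy_Schwarz) auto
    finally show "norm ((\<integral>x. F n x * G n x \<partial>lborel) - (\<integral>x. f x * g x \<partial>lborel)) \<le> ?b n" .
  qed
qed

lemma L2_tendsto_dominated:
  assumes "\<And>n. F n \<in> borel_measurable borel" "f \<in> borel_measurable borel" "memL2 g"
    and "\<And>n. AE x in lborel. cmod (F n x) \<le> cmod (g x)"
    and "AE x in lborel. (\<lambda>n. F n x) \<longlonglongrightarrow> f x"
  shows "L2_tendsto F f"
proof -
  note [measurable] = assms(1,2)
  have F: "memL2 (F n)" for n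
    by (rule memL2_bound[OF assms(3), where C=1]) (use assms(4) in auto)
  have fg: "AE x in lborel. cmod (f x) \<le> cmod (g x)"
  proof -
    have "AE x in lborel. \<forall>n. cmod (F n x) \<le> cmod (g x)"
      using assms(4) by (simp add: AE_all_countable)
    with assms(5) show ?thesis
    proof eventually_elim
      case (elim x)
      show ?case by (rule LIMSEQ_le_const2[OF tendsto_norm[OF elim(1)]]) (use elim(2) in auto)
    qed
  qed
  have f: "memL2 f"
    by (rule memL2_bound[OF assms(3), where C=1]) (use fg in auto)
  have "(\<lambda>n. \<integral>x. (cmod (F n x - f x))\<^sup>2 \<partial>lborel) \<longlonglongrightarrow> (\<integral>x. 0 \<partial>(lborel :: (real^3) measure))"
  proof (rule integral_dominated_convergence)
    \<comment> \<open>The limit inherits the bound |f| <= |g|, so |F n - f| <= 2 |g|.\<close>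
    show "integrable lborel (\<lambda>x. 4 * (cmod (g x))\<^sup>2)"
      using assms(3) by (simp add: memL2_def)
    show "AE x in lborel. (\<lambda>n. (cmod (F n x - f x))\<^sup>2) \<longlonglongrightarrow> 0"
      using assms(5)
    proof eventually_elim
      case (elim x)
      then have "(\<lambda>n. (cmod (F n x - f x))\<^sup>2) \<longlonglongrightarrow> (cmod (f x - f x))\<^sup>2"
        by (intro tendsto_intros)
      then show ?case by simp
    qed
    show "AE x in lborel. norm ((cmod (F n x - f x))\<^sup>2) \<le> 4 * (cmod (g x))\<^sup>2" for n
      using assms(4)[of n] fg
    proof eventually_elim
      case (elim x)
      have "cmod (F n x - f x) \<le> 2 * cmod (g x)"
        using elim norm_triangle_ineq4[of "F n x" "f x"] by linarith
      from power_mono[OF this, of 2] show ?case by simp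
    qed
  qed auto
  from tendsto_real_sqrt[OF this] show ?thesis
    using F f by (simp add: L2_tendsto_def Lp_norm_2)
qed

text \<open>Riesz-Fischer: a subsequence with geometrically small increments converges almost
  everywhere, and Fatou's lemma along it turns the Cauchy bound into a bound for the distance to the
  pointwise limit.\<close>

lemma L2_complete:
  assumes F: "\<And>n. memL2 (F n)"
    and Cauchy: "\<And>e. e > 0 \<Longrightarrow> \<exists>N. \<forall>m\<ge>N. \<forall>n\<ge>N. Lp_norm 2 (\<lambda>x. F m x - F n x) < e"
  shows "\<exists>f. L2_tendsto F f"
proof -
  note [measurable] = memL2_measurable[OF F]
  define e where "e k = (1/2 :: real) ^ k" for k :: nat
  have "\<forall>k. \<exists>N. \<forall>m\<ge>N. \<forall>n\<ge>N. Lp_norm 2 (\<lambda>x. F m x - F n x) < e k"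
    using Cauchy by (auto simp: e_def)
  then obtain N where N: "\<And>k m n. m \<ge> N k \<Longrightarrow> n \<ge> N k \<Longrightarrow> Lp_norm 2 (\<lambda>x. F m x - F n x) < e k"
    by metis
  \<comment> \<open>Adding \<open>k\<close> and summing all thresholds up to \<open>k\<close> gives
    at once \<open>r k \<ge> N k\<close>, \<open>r (Suc k) \<ge> N k\<close> and
    \<open>r k \<ge> k\<close>.\<close>
  define r where "r k = k + (\<Sum>i\<le>k. N i)" for k
  have r: "r k \<ge> N k" "r (Suc k) \<ge> N k" "r k \<ge> k" for k
    using member_le_sum[of k "{..k}" N] by (auto simp: r_def)
  define G where "G k = F (r k)" for k
  have G: "memL2 (G k)" for k by (simp add: G_def F)
  note [measurable] = memL2_measurable[OF G]
  have Gd: "(Lp_norm 2 (\<lambda>x. G (Suc k) x - G k x))\<^sup>2 \<le> (1/4) ^ k" for k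
  proof -
    have "(Lp_norm 2 (\<lambda>x. G (Suc k) x - G k x))\<^sup>2 \<le> (e k)\<^sup>2"
      using N[OF r(2,1), of k] by (intro power_mono) (auto simp: G_def)
    also have "\<dots> = (1/4) ^ k"
      by (simp add: e_def power2_eq_square power_mult_distrib[symmetric])
    finally show ?thesis .
  qed
  \<comment> \<open>The weight (3/2)^k still leaves a convergent series of integrals, since 3/2
    times 1/4 is 3/8. It forces |G (Suc k) x - G k x| <= (2/3)^(k/2) for large k at almost every x,
    and this is summable.\<close>
  let ?d = "\<lambda>k x. (3/2) ^ k * (cmod (G (Suc k) x - G k x))\<^sup>2"
  have "(\<integral>\<^sup>+x. (\<Sum>k. ennreal (?d k x)) \<partial>lborel) = (\<Sum>k. \<integral>\<^sup>+x. ennreal (?d k x) \<partial>lborel)"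
    by (rule nn_integral_suminf) auto
  also have "\<dots> = (\<Sum>k. ennreal ((3/2) ^ k * (Lp_norm 2 (\<lambda>x. G (Suc k) x - G k x))\<^sup>2))"
    using memL2_diff[OF G G]
    by (intro suminf_cong)
       (simp add: ennreal_mult nn_integral_cmult nn_integral_cmod_square)
  also have "\<dots> \<le> (\<Sum>k. ennreal ((3/8) ^ k))"
  proof (intro suminf_le summableI ennreal_leI)
    fix k
    have "(3/2) ^ k * (Lp_norm 2 (\<lambda>x. G (Suc k) x - G k x))\<^sup>2 \<le> (3/2) ^ k * (1/4 :: real) ^ k"
      by (intro mult_left_mono Gd) auto
    then show "(3/2) ^ k * (Lp_norm 2 (\<lambda>x. G (Suc k) x - G k x))\<^sup>2 \<le> (3/8) ^ k"
      by (simp flip: power_mult_distrib)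
  qed
  also have "\<dots> = ennreal (\<Sum>k. (3/8) ^ k)"
    by (rule suminf_ennreal2) (simp_all add: summable_geometric)
  also have "\<dots> < \<infinity>" by simp
  finally have fin: "(\<integral>\<^sup>+x. (\<Sum>k. ennreal (?d k x)) \<partial>lborel) \<noteq> \<infinity>" by simp
  have "AE x in lborel. (\<Sum>k. ennreal (?d k x)) \<noteq> top"
    by (rule nn_integral_PInf_AE[OF _ fin, unfolded infinity_ennreal_def]) measurable
  then have conv: "AE x in lborel. convergent (\<lambda>k. G k x)"
  proof eventually_elim
    case (elim x)
    have "summable (\<lambda>k. ?d k x)"
      by (rule summable_suminf_not_top[OF _ elim]) (rule mult_nonneg_nonneg, simp_all)
    then have "(\<lambda>k. ?d k x) \<longlonglongrightarrow> 0" by (rule summable_LIMSEQ_zero)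
    then have ev: "\<forall>\<^sub>F k in sequentially. ?d k x < 1" by (rule order_tendstoD) simp
    have "summable (\<lambda>k. G (Suc k) x - G k x)"
    proof (rule summable_comparison_test_ev)
      show "summable (\<lambda>k. sqrt (2/3) ^ k)" by (rule summable_geometric) simp
      show "\<forall>\<^sub>F k in sequentially. norm (G (Suc k) x - G k x) \<le> sqrt (2/3) ^ k"
        using ev
      proof eventually_elim
        case (elim k)
        have "(cmod (G (Suc k) x - G k x))\<^sup>2 = (2/3) ^ k * ?d k x"
          by (simp add: power_divide)
        also have "\<dots> \<le> (2/3) ^ k * 1"
          using elim by (intro mult_left_mono) auto
        also have "\<dots> = ((sqrt (2/3))\<^sup>2) ^ k"
          by (subst real_sqrt_pow2) auto
        also have "\<dots> = (sqrt (2/3) ^ k)\<^sup>2"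
          by (simp only: power_mult[symmetric] mult.commute)
        finally show ?case
          by (rule power2_le_imp_le) (rule zero_le_power, rule real_sqrt_ge_zero, simp)
      qed
    qed
    then have "(\<lambda>n. \<Sum>k<n. G (Suc k) x - G k x) \<longlonglongrightarrow> (\<Sum>k. G (Suc k) x - G k x)"
      by (rule summable_LIMSEQ)
    then have "(\<lambda>n. G n x - G 0 x) \<longlonglongrightarrow> (\<Sum>k. G (Suc k) x - G k x)"
      by (simp only: sum_lessThan_telescope[of "\<lambda>k. G k x"])
    from tendsto_add[OF this tendsto_const[of "G 0 x"]] show ?case
      by (auto simp: convergent_def)
  qed
  define f where "f x = lim (\<lambda>k. G k x)" for x
  have [measurable]: "f \<in> borel_measurable borel"
    unfolding f_def by measurable
  have lim: "AE x in lborel. (\<lambda>k. G k x) \<longlonglongrightarrow> f x"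
    using conv unfolding f_def by (simp only: convergent_LIMSEQ_iff)
  \<comment> \<open>Fatou's lemma along the subsequence; \<open>r j \<ge> j\<close> puts its late
    members into the Cauchy range.\<close>
  have key: "(\<integral>\<^sup>+x. ennreal ((cmod (F n x - f x))\<^sup>2) \<partial>lborel) \<le> ennreal ((e k)\<^sup>2)" if "n \<ge> N k" for n k
  proof -
    have "(\<integral>\<^sup>+x. ennreal ((cmod (F n x - f x))\<^sup>2) \<partial>lborel)
        = (\<integral>\<^sup>+x. liminf (\<lambda>j. ennreal ((cmod (F n x - G j x))\<^sup>2)) \<partial>lborel)"
    proof (rule nn_integral_cong_AE)
      show "AE x in lborel. ennreal ((cmod (F n x - f x))\<^sup>2) = liminf (\<lambda>j. ennreal ((cmod (F n x - G j x))\<^sup>2))"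
        using lim
      proof eventually_elim
        case (elim x)
        from this have "(\<lambda>j. ennreal ((cmod (F n x - G j x))\<^sup>2)) \<longlonglongrightarrow> ennreal ((cmod (F n x - f x))\<^sup>2)"
          by (intro tendsto_intros)
        then show ?case by (rule lim_imp_Liminf[OF sequentially_bot, symmetric])
      qed
    qed
    also have "\<dots> \<le> liminf (\<lambda>j. \<integral>\<^sup>+x. ennreal ((cmod (F n x - G j x))\<^sup>2) \<partial>lborel)"
      by (rule nn_integral_liminf) auto
    also have "\<dots> \<le> ennreal ((e k)\<^sup>2)"
    proof -
      have "\<forall>\<^sub>F j in sequentially. (\<integral>\<^sup>+x. ennreal ((cmod (F n x - G j x))\<^sup>2) \<partial>lborel) \<le> ennreal ((e k)\<^sup>2)"
        using eventually_ge_at_top[of "N k"]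
      proof eventually_elim
        case (elim j)
        then have "Lp_norm 2 (\<lambda>x. F n x - G j x) < e k"
          unfolding G_def using that r(3)[of j] by (intro N) auto
        then show ?case
          using memL2_diff[OF F G, of n j]
          by (subst nn_integral_cmod_square) (auto intro!: ennreal_leI power_mono)
      qed
      from Liminf_mono[OF this] show ?thesis by (simp add: Liminf_const)
    qed
    finally show ?thesis .
  qed
  have Ff: "memL2 (\<lambda>x. F n x - f x)" if "n \<ge> N k" for n k
    unfolding memL2_def using le_less_trans[OF key[OF that] ennreal_less_top]
    by (intro conjI integrableI_bounded) auto
  have f: "memL2 f"
    using memL2_diff[OF F[of "N 0"] Ff[where k=0 and n="N 0", OF order_refl]] by simp
  have "(\<lambda>n. \<integral>\<^sup>+x. ennreal ((cmod (F n x - f x))\<^sup>2) \<partial>lborel) \<longlonglongrightarrow> 0"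
  proof (rule order_tendstoI)
    fix a :: ennreal assume "0 < a"
    have "(\<lambda>k. ennreal ((e k)\<^sup>2)) \<longlonglongrightarrow> ennreal (0\<^sup>2)"
      unfolding e_def by (intro tendsto_ennrealI tendsto_power LIMSEQ_power_zero) auto
    then have "\<forall>\<^sub>F k in sequentially. ennreal ((e k)\<^sup>2) < a"
      by (rule order_tendstoD) (use \<open>0 < a\<close> in simp)
    then obtain k where k: "ennreal ((e k)\<^sup>2) < a"
      by (auto simp: eventually_sequentially)
    show "\<forall>\<^sub>F n in sequentially. (\<integral>\<^sup>+x. ennreal ((cmod (F n x - f x))\<^sup>2) \<partial>lborel) < a"
      using eventually_ge_at_top by eventually_elim (rule le_less_trans[OF key k])
  qed simp
  then show ?thesis
    using L2_tendsto_nn_integral[of F f, OF F f] by (intro exI[of _ f]) simp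
qed

subsection \<open>Affine changes of variables\<close>

context
  fixes t :: "real^3" and c :: real
  assumes c: "c \<noteq> 0"
begin

lemma nn_integral_affine3:
  assumes [measurable]: "f \<in> borel_measurable borel"
  shows "(\<integral>\<^sup>+x. f x \<partial>lborel) = ennreal (\<bar>c\<bar> ^ 3) * (\<integral>\<^sup>+x. f (t + c *\<^sub>R x) \<partial>lborel)"
  by (subst lborel_affine[OF c, of t])
     (simp add: nn_integral_density nn_integral_distr nn_integral_cmult)

lemma AE_affine3:
  assumes "AE x in lborel. P x" shows "AE x in lborel. P (t + c *\<^sub>R x)"
proof -
  from assms obtain N where N: "N \<in> null_sets lborel" "{x \<in> space lborel. \<not> P x} \<subseteq> N"
    by (auto elim!: AE_E simp: null_sets_def)
  then have [measurable]: "N \<in> sets borel" by auto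
  have "ennreal (\<bar>c\<bar> ^ 3) * (\<integral>\<^sup>+x. indicator N (t + c *\<^sub>R x) \<partial>lborel) = (\<integral>\<^sup>+x. indicator N x \<partial>lborel)"
    by (subst (2) nn_integral_affine3) simp_all
  also have "\<dots> = 0" using N by (simp add: null_sets_def)
  finally have "(\<integral>\<^sup>+x. indicator N (t + c *\<^sub>R x) \<partial>lborel) = 0"
    using c by (simp add: ennreal_eq_0_iff)
  then have "AE x in lborel. indicator N (t + c *\<^sub>R x) = (0::ennreal)"
    by (subst (asm) nn_integral_0_iff_AE) auto
  then show ?thesis
    by (rule AE_mp) (use N(2) in \<open>auto simp: indicator_def split: if_splits\<close>)
qed

lemma integrable_affine3:
  fixes f :: "real^3 \<Rightarrow> 'b::{banach, second_countable_topology}"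
  assumes f: "integrable lborel f" shows "integrable lborel (\<lambda>x. f (t + c *\<^sub>R x))"
proof (rule integrableI_bounded)
  note [measurable] = borel_measurable_integrable[OF f]
  show "(\<lambda>x. f (t + c *\<^sub>R x)) \<in> borel_measurable lborel" by measurable
  have "ennreal (\<bar>c\<bar> ^ 3) * (\<integral>\<^sup>+x. norm (f (t + c *\<^sub>R x)) \<partial>lborel) = (\<integral>\<^sup>+x. norm (f x) \<partial>lborel)"
    by (rule nn_integral_affine3[symmetric]) measurable
  also have "\<dots> < \<infinity>" using f by (simp add: integrable_iff_bounded)
  finally show "(\<integral>\<^sup>+x. norm (f (t + c *\<^sub>R x)) \<partial>lborel) < \<infinity>"
    using c by (auto simp: ennreal_mult_less_top)
qed

end

text \<open>Having an equivalence makes \<open>integral_affine3\<close> hold for every f: if f is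
  not integrable, both Bochner integrals take the default value 0.\<close>

lemma integrable_affine3_iff:
  fixes f :: "real^3 \<Rightarrow> 'b::{banach, second_countable_topology}"
  assumes "c \<noteq> 0"
  shows "integrable lborel (\<lambda>x. f (t + c *\<^sub>R x)) \<longleftrightarrow> integrable lborel f"
proof
  have "t + c *\<^sub>R (- (1 / c) *\<^sub>R t + (1 / c) *\<^sub>R x) = x" for x
    using assms by (simp add: scaleR_add_right scaleR_diff_right)
  moreover assume "integrable lborel (\<lambda>x. f (t + c *\<^sub>R x))"
  ultimately show "integrable lborel f"
    using integrable_affine3[of "1 / c" "\<lambda>x. f (t + c *\<^sub>R x)" "- (1 / c) *\<^sub>R t"] assms by simp
next
  assume "integrable lborel f" then show "integrable lborel (\<lambda>x. f (t + c *\<^sub>R x))"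
    by (rule integrable_affine3[OF assms])
qed

lemma integral_affine3:
  fixes f :: "real^3 \<Rightarrow> 'b::{banach, second_countable_topology}"
  assumes c: "c \<noteq> 0"
  shows "(\<integral>x. f (t + c *\<^sub>R x) \<partial>lborel) = (1 / \<bar>c\<bar> ^ 3) *\<^sub>R (\<integral>x. f x \<partial>lborel)"
proof cases
  assume f[measurable]: "integrable lborel f"
  have "(\<integral>x. f x \<partial>lborel) = \<bar>c\<bar> ^ 3 *\<^sub>R (\<integral>x. f (t + c *\<^sub>R x) \<partial>lborel)"
    using c f f[THEN borel_measurable_integrable] integrable_affine3[OF c f, of t]
    by (subst lborel_affine[OF c, of t])
       (simp add: integral_density integral_distr)
  then show ?thesis using c by simp
next
  assume "\<not> integrable lborel f" with c show ?thesis
    by (simp add: integrable_affine3_iff not_integrable_integral_eq)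
qed

section \<open>Density of continuous functions and its consequences\<close>

definition Cc :: "(real^3 \<Rightarrow> complex) \<Rightarrow> bool" where
  "Cc g \<longleftrightarrow> continuous_on UNIV g \<and> (\<exists>R. \<forall>x. R < norm x \<longrightarrow> g x = 0)"

lemma CcE:
  assumes "Cc g"
  obtains M R where "continuous_on UNIV g" "M \<ge> 0" "R > 0" "\<And>x. cmod (g x) \<le> M * indicator (cball 0 R) x"
proof -
  from assms obtain R' where R': "continuous_on UNIV g" "\<And>x. R' < norm x \<Longrightarrow> g x = 0"
    by (auto simp: Cc_def)
  define R where "R = max R' 1"
  have R: "R > 0" "\<And>x. R < norm x \<Longrightarrow> g x = 0" using R'(2) by (auto simp: R_def)
  have "compact (g ` cball 0 R)"
    by (intro compact_continuous_image continuous_on_subset[OF R'(1)]) auto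
  then obtain M where M: "\<And>x. x \<in> cball 0 R \<Longrightarrow> cmod (g x) \<le> M"
    by (meson bounded_iff compact_imp_bounded imageI)
  have "cmod (g x) \<le> max M 0 * indicator (cball 0 R) x" for x
  proof (cases "x \<in> cball 0 R")
    case True then show ?thesis using M[OF True] by simp
  next
    case False then show ?thesis using R(2)[of x] by simp
  qed
  then show thesis using that[OF R'(1), of "max M 0" R] R by simp
qed

lemma memL2_indicator:
  assumes [measurable]: "A \<in> sets borel" and "bounded A"
  shows "memL2 (\<lambda>x. M * indicator A x)"
proof -
  have "emeasure lborel A < \<infinity>" using emeasure_bounded_finite assms(2) by simp
  then have "integrable lborel (\<lambda>x. (cmod M)\<^sup>2 * indicator A x)"
    by (intro integrable_mult_right) (auto intro!: integrable_real_indicator)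
  moreover have "(\<lambda>x. (cmod (M * indicator A x))\<^sup>2) = (\<lambda>x. (cmod M)\<^sup>2 * indicator A x)"
    by (auto simp: fun_eq_iff norm_mult power_mult_distrib indicator_def)
  ultimately show ?thesis by (simp add: memL2_def)
qed

lemma memL2_Cc: assumes "Cc g" shows "memL2 g"
proof -
  obtain M R where *: "continuous_on UNIV g" "M \<ge> 0" "\<And>x. cmod (g x) \<le> M * indicator (cball 0 R) x"
    using CcE[OF assms] by metis
  have "cmod (complex_of_real M * indicator (cball 0 R) x) = M * indicator (cball 0 R) x" for x :: "real^3"
    using *(2) by (simp add: norm_mult indicator_def)
  then show ?thesis
    using *(3) borel_measurable_continuous_onI[OF *(1)]
    by (intro memL2_bound[OF memL2_indicator[of "cball 0 R" "complex_of_real M"], of g 1]) auto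
qed

text \<open>Cut A to its part B in a large ball, enclose B and its complement in open sets U and W
  with small excess, and let Urysohn's lemma produce a function equal to 1 off W and to 0 off V, the
  part of U inside the ball. It can differ from the indicator of A only on A outside the ball, on U
  - B and on W - - B, each of measure below e / 4.\<close>

lemma indicator_approx_continuous:
  fixes A :: "(real^3) set"
  assumes A [measurable]: "A \<in> sets borel" and fin: "emeasure lborel A < \<infinity>" and "e > 0"
  shows "\<exists>\<phi> :: real^3 \<Rightarrow> real. continuous_on UNIV \<phi> \<and> (\<exists>R. \<forall>x. R < norm x \<longrightarrow> \<phi> x = 0) \<and>
    (\<forall>x. 0 \<le> \<phi> x \<and> \<phi> x \<le> 1) \<and> (\<integral>\<^sup>+x. ennreal \<bar>indicator A x - \<phi> x\<bar> \<partial>lborel) < ennreal e"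
proof -
  define d where "d = e / 4"
  have d: "d > 0" using \<open>e > 0\<close> by (simp add: d_def)
  have "(\<lambda>n. emeasure lborel (A - ball 0 (real n))) \<longlonglongrightarrow> emeasure lborel (\<Inter>n. A - ball 0 (real n))"
  proof (rule Lim_emeasure_decseq)
    show "decseq (\<lambda>n. A - ball 0 (real n))" by (auto simp: decseq_def)
    show "emeasure lborel (A - ball 0 (real i)) \<noteq> \<infinity>" for i
      using emeasure_mono[of "A - ball 0 (real i)" A lborel] fin
      by (auto simp: top_unique less_top[symmetric])
  qed auto
  moreover have "(\<Inter>n. A - ball 0 (real n)) = {}"
  proof -
    have "\<exists>n. x \<in> ball 0 (real n)" for x :: "real^3"
      using reals_Archimedean2[of "norm x"] by simp
    then show ?thesis by blast
  qed
  ultimately have "(\<lambda>n. emeasure lborel (A - ball 0 (real n))) \<longlonglongrightarrow> 0"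
    by (simp only: emeasure_empty)
  then have "\<forall>\<^sub>F n in sequentially. emeasure lborel (A - ball 0 (real n)) < ennreal d"
    by (rule order_tendstoD) (use d in simp)
  then obtain n where n: "emeasure lborel (A - ball 0 (real n)) < ennreal d"
    by (auto simp: eventually_sequentially)
  define B where "B = A \<inter> ball 0 (real n)"
  have B [measurable]: "B \<in> sets borel" by (simp add: B_def)
  obtain U where U: "open U" "B \<subseteq> U" "emeasure lborel (U - B) < ennreal d"
    using outer_regular_lborel[OF B d] by blast
  obtain W where W: "open W" "- B \<subseteq> W" "emeasure lborel (W - - B) < ennreal d"
    using outer_regular_lborel[of "- B" d] B d by (auto simp: sets.compl_sets)
  note [measurable] = borel_open[OF U(1)] borel_open[OF W(1)]
  define V where "V = U \<inter> ball 0 (real n)"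
  have V: "open V" "B \<subseteq> V" using U by (auto simp: V_def B_def)
  have "closed (- W)" "closed (- V)" "- W \<inter> - V = {}"
    using W V by auto
  then obtain \<phi> :: "real^3 \<Rightarrow> real" where \<phi>: "continuous_on UNIV \<phi>" "\<And>x. \<phi> x \<in> closed_segment 1 0"
      "\<And>x. x \<in> - W \<Longrightarrow> \<phi> x = 1" "\<And>x. x \<in> - V \<Longrightarrow> \<phi> x = 0"
    by (rule Urysohn[where a="1::real" and b=0]) blast
  have \<phi>01: "0 \<le> \<phi> x" "\<phi> x \<le> 1" for x
    using \<phi>(2)[of x] by (auto simp: closed_segment_eq_real_ivl split: if_splits)
  have "ennreal \<bar>indicator A x - \<phi> x\<bar>
     \<le> indicator (A - ball 0 (real n)) x + indicator (U - B) x + indicator (W - - B) x" for x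
  proof (cases "x \<in> - W")
    case True
    then have "x \<in> A" using W(2) by (auto simp: B_def)
    then show ?thesis using \<phi>(3)[OF True] by simp
  next
    case W1: False
    show ?thesis
    proof (cases "x \<in> B")
      case True
      then have "indicator (W - - B) x = (1::ennreal)" using W1 by simp
      moreover have "ennreal \<bar>indicator A x - \<phi> x\<bar> \<le> 1"
        using True \<phi>01[of x] by (auto simp: B_def indicator_def abs_if)
      ultimately show ?thesis by (simp add: add_increasing)
    next
      case nB: False
      show ?thesis
      proof (cases "x \<in> V")
        case True
        then have "x \<notin> A" "x \<in> U - B" using nB by (auto simp: V_def B_def)
        then show ?thesis using \<phi>01[of x] by (simp add: add_increasing add_increasing2)
      next
        case False
        then have "\<phi> x = 0" using \<phi>(4) by simp
        then show ?thesis using nB by (auto simp: B_def indicator_def)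
      qed
    qed
  qed
  then have "(\<integral>\<^sup>+x. ennreal \<bar>indicator A x - \<phi> x\<bar> \<partial>lborel)
     \<le> (\<integral>\<^sup>+x. indicator (A - ball 0 (real n)) x + indicator (U - B) x + indicator (W - - B) x \<partial>lborel)"
    by (rule nn_integral_mono)
  also have "\<dots> = emeasure lborel (A - ball 0 (real n)) + emeasure lborel (U - B) + emeasure lborel (W - - B)"
  proof -
    have m: "indicator (A - ball 0 (real n)) \<in> borel_measurable (lborel :: (real^3) measure)"
      "indicator (U - B) \<in> borel_measurable (lborel :: (real^3) measure)"
      "indicator (W - - B) \<in> borel_measurable (lborel :: (real^3) measure)"
      by (auto intro!: borel_measurable_indicator sets.Diff sets.Int simp: Diff_eq)
    show ?thesis
      using m by (subst nn_integral_add[OF borel_measurable_add[OF m(1,2)] m(3)], subst nn_integral_add[OF m(1,2)])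
        (simp add: Diff_eq sets.Int)
  qed
  also have "\<dots> \<le> ennreal d + ennreal d + ennreal d"
    using n U(3) W(3) by (intro add_mono less_imp_le)
  also have "\<dots> = ennreal (3 * d)" using d by (simp flip: ennreal_plus)
  also have "\<dots> < ennreal e" using \<open>e > 0\<close> by (intro ennreal_lessI) (auto simp: d_def)
  finally have "(\<integral>\<^sup>+x. ennreal \<bar>indicator A x - \<phi> x\<bar> \<partial>lborel) < ennreal e" .
  moreover have "\<phi> x = 0" if "real n < norm x" for x
    using \<phi>(4)[of x] that by (auto simp: V_def)
  ultimately show ?thesis using \<phi>(1) \<phi>01 by blast
qed

lemma integrable_approx_Cc:
  fixes f :: "real^3 \<Rightarrow> complex"
  assumes "integrable lborel f"
  shows "\<forall>e>0. \<exists>g. Cc g \<and> (\<integral>\<^sup>+x. ennreal (cmod (f x - g x)) \<partial>lborel) < ennreal e"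
  using assms
proof (induction rule: integrable_induct)
  case (base A c)
  show ?case
  proof (intro allI impI)
    fix e :: real assume "e > 0"
    \<comment> \<open>The summand 1 covers the case c = 0.\<close>
    then have "e / (cmod c + 1) > 0" by (simp add: add_nonneg_pos)
    from indicator_approx_continuous[OF _ base(2) this] base(1) obtain \<phi> :: "real^3 \<Rightarrow> real"
      where \<phi>: "continuous_on UNIV \<phi>" "\<exists>R. \<forall>x. R < norm x \<longrightarrow> \<phi> x = 0"
        "(\<integral>\<^sup>+x. ennreal \<bar>indicator A x - \<phi> x\<bar> \<partial>lborel) < ennreal (e / (cmod c + 1))"
      by auto
    note [measurable] = borel_measurable_continuous_onI[OF \<phi>(1)] base(1)
    have "(\<integral>\<^sup>+x. ennreal (cmod (indicator A x *\<^sub>R c - \<phi> x *\<^sub>R c)) \<partial>lborel)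
       = (\<integral>\<^sup>+x. ennreal (cmod c) * ennreal \<bar>indicator A x - \<phi> x\<bar> \<partial>lborel)"
      by (simp flip: scaleR_diff_left ennreal_mult add: mult.commute)
    also have "\<dots> = ennreal (cmod c) * (\<integral>\<^sup>+x. ennreal \<bar>indicator A x - \<phi> x\<bar> \<partial>lborel)"
      by (rule nn_integral_cmult) measurable
    also have "\<dots> \<le> ennreal (cmod c) * ennreal (e / (cmod c + 1))"
      by (rule mult_left_mono[OF less_imp_le[OF \<phi>(3)]]) simp
    also have "\<dots> = ennreal (cmod c * (e / (cmod c + 1)))"
      using \<open>e > 0\<close> by (intro ennreal_mult[symmetric] divide_nonneg_nonneg) simp_all
    also have "\<dots> < ennreal e"
    proof (rule ennreal_lessI[OF \<open>e > 0\<close>])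
      have "cmod c + 1 > 0" by (simp add: add_nonneg_pos)
      then show "cmod c * (e / (cmod c + 1)) < e" using \<open>e > 0\<close> by (simp add: field_simps)
    qed
    finally show "\<exists>g. Cc g \<and> (\<integral>\<^sup>+x. ennreal (cmod (indicator A x *\<^sub>R c - g x)) \<partial>lborel) < ennreal e"
      using \<phi>(1,2) by (intro exI[of _ "\<lambda>x. \<phi> x *\<^sub>R c"]) (auto simp: Cc_def intro!: continuous_intros)
  qed
next
  case (add f g)
  show ?case
  proof (intro allI impI)
    fix e :: real assume "e > 0"
    then have e2: "e / 2 > 0" by simp
    obtain f' where f': "Cc f'" "(\<integral>\<^sup>+x. ennreal (cmod (f x - f' x)) \<partial>lborel) < ennreal (e/2)"
      using add(3) e2 by blast
    obtain g' where g': "Cc g'" "(\<integral>\<^sup>+x. ennreal (cmod (g x - g' x)) \<partial>lborel) < ennreal (e/2)"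
      using add(4) e2 by blast
    note [measurable] = borel_measurable_integrable[OF add(1)] borel_measurable_integrable[OF add(2)]
      memL2_measurable[OF memL2_Cc[OF f'(1)]] memL2_measurable[OF memL2_Cc[OF g'(1)]]
    have "(\<integral>\<^sup>+x. ennreal (cmod (f x + g x - (f' x + g' x))) \<partial>lborel)
       \<le> (\<integral>\<^sup>+x. ennreal (cmod (f x - f' x)) + ennreal (cmod (g x - g' x)) \<partial>lborel)"
      by (intro nn_integral_mono) (simp add: norm_diff_triangle_ineq flip: ennreal_plus)
    also have "\<dots> = (\<integral>\<^sup>+x. ennreal (cmod (f x - f' x)) \<partial>lborel) + (\<integral>\<^sup>+x. ennreal (cmod (g x - g' x)) \<partial>lborel)"
      by (rule nn_integral_add) auto
    also have "\<dots> < ennreal (e/2) + ennreal (e/2)"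
      using f'(2) g'(2) by (rule add_strict_mono)
    also have "\<dots> = ennreal e" using \<open>e > 0\<close> by (simp flip: ennreal_plus)
    finally have "(\<integral>\<^sup>+x. ennreal (cmod (f x + g x - (f' x + g' x))) \<partial>lborel) < ennreal e" .
    moreover have "Cc (\<lambda>x. f' x + g' x)"
    proof -
      obtain R where R: "\<And>x. R < norm x \<Longrightarrow> f' x = 0" "continuous_on UNIV f'" using f'(1) by (auto simp: Cc_def)
      obtain S where S: "\<And>x. S < norm x \<Longrightarrow> g' x = 0" "continuous_on UNIV g'" using g'(1) by (auto simp: Cc_def)
      show ?thesis unfolding Cc_def
        using R S by (intro conjI continuous_intros exI[of _ "max R S"]) auto
    qed
    ultimately show "\<exists>h. Cc h \<and> (\<integral>\<^sup>+x. ennreal (cmod (f x + g x - h x)) \<partial>lborel) < ennreal e" by blast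
  qed
next
  case (lim f s)
  have conv: "(\<lambda>i. s i x) \<longlonglongrightarrow> f x" and le: "norm (s i x) \<le> 2 * norm (f x)" for i x
    using lim.hyps by simp_all
  have P: "\<exists>g. Cc g \<and> (\<integral>\<^sup>+x. ennreal (cmod (s i x - g x)) \<partial>lborel) < ennreal e" if "e > 0" for i e
    using lim.IH that by blast
  have ints: "integrable lborel (s i)" and intf: "integrable lborel f" for i
    using lim.hyps by simp_all
  show ?case
  proof (intro allI impI)
    fix e :: real assume "e > 0"
    then have e2: "e / 2 > 0" by simp
    have int: "integrable lborel (\<lambda>x. s i x - f x)" for i using ints intf by auto
    have "(\<lambda>i. \<integral>x. cmod (s i x - f x) \<partial>lborel) \<longlonglongrightarrow> (\<integral>x. 0 \<partial>(lborel :: (real^3) measure))"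
    proof (rule integral_dominated_convergence)
      show "integrable lborel (\<lambda>x. 3 * cmod (f x))" using intf by auto
      show "AE x in lborel. (\<lambda>i. cmod (s i x - f x)) \<longlonglongrightarrow> 0"
      proof (rule AE_I2)
        fix x :: "real^3"
        have "(\<lambda>i. s i x) \<longlonglongrightarrow> f x" by (rule conv)
        then show "(\<lambda>i. cmod (s i x - f x)) \<longlonglongrightarrow> 0"
          by (intro tendsto_norm_zero LIM_zero)
      qed
      show "AE x in lborel. norm (cmod (s i x - f x)) \<le> 3 * cmod (f x)" for i
      proof (rule AE_I2)
        fix x :: "real^3"
        show "norm (cmod (s i x - f x)) \<le> 3 * cmod (f x)"
          using le[of i x] norm_triangle_ineq4[of "s i x" "f x"] by simp
      qed
    qed (use int in auto)
    then have "\<forall>\<^sub>F i in sequentially. (\<integral>x. cmod (s i x - f x) \<partial>lborel) < e / 2"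
      by (intro order_tendstoD) (use e2 in auto)
    then obtain i where i: "(\<integral>x. cmod (s i x - f x) \<partial>lborel) < e / 2"
      by (auto simp: eventually_sequentially)
    have i2: "(\<integral>\<^sup>+x. ennreal (cmod (f x - s i x)) \<partial>lborel) < ennreal (e / 2)"
    proof -
      have "(\<integral>\<^sup>+x. ennreal (cmod (f x - s i x)) \<partial>lborel) = ennreal (\<integral>x. cmod (s i x - f x) \<partial>lborel)"
        using int[of i] by (subst nn_integral_eq_integral[symmetric]) (simp_all add: norm_minus_commute[of "f _"])
      then show ?thesis using i e2 by (simp add: ennreal_lessI)
    qed
    obtain g where g: "Cc g" "(\<integral>\<^sup>+x. ennreal (cmod (s i x - g x)) \<partial>lborel) < ennreal (e/2)"
      using P e2 by blast
    note [measurable] = borel_measurable_integrable[OF ints] borel_measurable_integrable[OF intf]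
      memL2_measurable[OF memL2_Cc[OF g(1)]]
    have "(\<integral>\<^sup>+x. ennreal (cmod (f x - g x)) \<partial>lborel)
       \<le> (\<integral>\<^sup>+x. ennreal (cmod (f x - s i x)) + ennreal (cmod (s i x - g x)) \<partial>lborel)"
    proof (intro nn_integral_mono)
      fix x
      have "cmod (f x - g x) \<le> cmod (f x - s i x) + cmod (s i x - g x)"
        using norm_triangle_ineq[of "f x - s i x" "s i x - g x"] by simp
      then show "ennreal (cmod (f x - g x)) \<le> ennreal (cmod (f x - s i x)) + ennreal (cmod (s i x - g x))"
        by (simp flip: ennreal_plus)
    qed
    also have "\<dots> = (\<integral>\<^sup>+x. ennreal (cmod (f x - s i x)) \<partial>lborel) + (\<integral>\<^sup>+x. ennreal (cmod (s i x - g x)) \<partial>lborel)"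
      by (rule nn_integral_add) auto
    also have "\<dots> < ennreal (e/2) + ennreal (e/2)"
      using i2 g(2) by (rule add_strict_mono)
    also have "\<dots> = ennreal e" using \<open>e > 0\<close> by (simp flip: ennreal_plus)
    finally show "\<exists>h. Cc h \<and> (\<integral>\<^sup>+x. ennreal (cmod (f x - h x)) \<partial>lborel) < ennreal e"
      using g(1) by blast
  qed
qed

text \<open>Cutting in space makes a square integrable function integrable; cutting in height makes
  it bounded, which is what lets an L1 approximation be upgraded to L2.\<close>

lemma memL2_truncate:
  assumes f: "memL2 f"
  defines "F \<equiv> \<lambda>n x. indicator (cball 0 (real n)) x * (if cmod (f x) \<le> real n then f x else 0)"
  shows "L2_tendsto F f" "integrable lborel (F n)" "cmod (F n x) \<le> real n"
proof -
  note [measurable] = memL2_measurable[OF f]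
  have F[measurable]: "F n \<in> borel_measurable borel" for n
  proof -
    have [measurable]: "cball 0 (real n) \<in> sets (borel :: (real^3) measure)" by (rule borel_closed) simp
    have "{x. cmod (f x) \<le> real n} \<in> sets borel" by measurable
    then have [measurable]: "(\<lambda>x. if cmod (f x) \<le> real n then f x else 0) \<in> borel_measurable borel"
      by (intro measurable_If) auto
    show ?thesis unfolding F_def by (intro borel_measurable_times borel_measurable_indicator) auto
  qed
  have le: "cmod (F n x) \<le> cmod (f x)" for n x
    by (auto simp: F_def norm_mult indicator_def)
  show lim: "L2_tendsto F f"
  proof (rule L2_tendsto_dominated[OF F _ f])
    show "AE x in lborel. (\<lambda>n. F n x) \<longlonglongrightarrow> f x"
    proof (rule AE_I2)
      fix x
      obtain N :: nat where N: "real N \<ge> max (norm x) (cmod (f x))"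
        using real_arch_simple by blast
      have "\<forall>\<^sub>F n in sequentially. F n x = f x"
        using eventually_ge_at_top[of N]
      proof eventually_elim
        case (elim n)
        then have "real n \<ge> max (norm x) (cmod (f x))" using N by linarith
        then show ?case by (simp add: F_def)
      qed
      then show "(\<lambda>n. F n x) \<longlonglongrightarrow> f x" by (rule tendsto_eventually)
    qed
  qed (use le in auto)
  have "memL2 (F n)" using lim by (simp add: L2_tendsto_def)
  from memL2_integrable_mult[OF memL2_indicator[of "cball 0 (real n)" 1] this]
  have "integrable lborel (\<lambda>x. 1 * indicator (cball 0 (real n)) x * F n x)" by simp
  also have "(\<lambda>x. 1 * indicator (cball 0 (real n)) x * F n x) = F n"
    by (auto simp: F_def fun_eq_iff indicator_def)
  finally show "integrable lborel (F n)" .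
  show "cmod (F n x) \<le> real n" by (auto simp: F_def norm_mult indicator_def)
qed

text \<open>The bounded truncation \<open>F n\<close> is approximated in L1 by g, and g is projected
  onto the disc of radius n. The projection is nonexpansive and fixes the values of
  \<open>F n\<close>, so |F n - h|^2 <= 2 n |F n - g|, and L1 smallness becomes L2
  smallness.\<close>

lemma memL2_approx_Cc:
  assumes f: "memL2 f" and "e > 0"
  shows "\<exists>g. Cc g \<and> Lp_norm 2 (\<lambda>x. f x - g x) < e"
proof -
  define F where "F n x = indicator (cball 0 (real n)) x * (if cmod (f x) \<le> real n then f x else 0)" for n x
  have F: "L2_tendsto F f" "integrable lborel (F n)" "cmod (F n x) \<le> real n" for n x
    using memL2_truncate[OF f] unfolding F_def by blast+
  have Fm: "memL2 (F n)" for n using F(1) by (simp add: L2_tendsto_def)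
  have "\<forall>\<^sub>F n in sequentially. Lp_norm 2 (\<lambda>x. F n x - f x) < e / 2"
    using F(1) \<open>e > 0\<close> unfolding L2_tendsto_def by (intro order_tendstoD) auto
  then obtain n where n: "Lp_norm 2 (\<lambda>x. F n x - f x) < e / 2"
    by (auto simp: eventually_sequentially)
  \<comment> \<open>Chosen so that 2 n d < (e / 2)^2; the summand 1 allows n = 0.\<close>
  define d where "d = (e / 2)\<^sup>2 / (2 * real n + 1)"
  have d: "d > 0" using \<open>e > 0\<close> by (simp add: d_def)
  obtain g where g: "Cc g" "(\<integral>\<^sup>+x. ennreal (cmod (F n x - g x)) \<partial>lborel) < ennreal d"
    using integrable_approx_Cc[OF F(2)] d by blast
  define h where "h x = closest_point (cball 0 (real n)) (g x)" for x
  have ne: "cball 0 (real n) \<noteq> ({} :: complex set)" by simp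
  have "continuous_on UNIV h"
    unfolding h_def using g(1) ne
    by (intro continuous_on_compose2[OF continuous_on_closest_point[of "cball 0 (real n)" UNIV]])
       (auto simp: Cc_def)
  moreover have "closest_point (cball 0 (real n)) 0 = (0 :: complex)"
    by (rule closest_point_self) simp
  ultimately have h: "Cc h"
    using g(1) unfolding Cc_def h_def by metis
  note hm = memL2_Cc[OF h]
  note [measurable] = memL2_measurable[OF Fm] memL2_measurable[OF hm] memL2_measurable[OF memL2_Cc[OF g(1)]]
  have pt: "(cmod (F n x - h x))\<^sup>2 \<le> 2 * real n * cmod (F n x - g x)" for x
  proof -
    have Fself: "closest_point (cball 0 (real n)) (F n x) = F n x"
      by (rule closest_point_self) (use F(3) in simp)
    have "dist (closest_point (cball 0 (real n)) (F n x)) (h x) \<le> dist (F n x) (g x)"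
      unfolding h_def by (rule closest_point_lipschitz[OF convex_cball closed_cball ne])
    then have 1: "cmod (F n x - h x) \<le> cmod (F n x - g x)"
      unfolding Fself by (simp add: dist_norm)
    have "h x \<in> cball 0 (real n)"
      unfolding h_def by (rule closest_point_in_set[OF closed_cball ne])
    then have 2: "cmod (F n x - h x) \<le> 2 * real n"
      using F(3)[of n x] norm_triangle_ineq4[of "F n x" "h x"] by simp
    show ?thesis unfolding power2_eq_square
      by (rule mult_mono[OF 2 1]) auto
  qed
  have "ennreal ((Lp_norm 2 (\<lambda>x. F n x - h x))\<^sup>2) = (\<integral>\<^sup>+x. ennreal ((cmod (F n x - h x))\<^sup>2) \<partial>lborel)"
    by (rule nn_integral_cmod_square[OF memL2_diff[OF Fm hm], symmetric])
  also have "\<dots> \<le> (\<integral>\<^sup>+x. ennreal (2 * real n) * ennreal (cmod (F n x - g x)) \<partial>lborel)"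
    by (intro nn_integral_mono) (simp add: pt flip: ennreal_mult)
  also have "\<dots> = ennreal (2 * real n) * (\<integral>\<^sup>+x. ennreal (cmod (F n x - g x)) \<partial>lborel)"
    by (rule nn_integral_cmult) auto
  also have "\<dots> \<le> ennreal (2 * real n) * ennreal d"
    by (rule mult_left_mono[OF less_imp_le[OF g(2)]]) simp
  also have "\<dots> = ennreal (2 * real n * d)"
    using d by (simp add: ennreal_mult)
  also have "\<dots> < ennreal ((e / 2)\<^sup>2)"
    using \<open>e > 0\<close> by (intro ennreal_lessI) (auto simp: d_def field_simps)
  finally have "(Lp_norm 2 (\<lambda>x. F n x - h x))\<^sup>2 < (e / 2)\<^sup>2"
    by (simp add: ennreal_less_iff)
  then have "Lp_norm 2 (\<lambda>x. F n x - h x) < e / 2"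
    by (rule power2_less_imp_less) (use \<open>e > 0\<close> in simp)
  then have "Lp_norm 2 (\<lambda>x. f x - h x) < e"
    using Lp_norm_2_triangle_diff[OF f Fm[of n] hm] n Lp_norm_2_minus_commute[of f "F n"] by simp
  then show ?thesis using h by blast
qed

text \<open>Operators bounded uniformly on L2 converge strongly as soon as they converge on a dense
  set, here the continuous functions of compact support. The error e is split into three: two from
  the uniform bound, one from convergence on the dense set.\<close>

lemma L2_tendsto_operators:
  assumes diff: "\<And>n f g x. T n (\<lambda>x. f x - g x) x = T n f x - T n g x"
      "\<And>f g x. S (\<lambda>x. f x - g x) x = S f x - S g x"
    and mem: "\<And>n f. memL2 f \<Longrightarrow> memL2 (T n f)" "\<And>f. memL2 f \<Longrightarrow> memL2 (S f)"
    and bound: "\<And>n f. memL2 f \<Longrightarrow> Lp_norm 2 (T n f) \<le> C * Lp_norm 2 f"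
      "\<And>f. memL2 f \<Longrightarrow> Lp_norm 2 (S f) \<le> C * Lp_norm 2 f"
    and Cc: "\<And>g. Cc g \<Longrightarrow> L2_tendsto (\<lambda>n. T n g) (S g)"
    and f: "memL2 f"
  shows "L2_tendsto (\<lambda>n. T n f) (S f)"
  unfolding L2_tendsto_def
proof (intro conjI allI mem f)
  show "(\<lambda>n. Lp_norm 2 (\<lambda>x. T n f x - S f x)) \<longlonglongrightarrow> 0"
  proof (rule LIMSEQ_I)
    fix e :: real assume "e > 0"
    define d where "d = e / (3 * (\<bar>C\<bar> + 1))"
    have d: "d > 0" using \<open>e > 0\<close> by (simp add: d_def add_nonneg_pos)
    have Cd: "C * d \<le> e / 3"
    proof -
      have "C * d \<le> (\<bar>C\<bar> + 1) * d" using d by (intro mult_right_mono) auto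
      also have "\<dots> = e / 3" by (simp add: d_def add_nonneg_pos[THEN less_imp_neq, symmetric] field_simps)
      finally show ?thesis .
    qed
    obtain g where g: "Cc g" "Lp_norm 2 (\<lambda>x. f x - g x) < d"
      using memL2_approx_Cc[OF f d] by blast
    note gm = memL2_Cc[OF g(1)]
    have fg: "memL2 (\<lambda>x. f x - g x)" using f gm by (rule memL2_diff)
    have "\<forall>\<^sub>F n in sequentially. Lp_norm 2 (\<lambda>x. T n g x - S g x) < e / 3"
      using Cc[OF g(1)] \<open>e > 0\<close> unfolding L2_tendsto_def by (intro order_tendstoD) auto
    then obtain N where N: "\<And>n. n \<ge> N \<Longrightarrow> Lp_norm 2 (\<lambda>x. T n g x - S g x) < e / 3"
      by (auto simp: eventually_sequentially)
    have Td: "T n (\<lambda>x. f x - g x) = (\<lambda>x. T n f x - T n g x)" for n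
      by (rule ext) (rule diff(1))
    have Sd: "S (\<lambda>x. f x - g x) = (\<lambda>x. S f x - S g x)"
      by (rule ext) (rule diff(2))
    have Cpos: "C * Lp_norm 2 (\<lambda>x. f x - g x) \<le> e / 3"
    proof (cases "C \<ge> 0")
      case True
      then have "C * Lp_norm 2 (\<lambda>x. f x - g x) \<le> C * d" using g(2) by (intro mult_left_mono) auto
      then show ?thesis using Cd by linarith
    next
      case False
      then have "C * Lp_norm 2 (\<lambda>x. f x - g x) \<le> 0" by (simp add: mult_nonpos_nonneg)
      then show ?thesis using \<open>e > 0\<close> by linarith
    qed
    have "Lp_norm 2 (\<lambda>x. T n f x - S f x) < e" if "n \<ge> N" for n
    proof -
      have 1: "Lp_norm 2 (\<lambda>x. T n f x - T n g x) \<le> e / 3"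
        using bound(1)[OF fg, of n] Cpos unfolding Td by linarith
      have 2: "Lp_norm 2 (\<lambda>x. S g x - S f x) \<le> e / 3"
        using bound(2)[OF fg] Cpos unfolding Sd Lp_norm_2_minus_commute[of "S g" "S f"] by linarith
      have "Lp_norm 2 (\<lambda>x. T n f x - S f x)
          \<le> Lp_norm 2 (\<lambda>x. T n f x - T n g x) + Lp_norm 2 (\<lambda>x. T n g x - S f x)"
        by (rule Lp_norm_2_triangle_diff[OF mem(1)[OF f] mem(1)[OF gm] mem(2)[OF f]])
      also have "Lp_norm 2 (\<lambda>x. T n g x - S f x)
          \<le> Lp_norm 2 (\<lambda>x. T n g x - S g x) + Lp_norm 2 (\<lambda>x. S g x - S f x)"
        by (rule Lp_norm_2_triangle_diff[OF mem(1)[OF gm] mem(2)[OF gm] mem(2)[OF f]])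
      finally show ?thesis using 1 2 N[OF that] by linarith
    qed
    then show "\<exists>N. \<forall>n\<ge>N. norm (Lp_norm 2 (\<lambda>x. T n f x - S f x) - 0) < e"
      by auto
  qed
qed

section \<open>Strong continuity of translations and dilations on L2\<close>

lemma memL2_affine:
  assumes "memL2 f" "c \<noteq> 0" shows "memL2 (\<lambda>x. f (t + c *\<^sub>R x))"
  using assms integrable_affine3[OF assms(2) memL2_integrable[OF assms(1)], of t]
  unfolding memL2_def by (auto intro: measurable_compose[rotated])

lemma Lp_norm_2_affine:
  assumes "c \<noteq> 0"
  shows "Lp_norm 2 (\<lambda>x. f (t + c *\<^sub>R x)) = sqrt (1 / \<bar>c\<bar> ^ 3) * Lp_norm 2 f"
  using integral_affine3[OF assms, of "\<lambda>x. (cmod (f x))\<^sup>2" t]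
  by (simp add: Lp_norm_2 real_sqrt_mult real_sqrt_divide)

text \<open>Translations serve the mollification below, dilations the continuity of the path
  \<open>dilate t u\<close>. Treating both at once costs only a bound for
  \<open>inverse (c n)\<close>, which makes the operators uniformly bounded.\<close>

lemma L2_tendsto_affine:
  fixes t :: "nat \<Rightarrow> real^3"
  assumes f: "memL2 f" and t: "t \<longlonglongrightarrow> t0" and c: "c \<longlonglongrightarrow> c0" "\<And>n. c n \<noteq> 0" "c0 \<noteq> 0"
  shows "L2_tendsto (\<lambda>n x. f (t n + c n *\<^sub>R x)) (\<lambda>x. f (t0 + c0 *\<^sub>R x))"
proof -
  have "(\<lambda>n. inverse (c n)) \<longlonglongrightarrow> inverse c0" by (intro tendsto_inverse c)
  then have "Bseq (\<lambda>n. inverse (c n))" using convergent_imp_Bseq convergent_def by blast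
  then obtain K where K: "K > 0" "\<And>n. norm (inverse (c n)) \<le> K" by (auto elim: BseqE)
  have K0: "\<bar>inverse c0\<bar> \<le> K"
    using LIMSEQ_le_const2[OF tendsto_norm[OF \<open>(\<lambda>n. inverse (c n)) \<longlonglongrightarrow> inverse c0\<close>], of K] K by auto
  obtain L where L: "\<And>n. norm (t n) \<le> L"
    using t convergent_imp_Bseq convergent_def by (metis BseqE)
  have bd: "sqrt (1 / \<bar>d\<bar> ^ 3) \<le> sqrt (K ^ 3)" if "\<bar>inverse d\<bar> \<le> K" for d :: real
    using power_mono[OF that, of 3] by (simp add: power_inverse power_abs divide_inverse abs_inverse)
  show ?thesis
  proof (rule L2_tendsto_operators[where T="\<lambda>n f x. f (t n + c n *\<^sub>R x)" and S="\<lambda>f x. f (t0 + c0 *\<^sub>R x)" and C="sqrt (K ^ 3)"])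
    show "Lp_norm 2 (\<lambda>x. g (t n + c n *\<^sub>R x)) \<le> sqrt (K ^ 3) * Lp_norm 2 g" for n and g
      unfolding Lp_norm_2_affine[OF c(2)] by (intro mult_right_mono bd) (use K in auto)
    show "Lp_norm 2 (\<lambda>x. g (t0 + c0 *\<^sub>R x)) \<le> sqrt (K ^ 3) * Lp_norm 2 g" for g
      unfolding Lp_norm_2_affine[OF c(3)] by (intro mult_right_mono bd K0) auto
    fix g assume g: "Cc g"
    obtain M R where MR: "continuous_on UNIV g" "M \<ge> 0" "R > 0" "\<And>x. cmod (g x) \<le> M * indicator (cball 0 R) x"
      using CcE[OF g] by metis
    note [measurable] = borel_measurable_continuous_onI[OF MR(1)]
    \<comment> \<open>If \<open>t n + c n *\<^sub>R x\<close> lies in the ball of radius R that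
      carries g, then |c n| |x| <= R + L, so x lies in one ball that is the same for all n.\<close>
    define R' where "R' = K * (R + L)"
    show "L2_tendsto (\<lambda>n x. g (t n + c n *\<^sub>R x)) (\<lambda>x. g (t0 + c0 *\<^sub>R x))"
    proof (rule L2_tendsto_dominated[OF _ _ memL2_indicator[of "cball 0 R'" "complex_of_real M"]])
      show "AE x in lborel. cmod (g (t n + c n *\<^sub>R x)) \<le> cmod (complex_of_real M * indicator (cball 0 R') x)" for n
      proof (rule AE_I2)
        fix x :: "real^3"
        show "cmod (g (t n + c n *\<^sub>R x)) \<le> cmod (complex_of_real M * indicator (cball 0 R') x)"
        proof (cases "norm (t n + c n *\<^sub>R x) \<le> R")
          case True
          have "norm (c n *\<^sub>R x) \<le> norm (t n + c n *\<^sub>R x) + norm (t n)"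
            using norm_triangle_ineq4[of "t n + c n *\<^sub>R x" "t n"] by simp
          then have "\<bar>c n\<bar> * norm x \<le> R + L" using True L[of n] by simp
          then have "\<bar>inverse (c n)\<bar> * (\<bar>c n\<bar> * norm x) \<le> K * (R + L)"
            using K(2)[of n] K(1) by (intro mult_mono) auto
          then have "norm x \<le> R'" using c(2)[of n] by (simp add: R'_def abs_inverse field_simps)
          then show ?thesis using MR(2) MR(4)[of "t n + c n *\<^sub>R x"] True by (simp add: norm_mult)
        next
          case False
          then show ?thesis using MR(4)[of "t n + c n *\<^sub>R x"] by simp
        qed
      qed
      show "AE x in lborel. (\<lambda>n. g (t n + c n *\<^sub>R x)) \<longlonglongrightarrow> g (t0 + c0 *\<^sub>R x)"
        by (intro AE_I2 continuous_on_tendsto_compose[OF MR(1)] tendsto_intros t c) auto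
    qed auto
  qed (use f c(2,3) memL2_affine in auto)
qed

subsection \<open>Mollification\<close>

text \<open>The usual convolution with the rescaled kernel after the substitution y = x - e w. In
  this form the kernel is fixed and only the translation of f depends on e.\<close>

definition mollify :: "(real^3 \<Rightarrow> real) \<Rightarrow> real \<Rightarrow> (real^3 \<Rightarrow> complex) \<Rightarrow> real^3 \<Rightarrow> complex" where
  "mollify \<rho> e f x = (\<integral>w. \<rho> w *\<^sub>R f (x - e *\<^sub>R w) \<partial>lborel)"

text \<open>By Cauchy-Schwarz for the probability density \<rho>, the squared error at x is at most
  the \<rho>-average over w of |f (x - e w) - f x|^2. Integrating in x first leaves the squared L2
  distance of f to a translate, which tends to 0 for each w and is bounded by (2 ||f||)^2.\<close>

lemma mollify_L2_tendsto:
  assumes \<rho>: "integrable lborel \<rho>" "\<And>w. 0 \<le> \<rho> w" "(\<integral>w. \<rho> w \<partial>lborel) = 1"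
    and f: "memL2 f" and e: "e \<longlonglongrightarrow> 0"
  shows "L2_tendsto (\<lambda>n. mollify \<rho> (e n) f) f"
proof -
  note [measurable] = borel_measurable_integrable[OF \<rho>(1)] memL2_measurable[OF f]
  have [measurable]: "mollify \<rho> (e n) f \<in> borel_measurable borel" for n
    unfolding mollify_def[abs_def] by measurable
  have \<rho>nn: "(\<integral>\<^sup>+w. ennreal (\<rho> w) \<partial>lborel) = 1"
    using \<rho> by (subst nn_integral_eq_integral) auto
  define D where "D n w = (\<integral>\<^sup>+x. ennreal ((cmod (f (x - e n *\<^sub>R w) - f x))\<^sup>2) \<partial>lborel)" for n w
  have [measurable]: "D n \<in> borel_measurable borel" for n unfolding D_def by measurable
  have sh: "(\<lambda>x. f (x - z)) = (\<lambda>x. f (- z + 1 *\<^sub>R x))" for z by simp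
  have shm: "memL2 (\<lambda>x. f (x - z))" for z unfolding sh by (rule memL2_affine[OF f]) simp
  have shn: "Lp_norm 2 (\<lambda>x. f (x - z)) = Lp_norm 2 f" for z
    unfolding sh by (subst Lp_norm_2_affine) auto
  have D_eq: "D n w = ennreal ((Lp_norm 2 (\<lambda>x. f (x - e n *\<^sub>R w) - f x))\<^sup>2)" for n w
    unfolding D_def by (rule nn_integral_cmod_square[OF memL2_diff[OF shm f]])
  have D_le: "D n w \<le> ennreal ((2 * Lp_norm 2 f)\<^sup>2)" for n w
    unfolding D_eq
  proof (intro ennreal_leI power_mono)
    have "Lp_norm 2 (\<lambda>x. f (x - e n *\<^sub>R w) + - f x) \<le> Lp_norm 2 (\<lambda>x. f (x - e n *\<^sub>R w)) + Lp_norm 2 (\<lambda>x. - f x)"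
      by (rule Lp_norm_2_triangle[OF shm memL2_minus[OF f]])
    then show "Lp_norm 2 (\<lambda>x. f (x - e n *\<^sub>R w) - f x) \<le> 2 * Lp_norm 2 f"
      using Lp_norm_2_cmult[of "-1" f] by (simp add: shn)
  qed simp
  have D_lim: "(\<lambda>n. D n w) \<longlonglongrightarrow> 0" for w
  proof -
    have "L2_tendsto (\<lambda>n x. f (- (e n *\<^sub>R w) + 1 *\<^sub>R x)) (\<lambda>x. f (- (0 *\<^sub>R w) + 1 *\<^sub>R x))"
      by (rule L2_tendsto_affine[OF f tendsto_minus[OF tendsto_scaleR[OF e tendsto_const]]]) auto
    then have "L2_tendsto (\<lambda>n x. f (x - e n *\<^sub>R w)) f" by simp
    then show ?thesis
      unfolding D_def by (subst L2_tendsto_nn_integral[OF shm f])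
  qed
  have pt: "ennreal ((cmod (mollify \<rho> (e n) f x - f x))\<^sup>2)
      \<le> (\<integral>\<^sup>+w. ennreal (\<rho> w) * ennreal ((cmod (f (x - e n *\<^sub>R w) - f x))\<^sup>2) \<partial>lborel)" for n x
  proof -
    let ?h = "\<lambda>w. \<rho> w *\<^sub>R (f (x - e n *\<^sub>R w) - f x)"
    have "ennreal (cmod (mollify \<rho> (e n) f x - f x)) \<le> (\<integral>\<^sup>+w. ennreal (cmod (?h w)) \<partial>lborel)"
    proof (cases "integrable lborel ?h")
      case True
      have i2: "integrable lborel (\<lambda>w. \<rho> w *\<^sub>R f x)" using \<rho>(1) by simp
      have i1: "integrable lborel (\<lambda>w. \<rho> w *\<^sub>R f (x - e n *\<^sub>R w))"
        using Bochner_Integration.integrable_add[OF True i2] by (simp add: algebra_simps)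
      have "mollify \<rho> (e n) f x - f x = (\<integral>w. ?h w \<partial>lborel)"
        unfolding scaleR_diff_right mollify_def
        using i1 i2 \<rho> by simp
      then show ?thesis using integral_norm_bound_ennreal[OF True] by simp
    next
      \<comment> \<open>If the integrand is not integrable, the right hand side is infinite, so the
        default value of the Bochner integral does no harm.\<close>
      case False
      then have "(\<integral>\<^sup>+w. ennreal (cmod (?h w)) \<partial>lborel) = \<infinity>"
      proof (rule_tac ccontr)
        assume "(\<integral>\<^sup>+w. ennreal (cmod (?h w)) \<partial>lborel) \<noteq> \<infinity>"
        then have "(\<integral>\<^sup>+w. ennreal (cmod (?h w)) \<partial>lborel) < \<infinity>"
          by (simp only: infinity_ennreal_def less_top[symmetric] simp_thms)
        moreover have "?h \<in> borel_measurable lborel" by measurable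
        ultimately have "integrable lborel ?h" by (intro integrableI_bounded)
        then show False using False by contradiction
      qed
      then show ?thesis by simp
    qed
    also have "\<dots> = (\<integral>\<^sup>+w. ennreal (sqrt (\<rho> w)) * ennreal (sqrt (\<rho> w) * cmod (f (x - e n *\<^sub>R w) - f x)) \<partial>lborel)"
      using \<rho>(2) by (intro nn_integral_cong) (simp add: ennreal_mult[symmetric] flip: mult.assoc)
    finally have "(ennreal (cmod (mollify \<rho> (e n) f x - f x)))\<^sup>2
       \<le> (\<integral>\<^sup>+w. ennreal (sqrt (\<rho> w)) * ennreal (sqrt (\<rho> w) * cmod (f (x - e n *\<^sub>R w) - f x)) \<partial>lborel)\<^sup>2"
      by (rule power_mono) simp
    also have "\<dots> \<le> (\<integral>\<^sup>+w. (ennreal (sqrt (\<rho> w)))\<^sup>2 \<partial>lborel)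
        * (\<integral>\<^sup>+w. (ennreal (sqrt (\<rho> w) * cmod (f (x - e n *\<^sub>R w) - f x)))\<^sup>2 \<partial>lborel)"
      by (rule Cauchy_Schwarz_nn_integral) measurable
    also have "(\<integral>\<^sup>+w. (ennreal (sqrt (\<rho> w)))\<^sup>2 \<partial>lborel) = 1"
      using \<rho>(2) by (simp add: ennreal_power \<rho>nn)
    also have "(\<integral>\<^sup>+w. (ennreal (sqrt (\<rho> w) * cmod (f (x - e n *\<^sub>R w) - f x)))\<^sup>2 \<partial>lborel)
       = (\<integral>\<^sup>+w. ennreal (\<rho> w) * ennreal ((cmod (f (x - e n *\<^sub>R w) - f x))\<^sup>2) \<partial>lborel)"
      using \<rho>(2) by (intro nn_integral_cong) (simp add: ennreal_power power_mult_distrib ennreal_mult)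
    finally show ?thesis by (simp add: ennreal_power)
  qed
  have le: "(\<integral>\<^sup>+x. ennreal ((cmod (mollify \<rho> (e n) f x - f x))\<^sup>2) \<partial>lborel)
      \<le> (\<integral>\<^sup>+w. ennreal (\<rho> w) * D n w \<partial>lborel)" for n
  proof -
    have "(\<integral>\<^sup>+x. ennreal ((cmod (mollify \<rho> (e n) f x - f x))\<^sup>2) \<partial>lborel)
      \<le> (\<integral>\<^sup>+x. (\<integral>\<^sup>+w. ennreal (\<rho> w) * ennreal ((cmod (f (x - e n *\<^sub>R w) - f x))\<^sup>2) \<partial>lborel) \<partial>lborel)"
      by (intro nn_integral_mono pt)
    also have "\<dots> = (\<integral>\<^sup>+w. (\<integral>\<^sup>+x. ennreal (\<rho> w) * ennreal ((cmod (f (x - e n *\<^sub>R w) - f x))\<^sup>2) \<partial>lborel) \<partial>lborel)"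
      by (rule lborel_pair.Fubini') measurable
    also have "\<dots> = (\<integral>\<^sup>+w. ennreal (\<rho> w) * D n w \<partial>lborel)"
      unfolding D_def by (intro nn_integral_cong nn_integral_cmult) measurable
    finally show ?thesis .
  qed
  have lim: "(\<lambda>n. \<integral>\<^sup>+w. ennreal (\<rho> w) * D n w \<partial>lborel) \<longlonglongrightarrow> (\<integral>\<^sup>+w. 0 \<partial>(lborel :: (real^3) measure))"
  proof (rule nn_integral_dominated_convergence[where w="\<lambda>w. ennreal (\<rho> w) * ennreal ((2 * Lp_norm 2 f)\<^sup>2)"])
    show "AE w in lborel. ennreal (\<rho> w) * D n w \<le> ennreal (\<rho> w) * ennreal ((2 * Lp_norm 2 f)\<^sup>2)" for n
      by (intro AE_I2 mult_left_mono D_le) simp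
    show "(\<integral>\<^sup>+w. ennreal (\<rho> w) * ennreal ((2 * Lp_norm 2 f)\<^sup>2) \<partial>lborel) < \<infinity>"
      by (simp add: nn_integral_multc \<rho>nn del: ennreal_power)
    show "AE w in lborel. (\<lambda>n. ennreal (\<rho> w) * D n w) \<longlonglongrightarrow> 0"
    proof (rule AE_I2)
      fix w
      have "(\<lambda>n. ennreal (\<rho> w) * D n w) \<longlonglongrightarrow> ennreal (\<rho> w) * 0"
        by (intro ennreal_tendsto_cmult D_lim) simp
      then show "(\<lambda>n. ennreal (\<rho> w) * D n w) \<longlonglongrightarrow> 0" by simp
    qed
  qed measurable
  have "(\<lambda>n. \<integral>\<^sup>+x. ennreal ((cmod (mollify \<rho> (e n) f x - f x))\<^sup>2) \<partial>lborel) \<longlonglongrightarrow> 0"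
    by (rule tendsto_sandwich[OF _ _ tendsto_const, of _ _ sequentially "\<lambda>n. \<integral>\<^sup>+w. ennreal (\<rho> w) * D n w \<partial>lborel"])
       (use le lim in auto)
  moreover have mem: "memL2 (mollify \<rho> (e n) f)" for n
  proof -
    have "(\<integral>\<^sup>+w. ennreal (\<rho> w) * D n w \<partial>lborel) \<le> (\<integral>\<^sup>+w. ennreal (\<rho> w) * ennreal ((2 * Lp_norm 2 f)\<^sup>2) \<partial>lborel)"
      by (intro nn_integral_mono mult_left_mono D_le) simp
    also have "\<dots> < \<infinity>" by (simp add: nn_integral_multc \<rho>nn del: ennreal_power)
    finally have "(\<integral>\<^sup>+x. ennreal ((cmod (mollify \<rho> (e n) f x - f x))\<^sup>2) \<partial>lborel) < \<infinity>"
      using le[of n] by (rule le_less_trans[rotated])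
    then have "memL2 (\<lambda>x. mollify \<rho> (e n) f x - f x)"
      unfolding memL2_def by (intro conjI integrableI_bounded) auto
    from memL2_add[OF this f] show ?thesis by simp
  qed
  ultimately show ?thesis
    using L2_tendsto_nn_integral[of "\<lambda>n. mollify \<rho> (e n) f" f, OF mem f] by simp
qed

section \<open>The Plancherel theorem\<close>

subsection \<open>Coordinates and Gaussians\<close>

text \<open>Carries iterated integrals over a product type to \<open>real^3\<close>. Two arguments
  work coordinate by coordinate: the transform of the Gaussian and the Ladyzhenskaya
  inequality.\<close>

definition coords3 :: "real \<times> real \<times> real \<Rightarrow> real^3" where
  "coords3 = (\<lambda>(x, y, z). vector [x, y, z])"

lemma coords3_nth [simp]:
  "coords3 (x, y, z) $ 1 = x" "coords3 (x, y, z) $ 2 = y" "coords3 (x, y, z) $ 3 = z"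
  by (simp_all add: coords3_def)

lemma measurable_coords3 [measurable]: "coords3 \<in> borel_measurable borel"
proof -
  have "coords3 p = fst p *\<^sub>R axis 1 1 + fst (snd p) *\<^sub>R axis 2 1 + snd (snd p) *\<^sub>R axis 3 1" for p
    by (cases p) (auto simp: vec_eq_iff forall_3 axis_def)
  then have eq: "coords3 = (\<lambda>p. fst p *\<^sub>R axis 1 1 + fst (snd p) *\<^sub>R axis 2 1 + snd (snd p) *\<^sub>R axis 3 1)"
    by (rule ext)
  have "continuous_on UNIV (\<lambda>p :: real \<times> real \<times> real. fst p *\<^sub>R axis 1 1 + fst (snd p) *\<^sub>R axis 2 1 + snd (snd p) *\<^sub>R axis 3 1 :: real^3)"
    by (intro continuous_intros)
  then show ?thesis unfolding eq by (rule borel_measurable_continuous_onI)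
qed

lemma prod_Basis_vec: "(\<Prod>b\<in>(Basis :: (real^3) set). g b) = g (axis 1 1) * g (axis 2 1) * g (axis 3 1)"
proof -
  have B: "(Basis :: (real^3) set) = {axis 1 1, axis 2 1, axis 3 1}"
    by (auto simp: Basis_vec_def UNIV_3)
  show ?thesis unfolding B by (simp add: axis_eq_axis mult.assoc)
qed

text \<open>A measure that gives every open box the product of its side lengths is Lebesgue measure,
  and the preimage of a box is again a box.\<close>

lemma lborel_coords3: "distr lborel borel coords3 = lborel"
proof (rule lborel_eqI[symmetric])
  fix l u :: "real^3"
  assume le: "\<And>b. b \<in> Basis \<Longrightarrow> l \<bullet> b \<le> u \<bullet> b"
  have le': "l $ i \<le> u $ i" for i
    using le[of "axis i 1"] by (simp add: inner_axis axis_in_Basis_iff)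
  have "coords3 -` box l u = box (l$1, l$2, l$3) (u$1, u$2, u$3)"
    by (auto simp: mem_box_cart forall_3 mem_box Basis_prod_def ball_Un)
  then have "emeasure (distr lborel borel coords3) (box l u) = emeasure lborel (box (l$1, l$2, l$3) (u$1, u$2, u$3))"
    by (subst emeasure_distr) auto
  also have "\<dots> = ennreal ((u$1 - l$1) * (u$2 - l$2) * (u$3 - l$3))"
  proof -
    have B: "(Basis :: (real \<times> real \<times> real) set) = {(1, 0, 0), (0, 1, 0), (0, 0, 1)}"
      by (auto simp: Basis_prod_def zero_prod_def)
    show ?thesis
      by (subst emeasure_lborel_box) (auto simp: B le' mult.assoc)
  qed
  finally show "emeasure (distr lborel borel coords3) (box l u) = (\<Prod>b\<in>Basis. (u - l) \<bullet> b)"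
    by (simp add: prod_Basis_vec inner_axis)
qed simp

lemma nn_integral_coords3:
  fixes f :: "real^3 \<Rightarrow> ennreal"
  assumes f[measurable]: "f \<in> borel_measurable borel"
  shows "(\<integral>\<^sup>+v. f v \<partial>lborel) = (\<integral>\<^sup>+x. \<integral>\<^sup>+y. \<integral>\<^sup>+z. f (coords3 (x, y, z)) \<partial>lborel \<partial>lborel \<partial>lborel)"
proof -
  have "(\<integral>\<^sup>+v. f v \<partial>lborel) = (\<integral>\<^sup>+p. f (coords3 p) \<partial>lborel)"
    by (subst lborel_coords3[symmetric]) (rule nn_integral_distr, auto)
  also have "\<dots> = (\<integral>\<^sup>+p. f (coords3 p) \<partial>(lborel \<Otimes>\<^sub>M lborel))"
    by (simp add: lborel_prod)
  also have "\<dots> = (\<integral>\<^sup>+x. \<integral>\<^sup>+q. f (coords3 (x, q)) \<partial>lborel \<partial>lborel)"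
    by (rule lborel.nn_integral_fst[symmetric]) (simp add: lborel_prod)
  also have "\<dots> = (\<integral>\<^sup>+x. \<integral>\<^sup>+q. f (coords3 (x, q)) \<partial>(lborel \<Otimes>\<^sub>M lborel) \<partial>lborel)"
    by (simp add: lborel_prod)
  also have "\<dots> = (\<integral>\<^sup>+x. \<integral>\<^sup>+y. \<integral>\<^sup>+z. f (coords3 (x, y, z)) \<partial>lborel \<partial>lborel \<partial>lborel)"
    by (intro nn_integral_cong, rule lborel.nn_integral_fst[symmetric]) (simp add: lborel_prod)
  finally show ?thesis .
qed

lemma integrable_pair_mult:
  fixes f :: "'a::euclidean_space \<Rightarrow> complex" and g :: "'b::euclidean_space \<Rightarrow> complex"
  assumes f: "integrable lborel f" and g: "integrable lborel g"
  shows "integrable (lborel \<Otimes>\<^sub>M lborel) (\<lambda>(x, y). f x * g y)" (is ?i)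
    and "(\<integral>p. (\<lambda>(x, y). f x * g y) p \<partial>(lborel \<Otimes>\<^sub>M lborel)) = (\<integral>x. f x \<partial>lborel) * (\<integral>y. g y \<partial>lborel)"
proof -
  note [measurable] = borel_measurable_integrable[OF f] borel_measurable_integrable[OF g]
  show i: ?i
  proof (rule lborel_pair.Fubini_integrable)
    show "integrable lborel (\<lambda>x. \<integral>y. norm ((\<lambda>(x, y). f x * g y) (x, y)) \<partial>lborel)"
      using f by (simp add: norm_mult)
    show "AE x in lborel. integrable lborel (\<lambda>y. (\<lambda>(x, y). f x * g y) (x, y))"
      using g by simp
  qed measurable
  show "(\<integral>p. (\<lambda>(x, y). f x * g y) p \<partial>(lborel \<Otimes>\<^sub>M lborel)) = (\<integral>x. f x \<partial>lborel) * (\<integral>y. g y \<partial>lborel)"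
    by (subst lborel_pair.integral_fst'[OF i, symmetric]) simp
qed

lemma integral_prod_coords3:
  fixes f g h :: "real \<Rightarrow> complex"
  assumes f: "integrable lborel f" and g: "integrable lborel g" and h: "integrable lborel h"
  shows "integrable lborel (\<lambda>v :: real^3. f (v$1) * (g (v$2) * h (v$3)))"
    and "(\<integral>v. f (v$1) * (g (v$2) * h (v$3)) \<partial>(lborel :: (real^3) measure))
       = (\<integral>x. f x \<partial>lborel) * ((\<integral>x. g x \<partial>lborel) * (\<integral>x. h x \<partial>lborel))"
proof -
  note [measurable] = borel_measurable_integrable[OF f] borel_measurable_integrable[OF g] borel_measurable_integrable[OF h]
  have nth [measurable]: "(\<lambda>v :: real^3. v $ i) \<in> borel_measurable borel" for i
    by (intro borel_measurable_continuous_onI continuous_intros)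
  have m: "(\<lambda>v :: real^3. f (v$1) * (g (v$2) * h (v$3))) \<in> borel_measurable borel" by measurable
  note gh = integrable_pair_mult[OF g h, unfolded lborel_prod]
  note fgh = integrable_pair_mult[OF f gh(1), unfolded lborel_prod gh(2)]
  have e: "(\<lambda>p. f (coords3 p $ 1) * (g (coords3 p $ 2) * h (coords3 p $ 3))) = (\<lambda>(x, q). f x * (\<lambda>(y, z). g y * h z) q)"
    by (auto simp: fun_eq_iff)
  show "integrable lborel (\<lambda>v :: real^3. f (v$1) * (g (v$2) * h (v$3)))"
    by (subst lborel_coords3[symmetric], subst integrable_distr_eq) (use m fgh(1) in \<open>simp_all add: e\<close>)
  show "(\<integral>v. f (v$1) * (g (v$2) * h (v$3)) \<partial>(lborel :: (real^3) measure))
       = (\<integral>x. f x \<partial>lborel) * ((\<integral>x. g x \<partial>lborel) * (\<integral>x. h x \<partial>lborel))"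
    by (subst lborel_coords3[symmetric], subst integral_distr) (use m fgh(2) in \<open>simp_all add: e\<close>)
qed

definition gauss :: "real^3 \<Rightarrow> real" where
  "gauss x = exp (- (norm x)\<^sup>2 / 2)"

text \<open>The normalization of \<open>gauss\<close> to mass 1. With the transform taken without
  prefactor, \<open>gauss_density\<close> is sent to \<open>gauss\<close>, and \<open>gauss\<close>
  to (2 pi)^3 times \<open>gauss_density\<close>.\<close>

definition gauss_density :: "real^3 \<Rightarrow> real" where
  "gauss_density x = gauss x / sqrt (2 * pi) ^ 3"

lemma norm_vec3_square: "(norm (x :: real^3))\<^sup>2 = (x$1)\<^sup>2 + (x$2)\<^sup>2 + (x$3)\<^sup>2"
  by (simp add: norm_vec_def L2_set_def sum_3)

lemma gauss_density_prod:
  "gauss_density x = std_normal_density (x$1) * (std_normal_density (x$2) * std_normal_density (x$3))"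
  unfolding gauss_density_def gauss_def norm_vec3_square std_normal_density_def
  by (simp add: power3_eq_cube mult_exp_exp[symmetric] field_simps exp_add[symmetric] flip: exp_minus)

lemma gauss_bounds: "0 < gauss x" "gauss x \<le> 1" "0 < gauss_density x"
  by (auto simp: gauss_def gauss_density_def)

lemma gauss_minus [simp]: "gauss (- x) = gauss x" "gauss_density (- x) = gauss_density x"
  by (simp_all add: gauss_def gauss_density_def)

lemma measurable_gauss [measurable]: "gauss \<in> borel_measurable borel" "gauss_density \<in> borel_measurable borel"
  unfolding gauss_def[abs_def] gauss_density_def[abs_def]
  by (intro borel_measurable_continuous_onI continuous_intros; simp)+

text \<open>The characteristic function of the standard normal distribution, read at -t because
  \<open>fourier\<close> carries the opposite sign in the exponent.\<close>

lemma char_normal: "(\<integral>x. exp (- \<i> * complex_of_real (x * t)) * complex_of_real (std_normal_density x) \<partial>lborel)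
   = complex_of_real (exp (- t\<^sup>2 / 2))"
proof -
  have [measurable]: "(\<lambda>x. iexp (- t * x)) \<in> borel_measurable borel"
    by (intro borel_measurable_continuous_onI continuous_intros)
  have "char std_normal_distribution (- t) = (\<integral>x. std_normal_density x *\<^sub>R iexp (- t * x) \<partial>lborel)"
    unfolding char_def by (subst integral_density) auto
  also have "\<dots> = (\<integral>x. exp (- \<i> * complex_of_real (x * t)) * complex_of_real (std_normal_density x) \<partial>lborel)"
    by (intro Bochner_Integration.integral_cong) (auto simp: scaleR_conv_of_real mult_ac)
  finally show ?thesis by (simp add: char_std_normal_distribution)
qed

lemma fourier_gauss_density: "fourier (\<lambda>x. complex_of_real (gauss_density x)) \<xi> = complex_of_real (gauss \<xi>)"
  and integrable_gauss_density: "integrable lborel gauss_density"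
  and integral_gauss_density: "(\<integral>x. gauss_density x \<partial>lborel) = 1"
proof -
  let ?g = "\<lambda>t x. exp (- \<i> * complex_of_real (x * t)) * complex_of_real (std_normal_density x)"
  have gm: "?g t \<in> borel_measurable borel" for t :: real
  proof -
    have [measurable]: "(\<lambda>x :: real. exp (- \<i> * complex_of_real (x * t))) \<in> borel_measurable borel"
      by (intro borel_measurable_continuous_onI continuous_intros)
    show ?thesis by measurable
  qed
  have i: "integrable lborel (?g t)" for t :: real
    by (rule integrable_dominated[where g=std_normal_density]) (use gm in \<open>auto simp: norm_mult\<close>)
  have e: "exp (- \<i> * complex_of_real (x \<bullet> \<xi>)) * complex_of_real (gauss_density x)
      = ?g (\<xi>$1) (x$1) * (?g (\<xi>$2) (x$2) * ?g (\<xi>$3) (x$3))" for x \<xi>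
    by (simp add: gauss_density_prod inner_vec_def sum_3 exp_add[symmetric] algebra_simps exp_diff)
  show F: "fourier (\<lambda>x. complex_of_real (gauss_density x)) \<xi> = complex_of_real (gauss \<xi>)" for \<xi>
  proof -
    have "fourier (\<lambda>x. complex_of_real (gauss_density x)) \<xi>
       = complex_of_real (exp (- (\<xi>$1)\<^sup>2 / 2)) * (complex_of_real (exp (- (\<xi>$2)\<^sup>2 / 2)) * complex_of_real (exp (- (\<xi>$3)\<^sup>2 / 2)))"
      unfolding fourier_def e integral_prod_coords3(2)[OF i i i] char_normal ..
    also have "\<dots> = complex_of_real (gauss \<xi>)"
      unfolding gauss_def norm_vec3_square of_real_mult[symmetric] exp_add[symmetric]
      by (simp add: add_divide_distrib)
    finally show ?thesis .
  qed
  have "integrable lborel (\<lambda>x. complex_of_real (gauss_density x))"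
    using integral_prod_coords3(1)[OF i i i, of 0 0 0] by (simp add: gauss_density_prod)
  then show i0: "integrable lborel gauss_density"
    by (simp only: complex_of_real_integrable_eq)
  have "complex_of_real (\<integral>x. gauss_density x \<partial>lborel) = fourier (\<lambda>x. complex_of_real (gauss_density x)) 0"
    unfolding fourier_def by simp
  also have "\<dots> = 1" unfolding F by (simp add: gauss_def)
  finally show "(\<integral>x. gauss_density x \<partial>lborel) = 1" by (simp only: of_real_eq_1_iff)
qed

lemma gauss_eq: "gauss x = sqrt (2 * pi) ^ 3 * gauss_density x"
  by (simp add: gauss_density_def)

lemma integrable_gauss: "integrable lborel gauss"
  unfolding gauss_eq[abs_def] using integrable_gauss_density by simp

lemma fourier_gauss: "fourier (\<lambda>x. complex_of_real (gauss x)) \<xi> = complex_of_real ((2 * pi) ^ 3 * gauss_density \<xi>)"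
proof -
  have "fourier (\<lambda>x. complex_of_real (gauss x)) \<xi> = complex_of_real (sqrt (2 * pi) ^ 3) * fourier (\<lambda>x. complex_of_real (gauss_density x)) \<xi>"
    unfolding fourier_def gauss_eq of_real_mult
    by (subst integral_mult_right_zero[symmetric]) (simp add: mult_ac)
  also have "\<dots> = complex_of_real (sqrt (2 * pi) ^ 3 * (sqrt (2 * pi) ^ 3 * gauss_density \<xi>))"
    unfolding fourier_gauss_density gauss_eq by simp
  also have "sqrt (2 * pi) ^ 3 * (sqrt (2 * pi) ^ 3 * gauss_density \<xi>) = (2 * pi) ^ 3 * gauss_density \<xi>"
    unfolding mult.assoc[symmetric] power_mult_distrib[symmetric] by simp
  finally show ?thesis .
qed

lemma gauss_scaled_integrable: "e \<noteq> 0 \<Longrightarrow> integrable lborel (\<lambda>x. gauss (e *\<^sub>R x))"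
  using integrable_affine3[OF _ integrable_gauss, of e 0] by simp

lemma gauss_scaled_le: "cmod (complex_of_real (gauss (e *\<^sub>R x))) \<le> 1"
  using gauss_bounds(1,2)[of "e *\<^sub>R x"] by (simp add: norm_of_real)

subsection \<open>The Fourier transform of integrable functions\<close>

lemma fourier_kernel_measurable [measurable]:
  "(\<lambda>p :: (real^3) \<times> (real^3). exp (- \<i> * complex_of_real (fst p \<bullet> snd p))) \<in> borel_measurable (borel \<Otimes>\<^sub>M borel)"
  unfolding borel_prod by (intro borel_measurable_continuous_onI continuous_intros)

lemma fourier_measurable:
  assumes "f \<in> borel_measurable borel" shows "fourier f \<in> borel_measurable borel"
proof -
  note [measurable] = assms
  show ?thesis unfolding fourier_def[abs_def] by measurable
qed

lemma fourier_bound: "cmod (fourier f \<xi>) \<le> (\<integral>x. cmod (f x) \<partial>lborel)"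
  unfolding fourier_def by (rule order_trans[OF integral_norm_bound]) (simp add: norm_mult)

lemma integrable_kernel:
  fixes f :: "real^3 \<Rightarrow> complex"
  assumes "integrable lborel f"
  shows "integrable lborel (\<lambda>x. exp (- \<i> * complex_of_real (x \<bullet> \<xi>)) * f x)"
    "integrable lborel (\<lambda>x. exp (\<i> * complex_of_real (x \<bullet> \<xi>)) * f x)"
proof -
  note [measurable] = borel_measurable_integrable[OF assms]
  have [measurable]: "(\<lambda>x. exp (- \<i> * complex_of_real (x \<bullet> \<xi>))) \<in> borel_measurable borel"
    "(\<lambda>x. exp (\<i> * complex_of_real (x \<bullet> \<xi>))) \<in> borel_measurable borel"
    by (intro borel_measurable_continuous_onI continuous_intros)+
  show "integrable lborel (\<lambda>x. exp (- \<i> * complex_of_real (x \<bullet> \<xi>)) * f x)"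
    by (rule integrable_dominated[OF integrable_norm[OF assms]]) (auto simp: norm_mult)
  show "integrable lborel (\<lambda>x. exp (\<i> * complex_of_real (x \<bullet> \<xi>)) * f x)"
    by (rule integrable_dominated[OF integrable_norm[OF assms]]) (auto simp: norm_mult)
qed

lemma integrable_mult_bounded:
  fixes f g :: "real^3 \<Rightarrow> complex"
  assumes f: "integrable lborel f" and [measurable]: "g \<in> borel_measurable borel" and g: "\<And>x. cmod (g x) \<le> C"
  shows "integrable lborel (\<lambda>x. f x * g x)" "integrable lborel (\<lambda>x. g x * f x)"
proof -
  note [measurable] = borel_measurable_integrable[OF f]
  have "cmod (g x * f x) \<le> C * cmod (f x)" for x
    unfolding norm_mult by (rule mult_right_mono[OF g]) simp
  then show *: "integrable lborel (\<lambda>x. g x * f x)"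
    by (intro integrable_dominated[OF integrable_mult_right[OF integrable_norm[OF f], of C]]) auto
  then show "integrable lborel (\<lambda>x. f x * g x)" by (simp add: mult.commute)
qed

text \<open>Fubini, together with the symmetry of the kernel. Inversion and Plancherel below are
  obtained from this multiplication formula by inserting Gaussians.\<close>

lemma fourier_exchange:
  assumes f: "integrable lborel f" and g: "integrable lborel g"
  shows "(\<integral>\<xi>. fourier f \<xi> * g \<xi> \<partial>lborel) = (\<integral>x. f x * fourier g x \<partial>lborel)"
proof -
  note [measurable] = borel_measurable_integrable[OF f] borel_measurable_integrable[OF g]
  let ?k = "\<lambda>x \<xi>. exp (- \<i> * complex_of_real (x \<bullet> \<xi>)) * (f x * g \<xi>)"
  have km: "case_prod ?k \<in> borel_measurable (lborel \<Otimes>\<^sub>M lborel)"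
  proof -
    have "(\<lambda>p. exp (- \<i> * complex_of_real (fst p \<bullet> snd p)) * (f (fst p) * g (snd p))) \<in> borel_measurable (borel \<Otimes>\<^sub>M borel)"
      by (intro borel_measurable_times fourier_kernel_measurable) measurable
    then show ?thesis by (simp add: case_prod_beta')
  qed
  have int: "integrable (lborel \<Otimes>\<^sub>M lborel) (case_prod ?k)"
    by (rule integrable_dominated[OF integrable_norm[OF integrable_pair_mult(1)[OF f g]] km])
       (auto simp: norm_mult)
  have "(\<integral>\<xi>. fourier f \<xi> * g \<xi> \<partial>lborel) = (\<integral>\<xi>. (\<integral>x. ?k x \<xi> \<partial>lborel) \<partial>lborel)"
  proof (rule Bochner_Integration.integral_cong[OF refl])
    fix \<xi>
    have "fourier f \<xi> * g \<xi> = (\<integral>x. exp (- \<i> * complex_of_real (x \<bullet> \<xi>)) * f x * g \<xi> \<partial>lborel)"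
      unfolding fourier_def by (rule integral_mult_left_zero[symmetric])
    then show "fourier f \<xi> * g \<xi> = (\<integral>x. ?k x \<xi> \<partial>lborel)" by (simp only: mult.assoc)
  qed
  also have "\<dots> = (\<integral>x. (\<integral>\<xi>. ?k x \<xi> \<partial>lborel) \<partial>lborel)"
    by (rule lborel_pair.Fubini_integral[OF int])
  also have "\<dots> = (\<integral>x. f x * fourier g x \<partial>lborel)"
  proof (rule Bochner_Integration.integral_cong[OF refl])
    fix x
    have "(\<integral>\<xi>. ?k x \<xi> \<partial>lborel) = (\<integral>\<xi>. f x * (exp (- \<i> * complex_of_real (\<xi> \<bullet> x)) * g \<xi>) \<partial>lborel)"
      by (intro Bochner_Integration.integral_cong) (simp_all add: inner_commute mult_ac)
    also have "\<dots> = f x * fourier g x" unfolding fourier_def by (rule integral_mult_right_zero)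
    finally show "(\<integral>\<xi>. ?k x \<xi> \<partial>lborel) = f x * fourier g x" .
  qed
  finally show ?thesis .
qed

text \<open>The multiplication formula for f and a modulated Gaussian, whose transform is a Gaussian
  density of width e centred at x. The damping makes the inversion integral converge without
  integrability of \<open>fourier f\<close>; its effect on the other side is a mollification of
  f.\<close>

lemma fourier_gauss_summation:
  assumes f: "integrable lborel f" and e: "e > 0"
  shows "(\<integral>\<xi>. exp (\<i> * complex_of_real (\<xi> \<bullet> x)) * (fourier f \<xi> * complex_of_real (gauss (e *\<^sub>R \<xi>))) \<partial>lborel)
    = complex_of_real ((2 * pi) ^ 3) * mollify gauss_density e f x"
proof -
  define g where "g \<xi> = exp (\<i> * complex_of_real (\<xi> \<bullet> x)) * complex_of_real (gauss (e *\<^sub>R \<xi>))" for \<xi>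
  have g: "integrable lborel g"
    unfolding g_def by (rule integrable_kernel(2)) (use gauss_scaled_integrable[of e] e in simp)
  have Fg: "fourier g y = complex_of_real ((2 * pi) ^ 3 / e ^ 3 * gauss_density ((1 / e) *\<^sub>R (x - y)))" for y
  proof -
    have sym: "gauss_density ((1 / e) *\<^sub>R (y - x)) = gauss_density ((1 / e) *\<^sub>R (x - y))"
      using gauss_minus(2)[of "(1 / e) *\<^sub>R (x - y)"] by (simp flip: scaleR_minus_right)
    let ?G = "\<lambda>\<eta>. exp (- \<i> * complex_of_real (\<eta> \<bullet> ((1 / e) *\<^sub>R (y - x)))) * complex_of_real (gauss \<eta>)"
    have "fourier g y = (\<integral>\<xi>. ?G (0 + e *\<^sub>R \<xi>) \<partial>lborel)"
      unfolding fourier_def g_def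
    proof (rule Bochner_Integration.integral_cong[OF refl])
      fix \<xi>
      have "exp (- \<i> * complex_of_real (\<xi> \<bullet> y)) * exp (\<i> * complex_of_real (\<xi> \<bullet> x)) = exp (- \<i> * complex_of_real (\<xi> \<bullet> (y - x)))"
        by (simp add: exp_add[symmetric] inner_diff_right algebra_simps)
      moreover have "(0 + e *\<^sub>R \<xi>) \<bullet> ((1 / e) *\<^sub>R (y - x)) = \<xi> \<bullet> (y - x)" using e by simp
      ultimately show "exp (- \<i> * complex_of_real (\<xi> \<bullet> y)) * (exp (\<i> * complex_of_real (\<xi> \<bullet> x)) * complex_of_real (gauss (e *\<^sub>R \<xi>)))
          = ?G (0 + e *\<^sub>R \<xi>)"
        by (simp only: mult.assoc[symmetric] add_0_left)
    qed
    also have "\<dots> = (1 / \<bar>e\<bar> ^ 3) *\<^sub>R (\<integral>\<eta>. ?G \<eta> \<partial>lborel)"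
      by (rule integral_affine3) (use e in simp)
    also have "(\<integral>\<eta>. ?G \<eta> \<partial>lborel) = fourier (\<lambda>x. complex_of_real (gauss x)) ((1 / e) *\<^sub>R (y - x))"
      unfolding fourier_def ..
    finally show ?thesis unfolding fourier_gauss
      using e unfolding sym
      by (simp add: scaleR_conv_of_real)
  qed
  have "(\<integral>\<xi>. exp (\<i> * complex_of_real (\<xi> \<bullet> x)) * (fourier f \<xi> * complex_of_real (gauss (e *\<^sub>R \<xi>))) \<partial>lborel)
      = (\<integral>\<xi>. fourier f \<xi> * g \<xi> \<partial>lborel)"
    by (simp add: g_def mult_ac)
  also have "\<dots> = (\<integral>y. f y * fourier g y \<partial>lborel)" by (rule fourier_exchange[OF f g])
  also have "\<dots> = (\<integral>y. complex_of_real ((2 * pi) ^ 3 / e ^ 3) * (gauss_density ((1 / e) *\<^sub>R (x - y)) *\<^sub>R f y) \<partial>lborel)"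
    unfolding Fg by (simp add: scaleR_conv_of_real mult_ac)
  also have "\<dots> = complex_of_real ((2 * pi) ^ 3 / e ^ 3) * (\<integral>y. gauss_density ((1 / e) *\<^sub>R (x - y)) *\<^sub>R f y \<partial>lborel)"
    by (rule integral_mult_right_zero)
  also have "(\<integral>y. gauss_density ((1 / e) *\<^sub>R (x - y)) *\<^sub>R f y \<partial>lborel) = complex_of_real (e ^ 3) * mollify gauss_density e f x"
  proof -
    have "mollify gauss_density e f x = (\<integral>w. (\<lambda>y. gauss_density ((1 / e) *\<^sub>R (x - y)) *\<^sub>R f y) (x + (- e) *\<^sub>R w) \<partial>lborel)"
      unfolding mollify_def using e by (intro Bochner_Integration.integral_cong) auto
    also have "\<dots> = (1 / \<bar>- e\<bar> ^ 3) *\<^sub>R (\<integral>y. gauss_density ((1 / e) *\<^sub>R (x - y)) *\<^sub>R f y \<partial>lborel)"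
      by (rule integral_affine3) (use e in simp)
    finally show ?thesis using e by (simp add: scaleR_conv_of_real)
  qed
  finally show ?thesis using e by (simp add: mult.assoc[symmetric])
qed

subsection \<open>Plancherel and Parseval\<close>

lemma gauss_mollify:
  assumes "memL2 f" "e \<longlonglongrightarrow> 0" shows "L2_tendsto (\<lambda>n. mollify gauss_density (e n) f) f"
  by (rule mollify_L2_tendsto[OF integrable_gauss_density _ integral_gauss_density assms])
     (use gauss_bounds(3) in \<open>simp add: less_imp_le\<close>)

text \<open>With the Gaussian weight the conjugate transform of g becomes integrable, so the
  multiplication formula applies; by \<open>fourier_gauss_summation\<close> the transform of the
  weighted function is the conjugate of a mollified g.\<close>

lemma fourier_gauss_Parseval:
  assumes f: "integrable lborel f" and g: "integrable lborel g" and e: "e > 0"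
  shows "(\<integral>\<xi>. fourier f \<xi> * cnj (fourier g \<xi>) * complex_of_real (gauss (e *\<^sub>R \<xi>)) \<partial>lborel)
    = complex_of_real ((2 * pi) ^ 3) * (\<integral>x. f x * cnj (mollify gauss_density e g x) \<partial>lborel)"
proof -
  define k where "k \<xi> = cnj (fourier g \<xi>) * complex_of_real (gauss (e *\<^sub>R \<xi>))" for \<xi>
  have Fm[measurable]: "fourier g \<in> borel_measurable borel" by (rule fourier_measurable[OF borel_measurable_integrable[OF g, simplified]])
  have cm[measurable]: "(\<lambda>\<xi>. cnj (fourier g \<xi>)) \<in> borel_measurable borel"
    by (rule measurable_compose[OF Fm], rule borel_measurable_continuous_onI, rule continuous_on_cnj, rule continuous_on_id)
  have k: "integrable lborel k"
    unfolding k_def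
    by (rule integrable_mult_bounded(2)[OF _ cm]) (use gauss_scaled_integrable[of e] e fourier_bound[of g] in auto)
  have Fk: "fourier k x = cnj (complex_of_real ((2 * pi) ^ 3) * mollify gauss_density e g x)" for x
  proof -
    have "fourier k x = (\<integral>\<xi>. cnj (exp (\<i> * complex_of_real (\<xi> \<bullet> x)) * (fourier g \<xi> * complex_of_real (gauss (e *\<^sub>R \<xi>)))) \<partial>lborel)"
      unfolding fourier_def[of k] k_def
      by (intro Bochner_Integration.integral_cong) (simp_all add: exp_cnj)
    also have "\<dots> = cnj (\<integral>\<xi>. exp (\<i> * complex_of_real (\<xi> \<bullet> x)) * (fourier g \<xi> * complex_of_real (gauss (e *\<^sub>R \<xi>))) \<partial>lborel)"
      by (rule Bochner_Integration.integral_cnj)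
    finally show ?thesis unfolding fourier_gauss_summation[OF g e] .
  qed
  have "(\<integral>\<xi>. fourier f \<xi> * cnj (fourier g \<xi>) * complex_of_real (gauss (e *\<^sub>R \<xi>)) \<partial>lborel) = (\<integral>\<xi>. fourier f \<xi> * k \<xi> \<partial>lborel)"
    by (simp add: k_def mult.assoc)
  also have "\<dots> = (\<integral>x. f x * fourier k x \<partial>lborel)" by (rule fourier_exchange[OF f k])
  also have "\<dots> = (\<integral>x. complex_of_real ((2 * pi) ^ 3) * (f x * cnj (mollify gauss_density e g x)) \<partial>lborel)"
    unfolding Fk by (simp add: mult_ac)
  also have "\<dots> = complex_of_real ((2 * pi) ^ 3) * (\<integral>x. f x * cnj (mollify gauss_density e g x) \<partial>lborel)"
    by (rule integral_mult_right_zero)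
  finally show ?thesis .
qed

lemma L2_tendsto_cnj:
  assumes "L2_tendsto F f" shows "L2_tendsto (\<lambda>n x. cnj (F n x)) (\<lambda>x. cnj (f x))"
proof -
  have "Lp_norm 2 (\<lambda>x. cnj (F n x) - cnj (f x)) = Lp_norm 2 (\<lambda>x. F n x - f x)" for n
    unfolding Lp_norm_2 complex_cnj_diff[symmetric] complex_mod_cnj ..
  then show ?thesis using assms memL2_cnj unfolding L2_tendsto_def by simp
qed

lemma fourier_gauss_Parseval_limit:
  assumes f: "integrable lborel f" "memL2 f" and g: "integrable lborel g" "memL2 g"
  shows "(\<lambda>n. \<integral>\<xi>. fourier f \<xi> * cnj (fourier g \<xi>) * complex_of_real (gauss ((1 / real (Suc n)) *\<^sub>R \<xi>)) \<partial>lborel)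
    \<longlonglongrightarrow> complex_of_real ((2 * pi) ^ 3) * (\<integral>x. f x * cnj (g x) \<partial>lborel)"
proof -
  have "(\<lambda>n. \<integral>x. f x * cnj (mollify gauss_density (1 / real (Suc n)) g x) \<partial>lborel) \<longlonglongrightarrow> (\<integral>x. f x * cnj (g x) \<partial>lborel)"
    by (rule L2_tendsto_integral_mult[OF L2_tendsto_const[OF f(2)] L2_tendsto_cnj[OF gauss_mollify[OF g(2) lim_1_over_n[THEN LIMSEQ_Suc]]]])
  then show ?thesis
    by (subst fourier_gauss_Parseval[OF f(1) g(1)]) (auto intro: tendsto_mult_left)
qed

text \<open>Square integrability of the transform is a conclusion, so the weights are removed by
  monotone rather than dominated convergence: they increase to 1, and the weighted integrals have a
  finite limit.\<close>

theorem Plancherel: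
  assumes f: "integrable lborel f" "memL2 f"
  shows "memL2 (fourier f)" "(Lp_norm 2 (fourier f))\<^sup>2 = (2 * pi) ^ 3 * (Lp_norm 2 f)\<^sup>2"
proof -
  have Fm[measurable]: "fourier f \<in> borel_measurable borel" by (rule fourier_measurable[OF memL2_measurable[OF f(2)]])
  let ?u = "\<lambda>n \<xi>. (cmod (fourier f \<xi>))\<^sup>2 * gauss ((1 / real (Suc n)) *\<^sub>R \<xi>)"
  have gmono: "gauss ((1 / real (Suc n)) *\<^sub>R \<xi>) \<le> gauss ((1 / real (Suc (Suc n))) *\<^sub>R \<xi>)" for n and \<xi> :: "real^3"
  proof -
    have "norm ((1 / real (Suc (Suc n))) *\<^sub>R \<xi>) \<le> norm ((1 / real (Suc n)) *\<^sub>R \<xi>)"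
      by (auto intro!: mult_right_mono divide_left_mono)
    from power_mono[OF this, of 2] show ?thesis by (simp add: gauss_def)
  qed
  have glim: "(\<lambda>n. gauss ((1 / real (Suc n)) *\<^sub>R \<xi>)) \<longlonglongrightarrow> 1" for \<xi>
  proof -
    have "(\<lambda>n. gauss ((1 / real (Suc n)) *\<^sub>R \<xi>)) \<longlonglongrightarrow> exp (- (norm (0 *\<^sub>R \<xi>))\<^sup>2 / 2)"
      unfolding gauss_def by (intro tendsto_intros lim_1_over_n[THEN LIMSEQ_Suc]) simp
    then show ?thesis by simp
  qed
  have int: "integrable lborel (?u n)" for n
  proof -
    have "integrable lborel (\<lambda>\<xi>. complex_of_real (gauss ((1 / real (Suc n)) *\<^sub>R \<xi>)) * complex_of_real ((cmod (fourier f \<xi>))\<^sup>2))"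
    proof (rule integrable_mult_bounded(1))
      show "integrable lborel (\<lambda>\<xi>. complex_of_real (gauss ((1 / real (Suc n)) *\<^sub>R \<xi>)))"
        using gauss_scaled_integrable[of "1 / real (Suc n)"] by simp
      show "cmod (complex_of_real ((cmod (fourier f \<xi>))\<^sup>2)) \<le> (\<integral>x. cmod (f x) \<partial>lborel)\<^sup>2" for \<xi>
        using power_mono[OF fourier_bound[of f \<xi>], of 2] by (simp add: norm_power)
    qed measurable
    then show ?thesis
      unfolding of_real_mult[symmetric] complex_of_real_integrable_eq by (simp add: mult.commute)
  qed
  have "(\<lambda>n. \<integral>\<^sup>+\<xi>. ennreal (?u n \<xi>) \<partial>lborel) \<longlonglongrightarrow> (\<integral>\<^sup>+\<xi>. ennreal ((cmod (fourier f \<xi>))\<^sup>2) \<partial>lborel)"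
  proof (rule nn_integral_LIMSEQ)
    show "incseq (\<lambda>n \<xi>. ennreal (?u n \<xi>))"
      by (intro incseq_SucI le_funI ennreal_leI mult_left_mono gmono) simp
    show "(\<lambda>n. ennreal (?u n \<xi>)) \<longlonglongrightarrow> ennreal ((cmod (fourier f \<xi>))\<^sup>2)" for \<xi>
      using tendsto_mult_left[OF glim, of "(cmod (fourier f \<xi>))\<^sup>2"] by (intro tendsto_ennrealI) simp
  qed measurable
  moreover have "(\<integral>\<^sup>+\<xi>. ennreal (?u n \<xi>) \<partial>lborel) = ennreal (\<integral>\<xi>. ?u n \<xi> \<partial>lborel)" for n
    using int by (intro nn_integral_eq_integral AE_I2 mult_nonneg_nonneg less_imp_le[OF gauss_bounds(1)]) auto
  ultimately have lim1: "(\<lambda>n. ennreal (\<integral>\<xi>. ?u n \<xi> \<partial>lborel)) \<longlonglongrightarrow> (\<integral>\<^sup>+\<xi>. ennreal ((cmod (fourier f \<xi>))\<^sup>2) \<partial>lborel)"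
    by simp
  have "(\<lambda>n. complex_of_real (\<integral>\<xi>. ?u n \<xi> \<partial>lborel)) \<longlonglongrightarrow> complex_of_real ((2 * pi) ^ 3 * (Lp_norm 2 f)\<^sup>2)"
  proof -
    have "(\<integral>\<xi>. fourier f \<xi> * cnj (fourier f \<xi>) * complex_of_real (gauss ((1 / real (Suc n)) *\<^sub>R \<xi>)) \<partial>lborel)
        = complex_of_real (\<integral>\<xi>. ?u n \<xi> \<partial>lborel)" for n
      unfolding complex_norm_square[symmetric] of_real_mult[symmetric] by (rule integral_complex_of_real)
    moreover have "(\<integral>x. f x * cnj (f x) \<partial>lborel) = complex_of_real ((Lp_norm 2 f)\<^sup>2)"
      unfolding complex_norm_square[symmetric] Lp_norm_2_square by (rule integral_complex_of_real)
    ultimately show ?thesis using fourier_gauss_Parseval_limit[OF f f] by simp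
  qed
  then have "(\<lambda>n. \<integral>\<xi>. ?u n \<xi> \<partial>lborel) \<longlonglongrightarrow> (2 * pi) ^ 3 * (Lp_norm 2 f)\<^sup>2"
    by (simp only: tendsto_of_real_iff)
  from tendsto_ennrealI[OF this]
  have eq: "(\<integral>\<^sup>+\<xi>. ennreal ((cmod (fourier f \<xi>))\<^sup>2) \<partial>lborel) = ennreal ((2 * pi) ^ 3 * (Lp_norm 2 f)\<^sup>2)"
    by (rule LIMSEQ_unique[OF lim1])
  show F2: "memL2 (fourier f)"
    unfolding memL2_def using eq by (intro conjI integrableI_bounded) auto
  have "0 \<le> (2 * pi) ^ 3 * (Lp_norm 2 f)\<^sup>2" by simp
  then show "(Lp_norm 2 (fourier f))\<^sup>2 = (2 * pi) ^ 3 * (Lp_norm 2 f)\<^sup>2"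
    using eq unfolding nn_integral_cmod_square[OF F2] by simp
qed

text \<open>Plancherel has made the product of the two transforms integrable, so dominated
  convergence can now remove the Gaussian weight.\<close>

theorem Parseval:
  assumes f: "integrable lborel f" "memL2 f" and g: "integrable lborel g" "memL2 g"
  shows "(\<integral>\<xi>. fourier f \<xi> * cnj (fourier g \<xi>) \<partial>lborel) = complex_of_real ((2 * pi) ^ 3) * (\<integral>x. f x * cnj (g x) \<partial>lborel)"
proof (rule LIMSEQ_unique[OF _ fourier_gauss_Parseval_limit[OF f g]])
  have int: "integrable lborel (\<lambda>\<xi>. fourier f \<xi> * cnj (fourier g \<xi>))"
    by (rule memL2_integrable_mult[OF Plancherel(1)[OF f] memL2_cnj[OF Plancherel(1)[OF g]]])
  show "(\<lambda>n. \<integral>\<xi>. fourier f \<xi> * cnj (fourier g \<xi>) * complex_of_real (gauss ((1 / real (Suc n)) *\<^sub>R \<xi>)) \<partial>lborel)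
      \<longlonglongrightarrow> (\<integral>\<xi>. fourier f \<xi> * cnj (fourier g \<xi>) \<partial>lborel)"
  proof (rule integral_dominated_convergence[OF _ _ integrable_norm[OF int]])
    show "AE \<xi> in lborel. (\<lambda>n. fourier f \<xi> * cnj (fourier g \<xi>) * complex_of_real (gauss ((1 / real (Suc n)) *\<^sub>R \<xi>)))
        \<longlonglongrightarrow> fourier f \<xi> * cnj (fourier g \<xi>)"
    proof (rule AE_I2)
      fix \<xi>
      have "(\<lambda>n. fourier f \<xi> * cnj (fourier g \<xi>) * complex_of_real (gauss ((1 / real (Suc n)) *\<^sub>R \<xi>)))
        \<longlonglongrightarrow> fourier f \<xi> * cnj (fourier g \<xi>) * complex_of_real (exp (- (norm (0 *\<^sub>R \<xi>))\<^sup>2 / 2))"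
        unfolding gauss_def by (intro tendsto_intros lim_1_over_n[THEN LIMSEQ_Suc]) simp
      then show "(\<lambda>n. fourier f \<xi> * cnj (fourier g \<xi>) * complex_of_real (gauss ((1 / real (Suc n)) *\<^sub>R \<xi>)))
        \<longlonglongrightarrow> fourier f \<xi> * cnj (fourier g \<xi>)" by simp
    qed
    show "AE \<xi> in lborel. norm (fourier f \<xi> * cnj (fourier g \<xi>) * complex_of_real (gauss ((1 / real (Suc n)) *\<^sub>R \<xi>)))
        \<le> norm (fourier f \<xi> * cnj (fourier g \<xi>))" for n
      using gauss_scaled_le[of "1 / real (Suc n)"]
      by (intro AE_I2) (simp only: norm_mult mult_left_le mult_nonneg_nonneg norm_ge_zero)
    show "(\<lambda>\<xi>. fourier f \<xi> * cnj (fourier g \<xi>) * complex_of_real (gauss ((1 / real (Suc n)) *\<^sub>R \<xi>))) \<in> borel_measurable lborel" for n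
      by (intro borel_measurable_times borel_measurable_integrable[OF int]) measurable
  qed (rule borel_measurable_integrable[OF int])
qed

subsection \<open>The Fourier transform of square integrable functions\<close>

lemma fourier_diff:
  assumes "integrable lborel f" "integrable lborel g"
  shows "fourier (\<lambda>x. f x - g x) = (\<lambda>\<xi>. fourier f \<xi> - fourier g \<xi>)"
  unfolding fourier_def right_diff_distrib
  by (rule ext, rule Bochner_Integration.integral_diff) (rule integrable_kernel(1), fact)+

text \<open>By Plancherel the approximating transforms are square integrable, so both limits in the
  definition become convergence in the sense of \<open>L2_tendsto\<close>.\<close>

lemma has_L2_fourier_iff:
  "has_L2_fourier f g \<longleftrightarrow>
    (\<exists>F. (\<forall>n. integrable lborel (F n)) \<and> L2_tendsto F f \<and> L2_tendsto (\<lambda>n. fourier (F n)) g)"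
proof
  assume "has_L2_fourier f g"
  then obtain F where m: "memL2 f" "memL2 g" and F: "\<And>n. integrable lborel (F n)" "\<And>n. memL2 (F n)"
    and lim: "(\<lambda>n. \<integral>\<^sup>+x. ennreal ((cmod (F n x - f x))\<^sup>2) \<partial>lborel) \<longlonglongrightarrow> 0"
      "(\<lambda>n. \<integral>\<^sup>+\<xi>. ennreal ((cmod (fourier (F n) \<xi> - g \<xi>))\<^sup>2) \<partial>lborel) \<longlonglongrightarrow> 0"
    unfolding has_L2_fourier_def by blast
  have "L2_tendsto F f" "L2_tendsto (\<lambda>n. fourier (F n)) g"
    using lim L2_tendsto_nn_integral[of F f, OF F(2) m(1)]
      L2_tendsto_nn_integral[of "\<lambda>n. fourier (F n)" g, OF Plancherel(1)[OF F] m(2)] by simp_all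
  then show "\<exists>F. (\<forall>n. integrable lborel (F n)) \<and> L2_tendsto F f \<and> L2_tendsto (\<lambda>n. fourier (F n)) g"
    using F(1) by blast
next
  assume "\<exists>F. (\<forall>n. integrable lborel (F n)) \<and> L2_tendsto F f \<and> L2_tendsto (\<lambda>n. fourier (F n)) g"
  then obtain F where F: "\<And>n. integrable lborel (F n)" and l: "L2_tendsto F f" "L2_tendsto (\<lambda>n. fourier (F n)) g"
    by blast
  have m: "memL2 (F n)" "memL2 (fourier (F n))" "memL2 f" "memL2 g" for n
    using l by (simp_all add: L2_tendsto_def)
  show "has_L2_fourier f g"
    unfolding has_L2_fourier_def
    using F m l L2_tendsto_nn_integral[of F f, OF m(1) m(3)]
      L2_tendsto_nn_integral[of "\<lambda>n. fourier (F n)" g, OF m(2) m(4)] by blast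
qed

lemma has_L2_fourier_memL2:
  assumes "has_L2_fourier f g" shows "memL2 f" "memL2 g"
  using assms by (simp_all add: has_L2_fourier_def)

lemma has_L2_fourier_fourier:
  assumes "integrable lborel f" "memL2 f" shows "has_L2_fourier f (fourier f)"
  unfolding has_L2_fourier_iff
  by (rule exI[of _ "\<lambda>n. f"]) (simp add: assms L2_tendsto_const Plancherel(1))

lemma has_L2_fourier_Parseval:
  assumes "has_L2_fourier f g" "has_L2_fourier f' g'"
  shows "(\<integral>\<xi>. g \<xi> * cnj (g' \<xi>) \<partial>lborel) = complex_of_real ((2 * pi) ^ 3) * (\<integral>x. f x * cnj (f' x) \<partial>lborel)"
proof -
  obtain F where F: "\<And>n. integrable lborel (F n)" "L2_tendsto F f" "L2_tendsto (\<lambda>n. fourier (F n)) g"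
    using assms(1) unfolding has_L2_fourier_iff by blast
  obtain G where G: "\<And>n. integrable lborel (G n)" "L2_tendsto G f'" "L2_tendsto (\<lambda>n. fourier (G n)) g'"
    using assms(2) unfolding has_L2_fourier_iff by blast
  have m: "memL2 (F n)" "memL2 (G n)" for n using F(2) G(2) by (simp_all add: L2_tendsto_def)
  have 1: "(\<lambda>n. \<integral>\<xi>. fourier (F n) \<xi> * cnj (fourier (G n) \<xi>) \<partial>lborel) \<longlonglongrightarrow> (\<integral>\<xi>. g \<xi> * cnj (g' \<xi>) \<partial>lborel)"
    by (rule L2_tendsto_integral_mult[OF F(3) L2_tendsto_cnj[OF G(3)]])
  have 2: "(\<lambda>n. complex_of_real ((2 * pi) ^ 3) * (\<integral>x. F n x * cnj (G n x) \<partial>lborel))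
      \<longlonglongrightarrow> complex_of_real ((2 * pi) ^ 3) * (\<integral>x. f x * cnj (f' x) \<partial>lborel)"
    by (rule tendsto_mult_left[OF L2_tendsto_integral_mult[OF F(2) L2_tendsto_cnj[OF G(2)]]])
  show ?thesis
    by (rule LIMSEQ_unique[OF 1]) (use 2 in \<open>simp only: Parseval[OF F(1) m(1) G(1) m(2)]\<close>)
qed

lemma integral_mult_cnj_self: "(\<integral>x. f x * cnj (f x) \<partial>lborel) = complex_of_real ((Lp_norm 2 f)\<^sup>2)"
  unfolding complex_norm_square[symmetric] Lp_norm_2_square by (rule integral_complex_of_real)

lemma has_L2_fourier_norm:
  assumes "has_L2_fourier f g" shows "Lp_norm 2 g = sqrt ((2 * pi) ^ 3) * Lp_norm 2 f"
proof -
  have "(Lp_norm 2 g)\<^sup>2 = (2 * pi) ^ 3 * (Lp_norm 2 f)\<^sup>2"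
    using has_L2_fourier_Parseval[OF assms assms]
    unfolding integral_mult_cnj_self of_real_mult[symmetric] of_real_eq_iff .
  from arg_cong[OF this, of sqrt] show ?thesis by (simp add: real_sqrt_mult)
qed

lemma has_L2_fourier_diff:
  assumes "has_L2_fourier f g" "has_L2_fourier f' g'"
  shows "has_L2_fourier (\<lambda>x. f x - f' x) (\<lambda>\<xi>. g \<xi> - g' \<xi>)"
proof -
  obtain F where F: "\<And>n. integrable lborel (F n)" "L2_tendsto F f" "L2_tendsto (\<lambda>n. fourier (F n)) g"
    using assms(1) unfolding has_L2_fourier_iff by blast
  obtain G where G: "\<And>n. integrable lborel (G n)" "L2_tendsto G f'" "L2_tendsto (\<lambda>n. fourier (G n)) g'"
    using assms(2) unfolding has_L2_fourier_iff by blast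
  show ?thesis unfolding has_L2_fourier_iff
  proof (intro exI[of _ "\<lambda>n x. F n x - G n x"] conjI allI)
    show "integrable lborel (\<lambda>x. F n x - G n x)" for n by (intro Bochner_Integration.integrable_diff F G)
    show "L2_tendsto (\<lambda>n x. F n x - G n x) (\<lambda>x. f x - f' x)" by (rule L2_tendsto_diff[OF F(2) G(2)])
    show "L2_tendsto (\<lambda>n. fourier (\<lambda>x. F n x - G n x)) (\<lambda>\<xi>. g \<xi> - g' \<xi>)"
      unfolding fourier_diff[OF F(1) G(1)] by (rule L2_tendsto_diff[OF F(3) G(3)])
  qed
qed

text \<open>By linearity the difference of the two is a transform of 0, and the isometry makes it
  vanish.\<close>

lemma has_L2_fourier_unique:
  assumes "has_L2_fourier f g" "has_L2_fourier f g'" shows "AE \<xi> in lborel. g \<xi> = g' \<xi>"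
proof -
  have "has_L2_fourier (\<lambda>x. f x - f x) (\<lambda>\<xi>. g \<xi> - g' \<xi>)" by (rule has_L2_fourier_diff[OF assms])
  from has_L2_fourier_norm[OF this] have "Lp_norm 2 (\<lambda>\<xi>. g \<xi> - g' \<xi>) = 0"
    by (simp add: Lp_norm_2)
  then show ?thesis
    using memL2_diff[OF has_L2_fourier_memL2(2)[OF assms(1)] has_L2_fourier_memL2(2)[OF assms(2)]]
    by (simp add: Lp_norm_2_eq_0_iff)
qed

text \<open>A diagonal choice: the n-th pair is approximated within 1 / (n + 1) by a single
  integrable function and its transform.\<close>

lemma has_L2_fourier_closed:
  assumes hk: "\<And>n. has_L2_fourier (h n) (k n)" and lim: "L2_tendsto h h0" "L2_tendsto k k0"
  shows "has_L2_fourier h0 k0"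
proof -
  have "\<exists>F. integrable lborel F \<and> memL2 F \<and> Lp_norm 2 (\<lambda>x. F x - h n x) < inverse (real (Suc n))
      \<and> Lp_norm 2 (\<lambda>x. fourier F x - k n x) < inverse (real (Suc n))" for n
  proof -
    obtain F where F: "\<And>n. integrable lborel (F n)" "L2_tendsto F (h n)" "L2_tendsto (\<lambda>n. fourier (F n)) (k n)"
      using hk[of n] unfolding has_L2_fourier_iff by blast
    have "\<forall>\<^sub>F m in sequentially. Lp_norm 2 (\<lambda>x. F m x - h n x) < inverse (real (Suc n))"
      using F(2) unfolding L2_tendsto_def by (intro order_tendstoD) auto
    moreover have "\<forall>\<^sub>F m in sequentially. Lp_norm 2 (\<lambda>x. fourier (F m) x - k n x) < inverse (real (Suc n))"
      using F(3) unfolding L2_tendsto_def by (intro order_tendstoD) auto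
    ultimately have "\<forall>\<^sub>F m in sequentially. Lp_norm 2 (\<lambda>x. F m x - h n x) < inverse (real (Suc n))
        \<and> Lp_norm 2 (\<lambda>x. fourier (F m) x - k n x) < inverse (real (Suc n))"
      by (rule eventually_conj)
    then obtain m where "Lp_norm 2 (\<lambda>x. F m x - h n x) < inverse (real (Suc n))"
        "Lp_norm 2 (\<lambda>x. fourier (F m) x - k n x) < inverse (real (Suc n))"
      unfolding eventually_sequentially by blast
    then show ?thesis using F(1)[of m] F(2) unfolding L2_tendsto_def by blast
  qed
  then obtain F where F: "\<And>n. integrable lborel (F n)" "\<And>n. memL2 (F n)"
      "\<And>n. Lp_norm 2 (\<lambda>x. F n x - h n x) < inverse (real (Suc n))"
      "\<And>n. Lp_norm 2 (\<lambda>x. fourier (F n) x - k n x) < inverse (real (Suc n))"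
    by metis
  have m: "memL2 (h n)" "memL2 (k n)" "memL2 h0" "memL2 k0" for n using lim by (simp_all add: L2_tendsto_def)
  have gen: "L2_tendsto G g0"
    if G: "\<And>n. memL2 (G n)" and g: "L2_tendsto g g0"
      and le: "\<And>n. Lp_norm 2 (\<lambda>x. G n x - g n x) < inverse (real (Suc n))" for G g g0
  proof -
    have gm: "memL2 (g n)" "memL2 g0" for n using g by (simp_all add: L2_tendsto_def)
    have "(\<lambda>n. inverse (real (Suc n)) + Lp_norm 2 (\<lambda>x. g n x - g0 x)) \<longlonglongrightarrow> 0 + 0"
      using g unfolding L2_tendsto_def by (intro tendsto_add LIMSEQ_inverse_real_of_nat) simp
    then have l0: "(\<lambda>n. inverse (real (Suc n)) + Lp_norm 2 (\<lambda>x. g n x - g0 x)) \<longlonglongrightarrow> 0" by (simp only: add_0_left)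
    have "norm (Lp_norm 2 (\<lambda>x. G n x - g0 x)) \<le> inverse (real (Suc n)) + Lp_norm 2 (\<lambda>x. g n x - g0 x)" for n
      using Lp_norm_2_triangle_diff[OF G[of n] gm(1)[of n] gm(2)] le[of n]
      by (simp only: real_norm_def abs_of_nonneg[OF Lp_norm_2_nonneg])
    then have "(\<lambda>n. Lp_norm 2 (\<lambda>x. G n x - g0 x)) \<longlonglongrightarrow> 0"
      by (rule Lim_null_comparison[OF always_eventually[OF allI] l0])
    then show ?thesis using G gm unfolding L2_tendsto_def by blast
  qed
  have "L2_tendsto F h0" by (rule gen[OF F(2) lim(1) F(3)])
  moreover have "L2_tendsto (\<lambda>n. fourier (F n)) k0" by (rule gen[OF Plancherel(1)[OF F(1,2)] lim(2) F(4)])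
  ultimately show ?thesis using F(1) unfolding has_L2_fourier_iff by blast
qed

text \<open>The candidate is the inverse transform h of k, which is in L2 but perhaps not
  integrable. Multiplied by Gaussians it becomes integrable, and the transforms of these products
  are the Gaussian mollifications of k.\<close>

lemma has_L2_fourier_inverse_integrable:
  assumes k: "integrable lborel k" "memL2 k" shows "\<exists>h. has_L2_fourier h k"
proof -
  define c where "c = complex_of_real (1 / (2 * pi) ^ 3)"
  define h where "h x = c * fourier k (- x)" for x
  have "memL2 (\<lambda>x. fourier k (0 + (-1) *\<^sub>R x))"
    by (rule memL2_affine[OF Plancherel(1)[OF k]]) simp
  then have hm: "memL2 h" unfolding h_def by (intro memL2_cmult) simp
  note [measurable] = memL2_measurable[OF hm]
  define F where "F n x = complex_of_real (gauss ((1 / real (Suc n)) *\<^sub>R x)) * h x" for n x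
  have hb: "cmod (h x) \<le> cmod c * (\<integral>x. cmod (k x) \<partial>lborel)" for x
    unfolding h_def norm_mult by (intro mult_left_mono fourier_bound) simp
  have Fi: "integrable lborel (F n)" for n
    unfolding F_def
    by (rule integrable_mult_bounded(1)[OF _ _ hb]) (use gauss_scaled_integrable[of "1 / real (Suc n)"] in auto)
  have Fh: "L2_tendsto F h"
  proof (rule L2_tendsto_dominated[OF _ _ hm])
    show "F n \<in> borel_measurable borel" for n using borel_measurable_integrable[OF Fi] by simp
    show "AE x in lborel. cmod (F n x) \<le> cmod (h x)" for n
      unfolding F_def norm_mult
      by (intro AE_I2 mult_left_le_one_le gauss_scaled_le) auto
    show "AE x in lborel. (\<lambda>n. F n x) \<longlonglongrightarrow> h x"
    proof (rule AE_I2)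
      fix x
      have "(\<lambda>n. F n x) \<longlonglongrightarrow> complex_of_real (exp (- (norm (0 *\<^sub>R x))\<^sup>2 / 2)) * h x"
        unfolding F_def gauss_def by (intro tendsto_intros lim_1_over_n[THEN LIMSEQ_Suc]) simp
      then show "(\<lambda>n. F n x) \<longlonglongrightarrow> h x" by simp
    qed
  qed measurable
  have "fourier (F n) = mollify gauss_density (1 / real (Suc n)) k" for n
  proof
    fix \<xi>
    let ?e = "1 / real (Suc n)"
    let ?f = "\<lambda>x. exp (\<i> * complex_of_real (x \<bullet> \<xi>)) * (fourier k x * complex_of_real (gauss (?e *\<^sub>R x)))"
    have "fourier (F n) \<xi> = (\<integral>x. c * ?f (0 + (-1) *\<^sub>R x) \<partial>lborel)"
      unfolding fourier_def[of "F n"]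
    proof (rule Bochner_Integration.integral_cong[OF refl])
      fix x
      have "gauss (?e *\<^sub>R (- x)) = gauss (?e *\<^sub>R x)"
        using gauss_minus(1)[of "?e *\<^sub>R x"] by (simp flip: scaleR_minus_right)
      then show "exp (- \<i> * complex_of_real (x \<bullet> \<xi>)) * F n x = c * ?f (0 + (-1) *\<^sub>R x)"
        by (simp add: F_def h_def)
    qed
    also have "\<dots> = c * (\<integral>x. ?f (0 + (-1) *\<^sub>R x) \<partial>lborel)" by (rule integral_mult_right_zero)
    also have "(\<integral>x. ?f (0 + (-1) *\<^sub>R x) \<partial>lborel) = (1 / \<bar>-1\<bar> ^ 3) *\<^sub>R (\<integral>x. ?f x \<partial>lborel)"
      by (rule integral_affine3) simp
    also have "(\<integral>x. ?f x \<partial>lborel) = complex_of_real ((2 * pi) ^ 3) * mollify gauss_density ?e k \<xi>"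
      by (rule fourier_gauss_summation[OF k(1)]) simp
    finally show "fourier (F n) \<xi> = mollify gauss_density ?e k \<xi>"
      by (simp add: c_def)
  qed
  then have "L2_tendsto (\<lambda>n. fourier (F n)) k"
    using gauss_mollify[OF k(2) lim_1_over_n[THEN LIMSEQ_Suc]] by simp
  then show ?thesis using Fi Fh unfolding has_L2_fourier_iff by blast
qed

text \<open>Truncations of k have preimages, the isometry makes these a Cauchy sequence, and
  completeness with closedness of the graph gives a preimage of k. Surjectivity is what lets a
  multiplier exist: the symbol times a transform has to be a transform again.\<close>

theorem has_L2_fourier_surj:
  assumes k: "memL2 k" shows "\<exists>h. has_L2_fourier h k"
proof -
  define K where "K n x = indicator (cball 0 (real n)) x * (if cmod (k x) \<le> real n then k x else 0)" for n x
  have K: "L2_tendsto K k" "integrable lborel (K n)" for n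
    using memL2_truncate[OF k] unfolding K_def by blast+
  have Km: "memL2 (K n)" for n using K(1) by (simp add: L2_tendsto_def)
  obtain h where h: "\<And>n. has_L2_fourier (h n) (K n)"
    using has_L2_fourier_inverse_integrable[OF K(2) Km] by metis
  define s where "s = sqrt ((2 * pi) ^ 3)"
  have s: "s > 0" unfolding s_def by simp
  have iso: "Lp_norm 2 (\<lambda>x. h m x - h n x) = Lp_norm 2 (\<lambda>x. K m x - K n x) / s" for m n
    using has_L2_fourier_norm[OF has_L2_fourier_diff[OF h h], of m n] s unfolding s_def[symmetric] by simp
  have hm: "memL2 (h n)" for n by (rule has_L2_fourier_memL2(1)[OF h])
  have "\<exists>h0. L2_tendsto h h0"
  proof (rule L2_complete[OF hm])
    fix e :: real assume "e > 0"
    then have "\<forall>\<^sub>F n in sequentially. Lp_norm 2 (\<lambda>x. K n x - k x) < e * s / 2"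
      using K(1) s unfolding L2_tendsto_def by (intro order_tendstoD) auto
    then obtain N where N: "\<And>n. n \<ge> N \<Longrightarrow> Lp_norm 2 (\<lambda>x. K n x - k x) < e * s / 2"
      unfolding eventually_sequentially by blast
    have "Lp_norm 2 (\<lambda>x. h m x - h n x) < e" if "m \<ge> N" "n \<ge> N" for m n
    proof -
      have "Lp_norm 2 (\<lambda>x. K m x - K n x) < e * s"
        using Lp_norm_2_triangle_diff[OF Km[of m] k Km[of n]] N[OF that(1)] N[OF that(2)]
          Lp_norm_2_minus_commute[of k "K n"] by linarith
      then show ?thesis unfolding iso using s by (simp add: pos_divide_less_eq)
    qed
    then show "\<exists>N. \<forall>m\<ge>N. \<forall>n\<ge>N. Lp_norm 2 (\<lambda>x. h m x - h n x) < e" by blast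
  qed
  then obtain h0 where "L2_tendsto h h0" by blast
  from has_L2_fourier_closed[OF h this K(1)] show ?thesis by blast
qed

text \<open>The one point where the choice in \<open>fourier_multiplier\<close> is unfolded.
  Surjectivity gives existence, and uniqueness almost everywhere replaces the chosen transform of f
  by \<open>fourier f\<close>. Afterwards the convolution is known only through its membership in L2
  and its pairings.\<close>

lemma fourier_multiplier_Parseval:
  assumes m: "m \<in> borel_measurable borel" "\<And>\<xi>. \<bar>m \<xi>\<bar> \<le> C"
    and f: "integrable lborel f" "memL2 f" and \<psi>: "integrable lborel \<psi>" "memL2 \<psi>"
  shows "memL2 (fourier_multiplier m f)"
    "(\<integral>x. fourier_multiplier m f x * cnj (\<psi> x) \<partial>lborel)
      = complex_of_real (1 / (2 * pi) ^ 3) * (\<integral>\<xi>. complex_of_real (m \<xi>) * (fourier f \<xi> * cnj (fourier \<psi> \<xi>)) \<partial>lborel)"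
proof -
  note [measurable] = m(1)
  let ?h = "fourier_multiplier m f"
  have mm: "memL2 (\<lambda>\<xi>. complex_of_real (m \<xi>) * g \<xi>)" if g: "memL2 g" for g
  proof (rule memL2_bound[OF g])
    show "(\<lambda>\<xi>. complex_of_real (m \<xi>) * g \<xi>) \<in> borel_measurable borel"
      using memL2_measurable[OF g] by measurable
    show "AE \<xi> in lborel. cmod (complex_of_real (m \<xi>) * g \<xi>) \<le> C * cmod (g \<xi>)"
      by (rule AE_I2) (simp add: norm_mult mult_right_mono m(2))
  qed
  have "\<exists>h g. has_L2_fourier f g \<and> has_L2_fourier h (\<lambda>\<xi>. complex_of_real (m \<xi>) * g \<xi>)"
    using has_L2_fourier_fourier[OF f] has_L2_fourier_surj[OF mm[OF Plancherel(1)[OF f]]] by blast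
  then have "\<exists>g. has_L2_fourier f g \<and> has_L2_fourier ?h (\<lambda>\<xi>. complex_of_real (m \<xi>) * g \<xi>)"
    unfolding fourier_multiplier_def by (rule someI_ex)
  then obtain g where g: "has_L2_fourier f g" "has_L2_fourier ?h (\<lambda>\<xi>. complex_of_real (m \<xi>) * g \<xi>)"
    by blast
  show "memL2 ?h" by (rule has_L2_fourier_memL2(1)[OF g(2)])
  note [measurable] = memL2_measurable[OF has_L2_fourier_memL2(2)[OF g(1)]]
    memL2_measurable[OF Plancherel(1)[OF f]] memL2_measurable[OF memL2_cnj[OF Plancherel(1)[OF \<psi>]]]
  have "complex_of_real ((2 * pi) ^ 3) * (\<integral>x. ?h x * cnj (\<psi> x) \<partial>lborel)
      = (\<integral>\<xi>. complex_of_real (m \<xi>) * g \<xi> * cnj (fourier \<psi> \<xi>) \<partial>lborel)"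
    by (rule has_L2_fourier_Parseval[OF g(2) has_L2_fourier_fourier[OF \<psi>], symmetric])
  also have "\<dots> = (\<integral>\<xi>. complex_of_real (m \<xi>) * (fourier f \<xi> * cnj (fourier \<psi> \<xi>)) \<partial>lborel)"
  proof (rule integral_cong_AE)
    show "AE \<xi> in lborel. complex_of_real (m \<xi>) * g \<xi> * cnj (fourier \<psi> \<xi>) = complex_of_real (m \<xi>) * (fourier f \<xi> * cnj (fourier \<psi> \<xi>))"
      using has_L2_fourier_unique[OF g(1) has_L2_fourier_fourier[OF f]] by eventually_elim simp
  qed measurable
  finally show "(\<integral>x. ?h x * cnj (\<psi> x) \<partial>lborel)
      = complex_of_real (1 / (2 * pi) ^ 3) * (\<integral>\<xi>. complex_of_real (m \<xi>) * (fourier f \<xi> * cnj (fourier \<psi> \<xi>)) \<partial>lborel)"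
    by (simp add: field_simps)
qed

section \<open>Smooth functions\<close>

lemma partial_deriv_eq:
  "(f has_derivative f') (at x) \<Longrightarrow> partial_deriv i f x = f' (axis i 1)"
  unfolding partial_deriv_def by (simp add: frechet_derivative_at[symmetric])

text \<open>Smoothness is shown by exhibiting a class of differentiable functions that is stable
  under partial derivatives; the work in each application is the right choice of the class.\<close>

lemma smooth_coinduct:
  assumes "P f" "\<And>f x. P f \<Longrightarrow> f differentiable at x" "\<And>f i. P f \<Longrightarrow> P (partial_deriv i f)"
  shows "smooth f"
proof -
  have "P (foldr partial_deriv js f)" for js
    by (induction js) (use assms in auto)
  then show ?thesis using assms(2) by (simp add: smooth_def differentiable_on_def)
qed

lemma smooth_differentiable: "smooth f \<Longrightarrow> f differentiable at x"
  unfolding smooth_def by (drule spec[of _ "[]"]) (simp add: differentiable_on_def)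

lemma smooth_partial_deriv: "smooth f \<Longrightarrow> smooth (partial_deriv i f)"
proof -
  assume f: "smooth f"
  have "foldr partial_deriv js (partial_deriv i f) = foldr partial_deriv (js @ [i]) f" for js
    by simp
  then show ?thesis using f unfolding smooth_def by presburger
qed

lemma smooth_continuous: "smooth f \<Longrightarrow> continuous_on UNIV f"
  by (intro continuous_at_imp_continuous_on ballI differentiable_imp_continuous_within smooth_differentiable)

lemma sum_axis_mult: "(\<Sum>j\<in>UNIV. axis i 1 $ j * g j) = (g i :: real)"
proof -
  have "(\<Sum>j\<in>UNIV. axis i 1 $ j * g j) = (\<Sum>j\<in>UNIV. if j = i then g j else 0)"
    by (rule sum.cong) (auto simp: axis_def)
  then show ?thesis by simp
qed

lemma smooth_has_derivative:
  assumes "smooth f"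
  shows "(f has_derivative (\<lambda>h. \<Sum>i\<in>UNIV. h $ i * partial_deriv i f x)) (at x)"
proof -
  obtain f' where f': "(f has_derivative f') (at x)"
    using smooth_differentiable[OF assms] by (auto simp: differentiable_def)
  then interpret f': bounded_linear f' by (rule has_derivative_bounded_linear)
  have "f' h = (\<Sum>i\<in>UNIV. h $ i * partial_deriv i f x)" for h
  proof -
    have "h = (\<Sum>i\<in>UNIV. h $ i *\<^sub>R axis i 1)"
      by (simp add: vec_eq_iff axis_def if_distrib cong: if_cong)
    then have "f' h = f' (\<Sum>i\<in>UNIV. h $ i *\<^sub>R axis i 1)" by simp
    also have "\<dots> = (\<Sum>i\<in>UNIV. h $ i * f' (axis i 1))"
      by (simp add: f'.sum f'.scaleR)
    finally show ?thesis by (simp add: partial_deriv_eq[OF f'])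
  qed
  then have "f' = (\<lambda>h. \<Sum>i\<in>UNIV. h $ i * partial_deriv i f x)" by (rule ext)
  with f' show ?thesis by simp
qed

lemma partial_deriv_const [simp]: "partial_deriv i (\<lambda>x. c) = (\<lambda>x. 0)"
  by (rule ext, rule trans[OF partial_deriv_eq[OF has_derivative_const]]) simp

lemma partial_deriv_add:
  assumes "f differentiable at x" "g differentiable at x"
  shows "partial_deriv i (\<lambda>x. f x + g x) x = partial_deriv i f x + partial_deriv i g x"
  using partial_deriv_eq[OF has_derivative_add[OF assms[unfolded frechet_derivative_works]], of i]
  by (simp add: partial_deriv_def)

lemma partial_deriv_mult:
  assumes "f differentiable at x" "g differentiable at x"
  shows "partial_deriv i (\<lambda>x. f x * g x) x = f x * partial_deriv i g x + partial_deriv i f x * g x"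
  using partial_deriv_eq[OF has_derivative_mult[OF assms[unfolded frechet_derivative_works]], of i]
  by (simp add: partial_deriv_def)

lemma smooth_const [simp]: "smooth (\<lambda>x. c)"
proof (rule smooth_coinduct[where P="\<lambda>f. \<exists>c. f = (\<lambda>x. c)"])
  fix f :: "real^3 \<Rightarrow> real" assume "\<exists>c. f = (\<lambda>x. c)"
  then obtain c where f: "f = (\<lambda>x. c)" by blast
  show "f differentiable at x" for x unfolding f by (rule differentiable_const)
  show "\<exists>c. partial_deriv i f = (\<lambda>x. c)" for i unfolding f partial_deriv_const by blast
qed blast

text \<open>
  A derivative of a product is a sum of products, so smoothness of products is not directly
  inductive. It is for the algebra generated by the smooth functions.
\<close>

inductive smooth_alg :: "(real^3 \<Rightarrow> real) \<Rightarrow> bool" where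
  base: "smooth f \<Longrightarrow> smooth_alg f"
| add: "smooth_alg f \<Longrightarrow> smooth_alg g \<Longrightarrow> smooth_alg (\<lambda>x. f x + g x)"
| mult: "smooth_alg f \<Longrightarrow> smooth_alg g \<Longrightarrow> smooth_alg (\<lambda>x. f x * g x)"

lemma smooth_alg_deriv:
  assumes "smooth_alg f" shows "(\<forall>x. f differentiable at x) \<and> smooth_alg (partial_deriv i f)"
  using assms
proof induction
  case (base f)
  then show ?case by (simp add: smooth_differentiable smooth_alg.base smooth_partial_deriv)
next
  case (add f g)
  have d: "f differentiable at x" "g differentiable at x" for x
    using add.IH by simp_all
  have "partial_deriv i (\<lambda>x. f x + g x) = (\<lambda>x. partial_deriv i f x + partial_deriv i g x)"
    by (rule ext) (rule partial_deriv_add[OF d])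
  then show ?case
    using smooth_alg.add[OF add.IH(1)[THEN conjunct2] add.IH(2)[THEN conjunct2]] d
    by (simp only: differentiable_add simp_thms)
next
  case (mult f g)
  have d: "f differentiable at x" "g differentiable at x" for x
    using mult.IH by simp_all
  have "partial_deriv i (\<lambda>x. f x * g x) = (\<lambda>x. f x * partial_deriv i g x + partial_deriv i f x * g x)"
    by (rule ext) (rule partial_deriv_mult[OF d])
  then show ?case
    using smooth_alg.add[OF smooth_alg.mult[OF mult.hyps(1) mult.IH(2)[THEN conjunct2]]
        smooth_alg.mult[OF mult.IH(1)[THEN conjunct2] mult.hyps(2)]] d
    by (simp only: differentiable_mult simp_thms)
qed

lemma smooth_alg_smooth:
  assumes "smooth_alg f" shows "smooth f"
  by (rule smooth_coinduct[where P=smooth_alg, OF assms]) (simp_all only: smooth_alg_deriv)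

lemma smooth_mult:
  assumes "smooth f" "smooth g" shows "smooth (\<lambda>x. f x * g x)"
  by (rule smooth_alg_smooth[OF smooth_alg.mult[OF smooth_alg.base[OF assms(1)] smooth_alg.base[OF assms(2)]]])

lemma partial_deriv_affine:
  assumes "smooth f"
  shows "partial_deriv i (\<lambda>x. a * f (t + c *\<^sub>R x)) = (\<lambda>x. (a * c) * partial_deriv i f (t + c *\<^sub>R x))"
    and "(\<lambda>x. a * f (t + c *\<^sub>R x)) differentiable at x"
proof -
  have d: "((\<lambda>x. a * f (t + c *\<^sub>R x)) has_derivative (\<lambda>h. a * (\<Sum>i\<in>UNIV. (c *\<^sub>R h) $ i * partial_deriv i f (t + c *\<^sub>R x)))) (at x)" for x
    by (rule has_derivative_mult_right, rule has_derivative_compose[OF _ smooth_has_derivative[OF assms]])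
       (auto intro!: derivative_eq_intros)
  show "partial_deriv i (\<lambda>x. a * f (t + c *\<^sub>R x)) = (\<lambda>x. (a * c) * partial_deriv i f (t + c *\<^sub>R x))"
    by (rule ext, rule trans[OF partial_deriv_eq[OF d]]) (simp add: mult.assoc sum_axis_mult flip: sum_distrib_left)
  show "(\<lambda>x. a * f (t + c *\<^sub>R x)) differentiable at x" using d by (rule differentiableI)
qed

text \<open>The scalar factor in the class absorbs the power of c that each derivative
  produces.\<close>

lemma smooth_affine:
  assumes "smooth f" shows "smooth (\<lambda>x. f (t + c *\<^sub>R x))"
proof -
  have "smooth (\<lambda>x. 1 * f (t + c *\<^sub>R x))"
  proof (rule smooth_coinduct[where P="\<lambda>g. \<exists>a f. smooth f \<and> g = (\<lambda>x. a * f (t + c *\<^sub>R x))"])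
    show "\<exists>a h. smooth h \<and> (\<lambda>x. 1 * f (t + c *\<^sub>R x)) = (\<lambda>x. a * h (t + c *\<^sub>R x))" using assms by blast
  next
    fix g assume "\<exists>a f. smooth f \<and> g = (\<lambda>x. a * f (t + c *\<^sub>R x))"
    then obtain a f where g: "smooth f" "g = (\<lambda>x. a * f (t + c *\<^sub>R x))" by blast
    show "g differentiable at x" for x
      unfolding g(2) by (rule partial_deriv_affine(2)[OF g(1)])
    show "\<exists>a f. smooth f \<and> partial_deriv i g = (\<lambda>x. a * f (t + c *\<^sub>R x))" for i
      unfolding g(2) partial_deriv_affine(1)[OF g(1)] using smooth_partial_deriv[OF g(1)] by blast
  qed
  then show ?thesis by simp
qed

subsection \<open>Bump functions\<close>

text \<open>The function exp (-1/s), extended by 0, with a polynomial in 1/s in front: this family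
  is closed under differentiation, which the bare function is not.\<close>

definition flat_exp :: "real poly \<Rightarrow> real \<Rightarrow> real" where
  "flat_exp p s = (if s \<le> 0 then 0 else poly p (1 / s) * exp (- (1 / s)))"

lemma flat_exp_tendsto_0: "(flat_exp p \<longlongrightarrow> 0) (at 0)"
proof -
  have "((\<lambda>y. \<Sum>i\<le>degree p. coeff p i * (y ^ i / exp y)) \<longlongrightarrow> (\<Sum>i\<le>degree p. coeff p i * 0)) at_top"
    by (intro tendsto_intros tendsto_power_div_exp_0)
  then have "((\<lambda>y :: real. poly p y * exp (- y)) \<longlongrightarrow> 0) at_top"
    by (simp add: poly_altdef sum_distrib_right exp_minus divide_inverse mult.assoc)
  then have "((\<lambda>s :: real. poly p (1 / s) * exp (- (1 / s))) \<longlongrightarrow> 0) (at_right 0)"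
    unfolding at_top_to_right filterlim_filtermap by (simp add: inverse_eq_divide)
  then have r: "(flat_exp p \<longlongrightarrow> 0) (at_right 0)"
    by (rule Lim_transform_eventually) (auto simp: flat_exp_def eventually_at_filter)
  have "(flat_exp p \<longlongrightarrow> 0) (at_left 0)"
    by (rule Lim_transform_eventually[OF tendsto_const]) (auto simp: flat_exp_def eventually_at_filter)
  with r show ?thesis by (simp add: filterlim_split_at)
qed

text \<open>With y = 1/s one has d/ds = - y^2 d/dy, which sends p(y) exp (-y) to y^2 (p(y) - p'(y))
  exp (-y).\<close>

lemma flat_exp_deriv: "(flat_exp p has_real_derivative flat_exp ([:0, 0, 1:] * (p - pderiv p)) s) (at s)"
proof -
  consider "s < 0" | "s = 0" | "s > 0" by linarith
  then show ?thesis
  proof cases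
    case 1
    have "((\<lambda>s. 0) has_real_derivative 0) (at s)" by simp
    moreover have "\<forall>\<^sub>F x in nhds s. flat_exp p x = 0"
      using order_tendstoD(2)[OF filterlim_ident 1] by eventually_elim (simp add: flat_exp_def)
    ultimately have "(flat_exp p has_real_derivative 0) (at s)"
      by (subst DERIV_cong_ev[OF refl _ refl]) auto
    then show ?thesis using 1 by (simp add: flat_exp_def)
  next
    case 2
    \<comment> \<open>The difference quotient at 0 belongs to the same family, with polynomial y
      p(y), and therefore tends to 0.\<close>
    have "((\<lambda>h. (flat_exp p (0 + h) - flat_exp p 0) / h) \<longlongrightarrow> 0) (at 0)"
    proof (rule Lim_transform_eventually[OF flat_exp_tendsto_0[of "[:0, 1:] * p"]])
      show "\<forall>\<^sub>F h in at 0. flat_exp ([:0, 1:] * p) h = (flat_exp p (0 + h) - flat_exp p 0) / h"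
        by (auto simp: flat_exp_def eventually_at_filter)
    qed
    then have "(flat_exp p has_real_derivative 0) (at 0)" by (simp add: DERIV_def)
    then show ?thesis using 2 by (simp add: flat_exp_def)
  next
    case 3
    have "((\<lambda>s. poly p (1 / s) * exp (- (1 / s))) has_real_derivative
        (poly (pderiv p) (1 / s) * (- 1 / s\<^sup>2)) * exp (- (1 / s)) + poly p (1 / s) * (exp (- (1 / s)) * (1 / s\<^sup>2))) (at s)"
      using 3 by (auto intro!: derivative_eq_intros DERIV_chain2[OF poly_DERIV] simp: power2_eq_square field_simps)
    moreover have "\<forall>\<^sub>F x in nhds s. flat_exp p x = poly p (1 / x) * exp (- (1 / x))"
      using order_tendstoD(1)[OF filterlim_ident 3] by eventually_elim (simp add: flat_exp_def)
    ultimately have "(flat_exp p has_real_derivative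
        (poly (pderiv p) (1 / s) * (- 1 / s\<^sup>2)) * exp (- (1 / s)) + poly p (1 / s) * (exp (- (1 / s)) * (1 / s\<^sup>2))) (at s)"
      by (subst DERIV_cong_ev[OF refl _ refl]) auto
    then show ?thesis using 3 by (simp add: flat_exp_def power2_eq_square algebra_simps diff_divide_distrib)
  qed
qed

lemma smooth_flat_exp: "smooth (\<lambda>x. flat_exp p (a * x $ i + b))"
proof -
  have d: "((\<lambda>x :: real^3. k * flat_exp p (a * x $ i + b)) has_derivative
      (\<lambda>h. k * (flat_exp ([:0, 0, 1:] * (p - pderiv p)) (a * x $ i + b) * (a * h $ i)))) (at x)" for p k x
  proof -
    have inner: "((\<lambda>x :: real^3. a * x $ i + b) has_derivative (\<lambda>h. a * h $ i)) (at x)"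
      by (auto intro!: derivative_eq_intros bounded_linear.has_derivative[OF bounded_linear_vec_nth])
    show ?thesis
      by (rule has_derivative_mult_right,
          rule has_derivative_compose[OF inner flat_exp_deriv[unfolded has_field_derivative_def]])
  qed
  have "smooth (\<lambda>x. 1 * flat_exp p (a * x $ i + b))"
  proof (rule smooth_coinduct[where P="\<lambda>g. \<exists>k p. g = (\<lambda>x. k * flat_exp p (a * x $ i + b))"])
    show "\<exists>k q. (\<lambda>x :: real^3. 1 * flat_exp p (a * x $ i + b)) = (\<lambda>x. k * flat_exp q (a * x $ i + b))" by blast
  next
    fix g :: "real^3 \<Rightarrow> real" assume "\<exists>k p. g = (\<lambda>x. k * flat_exp p (a * x $ i + b))"
    then obtain k p where g: "g = (\<lambda>x. k * flat_exp p (a * x $ i + b))" by blast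
    show "g differentiable at x" for x
      unfolding g by (rule differentiableI[OF d])
    have "partial_deriv j g = (\<lambda>x. (k * a * axis j 1 $ i) * flat_exp ([:0, 0, 1:] * (p - pderiv p)) (a * x $ i + b))" for j
      unfolding g by (rule ext, rule trans[OF partial_deriv_eq[OF d]]) (simp only: mult_ac)
    then show "\<exists>k p. partial_deriv j g = (\<lambda>x. k * flat_exp p (a * x $ i + b))" for j by blast
  qed
  then show ?thesis by simp
qed

text \<open>A product of one-sided profiles at the six faces of the box from a to b. The parameter n
  steepens them: exp (-1/(n s)) tends to 1 for each s > 0, so the bumps tend to the indicator of the
  open box.\<close>

definition bump :: "real^3 \<Rightarrow> real^3 \<Rightarrow> real \<Rightarrow> real^3 \<Rightarrow> real" where
  "bump a b n x = (\<Prod>i\<in>UNIV. flat_exp 1 (n * x $ i + (- n * a $ i)) * flat_exp 1 ((- n) * x $ i + n * b $ i))"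

lemma prod_3: "prod f (UNIV :: 3 set) = f 1 * f 2 * f 3"
  unfolding UNIV_3 by (simp add: mult_ac)

lemma smooth_bump: "smooth (bump a b n)"
  unfolding bump_def[abs_def] prod_3 by (intro smooth_mult smooth_flat_exp)

lemma flat_exp_1_bounds: "0 \<le> flat_exp 1 s" "flat_exp 1 s \<le> 1"
  by (auto simp: flat_exp_def)

lemma bump_bounds: "0 \<le> bump a b n x" "bump a b n x \<le> 1"
  unfolding bump_def
  by (auto intro!: prod_nonneg prod_le_1 mult_nonneg_nonneg mult_le_one flat_exp_1_bounds)

lemma bump_pos_iff:
  assumes "n > 0" shows "bump a b n x > 0 \<longleftrightarrow> x \<in> box a b" "x \<notin> box a b \<Longrightarrow> bump a b n x = 0"
proof -
  have p: "flat_exp 1 s > 0 \<longleftrightarrow> s > 0" "flat_exp 1 s = 0 \<longleftrightarrow> s \<le> 0" for s by (auto simp: flat_exp_def)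
  have e: "n * x $ i + (- n * a $ i) = n * (x $ i - a $ i)" "(- n) * x $ i + n * b $ i = n * (b $ i - x $ i)" for i
    by (simp_all add: algebra_simps)
  have "bump a b n x = 0" if "x \<notin> box a b"
  proof -
    have "\<exists>i. x $ i \<le> a $ i \<or> x $ i \<ge> b $ i" using that unfolding mem_box_cart by (meson not_less)
    then obtain i where "x $ i \<le> a $ i \<or> x $ i \<ge> b $ i" by blast
    then have "flat_exp 1 (n * x $ i + (- n * a $ i)) * flat_exp 1 ((- n) * x $ i + n * b $ i) = 0"
      unfolding e using assms by (auto simp: p(2) mult_le_0_iff)
    then show ?thesis unfolding bump_def by (intro prod_zero) auto
  qed
  then show "x \<notin> box a b \<Longrightarrow> bump a b n x = 0" .
  moreover have "bump a b n x > 0" if "x \<in> box a b"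
    unfolding bump_def e using that assms by (intro prod_pos) (auto simp: p(1) mem_box_cart)
  ultimately show "bump a b n x > 0 \<longleftrightarrow> x \<in> box a b" by fastforce
qed

lemma bump_tendsto_indicator:
  "(\<lambda>n. bump a b (real (Suc n)) x) \<longlonglongrightarrow> indicator (box a b) x"
proof (cases "x \<in> box a b")
  case False
  then show ?thesis using bump_pos_iff(2)[of "real (Suc n)" for n] by simp
next
  case True
  have e1: "(\<lambda>n. flat_exp 1 (real (Suc n) * s)) \<longlonglongrightarrow> 1" if "s > 0" for s :: real
  proof -
    have "(\<lambda>n. exp (- ((1 / real (Suc n)) * (1 / s)))) \<longlonglongrightarrow> exp (- (0 * (1 / s)))"
      by (intro tendsto_intros lim_1_over_n[THEN LIMSEQ_Suc])
    moreover have "flat_exp 1 (real (Suc n) * s) = exp (- ((1 / real (Suc n)) * (1 / s)))" for n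
    proof -
      have "real (Suc n) * s > 0" using that by simp
      then show ?thesis by (simp add: flat_exp_def)
    qed
    ultimately show ?thesis by simp
  qed
  have e: "bump a b (real (Suc n)) x = (\<Prod>i\<in>UNIV. flat_exp 1 (real (Suc n) * (x $ i - a $ i)) * flat_exp 1 (real (Suc n) * (b $ i - x $ i)))" for n
    unfolding bump_def by (simp add: algebra_simps)
  have "(\<lambda>n. bump a b (real (Suc n)) x) \<longlonglongrightarrow> (\<Prod>i\<in>(UNIV :: 3 set). 1 * 1)"
    unfolding e using True by (intro tendsto_prod tendsto_mult e1) (auto simp: mem_box_cart)
  then show ?thesis using True by simp
qed

section \<open>Test functions\<close>

lemma test_function_iff: "test_function \<phi> \<longleftrightarrow> smooth \<phi> \<and> (\<exists>R. \<forall>x. R < norm x \<longrightarrow> \<phi> x = 0)"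
proof -
  have "compact (closure {x. \<phi> x \<noteq> 0}) \<longleftrightarrow> bounded {x. \<phi> x \<noteq> 0}"
    unfolding compact_eq_bounded_closed by (meson bounded_closure bounded_subset closed_closure closure_subset)
  also have "\<dots> \<longleftrightarrow> (\<exists>R. \<forall>x. R < norm x \<longrightarrow> \<phi> x = 0)"
    unfolding bounded_iff Ball_def mem_Collect_eq by (meson not_less)
  finally show ?thesis by (simp add: test_function_def)
qed

lemma test_function_smooth: "test_function \<phi> \<Longrightarrow> smooth \<phi>"
  by (simp add: test_function_def)

lemma test_function_Cc:
  assumes "test_function \<phi>" shows "Cc (\<lambda>x. complex_of_real (\<phi> x))"
proof -
  obtain R where "\<And>x. R < norm x \<Longrightarrow> \<phi> x = 0" "smooth \<phi>"
    using assms unfolding test_function_iff by blast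
  then show ?thesis unfolding Cc_def
    by (intro conjI continuous_on_of_real smooth_continuous exI[of _ R]) simp_all
qed

lemma test_function_measurable [measurable_dest]: "test_function \<phi> \<Longrightarrow> \<phi> \<in> borel_measurable borel"
  by (intro borel_measurable_continuous_onI smooth_continuous test_function_smooth)

lemma test_functionE:
  assumes "test_function \<phi>"
  obtains M R where "M \<ge> 0" "R > 0" "\<And>x. \<bar>\<phi> x\<bar> \<le> M * indicator (cball 0 R) x"
  using CcE[OF test_function_Cc[OF assms]] by (metis norm_of_real)

lemma test_function_partial_deriv:
  assumes "test_function \<phi>" shows "test_function (partial_deriv i \<phi>)"
proof -
  obtain R where R: "\<And>x. R < norm x \<Longrightarrow> \<phi> x = 0" using assms unfolding test_function_iff by blast
  have "partial_deriv i \<phi> x = 0" if x: "R < norm x" for x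
  proof -
    have "open {x :: real^3. R < norm x}" by (intro open_Collect_less continuous_intros)
    then have "(\<phi> has_derivative (\<lambda>h. 0)) (at x)"
      by (rule has_derivative_transform_within_open[OF has_derivative_const[of 0]]) (use R x in auto)
    from partial_deriv_eq[OF this] show ?thesis .
  qed
  then show ?thesis using assms unfolding test_function_iff by (blast intro: smooth_partial_deriv)
qed

lemma test_function_mult:
  assumes "test_function f" "smooth g" shows "test_function (\<lambda>x. f x * g x)"
proof -
  obtain R where "\<And>x. R < norm x \<Longrightarrow> f x = 0" "smooth f"
    using assms(1) unfolding test_function_iff by blast
  then show ?thesis unfolding test_function_iff
    using assms(2) by (intro conjI smooth_mult exI[of _ R]) simp_all
qed

lemma test_function_cmult:
  assumes "test_function f" shows "test_function (\<lambda>x. c * f x)"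
  using test_function_mult[OF assms smooth_const[of c]] by (simp only: mult.commute)

lemma test_function_affine:
  assumes "test_function f" "c \<noteq> 0" shows "test_function (\<lambda>x. f (t + c *\<^sub>R x))"
proof -
  obtain R where R: "\<And>x. R < norm x \<Longrightarrow> f x = 0" "smooth f"
    using assms(1) unfolding test_function_iff by blast
  have "f (t + c *\<^sub>R x) = 0" if "(R + norm t) / \<bar>c\<bar> < norm x" for x
  proof (rule R(1))
    have "R + norm t < \<bar>c\<bar> * norm x" using that assms(2) by (simp add: pos_divide_less_eq mult.commute)
    also have "\<bar>c\<bar> * norm x \<le> norm (t + c *\<^sub>R x) + norm t"
      using norm_triangle_ineq4[of "t + c *\<^sub>R x" t] by simp
    finally show "R < norm (t + c *\<^sub>R x)" by simp
  qed
  then show ?thesis using R(2) unfolding test_function_iff by (blast intro: smooth_affine)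
qed

lemma test_function_bump: "n > 0 \<Longrightarrow> test_function (bump a b n)"
proof -
  assume n: "n > 0"
  have "bounded (box a b)" by (rule bounded_box)
  then obtain R where "\<And>x. x \<in> box a b \<Longrightarrow> norm x \<le> R" unfolding bounded_iff by blast
  then have "bump a b n x = 0" if "R < norm x" for x
    using bump_pos_iff(2)[OF n, of x a b] that by (meson not_less)
  then show ?thesis unfolding test_function_iff by (intro conjI smooth_bump exI[of _ R] allI impI)
qed

lemma test_function_Lipschitz:
  assumes "test_function \<phi>" obtains L where "L \<ge> 0" "\<And>x y. \<bar>\<phi> x - \<phi> y\<bar> \<le> L * norm (x - y)"
proof -
  have "\<exists>M. \<forall>x. \<bar>partial_deriv i \<phi> x\<bar> \<le> M" for i
  proof -
    obtain M R where M: "M \<ge> 0" "\<And>x. \<bar>partial_deriv i \<phi> x\<bar> \<le> M * indicator (cball 0 R) x"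
      using test_functionE[OF test_function_partial_deriv[OF assms, of i]] by metis
    have le: "M * indicator (cball 0 R) x \<le> M" for x :: "real^3" using M(1) by (simp add: indicator_def)
    show ?thesis by (intro exI[of _ M] allI) (rule order_trans[OF M(2) le])
  qed
  then obtain M where M: "\<And>i x. \<bar>partial_deriv i \<phi> x\<bar> \<le> M i"
    using choice[of "\<lambda>i M. \<forall>x. \<bar>partial_deriv i \<phi> x\<bar> \<le> M"] by blast
  define L where "L = sum M UNIV"
  have "\<bar>\<phi> x - \<phi> y\<bar> \<le> L * norm (x - y)" for x y
    unfolding real_norm_def[symmetric]
  proof (rule differentiable_bound[OF convex_UNIV])
    fix x :: "real^3"
    show "(\<phi> has_derivative (\<lambda>h. \<Sum>i\<in>UNIV. h $ i * partial_deriv i \<phi> x)) (at x within UNIV)"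
      using smooth_has_derivative[OF test_function_smooth[OF assms]] by simp
    show "onorm (\<lambda>h. \<Sum>i\<in>UNIV. h $ i * partial_deriv i \<phi> x) \<le> L"
    proof (rule onorm_le)
      fix h :: "real^3"
      have "norm (\<Sum>i\<in>UNIV. h $ i * partial_deriv i \<phi> x) \<le> (\<Sum>i\<in>UNIV. norm h * M i)"
        by (rule sum_norm_le) (auto simp: abs_mult intro!: mult_mono M component_le_norm_cart)
      then show "norm (\<Sum>i\<in>UNIV. h $ i * partial_deriv i \<phi> x) \<le> L * norm h"
        by (simp add: L_def sum_distrib_left mult.commute)
    qed
  qed auto
  moreover have "L \<ge> 0"
    unfolding L_def using order_trans[OF abs_ge_zero M] by (intro sum_nonneg) auto
  ultimately show thesis using that by blast
qed

lemma test_function_diff_quotient: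
  assumes "test_function \<phi>"
  shows "(\<lambda>n. real (Suc n) * (\<phi> (x + (1 / real (Suc n)) *\<^sub>R axis i 1) - \<phi> x)) \<longlonglongrightarrow> partial_deriv i \<phi> x"
proof -
  have "((\<lambda>s. x + s *\<^sub>R axis i 1) has_derivative (\<lambda>s. s *\<^sub>R axis i 1)) (at 0)"
    by (auto intro!: derivative_eq_intros)
  then have "((\<lambda>s. \<phi> (x + s *\<^sub>R axis i 1)) has_derivative (\<lambda>s. \<Sum>j\<in>UNIV. (s *\<^sub>R axis i 1) $ j * partial_deriv j \<phi> x)) (at 0)"
    by (rule has_derivative_compose) (use smooth_has_derivative[OF test_function_smooth[OF assms], of x] in simp)
  also have "(\<lambda>s. \<Sum>j\<in>UNIV. (s *\<^sub>R axis i 1) $ j * partial_deriv j \<phi> x) = (\<lambda>s. partial_deriv i \<phi> x * s)"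
    by (simp add: mult.assoc sum_axis_mult flip: sum_distrib_left) (simp add: mult.commute)
  finally have "((\<lambda>s. \<phi> (x + s *\<^sub>R axis i 1)) has_real_derivative partial_deriv i \<phi> x) (at 0)"
    unfolding has_field_derivative_def .
  then have "((\<lambda>h. (\<phi> (x + h *\<^sub>R axis i 1) - \<phi> x) / h) \<longlongrightarrow> partial_deriv i \<phi> x) (at 0)"
    by (simp add: DERIV_def)
  moreover have "filterlim (\<lambda>n. 1 / real (Suc n)) (at 0) sequentially"
    by (rule filterlim_atI) (auto intro: lim_1_over_n[THEN LIMSEQ_Suc] simp del: of_nat_Suc)
  ultimately have "(\<lambda>n. (\<phi> (x + (1 / real (Suc n)) *\<^sub>R axis i 1) - \<phi> x) / (1 / real (Suc n))) \<longlonglongrightarrow> partial_deriv i \<phi> x"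
    by (rule filterlim_compose)
  then show ?thesis by (simp add: mult.commute)
qed

section \<open>Weak derivatives\<close>

lemma test_function_bounded:
  assumes "test_function \<phi>"
  shows "\<exists>M R. M \<ge> 0 \<and> R > 0 \<and> (\<forall>x. \<bar>\<phi> x\<bar> \<le> M * indicator (cball 0 R) x)"
  by (rule test_functionE[OF assms]) (intro exI conjI allI)

lemma test_function_Lipschitz_ex:
  assumes "test_function \<phi>"
  shows "\<exists>L\<ge>0. \<forall>x y. \<bar>\<phi> x - \<phi> y\<bar> \<le> L * norm (x - y)"
  by (rule test_function_Lipschitz[OF assms]) (intro exI conjI allI)

lemma locally_integrableD:
  assumes "locally_integrable u" "compact C"
  shows "integrable lborel (\<lambda>x. indicat_real C x *\<^sub>R u x)"
  using assms unfolding locally_integrable_def set_integrable_def by simp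

lemma locally_integrable_measurable:
  assumes "locally_integrable u" shows "u \<in> borel_measurable borel"
proof (rule borel_measurable_LIMSEQ_metric[where f="\<lambda>n x. indicator (cball 0 (real n)) x *\<^sub>R u x"])
  show "(\<lambda>x. indicator (cball 0 (real n)) x *\<^sub>R u x) \<in> borel_measurable borel" for n
  proof -
    have "integrable lborel (\<lambda>x. indicat_real (cball 0 (real n)) x *\<^sub>R u x)"
      by (rule locally_integrableD[OF assms compact_cball])
    from borel_measurable_integrable[OF this] show ?thesis by simp
  qed
  fix x :: "real^3"
  obtain N :: nat where N: "norm x \<le> real N" using real_arch_simple by blast
  have "\<forall>\<^sub>F n in sequentially. indicator (cball 0 (real n)) x *\<^sub>R u x = u x"
    using eventually_ge_at_top[of N]
  proof eventually_elim
    case (elim n)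
    then have "norm x \<le> real n" using N by linarith
    then show ?case by simp
  qed
  then show "(\<lambda>n. indicator (cball 0 (real n)) x *\<^sub>R u x) \<longlonglongrightarrow> u x" by (rule tendsto_eventually)
qed

lemma memL2_locally_integrable:
  assumes "memL2 u" shows "locally_integrable u"
  unfolding locally_integrable_def set_integrable_def
proof (intro allI impI)
  fix C :: "(real^3) set" assume "compact C"
  then have "C \<in> sets borel" "bounded C" by (auto intro: borel_compact compact_imp_bounded)
  from memL2_integrable_mult[OF memL2_indicator[OF this, of 1] assms]
  have "integrable lborel (\<lambda>x. 1 * indicator C x * u x)" .
  moreover have "(\<lambda>x. 1 * indicator C x * u x) = (\<lambda>x. indicator C x *\<^sub>R u x)"
    by (simp add: fun_eq_iff indicator_def)
  ultimately show "integrable lborel (\<lambda>x. indicat_real C x *\<^sub>R u x)" by simp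
qed

lemma locally_integrable_add:
  assumes "locally_integrable f" "locally_integrable g" shows "locally_integrable (\<lambda>x. f x + g x)"
  using assms unfolding locally_integrable_def set_integrable_def scaleR_add_right by simp

lemma locally_integrable_cmult:
  assumes "locally_integrable f" shows "locally_integrable (\<lambda>x. c * f x)"
  unfolding locally_integrable_def set_integrable_def
proof (intro allI impI)
  fix C :: "(real^3) set" assume "compact C"
  then have "integrable lborel (\<lambda>x. indicat_real C x *\<^sub>R f x)"
    by (rule locally_integrableD[OF assms])
  from integrable_mult_right[OF this, of c]
  show "integrable lborel (\<lambda>x. indicat_real C x *\<^sub>R (c * f x))" by simp
qed

lemma locally_integrable_test:
  assumes \<phi>: "test_function \<phi>" and u: "locally_integrable u"
  shows "integrable lborel (\<lambda>x. \<phi> x *\<^sub>R u x)"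
proof -
  obtain M R where M: "M \<ge> 0" "\<And>x. \<bar>\<phi> x\<bar> \<le> M * indicator (cball 0 R) x"
    using test_function_bounded[OF \<phi>] by blast
  note [measurable] = test_function_measurable[OF \<phi>] locally_integrable_measurable[OF u]
  have "integrable lborel (\<lambda>x. indicat_real (cball 0 R) x *\<^sub>R u x)"
    by (rule locally_integrableD[OF u compact_cball])
  from integrable_mult_right[OF integrable_norm[OF this], of M]
  show ?thesis
  proof (rule integrable_dominated)
    fix x
    have "norm (\<phi> x *\<^sub>R u x) \<le> (M * indicator (cball 0 R) x) * cmod (u x)"
      unfolding norm_scaleR by (rule mult_right_mono[OF M(2)]) simp
    then show "norm (\<phi> x *\<^sub>R u x) \<le> M * norm (indicat_real (cball 0 R) x *\<^sub>R u x)"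
      by (simp add: mult.assoc)
  qed measurable
qed

lemma has_weak_partial_add:
  assumes "has_weak_partial i u g" "has_weak_partial i w h"
  shows "has_weak_partial i (\<lambda>x. u x + w x) (\<lambda>x. g x + h x)"
proof -
  have l: "locally_integrable u" "locally_integrable g" "locally_integrable w" "locally_integrable h"
    using assms unfolding has_weak_partial_def by blast+
  have "(\<integral>x. partial_deriv i \<phi> x *\<^sub>R (u x + w x) \<partial>lborel) = - (\<integral>x. \<phi> x *\<^sub>R (g x + h x) \<partial>lborel)"
    if \<phi>: "test_function \<phi>" for \<phi>
  proof -
    note t = locally_integrable_test[OF \<phi>] locally_integrable_test[OF test_function_partial_deriv[OF \<phi>, of i]]
    have "(\<integral>x. partial_deriv i \<phi> x *\<^sub>R u x \<partial>lborel) = - (\<integral>x. \<phi> x *\<^sub>R g x \<partial>lborel)"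
      "(\<integral>x. partial_deriv i \<phi> x *\<^sub>R w x \<partial>lborel) = - (\<integral>x. \<phi> x *\<^sub>R h x \<partial>lborel)"
      using assms \<phi> unfolding has_weak_partial_def by blast+
    then show ?thesis
      unfolding scaleR_add_right
      by (simp add: Bochner_Integration.integral_add t l)
  qed
  then show ?thesis using l unfolding has_weak_partial_def by (blast intro: locally_integrable_add)
qed

lemma has_weak_partial_cmult:
  assumes "has_weak_partial i u g"
  shows "has_weak_partial i (\<lambda>x. c * u x) (\<lambda>x. c * g x)"
proof -
  have "(\<integral>x. partial_deriv i \<phi> x *\<^sub>R (c * u x) \<partial>lborel) = - (\<integral>x. \<phi> x *\<^sub>R (c * g x) \<partial>lborel)"
    if \<phi>: "test_function \<phi>" for \<phi>
  proof -
    have "(\<integral>x. partial_deriv i \<phi> x *\<^sub>R u x \<partial>lborel) = - (\<integral>x. \<phi> x *\<^sub>R g x \<partial>lborel)"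
      using assms \<phi> unfolding has_weak_partial_def by blast
    then show ?thesis
      unfolding mult_scaleR_right[symmetric] integral_mult_right_zero by simp
  qed
  then show ?thesis using assms unfolding has_weak_partial_def by (blast intro: locally_integrable_cmult)
qed

lemma has_weak_partial_diff:
  assumes "has_weak_partial i u g" "has_weak_partial i w h"
  shows "has_weak_partial i (\<lambda>x. u x - w x) (\<lambda>x. g x - h x)"
  using has_weak_partial_add[OF assms(1) has_weak_partial_cmult[OF assms(2), of "-1"]] by simp

lemma locally_integrable_Re:
  assumes "locally_integrable u" shows "locally_integrable (\<lambda>x. complex_of_real (Re (u x)))"
  unfolding locally_integrable_def set_integrable_def
proof (intro allI impI)
  fix C :: "(real^3) set" assume "compact C"
  then have "integrable lborel (\<lambda>x. indicat_real C x *\<^sub>R u x)"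
    by (rule locally_integrableD[OF assms])
  then have "integrable lborel (\<lambda>x. Re (indicat_real C x *\<^sub>R u x))" by (rule integrable_Re)
  then have "integrable lborel (\<lambda>x. complex_of_real (Re (indicat_real C x *\<^sub>R u x)))"
    by (simp only: complex_of_real_integrable_eq)
  then show "integrable lborel (\<lambda>x. indicat_real C x *\<^sub>R complex_of_real (Re (u x)))"
    by (simp add: scaleR_conv_of_real)
qed

text \<open>Test functions are real, so the real part passes through the defining identity.\<close>

lemma has_weak_partial_Re:
  assumes "has_weak_partial i u g"
  shows "has_weak_partial i (\<lambda>x. complex_of_real (Re (u x))) (\<lambda>x. complex_of_real (Re (g x)))"
proof -
  have l: "locally_integrable u" "locally_integrable g"
    using assms unfolding has_weak_partial_def by blast+
  have Re: "(\<integral>x. \<psi> x *\<^sub>R complex_of_real (Re (f x)) \<partial>lborel) = complex_of_real (Re (\<integral>x. \<psi> x *\<^sub>R f x \<partial>lborel))"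
    if "test_function \<psi>" "locally_integrable f" for \<psi> f
  proof -
    have "(\<integral>x. \<psi> x *\<^sub>R complex_of_real (Re (f x)) \<partial>lborel) = (\<integral>x. complex_of_real (Re (\<psi> x *\<^sub>R f x)) \<partial>lborel)"
      by (simp add: scaleR_conv_of_real)
    also have "\<dots> = complex_of_real (\<integral>x. Re (\<psi> x *\<^sub>R f x) \<partial>lborel)" by (rule integral_complex_of_real)
    also have "\<dots> = complex_of_real (Re (\<integral>x. \<psi> x *\<^sub>R f x \<partial>lborel))"
      by (simp only: integral_Re[OF locally_integrable_test[OF that]])
    finally show ?thesis .
  qed
  have "(\<integral>x. partial_deriv i \<phi> x *\<^sub>R complex_of_real (Re (u x)) \<partial>lborel) = - (\<integral>x. \<phi> x *\<^sub>R complex_of_real (Re (g x)) \<partial>lborel)"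
    if \<phi>: "test_function \<phi>" for \<phi>
  proof -
    have "(\<integral>x. partial_deriv i \<phi> x *\<^sub>R u x \<partial>lborel) = - (\<integral>x. \<phi> x *\<^sub>R g x \<partial>lborel)"
      using assms \<phi> unfolding has_weak_partial_def by blast
    then show ?thesis unfolding Re[OF \<phi> l(2)] Re[OF test_function_partial_deriv[OF \<phi>] l(1)] by simp
  qed
  then show ?thesis using l unfolding has_weak_partial_def by (blast intro: locally_integrable_Re)
qed

text \<open>Open boxes are stable under intersection and generate the Borel sets, so by the
  pi-lambda theorem all integrals of d over Borel subsets of a fixed box vanish. The fixed box makes
  d integrable, and such boxes exhaust the space.\<close>

lemma AE_eq_0_if_box_integrals_0:
  assumes d: "locally_integrable d"
    and box: "\<And>a b. (\<integral>x. indicator (box a b) x *\<^sub>R d x \<partial>lborel) = 0"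
  shows "AE x in lborel. d x = 0"
proof -
  have "AE x in lborel. indicat_real (box (- (real n *\<^sub>R One)) (real n *\<^sub>R One)) x *\<^sub>R d x = 0" for n :: nat
  proof (rule sigma_finite_measure.density_zero[OF sigma_finite_lborel])
    let ?B = "box (- (real n *\<^sub>R One)) (real n *\<^sub>R One) :: (real^3) set"
    let ?f = "\<lambda>x. indicat_real ?B x *\<^sub>R d x"
    have "integrable lborel (\<lambda>x. indicat_real (cbox (- (real n *\<^sub>R One)) (real n *\<^sub>R One)) x *\<^sub>R d x)"
      by (rule locally_integrableD[OF d compact_cbox])
    from integrable_mult_indicator[OF _ this, of ?B]
    have "integrable lborel (\<lambda>x. indicat_real ?B x *\<^sub>R (indicat_real (cbox (- (real n *\<^sub>R One)) (real n *\<^sub>R One)) x *\<^sub>R d x))"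
      by simp
    moreover have "(\<lambda>x. indicat_real ?B x *\<^sub>R (indicat_real (cbox (- (real n *\<^sub>R One)) (real n *\<^sub>R One)) x *\<^sub>R d x)) = ?f"
      using box_subset_cbox[of "- (real n *\<^sub>R One)" "real n *\<^sub>R One :: real^3"] by (auto simp: fun_eq_iff indicator_def)
    ultimately show int: "integrable lborel ?f" by simp
    let ?E = "range (\<lambda>(a, b). box a b :: (real^3) set)"
    have gen: "sets lborel = sigma_sets UNIV ?E" by (simp add: borel_eq_box)
    fix A :: "(real^3) set" assume A: "A \<in> sets lborel"
    show "set_lebesgue_integral lborel A ?f = 0"
    proof (rule sigma_sets_induct_disjoint[of ?E UNIV A "\<lambda>A. set_lebesgue_integral lborel A ?f = 0"])
      show "Int_stable ?E" by (auto simp: Int_stable_def box_Int_box)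
      show "A \<in> sigma_sets UNIV ?E" using A unfolding gen .
      show "set_lebesgue_integral lborel C ?f = 0" if C: "C \<in> ?E" for C
      proof -
        from C obtain a b where "C = box a b" by auto
        then have "\<exists>a' b'. C \<inter> ?B = box a' b'" by (simp only: box_Int_box) blast
        then obtain a' b' where ab: "C \<inter> ?B = box a' b'" by blast
        have "set_lebesgue_integral lborel C ?f = (\<integral>x. indicat_real (C \<inter> ?B) x *\<^sub>R d x \<partial>lborel)"
          unfolding set_lebesgue_integral_def
          by (rule Bochner_Integration.integral_cong) (auto simp: indicator_def)
        then show ?thesis unfolding ab using box by simp
      qed
      show "set_lebesgue_integral lborel {} ?f = 0" by (simp add: set_lebesgue_integral_def)
      show "set_lebesgue_integral lborel (UNIV - C) ?f = 0"
        if C: "C \<in> sigma_sets UNIV ?E" "set_lebesgue_integral lborel C ?f = 0" for C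
      proof -
        have Cs: "C \<in> sets lborel" using C(1) unfolding gen .
        have "(\<integral>x. indicat_real (UNIV - C) x *\<^sub>R ?f x \<partial>lborel) = (\<integral>x. ?f x - indicat_real C x *\<^sub>R ?f x \<partial>lborel)"
          by (rule Bochner_Integration.integral_cong) (auto simp: indicator_def)
        also have "\<dots> = (\<integral>x. ?f x \<partial>lborel) - (\<integral>x. indicat_real C x *\<^sub>R ?f x \<partial>lborel)"
          by (rule Bochner_Integration.integral_diff[OF int integrable_mult_indicator[OF Cs int]])
        finally show ?thesis using C(2) box unfolding set_lebesgue_integral_def by simp
      qed
      show "set_lebesgue_integral lborel (\<Union>i. C i) ?f = 0"
        if C: "disjoint_family C" "range C \<subseteq> sigma_sets UNIV ?E" "\<And>i. set_lebesgue_integral lborel (C i) ?f = 0"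
        for C :: "nat \<Rightarrow> (real^3) set"
      proof -
        have Cs: "C i \<in> sets lborel" for i using C(2) unfolding gen by blast
        have "set_lebesgue_integral lborel (\<Union>i. C i) ?f = (\<Sum>i. set_lebesgue_integral lborel (C i) ?f)"
        proof (rule lebesgue_integral_countable_add[OF Cs])
          show "C i \<inter> C j = {}" if "i \<noteq> j" for i j using C(1) that unfolding disjoint_family_on_def by blast
          show "set_integrable lborel (\<Union> (range C)) ?f"
            unfolding set_integrable_def by (rule integrable_mult_indicator[OF _ int]) (use Cs in auto)
        qed
        then show ?thesis using C(3) by simp
      qed
    qed auto
  qed
  then have "AE x in lborel. \<forall>n. indicat_real (box (- (real n *\<^sub>R One)) (real n *\<^sub>R One)) x *\<^sub>R d x = 0"
    by (simp only: AE_all_countable) blast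
  then show ?thesis
  proof eventually_elim
    case (elim x)
    obtain n where "x \<in> box (- (real n *\<^sub>R One)) (real n *\<^sub>R One)"
      using UN_box_eq_UNIV[where 'a="real^3"] by blast
    then show ?case using elim[rule_format, of n] by simp
  qed
qed

text \<open>The difference g - h is a weak derivative of 0, hence orthogonal to all test functions;
  bumps that converge to indicators turn this into vanishing integrals over boxes.\<close>

lemma has_weak_partial_unique:
  assumes "has_weak_partial i u g" "has_weak_partial i u h"
  shows "AE x in lborel. g x = h x"
proof -
  let ?d = "\<lambda>x. g x - h x"
  have D: "has_weak_partial i (\<lambda>x. u x - u x) ?d" by (rule has_weak_partial_diff[OF assms])
  then have d: "locally_integrable ?d" unfolding has_weak_partial_def by blast
  have t: "(\<integral>x. \<phi> x *\<^sub>R ?d x \<partial>lborel) = 0" if "test_function \<phi>" for \<phi>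
  proof -
    have "(\<integral>x. partial_deriv i \<phi> x *\<^sub>R (u x - u x) \<partial>lborel) = - (\<integral>x. \<phi> x *\<^sub>R ?d x \<partial>lborel)"
      using D that unfolding has_weak_partial_def by blast
    then show ?thesis by simp
  qed
  note [measurable] = locally_integrable_measurable[OF d]
  have "AE x in lborel. ?d x = 0"
  proof (rule AE_eq_0_if_box_integrals_0[OF d])
    fix a b :: "real^3"
    have tb: "test_function (bump a b (real (Suc n)))" for n by (rule test_function_bump) simp
    note [measurable] = test_function_measurable[OF tb]
    have "(\<lambda>n. \<integral>x. bump a b (real (Suc n)) x *\<^sub>R ?d x \<partial>lborel) \<longlonglongrightarrow> (\<integral>x. indicator (box a b) x *\<^sub>R ?d x \<partial>lborel)"
    proof (rule integral_dominated_convergence)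
      show "integrable lborel (\<lambda>x. norm (indicat_real (cbox a b) x *\<^sub>R ?d x))"
        by (rule integrable_norm[OF locally_integrableD[OF d compact_cbox]])
      show "AE x in lborel. (\<lambda>n. bump a b (real (Suc n)) x *\<^sub>R ?d x) \<longlonglongrightarrow> indicator (box a b) x *\<^sub>R ?d x"
        by (intro AE_I2 tendsto_scaleR bump_tendsto_indicator tendsto_const)
      show "AE x in lborel. norm (bump a b (real (Suc n)) x *\<^sub>R ?d x) \<le> norm (indicat_real (cbox a b) x *\<^sub>R ?d x)" for n
      proof (rule AE_I2)
        fix x
        have "\<bar>bump a b (real (Suc n)) x\<bar> \<le> \<bar>indicat_real (cbox a b) x\<bar>"
          using bump_bounds[of a b "real (Suc n)" x] bump_pos_iff(2)[of "real (Suc n)" x a b] box_subset_cbox[of a b]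
          by (cases "x \<in> box a b") auto
        then show "norm (bump a b (real (Suc n)) x *\<^sub>R ?d x) \<le> norm (indicat_real (cbox a b) x *\<^sub>R ?d x)"
          unfolding norm_scaleR by (rule mult_right_mono) simp
      qed
    qed measurable
    then show "(\<integral>x. indicator (box a b) x *\<^sub>R ?d x \<partial>lborel) = 0"
      unfolding t[OF tb] by (simp only: LIMSEQ_const_iff)
  qed
  then show ?thesis by simp
qed

text \<open>The derivative is a limit of difference quotients, whose integrals vanish by translation
  invariance. The Lipschitz constant dominates them on the ball of radius R + 1, as the shifts have
  length at most 1.\<close>

lemma integral_partial_deriv_0:
  assumes \<phi>: "test_function \<phi>" shows "(\<integral>x. partial_deriv i \<phi> x \<partial>lborel) = 0"
proof -
  obtain L where L: "L \<ge> 0" "\<And>x y. \<bar>\<phi> x - \<phi> y\<bar> \<le> L * norm (x - y)"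
    using test_function_Lipschitz_ex[OF \<phi>] by blast
  obtain M R where M: "M \<ge> 0" "R > 0" "\<And>x. \<bar>\<phi> x\<bar> \<le> M * indicator (cball 0 R) x"
    using test_function_bounded[OF \<phi>] by blast
  note [measurable] = test_function_measurable[OF \<phi>] test_function_measurable[OF test_function_partial_deriv[OF \<phi>]]
  have ball: "integrable lborel (\<lambda>x. c * indicat_real (cball (0::real^3) r) x)" for c r :: real
    by (intro integrable_mult_right integrable_real_indicator emeasure_lborel_cball_finite) simp
  have int: "integrable lborel \<phi>"
    by (rule integrable_dominated[OF ball[of M R]]) (use M(3) in auto)
  let ?s = "\<lambda>n x. real (Suc n) * (\<phi> (x + (1 / real (Suc n)) *\<^sub>R axis i 1) - \<phi> x)"
  have sh: "(\<lambda>x. \<phi> (x + z)) = (\<lambda>x. \<phi> (z + 1 *\<^sub>R x))" for z by (simp add: add.commute)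
  have "(\<integral>x. ?s n x \<partial>lborel) = 0" for n
  proof -
    have "integrable lborel (\<lambda>x. \<phi> (x + (1 / real (Suc n)) *\<^sub>R axis i 1))"
      unfolding sh by (rule integrable_affine3[OF _ int]) simp
    moreover have "(\<integral>x. \<phi> (x + (1 / real (Suc n)) *\<^sub>R axis i 1) \<partial>lborel) = (\<integral>x. \<phi> x \<partial>lborel)"
      unfolding sh by (subst integral_affine3) simp_all
    ultimately show ?thesis using int by simp
  qed
  moreover have "(\<lambda>n. \<integral>x. ?s n x \<partial>lborel) \<longlonglongrightarrow> (\<integral>x. partial_deriv i \<phi> x \<partial>lborel)"
  proof (rule integral_dominated_convergence[OF _ _ ball[of L "R + 1"]])
    show "AE x in lborel. (\<lambda>n. ?s n x) \<longlonglongrightarrow> partial_deriv i \<phi> x"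
      by (intro AE_I2 test_function_diff_quotient[OF \<phi>])
    show "AE x in lborel. norm (?s n x) \<le> L * indicat_real (cball 0 (R + 1)) x" for n
    proof (rule AE_I2)
      fix x
      let ?z = "(1 / real (Suc n)) *\<^sub>R axis i 1 :: real^3"
      have nz: "norm ?z = 1 / real (Suc n)" by simp
      show "norm (?s n x) \<le> L * indicat_real (cball 0 (R + 1)) x"
      proof (cases "x \<in> cball 0 (R + 1)")
        case True
        have "\<bar>\<phi> (x + ?z) - \<phi> x\<bar> \<le> L * (1 / real (Suc n))" using L(2)[of "x + ?z" x] nz by simp
        then have "real (Suc n) * \<bar>\<phi> (x + ?z) - \<phi> x\<bar> \<le> real (Suc n) * (L * (1 / real (Suc n)))"
          by (rule mult_left_mono) simp
        then show ?thesis using True by (simp add: abs_mult)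
      next
        case False
        have "norm x \<le> norm (x + ?z) + norm ?z" using norm_triangle_ineq4[of "x + ?z" ?z] by simp
        moreover have "norm ?z \<le> 1" unfolding nz by simp
        moreover have "R + 1 < norm x" using False by simp
        ultimately have "R < norm (x + ?z)" "R < norm x" by linarith+
        then have "\<phi> (x + ?z) = 0" "\<phi> x = 0" using M(3)[of "x + ?z"] M(3)[of x] by auto
        then show ?thesis using L(1) by simp
      qed
    qed
  qed measurable
  ultimately show ?thesis by (simp add: LIMSEQ_const_iff)
qed

lemma test_function_memL2: "test_function \<phi> \<Longrightarrow> memL2 (\<lambda>x. complex_of_real (\<phi> x))"
  by (rule memL2_Cc[OF test_function_Cc])

lemma test_function_integrable:
  assumes "test_function \<phi>" shows "integrable lborel \<phi>"
proof -
  obtain M R where M: "\<And>x. \<bar>\<phi> x\<bar> \<le> M * indicator (cball 0 R) x"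
    using test_function_bounded[OF assms] by blast
  have "integrable lborel (\<lambda>x. M * indicat_real (cball (0::real^3) R) x)"
    by (intro integrable_mult_right integrable_real_indicator emeasure_lborel_cball_finite) simp
  then show ?thesis
    by (rule integrable_dominated) (use M test_function_measurable[OF assms] in auto)
qed

text \<open>Integration by parts, from the vanishing integral of the derivative of a product of two
  test functions.\<close>

lemma has_weak_partial_test_function:
  assumes \<phi>: "test_function \<phi>"
  shows "has_weak_partial i (\<lambda>x. complex_of_real (\<phi> x)) (\<lambda>x. complex_of_real (partial_deriv i \<phi> x))"
  unfolding has_weak_partial_def
proof (intro conjI allI impI memL2_locally_integrable test_function_memL2 test_function_partial_deriv \<phi>)
  fix \<psi> assume \<psi>: "test_function \<psi>"
  have t1: "test_function (\<lambda>x. \<psi> x * partial_deriv i \<phi> x)"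
    by (rule test_function_mult[OF \<psi> smooth_partial_deriv[OF test_function_smooth[OF \<phi>]]])
  have t2: "test_function (\<lambda>x. partial_deriv i \<psi> x * \<phi> x)"
    by (rule test_function_mult[OF test_function_partial_deriv[OF \<psi>] test_function_smooth[OF \<phi>]])
  have "partial_deriv i (\<lambda>x. \<psi> x * \<phi> x) = (\<lambda>x. \<psi> x * partial_deriv i \<phi> x + partial_deriv i \<psi> x * \<phi> x)"
    by (rule ext, rule partial_deriv_mult) (rule smooth_differentiable, rule test_function_smooth, fact)+
  then have "(\<integral>x. \<psi> x * partial_deriv i \<phi> x + partial_deriv i \<psi> x * \<phi> x \<partial>lborel) = 0"
    using integral_partial_deriv_0[OF test_function_mult[OF \<psi> test_function_smooth[OF \<phi>]], of i] by simp
  then have "(\<integral>x. partial_deriv i \<psi> x * \<phi> x \<partial>lborel) = - (\<integral>x. \<psi> x * partial_deriv i \<phi> x \<partial>lborel)"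
    using test_function_integrable[OF t1] test_function_integrable[OF t2] by simp
  then show "(\<integral>x. partial_deriv i \<psi> x *\<^sub>R complex_of_real (\<phi> x) \<partial>lborel)
      = - (\<integral>x. \<psi> x *\<^sub>R complex_of_real (partial_deriv i \<phi> x) \<partial>lborel)"
    unfolding scaleR_conv_of_real of_real_mult[symmetric] integral_complex_of_real of_real_minus[symmetric] by simp
qed

subsection \<open>The space \<open>H\<^sup>1\<close>\<close>

lemma H1_memL2: "u \<in> H1 \<Longrightarrow> memL2 u"
  by (simp add: H1_def)

lemma H1I:
  assumes "memL2 u" "\<And>i. memL2 (g i)" "\<And>i. has_weak_partial i u (g i)" shows "u \<in> H1"
  using assms unfolding H1_def by blast

lemma has_weak_partial_weak_partial:
  assumes "has_weak_partial i u g" shows "has_weak_partial i u (weak_partial i u)"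
  unfolding weak_partial_def by (rule someI[of "has_weak_partial i u", OF assms])

lemma weak_partial_AE:
  assumes "has_weak_partial i u g" shows "AE x in lborel. weak_partial i u x = g x"
  by (rule has_weak_partial_unique[OF has_weak_partial_weak_partial[OF assms] assms])

lemma has_weak_partial_measurable:
  assumes "has_weak_partial i u g" shows "g \<in> borel_measurable borel"
  using assms unfolding has_weak_partial_def by (blast intro: locally_integrable_measurable)

lemma weak_partial_Lp_norm:
  assumes "has_weak_partial i u g" shows "Lp_norm 2 (weak_partial i u) = Lp_norm 2 g"
  by (rule Lp_norm_2_cong_AE[OF has_weak_partial_measurable[OF has_weak_partial_weak_partial[OF assms]]
      has_weak_partial_measurable[OF assms] weak_partial_AE[OF assms]])

text \<open>Membership in \<open>H1\<close> provides some square integrable weak derivative; the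
  chosen one agrees with it almost everywhere and so is square integrable too.\<close>

lemma H1_weak_partial:
  assumes "u \<in> H1"
  shows "has_weak_partial i u (weak_partial i u)" "memL2 (weak_partial i u)"
proof -
  obtain g where g: "memL2 g" "has_weak_partial i u g" using assms unfolding H1_def by blast
  show w: "has_weak_partial i u (weak_partial i u)" by (rule has_weak_partial_weak_partial[OF g(2)])
  have "AE x in lborel. g x = weak_partial i u x" using weak_partial_AE[OF g(2)] by eventually_elim simp
  then show "memL2 (weak_partial i u)"
    by (rule memL2_cong_AE[OF g(1) has_weak_partial_measurable[OF w]])
qed

lemma H1_add:
  assumes "u \<in> H1" "w \<in> H1" shows "(\<lambda>x. u x + w x) \<in> H1"
  by (rule H1I[OF memL2_add[OF H1_memL2[OF assms(1)] H1_memL2[OF assms(2)]]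
      memL2_add[OF H1_weak_partial(2)[OF assms(1)] H1_weak_partial(2)[OF assms(2)]]
      has_weak_partial_add[OF H1_weak_partial(1)[OF assms(1)] H1_weak_partial(1)[OF assms(2)]]])

lemma H1_cmult:
  assumes "u \<in> H1" shows "(\<lambda>x. c * u x) \<in> H1"
  by (rule H1I[OF memL2_cmult[OF H1_memL2[OF assms]] memL2_cmult[OF H1_weak_partial(2)[OF assms]]
      has_weak_partial_cmult[OF H1_weak_partial(1)[OF assms]]])

lemma H1_diff:
  assumes "u \<in> H1" "w \<in> H1" shows "(\<lambda>x. u x - w x) \<in> H1"
  using H1_add[OF assms(1) H1_cmult[OF assms(2), of "-1"]] by simp

lemma test_function_H1: "test_function \<phi> \<Longrightarrow> (\<lambda>x. complex_of_real (\<phi> x)) \<in> H1"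
  by (rule H1I[OF test_function_memL2 test_function_memL2[OF test_function_partial_deriv] has_weak_partial_test_function])

lemma grad_norm_L2_set: "grad_norm u = L2_set (\<lambda>i. Lp_norm 2 (weak_partial i u)) UNIV"
  by (simp add: grad_norm_def L2_set_def)

lemma grad_norm_nonneg [simp]: "0 \<le> grad_norm u"
  unfolding grad_norm_L2_set by (rule L2_set_nonneg)

text \<open>Frees the gradient norm from the choice: whatever weak derivatives are at hand compute
  it.\<close>

lemma grad_norm_eq:
  assumes "\<And>i. has_weak_partial i u (g i)"
  shows "grad_norm u = L2_set (\<lambda>i. Lp_norm 2 (g i)) UNIV"
  unfolding grad_norm_L2_set weak_partial_Lp_norm[OF assms] ..

lemma grad_norm_triangle:
  assumes u: "u \<in> H1" and w: "w \<in> H1"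
  shows "grad_norm (\<lambda>x. u x + w x) \<le> grad_norm u + grad_norm w"
proof -
  have "grad_norm (\<lambda>x. u x + w x) = L2_set (\<lambda>i. Lp_norm 2 (\<lambda>x. weak_partial i u x + weak_partial i w x)) UNIV"
    by (rule grad_norm_eq[OF has_weak_partial_add[OF H1_weak_partial(1)[OF u] H1_weak_partial(1)[OF w]]])
  also have "\<dots> \<le> L2_set (\<lambda>i. Lp_norm 2 (weak_partial i u) + Lp_norm 2 (weak_partial i w)) UNIV"
    by (intro L2_set_mono Lp_norm_2_triangle H1_weak_partial u w) auto
  also have "\<dots> \<le> grad_norm u + grad_norm w"
    unfolding grad_norm_L2_set by (rule L2_set_triangle_ineq)
  finally show ?thesis .
qed

lemma grad_norm_reverse_triangle:
  assumes u: "u \<in> H1" and w: "w \<in> H1"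
  shows "\<bar>grad_norm u - grad_norm w\<bar> \<le> grad_norm (\<lambda>x. u x - w x)"
proof -
  have "grad_norm (\<lambda>x. -1 * (u x - w x)) = grad_norm (\<lambda>x. u x - w x)"
    unfolding grad_norm_eq[OF has_weak_partial_cmult[OF H1_weak_partial(1)[OF H1_diff[OF u w]]]]
      Lp_norm_2_cmult grad_norm_L2_set by simp
  then have s: "grad_norm (\<lambda>x. w x - u x) = grad_norm (\<lambda>x. u x - w x)" by simp
  show ?thesis
    using grad_norm_triangle[OF H1_diff[OF u w] w] grad_norm_triangle[OF H1_diff[OF w u] u] s by simp
qed

subsection \<open>Dilations\<close>

lemma locally_integrable_scaled:
  assumes u: "locally_integrable u" and c: "c \<noteq> 0" shows "locally_integrable (\<lambda>x. u (c *\<^sub>R x))"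
  unfolding locally_integrable_def set_integrable_def
proof (intro allI impI)
  fix C :: "(real^3) set" assume "compact C"
  then have "compact ((\<lambda>x. c *\<^sub>R x) ` C)" by (rule compact_scaling)
  then have "integrable lborel (\<lambda>x. indicat_real ((\<lambda>x. c *\<^sub>R x) ` C) x *\<^sub>R u x)"
    by (rule locally_integrableD[OF u])
  from integrable_affine3[OF c this, of 0]
  have "integrable lborel (\<lambda>x. indicat_real ((\<lambda>x. c *\<^sub>R x) ` C) (c *\<^sub>R x) *\<^sub>R u (c *\<^sub>R x))" by simp
  moreover have "indicat_real ((\<lambda>x. c *\<^sub>R x) ` C) (c *\<^sub>R x) = indicat_real C x" for x
    using c by (auto simp: indicator_def image_iff)
  ultimately show "integrable lborel (\<lambda>x. indicat_real C x *\<^sub>R u (c *\<^sub>R x))" by simp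
qed

text \<open>The identity for u is tested with \<open>\<phi> (x / c)\<close>; the substitution
  contributes the same factor c^(-3) on both sides, and the chain rule the factor c.\<close>

lemma has_weak_partial_scaled:
  assumes u: "has_weak_partial i u g" and c: "c > 0"
  shows "has_weak_partial i (\<lambda>x. u (c *\<^sub>R x)) (\<lambda>x. complex_of_real c * g (c *\<^sub>R x))"
  unfolding has_weak_partial_def
proof (intro conjI allI impI locally_integrable_cmult)
  show "locally_integrable (\<lambda>x. u (c *\<^sub>R x))" "locally_integrable (\<lambda>x. g (c *\<^sub>R x))"
    using u c unfolding has_weak_partial_def by (intro locally_integrable_scaled; simp)+
  fix \<phi> assume \<phi>: "test_function \<phi>"
  let ?\<psi> = "\<lambda>x. \<phi> (0 + (1 / c) *\<^sub>R x)"
  have \<psi>: "test_function ?\<psi>" by (rule test_function_affine[OF \<phi>]) (use c in simp)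
  have d\<psi>: "partial_deriv i ?\<psi> x = (1 / c) * partial_deriv i \<phi> ((1 / c) *\<^sub>R x)" for x
    using partial_deriv_affine(1)[OF test_function_smooth[OF \<phi>], of i 1 0 "1 / c"] by (simp add: fun_eq_iff)
  have 1: "(\<integral>x. partial_deriv i ?\<psi> x *\<^sub>R u x \<partial>lborel) = - (\<integral>x. ?\<psi> x *\<^sub>R g x \<partial>lborel)"
    using u \<psi> unfolding has_weak_partial_def by blast
  have A: "(\<integral>x. partial_deriv i \<phi> x *\<^sub>R u (c *\<^sub>R x) \<partial>lborel) = (1 / c ^ 3) *\<^sub>R (c *\<^sub>R (\<integral>x. partial_deriv i ?\<psi> x *\<^sub>R u x \<partial>lborel))"
  proof -
    have "c *\<^sub>R (\<integral>x. partial_deriv i ?\<psi> x *\<^sub>R u x \<partial>lborel) = (\<integral>x. partial_deriv i \<phi> ((1 / c) *\<^sub>R x) *\<^sub>R u x \<partial>lborel)"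
      using c by (simp only: integral_scaleR_right[symmetric] d\<psi>) simp
    moreover have "(\<integral>x. (\<lambda>x. partial_deriv i \<phi> ((1 / c) *\<^sub>R x) *\<^sub>R u x) (0 + c *\<^sub>R x) \<partial>lborel)
        = (1 / \<bar>c\<bar> ^ 3) *\<^sub>R (\<integral>x. partial_deriv i \<phi> ((1 / c) *\<^sub>R x) *\<^sub>R u x \<partial>lborel)"
      by (rule integral_affine3) (use c in simp)
    ultimately show ?thesis using c by simp
  qed
  have B: "(\<integral>x. \<phi> x *\<^sub>R (complex_of_real c * g (c *\<^sub>R x)) \<partial>lborel) = (1 / c ^ 3) *\<^sub>R (c *\<^sub>R (\<integral>x. ?\<psi> x *\<^sub>R g x \<partial>lborel))"
  proof -
    have "(\<integral>x. (\<lambda>x. ?\<psi> x *\<^sub>R g x) (0 + c *\<^sub>R x) \<partial>lborel) = (1 / \<bar>c\<bar> ^ 3) *\<^sub>R (\<integral>x. ?\<psi> x *\<^sub>R g x \<partial>lborel)"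
      by (rule integral_affine3) (use c in simp)
    then have "(\<integral>x. \<phi> x *\<^sub>R g (c *\<^sub>R x) \<partial>lborel) = (1 / c ^ 3) *\<^sub>R (\<integral>x. ?\<psi> x *\<^sub>R g x \<partial>lborel)"
      using c by simp
    moreover have "(\<integral>x. \<phi> x *\<^sub>R (complex_of_real c * g (c *\<^sub>R x)) \<partial>lborel)
        = complex_of_real c * (\<integral>x. \<phi> x *\<^sub>R g (c *\<^sub>R x) \<partial>lborel)"
      by (subst integral_mult_right_zero[symmetric]) (simp only: mult_scaleR_right)
    ultimately show ?thesis by (simp add: scaleR_conv_of_real)
  qed
  show "(\<integral>x. partial_deriv i \<phi> x *\<^sub>R u (c *\<^sub>R x) \<partial>lborel) = - (\<integral>x. \<phi> x *\<^sub>R (complex_of_real c * g (c *\<^sub>R x)) \<partial>lborel)"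
    unfolding A B 1 by simp
qed

section \<open>Density of test functions in \<open>H\<^sup>1\<close>\<close>

text \<open>The mean value inequality for \<phi> minus its linear part at z, whose derivative is
  Lipschitz and vanishes at z. The constant does not depend on z, as differentiation under the
  integral requires.\<close>

lemma test_function_Taylor:
  assumes \<phi>: "test_function \<phi>"
  shows "\<exists>C\<ge>0. \<forall>z h. \<bar>\<phi> (z + h) - \<phi> z - (\<Sum>i\<in>UNIV. h $ i * partial_deriv i \<phi> z)\<bar> \<le> C * (norm h)\<^sup>2"
proof -
  have "\<forall>i. \<exists>L. 0 \<le> L \<and> (\<forall>x y. \<bar>partial_deriv i \<phi> x - partial_deriv i \<phi> y\<bar> \<le> L * norm (x - y))"
    using test_function_Lipschitz_ex[OF test_function_partial_deriv[OF \<phi>]] by simp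
  then obtain L where L: "\<And>i. 0 \<le> L i" "\<And>i x y. \<bar>partial_deriv i \<phi> x - partial_deriv i \<phi> y\<bar> \<le> L i * norm (x - y)"
    using choice[of "\<lambda>i L. 0 \<le> L \<and> (\<forall>x y. \<bar>partial_deriv i \<phi> x - partial_deriv i \<phi> y\<bar> \<le> L * norm (x - y))"] by blast
  define C where "C = sum L UNIV"
  have "\<bar>\<phi> (z + h) - \<phi> z - (\<Sum>i\<in>UNIV. h $ i * partial_deriv i \<phi> z)\<bar> \<le> C * (norm h)\<^sup>2" for z h
  proof -
    let ?\<psi> = "\<lambda>k. \<phi> (z + k) - (\<Sum>i\<in>UNIV. k $ i * partial_deriv i \<phi> z)"
    let ?D = "\<lambda>k d. (\<Sum>i\<in>UNIV. d $ i * partial_deriv i \<phi> (z + k)) - (\<Sum>i\<in>UNIV. d $ i * partial_deriv i \<phi> z)"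
    have "norm (?\<psi> h - ?\<psi> 0) \<le> (C * norm h) * norm (h - 0)"
    proof (rule differentiable_bound[of "cball 0 (norm h)" ?\<psi> ?D])
      fix k :: "real^3" assume k: "k \<in> cball 0 (norm h)"
      have "((\<lambda>k. z + k) has_derivative (\<lambda>d. d)) (at k)" by (auto intro!: derivative_eq_intros)
      from has_derivative_compose[OF this smooth_has_derivative[OF test_function_smooth[OF \<phi>]]]
      have d1: "((\<lambda>k. \<phi> (z + k)) has_derivative (\<lambda>d. \<Sum>i\<in>UNIV. d $ i * partial_deriv i \<phi> (z + k))) (at k)" .
      have d2: "((\<lambda>k. \<Sum>i\<in>UNIV. k $ i * partial_deriv i \<phi> z) has_derivative (\<lambda>d. \<Sum>i\<in>UNIV. d $ i * partial_deriv i \<phi> z)) (at k)"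
        by (intro has_derivative_sum has_derivative_mult_left bounded_linear.has_derivative[OF bounded_linear_vec_nth has_derivative_ident])
      show "(?\<psi> has_derivative ?D k) (at k within cball 0 (norm h))"
        by (rule has_derivative_at_withinI[OF has_derivative_diff[OF d1 d2]])
      show "onorm (?D k) \<le> C * norm h"
      proof (rule onorm_le)
        fix d :: "real^3"
        have "?D k d = (\<Sum>i\<in>UNIV. d $ i * (partial_deriv i \<phi> (z + k) - partial_deriv i \<phi> z))"
          by (simp add: sum_subtractf right_diff_distrib)
        also have "norm \<dots> \<le> (\<Sum>i\<in>UNIV. norm d * (L i * norm h))"
        proof (rule sum_norm_le)
          fix i
          have "\<bar>partial_deriv i \<phi> (z + k) - partial_deriv i \<phi> z\<bar> \<le> L i * norm k" using L(2)[of i "z + k" z] by simp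
          also have "\<dots> \<le> L i * norm h" using k by (intro mult_left_mono L(1)) simp
          finally show "norm (d $ i * (partial_deriv i \<phi> (z + k) - partial_deriv i \<phi> z)) \<le> norm d * (L i * norm h)"
            unfolding real_norm_def abs_mult by (intro mult_mono component_le_norm_cart) auto
        qed
        also have "\<dots> = C * norm h * norm d" unfolding C_def sum_distrib_left[symmetric] sum_distrib_right[symmetric] by simp
        finally show "norm (?D k d) \<le> C * norm h * norm d" .
      qed
    qed auto
    then show ?thesis by (simp add: power2_eq_square mult.assoc algebra_simps)
  qed
  moreover have "0 \<le> C" unfolding C_def by (intro sum_nonneg L(1))
  ultimately show ?thesis by blast
qed

section \<open>Convolution of locally integrable functions with test functions\<close>

definition conv :: "(real^3 \<Rightarrow> real) \<Rightarrow> (real^3 \<Rightarrow> real) \<Rightarrow> real^3 \<Rightarrow> real" where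
  "conv \<phi> w x = (\<integral>y. \<phi> (x - y) * w y \<partial>lborel)"

lemma test_function_reflect: "test_function \<phi> \<Longrightarrow> test_function (\<lambda>y. \<phi> (x - y))"
  using test_function_affine[of \<phi> "-1" x] by simp

lemma conv_integrable:
  assumes "test_function \<phi>" and w: "locally_integrable (\<lambda>x. complex_of_real (w x))"
  shows "integrable lborel (\<lambda>y. \<phi> (x - y) * w y)"
proof -
  have "integrable lborel (\<lambda>y. \<phi> (x - y) *\<^sub>R complex_of_real (w y))"
    by (rule locally_integrable_test[OF test_function_reflect[OF assms(1)] w])
  then show ?thesis unfolding scaleR_conv_of_real of_real_mult[symmetric] complex_of_real_integrable_eq .
qed

text \<open>The Taylor remainder is of order |h|^2 uniformly, and for |h| <= 1 it lives on a fixed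
  ball around x, on which w is integrable. The remainder of the convolution is therefore of order
  |h|^2 as well.\<close>

lemma conv_has_derivative:
  assumes \<phi>: "test_function \<phi>" and w: "locally_integrable (\<lambda>x. complex_of_real (w x))"
  shows "(conv \<phi> w has_derivative (\<lambda>h. \<Sum>i\<in>UNIV. h $ i * conv (partial_deriv i \<phi>) w x)) (at x)"
proof -
  obtain C where C: "0 \<le> C"
    "\<And>z h. \<bar>\<phi> (z + h) - \<phi> z - (\<Sum>i\<in>UNIV. h $ i * partial_deriv i \<phi> z)\<bar> \<le> C * (norm h)\<^sup>2"
    using test_function_Taylor[OF \<phi>] by blast
  obtain R where R: "R > 0" "\<And>x. R < norm x \<Longrightarrow> \<phi> x = 0" "\<And>i x. R < norm x \<Longrightarrow> partial_deriv i \<phi> x = 0"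
  proof -
    obtain M0 R0 where R0: "\<And>x. \<bar>\<phi> x\<bar> \<le> M0 * indicator (cball 0 R0) x"
      using test_function_bounded[OF \<phi>] by blast
    have "\<forall>i. \<exists>R. R > 0 \<and> (\<forall>x. R < norm x \<longrightarrow> partial_deriv i \<phi> x = 0)"
    proof
      fix i
      obtain M1 R1 where R1: "R1 > 0" "\<And>x. \<bar>partial_deriv i \<phi> x\<bar> \<le> M1 * indicator (cball 0 R1) x"
        using test_function_bounded[OF test_function_partial_deriv[OF \<phi>]] by blast
      have "partial_deriv i \<phi> x = 0" if "R1 < norm x" for x using R1(2)[of x] that by simp
      then show "\<exists>R. R > 0 \<and> (\<forall>x. R < norm x \<longrightarrow> partial_deriv i \<phi> x = 0)" using R1(1) by blast
    qed
    then obtain R1 where R1: "\<And>i. R1 i > 0" "\<And>i x. R1 i < norm x \<Longrightarrow> partial_deriv i \<phi> x = 0"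
      using choice[of "\<lambda>i R. R > 0 \<and> (\<forall>x. R < norm x \<longrightarrow> partial_deriv i \<phi> x = 0)"] by blast
    define R where "R = \<bar>R0\<bar> + sum R1 UNIV"
    have "sum R1 UNIV > 0" by (intro sum_pos R1(1)) auto
    moreover have "R1 i \<le> sum R1 UNIV" for i
      by (rule member_le_sum) (use R1(1) in \<open>auto intro: less_imp_le\<close>)
    ultimately have "R > 0" "R0 \<le> R" "\<And>i. R1 i \<le> R" unfolding R_def by (auto intro: add_increasing)
    have "\<phi> x = 0" if "R < norm x" for x using R0[of x] that \<open>R0 \<le> R\<close> by simp
    moreover have "partial_deriv i \<phi> x = 0" if "R < norm x" for i x
      by (rule R1(2)) (use that \<open>R1 i \<le> R\<close> in linarith)
    ultimately show thesis using that[OF \<open>R > 0\<close>] by blast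
  qed
  define B where "B = cball x (R + 1)"
  define K where "K = (\<integral>y. indicator B y * \<bar>w y\<bar> \<partial>lborel)"
  have Bi: "integrable lborel (\<lambda>y. indicator B y * \<bar>w y\<bar>)"
  proof -
    have "integrable lborel (\<lambda>y. norm (indicat_real B y *\<^sub>R complex_of_real (w y)))"
      unfolding B_def by (rule integrable_norm[OF locally_integrableD[OF w compact_cball]])
    then show ?thesis by simp
  qed
  note ci = conv_integrable[OF \<phi> w] conv_integrable[OF test_function_partial_deriv[OF \<phi>] w]
  have est: "\<bar>conv \<phi> w (x + h) - conv \<phi> w x - (\<Sum>i\<in>UNIV. h $ i * conv (partial_deriv i \<phi>) w x)\<bar> \<le> C * (norm h)\<^sup>2 * K"
    if h: "norm h \<le> 1" for h
  proof -
    let ?r = "\<lambda>y. (\<phi> (x + h - y) - \<phi> (x - y) - (\<Sum>i\<in>UNIV. h $ i * partial_deriv i \<phi> (x - y))) * w y"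
    have e: "?r y = \<phi> (x + h - y) * w y - \<phi> (x - y) * w y - (\<Sum>i\<in>UNIV. h $ i * (partial_deriv i \<phi> (x - y) * w y))" for y
      by (simp add: left_diff_distrib sum_distrib_right mult.assoc)
    have ri: "integrable lborel ?r" unfolding e using ci by simp
    have eq: "conv \<phi> w (x + h) - conv \<phi> w x - (\<Sum>i\<in>UNIV. h $ i * conv (partial_deriv i \<phi>) w x) = (\<integral>y. ?r y \<partial>lborel)"
      unfolding e conv_def using ci by simp
    have "\<bar>\<integral>y. ?r y \<partial>lborel\<bar> \<le> (\<integral>y. \<bar>?r y\<bar> \<partial>lborel)" using integral_norm_bound[of lborel ?r] by (simp only: real_norm_def)
    also have "\<dots> \<le> (\<integral>y. C * (norm h)\<^sup>2 * (indicator B y * \<bar>w y\<bar>) \<partial>lborel)"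
    proof (rule integral_mono)
      show "integrable lborel (\<lambda>y. \<bar>?r y\<bar>)" using integrable_norm[OF ri] by (simp only: real_norm_def)
      show "integrable lborel (\<lambda>y. C * (norm h)\<^sup>2 * (indicator B y * \<bar>w y\<bar>))" by (rule integrable_mult_right[OF Bi])
      fix y
      show "\<bar>?r y\<bar> \<le> C * (norm h)\<^sup>2 * (indicator B y * \<bar>w y\<bar>)"
      proof (cases "y \<in> B")
        case True
        have "\<bar>\<phi> (x - y + h) - \<phi> (x - y) - (\<Sum>i\<in>UNIV. h $ i * partial_deriv i \<phi> (x - y))\<bar> * \<bar>w y\<bar> \<le> C * (norm h)\<^sup>2 * \<bar>w y\<bar>"
          by (rule mult_right_mono[OF C(2)]) simp
        moreover have "x - y + h = x + h - y" by simp
        ultimately show ?thesis using True by (simp only: abs_mult indicator_simps mult_1_left)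
      next
        case False
        then have far: "R + 1 < norm (x - y)" by (simp add: B_def dist_norm)
        have "norm (x - y) \<le> norm (x + h - y) + norm h"
          using norm_triangle_ineq4[of "x + h - y" h] by simp
        then have "R < norm (x + h - y)" "R < norm (x - y)" using far h by linarith+
        then show ?thesis using R(2,3) False by simp
      qed
    qed
    also have "\<dots> = C * (norm h)\<^sup>2 * K" unfolding K_def by (rule integral_mult_right_zero)
    finally show ?thesis unfolding eq .
  qed
  show ?thesis
  proof (rule has_derivativeI_sandwich[of 1])
    show "bounded_linear (\<lambda>h :: real^3. \<Sum>i\<in>UNIV. h $ i * conv (partial_deriv i \<phi>) w x)"
      by (intro bounded_linear_sum bounded_linear_compose[OF bounded_linear_mult_left bounded_linear_vec_nth])
    show "norm (conv \<phi> w y - conv \<phi> w x - (\<Sum>i\<in>UNIV. (y - x) $ i * conv (partial_deriv i \<phi>) w x)) / norm (y - x)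
        \<le> C * norm (y - x) * K" if "y \<noteq> x" "dist y x < 1" for y
    proof -
      have "norm (y - x) > 0" "norm (y - x) \<le> 1" using that by (auto simp: dist_norm)
      then show ?thesis using est[of "y - x"] by (simp add: pos_divide_le_eq power2_eq_square mult_ac)
    qed
    have "((\<lambda>y. C * norm (y - x) * K) \<longlongrightarrow> C * norm (x - x) * K) (at x)" by (intro tendsto_intros)
    then show "((\<lambda>y. C * norm (y - x) * K) \<longlongrightarrow> 0) (at x)" by simp
  qed simp
qed

lemma partial_deriv_conv:
  assumes "test_function \<phi>" "locally_integrable (\<lambda>x. complex_of_real (w x))"
  shows "partial_deriv i (conv \<phi> w) = conv (partial_deriv i \<phi>) w"
  by (rule ext, rule trans[OF partial_deriv_eq[OF conv_has_derivative[OF assms]]]) (rule sum_axis_mult)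

lemma smooth_conv:
  assumes \<phi>: "test_function \<phi>" and w: "locally_integrable (\<lambda>x. complex_of_real (w x))"
  shows "smooth (conv \<phi> w)"
proof (rule smooth_coinduct[where P="\<lambda>f. \<exists>\<phi>. test_function \<phi> \<and> f = conv \<phi> w"])
  show "\<exists>\<psi>. test_function \<psi> \<and> conv \<phi> w = conv \<psi> w" using \<phi> by blast
  fix f assume "\<exists>\<psi>. test_function \<psi> \<and> f = conv \<psi> w"
  then obtain \<psi> where \<psi>: "test_function \<psi>" "f = conv \<psi> w" by blast
  show "f differentiable at x" for x
    unfolding \<psi>(2) by (rule differentiableI[OF conv_has_derivative[OF \<psi>(1) w]])
  show "\<exists>\<psi>. test_function \<psi> \<and> partial_deriv i f = conv \<psi> w" for i
    unfolding \<psi>(2) partial_deriv_conv[OF \<psi>(1) w] using test_function_partial_deriv[OF \<psi>(1)] by blast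
qed

text \<open>The weak derivative of w is tested with \<open>\<lambda>y. \<phi> (x - y)\<close>, whose
  own derivative brings the second minus sign.\<close>

lemma conv_partial_deriv_weak:
  assumes \<phi>: "test_function \<phi>"
    and wg: "has_weak_partial i (\<lambda>x. complex_of_real (w x)) (\<lambda>x. complex_of_real (g x))"
  shows "conv (partial_deriv i \<phi>) w = conv \<phi> g"
proof
  fix x
  have p: "partial_deriv i (\<lambda>y. \<phi> (x - y)) y = - partial_deriv i \<phi> (x - y)" for y
    using partial_deriv_affine(1)[OF test_function_smooth[OF \<phi>], of i 1 x "-1"] by (simp add: fun_eq_iff)
  have "(\<integral>y. partial_deriv i (\<lambda>y. \<phi> (x - y)) y *\<^sub>R complex_of_real (w y) \<partial>lborel)
      = - (\<integral>y. \<phi> (x - y) *\<^sub>R complex_of_real (g y) \<partial>lborel)"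
    using wg test_function_reflect[OF \<phi>, of x] unfolding has_weak_partial_def by blast
  then have "(\<integral>y. (- partial_deriv i \<phi> (x - y)) * w y \<partial>lborel) = - (\<integral>y. \<phi> (x - y) * g y \<partial>lborel)"
    unfolding p scaleR_conv_of_real of_real_mult[symmetric] integral_complex_of_real of_real_minus[symmetric] of_real_eq_iff .
  then show "conv (partial_deriv i \<phi>) w x = conv \<phi> g x"
    unfolding conv_def mult_minus_left integral_minus by simp
qed

text \<open>Connects convergence in L2, shown for \<open>mollify\<close>, with smoothness, shown for
  \<open>conv\<close>.\<close>

lemma mollify_conv:
  assumes "e > 0"
  shows "mollify \<eta> e (\<lambda>x. complex_of_real (w x)) x = complex_of_real (conv (\<lambda>z. (1 / e ^ 3) * \<eta> ((1 / e) *\<^sub>R z)) w x)"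
proof -
  let ?f = "\<lambda>y. complex_of_real (\<eta> ((1 / e) *\<^sub>R (x - y)) * w y)"
  have "mollify \<eta> e (\<lambda>x. complex_of_real (w x)) x = (\<integral>z. ?f (x + (- e) *\<^sub>R z) \<partial>lborel)"
  proof -
    have "(1 / e) *\<^sub>R (x - (x + (- e) *\<^sub>R z)) = z" for z using assms by simp
    then show ?thesis unfolding mollify_def
      by (intro Bochner_Integration.integral_cong) (simp_all add: scaleR_conv_of_real[where 'a=complex])
  qed
  also have "\<dots> = (1 / \<bar>- e\<bar> ^ 3) *\<^sub>R (\<integral>y. ?f y \<partial>lborel)"
    by (rule integral_affine3) (use assms in simp)
  also have "(\<integral>y. ?f y \<partial>lborel) = complex_of_real (\<integral>y. \<eta> ((1 / e) *\<^sub>R (x - y)) * w y \<partial>lborel)"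
    by (rule integral_complex_of_real)
  finally show ?thesis using assms
    by (simp add: conv_def scaleR_conv_of_real mult.assoc)
qed

lemma bump_unit:
  defines "b \<equiv> bump (-1) 1 1"
  shows "test_function b" "0 < b 0" "0 \<le> b x" "0 < (\<integral>x. b x \<partial>lborel)"
proof -
  show t: "test_function b" unfolding b_def by (rule test_function_bump) simp
  have box0: "0 \<in> box (-1) (1 :: real^3)" by (simp add: mem_box_cart)
  show "0 < b 0" unfolding b_def using bump_pos_iff(1)[of 1 "-1" 1 0] box0 by simp
  show nn: "0 \<le> b x" for x unfolding b_def by (rule bump_bounds)
  have "(\<integral>x. b x \<partial>lborel) \<noteq> 0"
  proof
    assume "(\<integral>x. b x \<partial>lborel) = 0"
    then have "AE x in lborel. b x = 0"
      using integral_nonneg_eq_0_iff_AE[OF test_function_integrable[OF t]] nn by simp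
    then have "AE x in lborel. x \<notin> box (-1) (1 :: real^3)"
      by eventually_elim (use bump_pos_iff(1)[of 1 "-1" 1] in \<open>force simp: b_def\<close>)
    then have "emeasure lborel (box (-1) (1 :: real^3)) = 0"
      by (subst (asm) AE_iff_measurable[OF _ refl]) auto
    moreover have "emeasure lborel (box (-1) (1 :: real^3)) = ennreal ((1 - - 1) * (1 - - 1) * (1 - - 1))"
    proof (subst emeasure_lborel_box)
      show "-1 \<bullet> b \<le> 1 \<bullet> b" if "b \<in> Basis" for b :: "real^3"
        using that by (auto simp: Basis_vec_def inner_axis)
    qed (simp add: prod_Basis_vec inner_axis)
    ultimately show False by simp
  qed
  then show "0 < (\<integral>x. b x \<partial>lborel)"
    using Bochner_Integration.integral_nonneg[of lborel b] nn by (simp add: less_le)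
qed

lemma standard_mollifier:
  obtains \<eta> where "test_function \<eta>" "\<And>x. 0 \<le> \<eta> x" "(\<integral>x. \<eta> x \<partial>lborel) = 1"
proof (rule that[of "\<lambda>x. (1 / (\<integral>x. bump (-1) 1 1 x \<partial>lborel)) * bump (-1) 1 1 x"])
  show "test_function (\<lambda>x. (1 / (\<integral>x. bump (-1) 1 1 x \<partial>lborel)) * bump (-1) 1 1 x)"
    by (rule test_function_cmult[OF bump_unit(1)])
  show "0 \<le> (1 / (\<integral>x. bump (-1) 1 1 x \<partial>lborel)) * bump (-1) 1 1 x" for x
    using bump_unit(3,4) by (intro mult_nonneg_nonneg) (auto intro: less_imp_le)
  show "(\<integral>x. (1 / (\<integral>x. bump (-1) 1 1 x \<partial>lborel)) * bump (-1) 1 1 x \<partial>(lborel :: (real^3) measure)) = 1"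
    unfolding integral_mult_right_zero using bump_unit(4) by simp
qed

text \<open>Split \<open>c n * F n\<close> into \<open>c n * (F n - f)\<close>, small by the uniform
  bound C, and \<open>c n * f\<close>, which converges by domination.\<close>

lemma L2_tendsto_mult_bounded:
  fixes c :: "nat \<Rightarrow> real^3 \<Rightarrow> real"
  assumes F: "L2_tendsto F f" and c: "\<And>n. c n \<in> borel_measurable borel" "\<And>n x. \<bar>c n x\<bar> \<le> C"
    and lim: "\<And>x. (\<lambda>n. c n x) \<longlonglongrightarrow> a"
  shows "L2_tendsto (\<lambda>n x. complex_of_real (c n x) * F n x) (\<lambda>x. complex_of_real a * f x)"
proof -
  note [measurable] = c(1)
  have m: "memL2 (F n)" "memL2 f" for n using F by (simp_all add: L2_tendsto_def)
  have C: "0 \<le> C" using order_trans[OF abs_ge_zero c(2)] .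
  have cm: "memL2 (\<lambda>x. complex_of_real (c n x) * g x)" if g: "memL2 g" for n g
  proof (rule memL2_bound[OF g])
    show "(\<lambda>x. complex_of_real (c n x) * g x) \<in> borel_measurable borel"
      using memL2_measurable[OF g] by measurable
    show "AE x in lborel. cmod (complex_of_real (c n x) * g x) \<le> C * cmod (g x)"
      by (rule AE_I2) (simp add: norm_mult mult_right_mono c(2))
  qed
  have 1: "L2_tendsto (\<lambda>n x. complex_of_real (c n x) * (F n x - f x)) (\<lambda>x. 0)"
    unfolding L2_tendsto_def
  proof (intro conjI allI cm memL2_diff m memL2_zero)
    have "(\<lambda>n. C * Lp_norm 2 (\<lambda>x. F n x - f x)) \<longlonglongrightarrow> C * 0"
      using F unfolding L2_tendsto_def by (intro tendsto_mult tendsto_const) simp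
    then have l: "(\<lambda>n. C * Lp_norm 2 (\<lambda>x. F n x - f x)) \<longlonglongrightarrow> 0" by simp
    have "norm (Lp_norm 2 (\<lambda>x. complex_of_real (c n x) * (F n x - f x) - 0)) \<le> C * Lp_norm 2 (\<lambda>x. F n x - f x)" for n
    proof -
      have "(Lp_norm 2 (\<lambda>x. complex_of_real (c n x) * (F n x - f x)))\<^sup>2 \<le> (\<integral>x. C\<^sup>2 * (cmod (F n x - f x))\<^sup>2 \<partial>lborel)"
        unfolding Lp_norm_2_square
      proof (rule integral_mono)
        show "integrable lborel (\<lambda>x. (cmod (complex_of_real (c n x) * (F n x - f x)))\<^sup>2)"
          by (rule memL2_integrable[OF cm[OF memL2_diff[OF m]]])
        show "integrable lborel (\<lambda>x. C\<^sup>2 * (cmod (F n x - f x))\<^sup>2)"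
          by (rule integrable_mult_right[OF memL2_integrable[OF memL2_diff[OF m]]])
        show "(cmod (complex_of_real (c n x) * (F n x - f x)))\<^sup>2 \<le> C\<^sup>2 * (cmod (F n x - f x))\<^sup>2" for x
          unfolding norm_mult power_mult_distrib
          using power_mono[OF c(2)[of n x], of 2] by (intro mult_right_mono) simp_all
      qed
      also have "\<dots> = (C * Lp_norm 2 (\<lambda>x. F n x - f x))\<^sup>2"
        by (simp add: Lp_norm_2_square power_mult_distrib)
      finally have "Lp_norm 2 (\<lambda>x. complex_of_real (c n x) * (F n x - f x)) \<le> C * Lp_norm 2 (\<lambda>x. F n x - f x)"
        by (rule power2_le_imp_le) (simp add: C)
      then show ?thesis by simp
    qed
    then show "(\<lambda>n. Lp_norm 2 (\<lambda>x. complex_of_real (c n x) * (F n x - f x) - 0)) \<longlonglongrightarrow> 0"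
      by (rule Lim_null_comparison[OF always_eventually[OF allI] l])
  qed
  have 2: "L2_tendsto (\<lambda>n x. complex_of_real (c n x) * f x) (\<lambda>x. complex_of_real a * f x)"
  proof (rule L2_tendsto_dominated[OF _ _ memL2_cmult[OF m(2), of "complex_of_real C"]])
    show "(\<lambda>x. complex_of_real (c n x) * f x) \<in> borel_measurable borel" for n
      by (rule memL2_measurable[OF cm[OF m(2)]])
    show "(\<lambda>x. complex_of_real a * f x) \<in> borel_measurable borel"
      by (rule memL2_measurable[OF memL2_cmult[OF m(2)]])
    show "AE x in lborel. cmod (complex_of_real (c n x) * f x) \<le> cmod (complex_of_real C * f x)" for n
      using C by (intro AE_I2) (simp add: norm_mult mult_right_mono c(2))
    show "AE x in lborel. (\<lambda>n. complex_of_real (c n x) * f x) \<longlonglongrightarrow> complex_of_real a * f x"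
      by (intro AE_I2 tendsto_mult tendsto_of_real lim tendsto_const)
  qed
  show ?thesis using L2_tendsto_add[OF 1 2] by (simp add: right_diff_distrib)
qed

text \<open>Mollification gives smoothness, and a slowly varying cutoff gives compact support.
  Mollification commutes with weak derivatives, so the one additional term is the derivative of the
  cutoff, which is of size \<open>e n\<close>. The theorem concerns real functions because test
  functions are real.\<close>

theorem test_function_dense:
  assumes w: "memL2 (\<lambda>x. complex_of_real (w x))"
    and g: "\<And>i. memL2 (\<lambda>x. complex_of_real (g i x))"
    and wg: "\<And>i. has_weak_partial i (\<lambda>x. complex_of_real (w x)) (\<lambda>x. complex_of_real (g i x))"
  shows "\<exists>\<phi>. (\<forall>n. test_function (\<phi> n)) \<and> L2_tendsto (\<lambda>n x. complex_of_real (\<phi> n x)) (\<lambda>x. complex_of_real (w x))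
    \<and> (\<forall>i. L2_tendsto (\<lambda>n x. complex_of_real (partial_deriv i (\<phi> n) x)) (\<lambda>x. complex_of_real (g i x)))"
proof -
  obtain \<eta> where \<eta>: "test_function \<eta>" "\<And>x. 0 \<le> \<eta> x" "(\<integral>x. \<eta> x \<partial>lborel) = 1"
    using standard_mollifier by blast
  define e where "e n = 1 / real (Suc n)" for n
  have e: "e n > 0" "e \<longlonglongrightarrow> 0" for n
    unfolding e_def using lim_1_over_n[THEN LIMSEQ_Suc] by auto
  define \<rho> where "\<rho> n z = (1 / e n ^ 3) * \<eta> ((1 / e n) *\<^sub>R z)" for n z
  have \<rho>: "test_function (\<rho> n)" for n
  proof -
    have "test_function (\<lambda>z. (1 / e n ^ 3) * \<eta> (0 + (1 / e n) *\<^sub>R z))"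
      by (intro test_function_cmult test_function_affine \<eta>(1)) (use e(1)[of n] in simp)
    moreover have "\<rho> n = (\<lambda>z. (1 / e n ^ 3) * \<eta> (0 + (1 / e n) *\<^sub>R z))"
      unfolding \<rho>_def by (simp only: add_0_left)
    ultimately show ?thesis by (simp only:)
  qed
  have moll: "L2_tendsto (\<lambda>n x. complex_of_real (conv (\<rho> n) u x)) (\<lambda>x. complex_of_real (u x))"
    if u: "memL2 (\<lambda>x. complex_of_real (u x))" for u
  proof -
    have "mollify \<eta> (e n) (\<lambda>x. complex_of_real (u x)) = (\<lambda>x. complex_of_real (conv (\<rho> n) u x))" for n
      unfolding \<rho>_def by (rule ext) (rule mollify_conv[OF e(1)])
    then show ?thesis
      using mollify_L2_tendsto[OF test_function_integrable[OF \<eta>(1)] \<eta>(2,3) u e(2)] by simp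
  qed
  \<comment> \<open>The value 1 at the origin suffices: by continuity
    \<open>cut (e n *\<^sub>R x)\<close> then tends to 1 at every x.\<close>
  define cut where "cut x = (1 / bump (-1) 1 1 (0::real^3)) * bump (-1) 1 1 x" for x :: "real^3"
  have cut: "test_function cut" "cut 0 = 1"
  proof -
    have "cut = (\<lambda>x. (1 / bump (-1) 1 1 (0::real^3)) * bump (-1) 1 1 x)" by (rule ext) (rule cut_def)
    then show "test_function cut" by (simp only: test_function_cmult[OF bump_unit(1)])
    show "cut 0 = 1" using bump_unit(2) by (simp add: cut_def)
  qed
  define c where "c n x = cut (0 + e n *\<^sub>R x)" for n x
  have c: "test_function (c n)" for n unfolding c_def by (rule test_function_affine[OF cut(1)]) (use e(1)[of n] in simp)
  have dc: "partial_deriv i (c n) x = e n * partial_deriv i cut (e n *\<^sub>R x)" for i n x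
    using partial_deriv_affine(1)[OF test_function_smooth[OF cut(1)], of i 1 0 "e n"] unfolding c_def by (simp add: fun_eq_iff)
  have bdd: "\<exists>M. \<forall>x. \<bar>f x\<bar> \<le> M" if f: "test_function f" for f
  proof -
    obtain M R where "M \<ge> 0" "\<And>x. \<bar>f x\<bar> \<le> M * indicator (cball 0 R) x" using test_function_bounded[OF f] by blast
    moreover have "M * indicator (cball 0 R) x \<le> M" for x :: "real^3" using \<open>M \<ge> 0\<close> by (simp add: indicator_def)
    ultimately show ?thesis by (intro exI[of _ M] allI) (rule order_trans)
  qed
  obtain M where M: "\<And>x. \<bar>cut x\<bar> \<le> M" using bdd[OF cut(1)] by blast
  define \<phi> where "\<phi> n x = c n x * conv (\<rho> n) w x" for n x
  note wl = memL2_locally_integrable[OF w]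
  have sm: "smooth (conv (\<rho> n) w)" for n by (rule smooth_conv[OF \<rho> wl])
  have \<phi>: "test_function (\<phi> n)" for n unfolding \<phi>_def by (rule test_function_mult[OF c sm])
  have c_lim: "(\<lambda>n. c n x) \<longlonglongrightarrow> 1" for x
  proof -
    have "(\<lambda>n. e n *\<^sub>R x) \<longlonglongrightarrow> 0 *\<^sub>R x" by (intro tendsto_intros e(2))
    from continuous_on_tendsto_compose[OF smooth_continuous[OF test_function_smooth[OF cut(1)]] this]
    show ?thesis unfolding c_def using cut(2) by simp
  qed
  have 1: "L2_tendsto (\<lambda>n x. complex_of_real (c n x) * complex_of_real (conv (\<rho> n) u x)) (\<lambda>x. complex_of_real 1 * complex_of_real (u x))"
    if u: "memL2 (\<lambda>x. complex_of_real (u x))" for u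
    by (rule L2_tendsto_mult_bounded[where C=M, OF moll[OF u] test_function_measurable[OF c] _ c_lim])
       (unfold c_def, rule M)
  have dphi: "partial_deriv i (\<phi> n) x = c n x * conv (\<rho> n) (g i) x + partial_deriv i (c n) x * conv (\<rho> n) w x" for i n x
    unfolding \<phi>_def
    by (subst partial_deriv_mult[OF smooth_differentiable[OF test_function_smooth[OF c]] smooth_differentiable[OF sm]])
       (simp only: partial_deriv_conv[OF \<rho> wl] conv_partial_deriv_weak[OF \<rho> wg])
  have 2: "L2_tendsto (\<lambda>n x. complex_of_real (partial_deriv i (c n) x) * complex_of_real (conv (\<rho> n) w x)) (\<lambda>x. complex_of_real 0 * complex_of_real (w x))" for i
  proof -
    obtain K where K: "\<And>x. \<bar>partial_deriv i cut x\<bar> \<le> K"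
      using bdd[OF test_function_partial_deriv[OF cut(1)]] by blast
    have K0: "0 \<le> K" using order_trans[OF abs_ge_zero K] .
    have bd: "\<bar>partial_deriv i (c n) x\<bar> \<le> e n * K" for n x
      unfolding dc abs_mult using K e(1)[of n] by (simp add: mult_left_mono)
    show ?thesis
    proof (rule L2_tendsto_mult_bounded[where C=K, OF moll[OF w] test_function_measurable[OF test_function_partial_deriv[OF c]]])
      show "\<bar>partial_deriv i (c n) x\<bar> \<le> K" for n x
      proof -
        have "e n * K \<le> 1 * K" by (rule mult_right_mono[OF _ K0]) (simp add: e_def)
        then show ?thesis using bd[of n x] by simp
      qed
      show "(\<lambda>n. partial_deriv i (c n) x) \<longlonglongrightarrow> 0" for x
      proof (rule Lim_null_comparison[OF always_eventually[OF allI]])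
        show "norm (partial_deriv i (c n) x) \<le> e n * K" for n using bd by simp
        show "(\<lambda>n. e n * K) \<longlonglongrightarrow> 0" using tendsto_mult_right[OF e(2), of K] by simp
      qed
    qed
  qed
  have "L2_tendsto (\<lambda>n x. complex_of_real (\<phi> n x)) (\<lambda>x. complex_of_real (w x))"
    using 1[OF w] by (simp add: \<phi>_def)
  moreover have "L2_tendsto (\<lambda>n x. complex_of_real (partial_deriv i (\<phi> n) x)) (\<lambda>x. complex_of_real (g i x))" for i
    using L2_tendsto_add[OF 1[OF g[of i]] 2[of i]] by (simp add: dphi)
  ultimately show ?thesis using \<phi> by blast
qed

section \<open>The Ladyzhenskaya inequality\<close>

lemma test_function_line_deriv:
  assumes "test_function \<phi>"
  shows "((\<lambda>s. \<phi> (p + s *\<^sub>R axis i 1)) has_real_derivative partial_deriv i \<phi> (p + s *\<^sub>R axis i 1)) (at s)"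
proof -
  have "((\<lambda>s. p + s *\<^sub>R axis i 1) has_derivative (\<lambda>h. h *\<^sub>R axis i 1)) (at s)"
    by (auto intro!: derivative_eq_intros)
  from has_derivative_compose[OF this smooth_has_derivative[OF test_function_smooth[OF assms]]]
  have "((\<lambda>s. \<phi> (p + s *\<^sub>R axis i 1)) has_derivative
      (\<lambda>h. \<Sum>j\<in>UNIV. (h *\<^sub>R axis i 1) $ j * partial_deriv j \<phi> (p + s *\<^sub>R axis i 1))) (at s)" .
  moreover have "(\<lambda>h. \<Sum>j\<in>UNIV. (h *\<^sub>R axis i 1) $ j * partial_deriv j \<phi> (p + s *\<^sub>R axis i 1))
      = (*) (partial_deriv i \<phi> (p + s *\<^sub>R axis i 1))"
  proof
    fix h :: real
    have "(\<Sum>j\<in>UNIV. (h *\<^sub>R axis i 1) $ j * partial_deriv j \<phi> (p + s *\<^sub>R axis i 1))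
        = h * (\<Sum>j\<in>UNIV. axis i 1 $ j * partial_deriv j \<phi> (p + s *\<^sub>R axis i 1))"
      by (simp add: sum_distrib_left mult.assoc)
    then show "(\<Sum>j\<in>UNIV. (h *\<^sub>R axis i 1) $ j * partial_deriv j \<phi> (p + s *\<^sub>R axis i 1))
        = partial_deriv i \<phi> (p + s *\<^sub>R axis i 1) * h"
      by (simp only: sum_axis_mult mult.commute)
  qed
  ultimately show ?thesis unfolding has_field_derivative_def by simp
qed

text \<open>The fundamental theorem of calculus for \<phi>^2 on the line through p in direction i,
  started at a point outside the support.\<close>

lemma test_function_line_bound:
  assumes \<phi>: "test_function \<phi>"
  shows "ennreal ((\<phi> (p + s *\<^sub>R axis i 1))\<^sup>2)
    \<le> (\<integral>\<^sup>+t. ennreal (2 * \<bar>\<phi> (p + t *\<^sub>R axis i 1)\<bar> * \<bar>partial_deriv i \<phi> (p + t *\<^sub>R axis i 1)\<bar>) \<partial>lborel)"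
proof -
  obtain M R where R: "R > 0" "\<And>x. \<bar>\<phi> x\<bar> \<le> M * indicator (cball 0 R) x"
    using test_function_bounded[OF \<phi>] by blast
  \<comment> \<open>At parameter a the line is outside the ball of radius R, because |a| > |p| +
    R.\<close>
  define a where "a = min s (- (norm p + R + 1))"
  have a: "a \<le> s" "\<bar>a\<bar> > norm p + R" unfolding a_def using R(1) norm_ge_zero[of p] by linarith+
  have "norm (a *\<^sub>R axis i 1 :: real^3) \<le> norm (p + a *\<^sub>R axis i 1) + norm p"
    using norm_triangle_ineq4[of "p + a *\<^sub>R axis i 1" p] by simp
  then have "norm (p + a *\<^sub>R axis i 1) > R" using a(2) by simp
  then have \<phi>a: "\<phi> (p + a *\<^sub>R axis i 1) = 0" using R(2)[of "p + a *\<^sub>R axis i 1"] by simp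
  let ?f = "\<lambda>t. \<phi> (p + t *\<^sub>R axis i 1)" and ?g = "\<lambda>t. partial_deriv i \<phi> (p + t *\<^sub>R axis i 1)"
  have line: "continuous_on UNIV (\<lambda>t. p + t *\<^sub>R axis i 1)" by (intro continuous_intros)
  have cf: "continuous_on UNIV ?f"
    by (rule continuous_on_compose2[OF smooth_continuous[OF test_function_smooth[OF \<phi>]] line subset_UNIV])
  have cg: "continuous_on UNIV ?g"
    by (rule continuous_on_compose2[OF smooth_continuous[OF test_function_smooth[OF test_function_partial_deriv[OF \<phi>]]] line subset_UNIV])
  have d: "((\<lambda>t. (?f t)\<^sup>2) has_real_derivative 2 * ?f t * ?g t) (at t)" for t
    by (auto intro!: derivative_eq_intros test_function_line_deriv[OF \<phi>])
  have cd: "continuous_on UNIV (\<lambda>t. 2 * ?f t * ?g t)" by (intro continuous_intros cf cg)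
  let ?k = "\<lambda>t. indicator {a..s} t *\<^sub>R (2 * ?f t * ?g t)"
  have FTC: "(\<integral>t. ?k t \<partial>lborel) = (?f s)\<^sup>2 - (?f a)\<^sup>2"
    by (rule integral_FTC_atLeastAtMost[OF a(1)])
       (use d cd in \<open>auto simp: has_real_derivative_iff_has_vector_derivative[symmetric] intro: has_field_derivative_at_within continuous_on_subset\<close>)
  have "ennreal ((?f s)\<^sup>2) = ennreal (norm (\<integral>t. ?k t \<partial>lborel))"
    unfolding FTC \<phi>a by simp
  also have "\<dots> \<le> (\<integral>\<^sup>+t. ennreal (norm (?k t)) \<partial>lborel)"
  proof (rule integral_norm_bound_ennreal)
    show "integrable lborel ?k"
      by (rule borel_integrable_compact) (auto intro: continuous_on_subset[OF cd])
  qed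
  also have "\<dots> \<le> (\<integral>\<^sup>+t. ennreal (2 * \<bar>?f t\<bar> * \<bar>?g t\<bar>) \<partial>lborel)"
    by (intro nn_integral_mono ennreal_leI) (auto simp: indicator_def abs_mult)
  finally show ?thesis .
qed

lemma Cauchy_Schwarz_nn_integral_iterated:
  fixes F G :: "real \<Rightarrow> real \<Rightarrow> ennreal"
  assumes [measurable]: "case_prod F \<in> borel_measurable (lborel \<Otimes>\<^sub>M lborel)"
    "case_prod G \<in> borel_measurable (lborel \<Otimes>\<^sub>M lborel)"
  shows "(\<integral>\<^sup>+y. \<integral>\<^sup>+z. F y z * G y z \<partial>lborel \<partial>lborel)\<^sup>2
    \<le> (\<integral>\<^sup>+y. \<integral>\<^sup>+z. (F y z)\<^sup>2 \<partial>lborel \<partial>lborel) * (\<integral>\<^sup>+y. \<integral>\<^sup>+z. (G y z)\<^sup>2 \<partial>lborel \<partial>lborel)"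
proof -
  have it: "(\<integral>\<^sup>+y. \<integral>\<^sup>+z. H y z \<partial>lborel \<partial>lborel) = (\<integral>\<^sup>+p. case_prod H p \<partial>(lborel \<Otimes>\<^sub>M lborel))"
    if "case_prod H \<in> borel_measurable (lborel \<Otimes>\<^sub>M lborel)" for H :: "real \<Rightarrow> real \<Rightarrow> ennreal"
    using lborel.nn_integral_fst[OF that] by simp
  have "(\<integral>\<^sup>+p. case_prod F p * case_prod G p \<partial>(lborel \<Otimes>\<^sub>M lborel))\<^sup>2
     \<le> (\<integral>\<^sup>+p. (case_prod F p)\<^sup>2 \<partial>(lborel \<Otimes>\<^sub>M lborel)) * (\<integral>\<^sup>+p. (case_prod G p)\<^sup>2 \<partial>(lborel \<Otimes>\<^sub>M lborel))"
    by (rule Cauchy_Schwarz_nn_integral) measurable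
  then show ?thesis
    by (subst (1 2 3) it) (simp_all add: case_prod_beta')
qed

text \<open>In \<phi>^4 = \<phi>^2 \<phi>^2 one factor is bounded by its line integral in the third
  direction, the other by that in the second. On the slice with first coordinate x the double
  integral of the bound then factorizes as \<open>Q 3 x * Q 2 x\<close>. Cauchy-Schwarz bounds each
  \<open>Q i x\<close> through the slice mass \<open>m x\<close>, and the first direction bounds
  \<open>m x\<close>. A last Cauchy-Schwarz in x gives 16 I^2, and the bound of I^2 another factor
  4, hence 64.\<close>

lemma Ladyzhenskaya_nn_integral:
  assumes \<phi>: "test_function \<phi>"
  shows "(\<integral>\<^sup>+v. ennreal (\<phi> v ^ 4) \<partial>lborel)\<^sup>2
    \<le> 64 * (\<integral>\<^sup>+v. ennreal ((\<phi> v)\<^sup>2) \<partial>lborel) * (\<integral>\<^sup>+v. ennreal ((partial_deriv 1 \<phi> v)\<^sup>2) \<partial>lborel)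
      * (\<integral>\<^sup>+v. ennreal ((partial_deriv 2 \<phi> v)\<^sup>2) \<partial>lborel) * (\<integral>\<^sup>+v. ennreal ((partial_deriv 3 \<phi> v)\<^sup>2) \<partial>lborel)"
proof -
  note [measurable] = test_function_measurable[OF \<phi>] test_function_measurable[OF test_function_partial_deriv[OF \<phi>]]
  define F where "F v = ennreal (2 * \<bar>\<phi> v\<bar>)" for v
  define G where "G i v = ennreal \<bar>partial_deriv i \<phi> v\<bar>" for i v
  define P where "P i v = F v * G i v" for i v
  define U where "U v = ennreal ((\<phi> v)\<^sup>2)" for v
  have [measurable]: "F \<in> borel_measurable borel" "G i \<in> borel_measurable borel"
    "P i \<in> borel_measurable borel" "U \<in> borel_measurable borel" for i
    unfolding F_def G_def P_def U_def by measurable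
  have F2: "(F v)\<^sup>2 = 4 * U v" for v
    by (simp add: F_def U_def ennreal_power power_mult_distrib ennreal_mult)
  have G2: "(G i v)\<^sup>2 = ennreal ((partial_deriv i \<phi> v)\<^sup>2)" for i v
    by (simp add: G_def ennreal_power)
  have line: "U (p + s *\<^sub>R axis i 1) \<le> (\<integral>\<^sup>+t. P i (p + t *\<^sub>R axis i 1) \<partial>lborel)" for p s i
    using test_function_line_bound[OF \<phi>, of p s i] by (simp add: U_def P_def F_def G_def ennreal_mult)
  have c1: "coords3 (x, y, z) = coords3 (0, y, z) + x *\<^sub>R axis 1 1"
    and c2: "coords3 (x, y, z) = coords3 (x, 0, z) + y *\<^sub>R axis 2 1"
    and c3: "coords3 (x, y, z) = coords3 (x, y, 0) + z *\<^sub>R axis 3 1" for x y z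
    by (simp_all add: vec_eq_iff forall_3 axis_def)
  have l1: "U (coords3 (x, y, z)) \<le> (\<integral>\<^sup>+t. P 1 (coords3 (t, y, z)) \<partial>lborel)" for x y z
    using line[of "coords3 (0, y, z)" x 1] unfolding c1[symmetric] .
  have l2: "U (coords3 (x, y, z)) \<le> (\<integral>\<^sup>+t. P 2 (coords3 (x, t, z)) \<partial>lborel)" for x y z
    using line[of "coords3 (x, 0, z)" y 2] unfolding c2[symmetric] .
  have l3: "U (coords3 (x, y, z)) \<le> (\<integral>\<^sup>+t. P 3 (coords3 (x, y, t)) \<partial>lborel)" for x y z
    using line[of "coords3 (x, y, 0)" z 3] unfolding c3[symmetric] .
  define m where "m x = (\<integral>\<^sup>+y. \<integral>\<^sup>+z. U (coords3 (x, y, z)) \<partial>lborel \<partial>lborel)" for x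
  define a where "a i x = (\<integral>\<^sup>+y. \<integral>\<^sup>+z. (G i (coords3 (x, y, z)))\<^sup>2 \<partial>lborel \<partial>lborel)" for i x
  define Q where "Q i x = (\<integral>\<^sup>+y. \<integral>\<^sup>+z. P i (coords3 (x, y, z)) \<partial>lborel \<partial>lborel)" for i x
  define I where "I = (\<integral>\<^sup>+v. P 1 v \<partial>lborel)"
  have [measurable]: "m \<in> borel_measurable borel" "a i \<in> borel_measurable borel" "Q i \<in> borel_measurable borel" for i
    unfolding m_def a_def Q_def by measurable
  have aG: "(\<integral>\<^sup>+x. a i x \<partial>lborel) = (\<integral>\<^sup>+v. (G i v)\<^sup>2 \<partial>lborel)" for i
    unfolding a_def by (rule nn_integral_coords3[symmetric]) measurable
  \<comment> \<open>The line integral in the first direction does not depend on x, so the bound of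
    the slice mass is uniform in x.\<close>
  have m_le: "m x \<le> I" for x
  proof -
    have "m x \<le> (\<integral>\<^sup>+y. \<integral>\<^sup>+z. \<integral>\<^sup>+t. P 1 (coords3 (t, y, z)) \<partial>lborel \<partial>lborel \<partial>lborel)"
      unfolding m_def by (intro nn_integral_mono l1)
    also have "\<dots> = (\<integral>\<^sup>+y. \<integral>\<^sup>+t. \<integral>\<^sup>+z. P 1 (coords3 (t, y, z)) \<partial>lborel \<partial>lborel \<partial>lborel)"
      by (intro nn_integral_cong lborel_pair.Fubini') measurable
    also have "\<dots> = (\<integral>\<^sup>+t. \<integral>\<^sup>+y. \<integral>\<^sup>+z. P 1 (coords3 (t, y, z)) \<partial>lborel \<partial>lborel \<partial>lborel)"
      by (rule lborel_pair.Fubini') measurable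
    also have "\<dots> = I" unfolding I_def by (rule nn_integral_coords3[symmetric]) measurable
    finally show ?thesis .
  qed
  have Q_le: "(Q i x)\<^sup>2 \<le> 4 * I * a i x" for i x
  proof -
    have "(Q i x)\<^sup>2 \<le> (\<integral>\<^sup>+y. \<integral>\<^sup>+z. (F (coords3 (x, y, z)))\<^sup>2 \<partial>lborel \<partial>lborel) * a i x"
      unfolding Q_def P_def a_def by (rule Cauchy_Schwarz_nn_integral_iterated) measurable
    also have "(\<integral>\<^sup>+y. \<integral>\<^sup>+z. (F (coords3 (x, y, z)))\<^sup>2 \<partial>lborel \<partial>lborel) = 4 * m x"
      unfolding F2 m_def by (simp add: nn_integral_cmult)
    also have "4 * m x * a i x \<le> 4 * I * a i x" by (intro mult_right_mono mult_left_mono m_le) auto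
    finally show ?thesis .
  qed
  have "(\<integral>\<^sup>+v. ennreal (\<phi> v ^ 4) \<partial>lborel) = (\<integral>\<^sup>+v. U v * U v \<partial>lborel)"
    by (intro nn_integral_cong) (simp add: U_def ennreal_mult[symmetric] power4_eq_xxxx power2_eq_square mult.assoc)
  also have "\<dots> = (\<integral>\<^sup>+x. \<integral>\<^sup>+y. \<integral>\<^sup>+z. U (coords3 (x, y, z)) * U (coords3 (x, y, z)) \<partial>lborel \<partial>lborel \<partial>lborel)"
    by (rule nn_integral_coords3) measurable
  also have "\<dots> \<le> (\<integral>\<^sup>+x. \<integral>\<^sup>+y. \<integral>\<^sup>+z. (\<integral>\<^sup>+t. P 3 (coords3 (x, y, t)) \<partial>lborel) * (\<integral>\<^sup>+t. P 2 (coords3 (x, t, z)) \<partial>lborel) \<partial>lborel \<partial>lborel \<partial>lborel)"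
    by (intro nn_integral_mono mult_mono l2 l3) auto
  also have "\<dots> = (\<integral>\<^sup>+x. Q 3 x * Q 2 x \<partial>lborel)"
  proof (rule nn_integral_cong)
    fix x
    have "(\<integral>\<^sup>+y. \<integral>\<^sup>+z. (\<integral>\<^sup>+t. P 3 (coords3 (x, y, t)) \<partial>lborel) * (\<integral>\<^sup>+t. P 2 (coords3 (x, t, z)) \<partial>lborel) \<partial>lborel \<partial>lborel)
      = (\<integral>\<^sup>+y. (\<integral>\<^sup>+t. P 3 (coords3 (x, y, t)) \<partial>lborel) * (\<integral>\<^sup>+z. \<integral>\<^sup>+t. P 2 (coords3 (x, t, z)) \<partial>lborel \<partial>lborel) \<partial>lborel)"
      by (intro nn_integral_cong nn_integral_cmult) measurable
    also have "\<dots> = Q 3 x * (\<integral>\<^sup>+z. \<integral>\<^sup>+t. P 2 (coords3 (x, t, z)) \<partial>lborel \<partial>lborel)"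
      unfolding Q_def by (rule nn_integral_multc) measurable
    also have "(\<integral>\<^sup>+z. \<integral>\<^sup>+t. P 2 (coords3 (x, t, z)) \<partial>lborel \<partial>lborel) = Q 2 x"
      unfolding Q_def by (rule lborel_pair.Fubini') measurable
    finally show "(\<integral>\<^sup>+y. \<integral>\<^sup>+z. (\<integral>\<^sup>+t. P 3 (coords3 (x, y, t)) \<partial>lborel) * (\<integral>\<^sup>+t. P 2 (coords3 (x, t, z)) \<partial>lborel) \<partial>lborel \<partial>lborel)
      = Q 3 x * Q 2 x" .
  qed
  finally have "(\<integral>\<^sup>+v. ennreal (\<phi> v ^ 4) \<partial>lborel)\<^sup>2 \<le> (\<integral>\<^sup>+x. Q 3 x * Q 2 x \<partial>lborel)\<^sup>2"
    by (rule power_mono) simp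
  also have "\<dots> \<le> (\<integral>\<^sup>+x. (Q 3 x)\<^sup>2 \<partial>lborel) * (\<integral>\<^sup>+x. (Q 2 x)\<^sup>2 \<partial>lborel)"
    by (rule Cauchy_Schwarz_nn_integral) measurable
  also have "\<dots> \<le> (\<integral>\<^sup>+x. 4 * I * a 3 x \<partial>lborel) * (\<integral>\<^sup>+x. 4 * I * a 2 x \<partial>lborel)"
    by (intro mult_mono nn_integral_mono Q_le) auto
  also have "\<dots> = 16 * I\<^sup>2 * (\<integral>\<^sup>+v. (G 2 v)\<^sup>2 \<partial>lborel) * (\<integral>\<^sup>+v. (G 3 v)\<^sup>2 \<partial>lborel)"
    unfolding aG[symmetric] by (simp add: nn_integral_cmult power2_eq_square mult_ac)
  also have "\<dots> \<le> 16 * (4 * (\<integral>\<^sup>+v. U v \<partial>lborel) * (\<integral>\<^sup>+v. (G 1 v)\<^sup>2 \<partial>lborel)) * (\<integral>\<^sup>+v. (G 2 v)\<^sup>2 \<partial>lborel) * (\<integral>\<^sup>+v. (G 3 v)\<^sup>2 \<partial>lborel)"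
  proof (intro mult_right_mono mult_left_mono)
    have "I\<^sup>2 \<le> (\<integral>\<^sup>+v. (F v)\<^sup>2 \<partial>lborel) * (\<integral>\<^sup>+v. (G 1 v)\<^sup>2 \<partial>lborel)"
      unfolding I_def P_def by (rule Cauchy_Schwarz_nn_integral) measurable
    then show "I\<^sup>2 \<le> 4 * (\<integral>\<^sup>+v. U v \<partial>lborel) * (\<integral>\<^sup>+v. (G 1 v)\<^sup>2 \<partial>lborel)"
      unfolding F2 by (simp add: nn_integral_cmult)
  qed auto
  also have "\<dots> = 64 * (\<integral>\<^sup>+v. U v \<partial>lborel) * (\<integral>\<^sup>+v. (G 1 v)\<^sup>2 \<partial>lborel) * (\<integral>\<^sup>+v. (G 2 v)\<^sup>2 \<partial>lborel) * (\<integral>\<^sup>+v. (G 3 v)\<^sup>2 \<partial>lborel)"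
    by (simp add: mult.assoc[symmetric])
  finally show ?thesis unfolding G2 U_def .
qed

theorem Ladyzhenskaya_test_function:
  assumes \<phi>: "test_function \<phi>"
  shows "(\<integral>\<^sup>+v. ennreal (\<phi> v ^ 4) \<partial>lborel) \<le> ennreal (8 * Lp_norm 2 (\<lambda>x. complex_of_real (\<phi> x))
    * Lp_norm 2 (\<lambda>x. complex_of_real (partial_deriv 1 \<phi> x))
    * Lp_norm 2 (\<lambda>x. complex_of_real (partial_deriv 2 \<phi> x))
    * Lp_norm 2 (\<lambda>x. complex_of_real (partial_deriv 3 \<phi> x)))" (is "_ \<le> ennreal ?B")
proof -
  have "test_function (\<lambda>x. \<phi> x * (\<phi> x * (\<phi> x * \<phi> x)))"
    by (intro test_function_mult[OF \<phi>] smooth_mult test_function_smooth[OF \<phi>])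
  then have int: "integrable lborel (\<lambda>x. \<phi> x ^ 4)"
    using test_function_integrable by (simp add: power4_eq_xxxx mult.assoc)
  have nn: "(\<integral>\<^sup>+v. ennreal (\<phi> v ^ 4) \<partial>lborel) = ennreal (\<integral>v. \<phi> v ^ 4 \<partial>lborel)"
    by (rule nn_integral_eq_integral[OF int]) simp
  have L: "(\<integral>\<^sup>+v. ennreal ((\<psi> v)\<^sup>2) \<partial>lborel) = ennreal ((Lp_norm 2 (\<lambda>x. complex_of_real (\<psi> x)))\<^sup>2)"
    if "test_function \<psi>" for \<psi>
    using nn_integral_cmod_square[OF test_function_memL2[OF that]] by simp
  note d = test_function_partial_deriv[OF \<phi>]
  have "ennreal ((\<integral>v. \<phi> v ^ 4 \<partial>lborel)\<^sup>2) \<le> ennreal (?B\<^sup>2)"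
    using Ladyzhenskaya_nn_integral[OF \<phi>] unfolding nn L[OF \<phi>] L[OF d]
    by (simp add: ennreal_power power_mult_distrib ennreal_mult)
  then have "(\<integral>v. \<phi> v ^ 4 \<partial>lborel)\<^sup>2 \<le> ?B\<^sup>2" by simp
  then have "(\<integral>v. \<phi> v ^ 4 \<partial>lborel) \<le> ?B" by (rule power2_le_imp_le) simp
  then show ?thesis unfolding nn by (rule ennreal_leI)
qed

lemma L2_tendsto_AE_subseq:
  assumes F: "L2_tendsto F f"
  obtains r :: "nat \<Rightarrow> nat" where "strict_mono r" "AE x in lborel. (\<lambda>n. F (r n) x) \<longlonglongrightarrow> f x"
proof -
  have m: "memL2 (F n)" "memL2 f" for n using F by (simp_all add: L2_tendsto_def)
  have "\<exists>r :: nat \<Rightarrow> nat. strict_mono r \<and> (AE x in lborel. (\<lambda>n. (cmod (F (r n) x - f x))\<^sup>2) \<longlonglongrightarrow> 0)"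
  proof (rule tendsto_L1_AE_subseq)
    show "integrable lborel (\<lambda>x. (cmod (F n x - f x))\<^sup>2)" for n by (rule memL2_integrable[OF memL2_diff[OF m]])
    have "(\<lambda>n. (Lp_norm 2 (\<lambda>x. F n x - f x))\<^sup>2) \<longlonglongrightarrow> 0\<^sup>2"
      using F unfolding L2_tendsto_def by (intro tendsto_power) simp
    then show "(\<lambda>n. \<integral>x. norm ((cmod (F n x - f x))\<^sup>2) \<partial>lborel) \<longlonglongrightarrow> 0"
      by (simp add: Lp_norm_2_square)
  qed
  then obtain r :: "nat \<Rightarrow> nat" where r: "strict_mono r" "AE x in lborel. (\<lambda>n. (cmod (F (r n) x - f x))\<^sup>2) \<longlonglongrightarrow> 0"
    by blast
  from r(2) have "AE x in lborel. (\<lambda>n. F (r n) x) \<longlonglongrightarrow> f x"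
  proof eventually_elim
    case (elim x)
    from tendsto_real_sqrt[OF elim] have "(\<lambda>n. cmod (F (r n) x - f x)) \<longlonglongrightarrow> 0" by simp
    then show ?case by (rule LIM_zero_cancel[OF tendsto_norm_zero_cancel])
  qed
  then show thesis by (rule that[OF r(1)])
qed

text \<open>The right hand side passes to the limit under the approximation of
  \<open>test_function_dense\<close>; the left hand side is lower semicontinuous by Fatou's lemma
  along an almost everywhere convergent subsequence.\<close>

theorem Ladyzhenskaya_real:
  assumes w: "memL2 (\<lambda>x. complex_of_real (w x))"
    and g: "\<And>i. memL2 (\<lambda>x. complex_of_real (g i x))"
    and wg: "\<And>i. has_weak_partial i (\<lambda>x. complex_of_real (w x)) (\<lambda>x. complex_of_real (g i x))"
  shows "(\<integral>\<^sup>+v. ennreal (w v ^ 4) \<partial>lborel) \<le> ennreal (8 * Lp_norm 2 (\<lambda>x. complex_of_real (w x))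
    * Lp_norm 2 (\<lambda>x. complex_of_real (g 1 x)) * Lp_norm 2 (\<lambda>x. complex_of_real (g 2 x))
    * Lp_norm 2 (\<lambda>x. complex_of_real (g 3 x)))" (is "_ \<le> ennreal ?B")
proof -
  obtain \<phi> where \<phi>: "\<And>n. test_function (\<phi> n)"
    "L2_tendsto (\<lambda>n x. complex_of_real (\<phi> n x)) (\<lambda>x. complex_of_real (w x))"
    "\<And>i. L2_tendsto (\<lambda>n x. complex_of_real (partial_deriv i (\<phi> n) x)) (\<lambda>x. complex_of_real (g i x))"
    using test_function_dense[OF w g wg] by blast
  obtain r :: "nat \<Rightarrow> nat" where r: "strict_mono r" "AE x in lborel. (\<lambda>n. complex_of_real (\<phi> (r n) x)) \<longlonglongrightarrow> complex_of_real (w x)"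
    using L2_tendsto_AE_subseq[OF \<phi>(2)] by blast
  note [measurable] = test_function_measurable[OF \<phi>(1)]
  let ?b = "\<lambda>n. 8 * Lp_norm 2 (\<lambda>x. complex_of_real (\<phi> n x))
    * Lp_norm 2 (\<lambda>x. complex_of_real (partial_deriv 1 (\<phi> n) x))
    * Lp_norm 2 (\<lambda>x. complex_of_real (partial_deriv 2 (\<phi> n) x))
    * Lp_norm 2 (\<lambda>x. complex_of_real (partial_deriv 3 (\<phi> n) x))"
  have "?b \<longlonglongrightarrow> ?B"
    by (intro tendsto_mult tendsto_const L2_tendsto_Lp_norm \<phi>(2,3))
  from LIMSEQ_subseq_LIMSEQ[OF this r(1)] have "(\<lambda>n. ?b (r n)) \<longlonglongrightarrow> ?B" by (simp add: o_def)
  then have lim: "(\<lambda>n. ennreal (?b (r n))) \<longlonglongrightarrow> ennreal ?B" by (rule tendsto_ennrealI)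
  have "(\<integral>\<^sup>+v. ennreal (w v ^ 4) \<partial>lborel) = (\<integral>\<^sup>+v. liminf (\<lambda>n. ennreal (\<phi> (r n) v ^ 4)) \<partial>lborel)"
  proof (rule nn_integral_cong_AE)
    show "AE v in lborel. ennreal (w v ^ 4) = liminf (\<lambda>n. ennreal (\<phi> (r n) v ^ 4))"
      using r(2)
    proof eventually_elim
      case (elim v)
      then have "(\<lambda>n. \<phi> (r n) v) \<longlonglongrightarrow> w v" by (simp only: tendsto_of_real_iff)
      then have "(\<lambda>n. ennreal (\<phi> (r n) v ^ 4)) \<longlonglongrightarrow> ennreal (w v ^ 4)"
        by (intro tendsto_ennrealI tendsto_power)
      then show ?case by (rule lim_imp_Liminf[OF sequentially_bot, symmetric])
    qed
  qed
  also have "\<dots> \<le> liminf (\<lambda>n. \<integral>\<^sup>+v. ennreal (\<phi> (r n) v ^ 4) \<partial>lborel)"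
    by (rule nn_integral_liminf) measurable
  also have "\<dots> \<le> liminf (\<lambda>n. ennreal (?b (r n)))"
    by (intro Liminf_mono always_eventually allI Ladyzhenskaya_test_function \<phi>(1))
  also have "\<dots> = ennreal ?B" by (rule lim_imp_Liminf[OF sequentially_bot lim])
  finally show ?thesis .
qed

text \<open>Each of the three directional norms is at most the full gradient norm, which yields the
  cube.\<close>

lemma H1_Re_L4:
  assumes u: "u \<in> H1"
  shows "(\<integral>\<^sup>+x. ennreal (Re (u x) ^ 4) \<partial>lborel) \<le> ennreal (8 * Lp_norm 2 u * grad_norm u ^ 3)"
proof -
  have Re: "memL2 (\<lambda>x. complex_of_real (Re (f x))) \<and> Lp_norm 2 (\<lambda>x. complex_of_real (Re (f x))) \<le> Lp_norm 2 f"
    if f: "memL2 f" for f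
  proof -
    note [measurable] = memL2_measurable[OF f]
    have m: "memL2 (\<lambda>x. complex_of_real (Re (f x)))"
    proof (rule memL2_bound[OF f, where C=1])
      show "(\<lambda>x. complex_of_real (Re (f x))) \<in> borel_measurable borel" by measurable
      show "AE x in lborel. cmod (complex_of_real (Re (f x))) \<le> 1 * cmod (f x)"
        by (rule AE_I2) (simp add: abs_Re_le_cmod)
    qed
    have "(Lp_norm 2 (\<lambda>x. complex_of_real (Re (f x))))\<^sup>2 \<le> (Lp_norm 2 f)\<^sup>2"
      unfolding Lp_norm_2_square
    proof (rule integral_mono[OF memL2_integrable[OF m] memL2_integrable[OF f]])
      show "(cmod (complex_of_real (Re (f x))))\<^sup>2 \<le> (cmod (f x))\<^sup>2" for x
        by (rule power_mono) (simp_all add: abs_Re_le_cmod)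
    qed
    then show ?thesis using m by (auto intro: power2_le_imp_le)
  qed
  note wp = H1_weak_partial[OF u]
  have le: "Lp_norm 2 (\<lambda>x. complex_of_real (Re (weak_partial i u x))) \<le> grad_norm u" for i
  proof -
    have "Lp_norm 2 (weak_partial i u) \<le> grad_norm u"
      unfolding grad_norm_L2_set by (rule member_le_L2_set) auto
    then show ?thesis using Re[OF wp(2)] order_trans by blast
  qed
  have "(\<integral>\<^sup>+x. ennreal (Re (u x) ^ 4) \<partial>lborel) \<le> ennreal (8 * Lp_norm 2 (\<lambda>x. complex_of_real (Re (u x)))
    * Lp_norm 2 (\<lambda>x. complex_of_real (Re (weak_partial 1 u x))) * Lp_norm 2 (\<lambda>x. complex_of_real (Re (weak_partial 2 u x)))
    * Lp_norm 2 (\<lambda>x. complex_of_real (Re (weak_partial 3 u x))))"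
    by (rule Ladyzhenskaya_real) (use Re H1_memL2[OF u] wp has_weak_partial_Re in blast)+
  also have "\<dots> \<le> ennreal (8 * Lp_norm 2 u * grad_norm u * grad_norm u * grad_norm u)"
    using Re[OF H1_memL2[OF u]] by (intro ennreal_leI mult_mono le mult_nonneg_nonneg) auto
  finally show ?thesis by (simp add: power3_eq_cube mult.assoc)
qed

text \<open>The imaginary part of u is the real part of -i u, so the inequality for real parts
  covers both, and (a + b)^2 <= 2 a^2 + 2 b^2 turns twice the constant 8 for each part into 32. This
  places |u|^2 in L2, where the dipolar convolution acts.\<close>

theorem H1_L4:
  assumes u: "u \<in> H1"
  shows "integrable lborel (\<lambda>x. cmod (u x) ^ 4)"
    and "(\<integral>x. cmod (u x) ^ 4 \<partial>lborel) \<le> 32 * Lp_norm 2 u * grad_norm u ^ 3"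
proof -
  note [measurable] = memL2_measurable[OF H1_memL2[OF u]]
  have gi: "grad_norm (\<lambda>x. - \<i> * u x) = grad_norm u"
    unfolding grad_norm_eq[OF has_weak_partial_cmult[OF H1_weak_partial(1)[OF u]]]
      Lp_norm_2_cmult grad_norm_L2_set by simp
  have im: "(\<integral>\<^sup>+x. ennreal (Im (u x) ^ 4) \<partial>lborel) \<le> ennreal (8 * Lp_norm 2 u * grad_norm u ^ 3)"
    using H1_Re_L4[OF H1_cmult[OF u, of "- \<i>"]] unfolding gi Lp_norm_2_cmult by simp
  have "(\<integral>\<^sup>+x. ennreal (cmod (u x) ^ 4) \<partial>lborel) \<le> (\<integral>\<^sup>+x. ennreal (2 * Re (u x) ^ 4) + ennreal (2 * Im (u x) ^ 4) \<partial>lborel)"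
  proof (rule nn_integral_mono)
    fix x
    have "cmod (u x) ^ 4 = ((Re (u x))\<^sup>2 + (Im (u x))\<^sup>2)\<^sup>2"
      by (simp add: cmod_power2[symmetric] power_mult[symmetric])
    also have "\<dots> \<le> 2 * Re (u x) ^ 4 + 2 * Im (u x) ^ 4"
      using sum_squares_bound[of "(Re (u x))\<^sup>2" "(Im (u x))\<^sup>2"] by (simp add: power2_sum power_mult[symmetric])
    finally show "ennreal (cmod (u x) ^ 4) \<le> ennreal (2 * Re (u x) ^ 4) + ennreal (2 * Im (u x) ^ 4)"
      by (simp flip: ennreal_plus add: ennreal_leI)
  qed
  also have "\<dots> = 2 * (\<integral>\<^sup>+x. ennreal (Re (u x) ^ 4) \<partial>lborel) + 2 * (\<integral>\<^sup>+x. ennreal (Im (u x) ^ 4) \<partial>lborel)"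
    by (simp add: nn_integral_add ennreal_mult nn_integral_cmult)
  also have "\<dots> \<le> 2 * ennreal (8 * Lp_norm 2 u * grad_norm u ^ 3) + 2 * ennreal (8 * Lp_norm 2 u * grad_norm u ^ 3)"
    by (intro add_mono mult_left_mono H1_Re_L4[OF u] im) auto
  also have "\<dots> = ennreal (32 * Lp_norm 2 u * grad_norm u ^ 3)"
    by (simp flip: ennreal_plus ennreal_mult ennreal_numeral)
  finally have le: "(\<integral>\<^sup>+x. ennreal (cmod (u x) ^ 4) \<partial>lborel) \<le> ennreal (32 * Lp_norm 2 u * grad_norm u ^ 3)" .
  show i: "integrable lborel (\<lambda>x. cmod (u x) ^ 4)"
    by (rule integrableI_bounded) (use le_less_trans[OF le ennreal_less_top] in simp_all)
  show "(\<integral>x. cmod (u x) ^ 4 \<partial>lborel) \<le> 32 * Lp_norm 2 u * grad_norm u ^ 3"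
    using le by (subst (asm) nn_integral_eq_integral[OF i]) simp_all
qed

section \<open>The interaction energy\<close>

text \<open>Division by zero gives the symbol the value 0 at the origin; elsewhere the numerator
  lies between -|\<xi>|^2 and 2 |\<xi>|^2.\<close>

lemma dipole_symbol_bound: "\<bar>dipole_symbol \<xi>\<bar> \<le> 8 / 3 * pi"
proof (cases "\<xi> = 0")
  case True then show ?thesis by (simp add: dipole_symbol_def)
next
  case False
  then have p: "(norm \<xi>)\<^sup>2 > 0" by simp
  have "\<bar>2 * (\<xi> $ 3)\<^sup>2 - (\<xi> $ 1)\<^sup>2 - (\<xi> $ 2)\<^sup>2\<bar> \<le> 2 * (norm \<xi>)\<^sup>2"
    unfolding norm_vec3_square by (auto simp: abs_if)
  then have "\<bar>(2 * (\<xi> $ 3)\<^sup>2 - (\<xi> $ 1)\<^sup>2 - (\<xi> $ 2)\<^sup>2) / (norm \<xi>)\<^sup>2\<bar> \<le> 2"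
    using p by (simp add: pos_divide_le_eq)
  then have "4 / 3 * pi * \<bar>(2 * (\<xi> $ 3)\<^sup>2 - (\<xi> $ 1)\<^sup>2 - (\<xi> $ 2)\<^sup>2) / (norm \<xi>)\<^sup>2\<bar> \<le> 4 / 3 * pi * 2"
    by (rule mult_left_mono) simp
  then show ?thesis unfolding dipole_symbol_def abs_mult[of "4 / 3 * pi"] by simp
qed

lemma dipole_symbol_scale: "t \<noteq> 0 \<Longrightarrow> dipole_symbol (t *\<^sub>R \<xi>) = dipole_symbol \<xi>"
proof -
  assume t: "t \<noteq> 0"
  have "2 * ((t *\<^sub>R \<xi>) $ 3)\<^sup>2 - ((t *\<^sub>R \<xi>) $ 1)\<^sup>2 - ((t *\<^sub>R \<xi>) $ 2)\<^sup>2 = t\<^sup>2 * (2 * (\<xi> $ 3)\<^sup>2 - (\<xi> $ 1)\<^sup>2 - (\<xi> $ 2)\<^sup>2)"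
    by (simp add: power_mult_distrib algebra_simps)
  moreover have "(norm (t *\<^sub>R \<xi>))\<^sup>2 = t\<^sup>2 * (norm \<xi>)\<^sup>2" by (simp add: power_mult_distrib)
  ultimately show ?thesis unfolding dipole_symbol_def using t by simp
qed

lemma dipole_symbol_measurable [measurable]: "dipole_symbol \<in> borel_measurable borel"
proof -
  have [measurable]: "(\<lambda>\<xi> :: real^3. \<xi> $ i) \<in> borel_measurable borel" for i
    by (intro borel_measurable_continuous_onI continuous_intros)
  show ?thesis unfolding dipole_symbol_def[abs_def] by measurable
qed

section \<open>The interaction as a Hermitian form\<close>

definition L12 :: "(real^3 \<Rightarrow> complex) \<Rightarrow> bool" where
  "L12 f \<longleftrightarrow> integrable lborel f \<and> memL2 f"

lemma L12_add: "L12 f \<Longrightarrow> L12 g \<Longrightarrow> L12 (\<lambda>x. f x + g x)"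
  unfolding L12_def by (simp add: memL2_add)

lemma L12_cmult: "L12 f \<Longrightarrow> L12 (\<lambda>x. c * f x)"
  unfolding L12_def by (simp add: memL2_cmult)

lemma L12_diff: "L12 f \<Longrightarrow> L12 g \<Longrightarrow> L12 (\<lambda>x. f x - g x)"
  unfolding L12_def by (simp add: memL2_diff)

lemma L12_fourier: "L12 f \<Longrightarrow> memL2 (fourier f)"
  unfolding L12_def by (blast intro: Plancherel(1))

lemma L12_Plancherel: "L12 f \<Longrightarrow> Lp_norm 2 (fourier f) = sqrt ((2 * pi) ^ 3) * Lp_norm 2 f"
  unfolding L12_def by (blast intro: has_L2_fourier_norm has_L2_fourier_fourier)

lemma fourier_add:
  assumes "integrable lborel f" "integrable lborel g"
  shows "fourier (\<lambda>x. f x + g x) = (\<lambda>\<xi>. fourier f \<xi> + fourier g \<xi>)"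
  unfolding fourier_def distrib_left
  by (rule ext, rule Bochner_Integration.integral_add) (rule integrable_kernel(1), fact)+

lemma fourier_cmult: "fourier (\<lambda>x. c * f x) = (\<lambda>\<xi>. c * fourier f \<xi>)"
  unfolding fourier_def mult.left_commute[of _ c] by (rule ext, rule integral_mult_right_zero)

text \<open>The form whose value at f = g = |u|^2 is the denominator of \<open>J\<close>. It is
  written with the transform instead of \<open>dipole_conv\<close>, so that linearity in f follows
  from that of \<open>fourier\<close> and involves no chosen representative; (2 pi)^(-3) is the
  Plancherel constant.\<close>

definition interaction :: "real \<Rightarrow> real \<Rightarrow> (real^3 \<Rightarrow> complex) \<Rightarrow> (real^3 \<Rightarrow> complex) \<Rightarrow> complex" where
  "interaction lam1 lam2 f g = - complex_of_real lam1 * (\<integral>x. f x * cnj (g x) \<partial>lborel)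
     - complex_of_real (lam2 / (2 * pi) ^ 3) *
       (\<integral>\<xi>. complex_of_real (dipole_symbol \<xi>) * (fourier f \<xi> * cnj (fourier g \<xi>)) \<partial>lborel)"

lemma memL2_dipole_symbol_mult:
  assumes g: "memL2 g" shows "memL2 (\<lambda>\<xi>. complex_of_real (dipole_symbol \<xi>) * g \<xi>)"
proof (rule memL2_bound[OF g])
  show "(\<lambda>\<xi>. complex_of_real (dipole_symbol \<xi>) * g \<xi>) \<in> borel_measurable borel"
    using memL2_measurable[OF g] by measurable
  show "AE \<xi> in lborel. cmod (complex_of_real (dipole_symbol \<xi>) * g \<xi>) \<le> (8 / 3 * pi) * cmod (g \<xi>)"
    unfolding norm_mult norm_of_real by (intro AE_I2 mult_right_mono dipole_symbol_bound) simp
qed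

lemma interaction_integrable:
  assumes "L12 f" "L12 g"
  shows "integrable lborel (\<lambda>x. f x * cnj (g x))"
    "integrable lborel (\<lambda>\<xi>. complex_of_real (dipole_symbol \<xi>) * (fourier f \<xi> * cnj (fourier g \<xi>)))"
proof -
  show "integrable lborel (\<lambda>x. f x * cnj (g x))"
    by (rule memL2_integrable_mult[OF _ memL2_cnj]) (use assms in \<open>simp_all add: L12_def\<close>)
  have "integrable lborel (\<lambda>\<xi>. (complex_of_real (dipole_symbol \<xi>) * fourier f \<xi>) * cnj (fourier g \<xi>))"
    by (rule memL2_integrable_mult[OF memL2_dipole_symbol_mult[OF L12_fourier[OF assms(1)]] memL2_cnj[OF L12_fourier[OF assms(2)]]])
  then show "integrable lborel (\<lambda>\<xi>. complex_of_real (dipole_symbol \<xi>) * (fourier f \<xi> * cnj (fourier g \<xi>)))"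
    by (simp only: mult.assoc)
qed

lemma interaction_add_left:
  assumes "L12 f" "L12 h" "L12 g"
  shows "interaction lam1 lam2 (\<lambda>x. f x + h x) g = interaction lam1 lam2 f g + interaction lam1 lam2 h g"
proof -
  note i = interaction_integrable[OF assms(1,3)] interaction_integrable[OF assms(2,3)]
  have "fourier (\<lambda>x. f x + h x) = (\<lambda>\<xi>. fourier f \<xi> + fourier h \<xi>)"
    using assms by (intro fourier_add) (simp_all add: L12_def)
  then show ?thesis unfolding interaction_def using i by (simp add: distrib_right distrib_left)
qed

lemma interaction_cmult_left:
  "interaction lam1 lam2 (\<lambda>x. c * f x) g = c * interaction lam1 lam2 f g"
proof -
  have 1: "(\<integral>x. c * f x * cnj (g x) \<partial>lborel) = c * (\<integral>x. f x * cnj (g x) \<partial>lborel)"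
    unfolding mult.assoc by (rule integral_mult_right_zero)
  have 2: "(\<integral>\<xi>. complex_of_real (dipole_symbol \<xi>) * (c * fourier f \<xi> * cnj (fourier g \<xi>)) \<partial>lborel)
      = c * (\<integral>\<xi>. complex_of_real (dipole_symbol \<xi>) * (fourier f \<xi> * cnj (fourier g \<xi>)) \<partial>lborel)"
    by (subst integral_mult_right_zero[symmetric]) (simp only: mult.assoc mult.left_commute[of c])
  show ?thesis unfolding interaction_def fourier_cmult 1 2 by (simp add: algebra_simps)
qed

lemma interaction_cnj: "interaction lam1 lam2 g f = cnj (interaction lam1 lam2 f g)"
proof -
  have 1: "(\<integral>x. g x * cnj (f x) \<partial>lborel) = cnj (\<integral>x. f x * cnj (g x) \<partial>lborel)"
    by (subst Bochner_Integration.integral_cnj[symmetric]) (simp add: mult.commute)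
  have 2: "(\<integral>\<xi>. complex_of_real (dipole_symbol \<xi>) * (fourier g \<xi> * cnj (fourier f \<xi>)) \<partial>lborel)
      = cnj (\<integral>\<xi>. complex_of_real (dipole_symbol \<xi>) * (fourier f \<xi> * cnj (fourier g \<xi>)) \<partial>lborel)"
    by (subst Bochner_Integration.integral_cnj[symmetric]) (simp add: mult.commute)
  show ?thesis unfolding interaction_def 1 2 by simp
qed

text \<open>Cauchy-Schwarz on both sides of the Fourier transform; 8/3 pi is the bound of the
  symbol, and Plancherel cancels the factor (2 pi)^3.\<close>

lemma interaction_bound:
  assumes f: "L12 f" and g: "L12 g"
  shows "cmod (interaction lam1 lam2 f g) \<le> (\<bar>lam1\<bar> + \<bar>lam2\<bar> * (8 / 3 * pi)) * (Lp_norm 2 f * Lp_norm 2 g)"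
proof -
  have m: "memL2 f" "memL2 g" "memL2 (fourier f)" "memL2 (fourier g)"
    using f g L12_fourier by (simp_all add: L12_def)
  have cn: "Lp_norm 2 (\<lambda>x. cnj (h x)) = Lp_norm 2 h" for h by (simp add: Lp_norm_2)
  have 1: "cmod (\<integral>x. f x * cnj (g x) \<partial>lborel) \<le> Lp_norm 2 f * Lp_norm 2 g"
    using memL2_Cauchy_Schwarz[OF m(1) memL2_cnj[OF m(2)]] unfolding cn .
  have Lm: "Lp_norm 2 (\<lambda>\<xi>. complex_of_real (dipole_symbol \<xi>) * fourier f \<xi>) \<le> (8 / 3 * pi) * Lp_norm 2 (fourier f)"
  proof -
    have "(Lp_norm 2 (\<lambda>\<xi>. complex_of_real (dipole_symbol \<xi>) * fourier f \<xi>))\<^sup>2 \<le> (\<integral>\<xi>. (8 / 3 * pi)\<^sup>2 * (cmod (fourier f \<xi>))\<^sup>2 \<partial>lborel)"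
      unfolding Lp_norm_2_square
    proof (rule integral_mono[OF memL2_integrable[OF memL2_dipole_symbol_mult[OF m(3)]] integrable_mult_right[OF memL2_integrable[OF m(3)]]])
      fix \<xi>
      have "\<bar>dipole_symbol \<xi>\<bar>\<^sup>2 \<le> (8 / 3 * pi)\<^sup>2" by (rule power_mono[OF dipole_symbol_bound]) simp
      then show "(cmod (complex_of_real (dipole_symbol \<xi>) * fourier f \<xi>))\<^sup>2 \<le> (8 / 3 * pi)\<^sup>2 * (cmod (fourier f \<xi>))\<^sup>2"
        unfolding norm_mult power_mult_distrib norm_of_real by (rule mult_right_mono) simp
    qed
    also have "\<dots> = ((8 / 3 * pi) * Lp_norm 2 (fourier f))\<^sup>2"
      unfolding power_mult_distrib[of _ "Lp_norm 2 _"] Lp_norm_2_square by (rule integral_mult_right_zero)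
    finally show ?thesis by (rule power2_le_imp_le) simp
  qed
  have "cmod (\<integral>\<xi>. complex_of_real (dipole_symbol \<xi>) * (fourier f \<xi> * cnj (fourier g \<xi>)) \<partial>lborel)
      \<le> Lp_norm 2 (\<lambda>\<xi>. complex_of_real (dipole_symbol \<xi>) * fourier f \<xi>) * Lp_norm 2 (fourier g)"
    using memL2_Cauchy_Schwarz[OF memL2_dipole_symbol_mult[OF m(3)] memL2_cnj[OF m(4)]] unfolding cn mult.assoc .
  also have "\<dots> \<le> (8 / 3 * pi) * Lp_norm 2 (fourier f) * Lp_norm 2 (fourier g)"
    by (rule mult_right_mono[OF Lm]) simp
  also have "\<dots> = (8 / 3 * pi) * ((2 * pi) ^ 3 * (Lp_norm 2 f * Lp_norm 2 g))"
  proof -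
    have s: "sqrt ((2 * pi) ^ 3) * sqrt ((2 * pi) ^ 3) = (2 * pi) ^ 3" by simp
    have "k * (r * p) * (r * q) = k * ((r * r) * (p * q))" for k r p q :: real by (simp only: mult_ac)
    from this[of "8 / 3 * pi" "sqrt ((2 * pi) ^ 3)"] show ?thesis
      unfolding L12_Plancherel[OF f] L12_Plancherel[OF g] s by blast
  qed
  finally have 2: "cmod (\<integral>\<xi>. complex_of_real (dipole_symbol \<xi>) * (fourier f \<xi> * cnj (fourier g \<xi>)) \<partial>lborel)
      \<le> (8 / 3 * pi) * ((2 * pi) ^ 3 * (Lp_norm 2 f * Lp_norm 2 g))" .
  have "cmod (interaction lam1 lam2 f g) \<le> \<bar>lam1\<bar> * cmod (\<integral>x. f x * cnj (g x) \<partial>lborel)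
      + \<bar>lam2\<bar> / (2 * pi) ^ 3 * cmod (\<integral>\<xi>. complex_of_real (dipole_symbol \<xi>) * (fourier f \<xi> * cnj (fourier g \<xi>)) \<partial>lborel)"
    unfolding interaction_def by (rule order_trans[OF norm_triangle_ineq4]) (simp add: norm_mult norm_divide norm_power)
  also have "\<dots> \<le> \<bar>lam1\<bar> * (Lp_norm 2 f * Lp_norm 2 g) + \<bar>lam2\<bar> / (2 * pi) ^ 3 * ((8 / 3 * pi) * ((2 * pi) ^ 3 * (Lp_norm 2 f * Lp_norm 2 g)))"
    by (intro add_mono mult_left_mono 1 2) auto
  also have "\<dots> = (\<bar>lam1\<bar> + \<bar>lam2\<bar> * (8 / 3 * pi)) * (Lp_norm 2 f * Lp_norm 2 g)"
  proof -
    have "(2 * pi) ^ 3 \<noteq> (0::real)" by simp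
    then show ?thesis by (simp add: algebra_simps)
  qed
  finally show ?thesis .
qed

lemma dipole_conv_memL2: "L12 f \<Longrightarrow> memL2 (dipole_conv f)"
  unfolding L12_def using fourier_multiplier_Parseval(1)[OF dipole_symbol_measurable dipole_symbol_bound] by blast

text \<open>Returns from the Fourier side to the convolution of the statement, both for the
  denominator of \<open>J\<close> and for the nonlinear terms of the weak equation.\<close>

lemma interaction_dipole_conv:
  assumes f: "L12 f" and g: "L12 g"
  shows "interaction lam1 lam2 f g = - complex_of_real lam1 * (\<integral>x. f x * cnj (g x) \<partial>lborel)
     - complex_of_real lam2 * (\<integral>x. dipole_conv f x * cnj (g x) \<partial>lborel)"
proof -
  have "(\<integral>x. dipole_conv f x * cnj (g x) \<partial>lborel) = complex_of_real (1 / (2 * pi) ^ 3) *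
      (\<integral>\<xi>. complex_of_real (dipole_symbol \<xi>) * (fourier f \<xi> * cnj (fourier g \<xi>)) \<partial>lborel)"
    using fourier_multiplier_Parseval(2)[OF dipole_symbol_measurable dipole_symbol_bound] f g
    unfolding L12_def by blast
  then show ?thesis unfolding interaction_def by simp
qed

lemma sq_mod_L12:
  assumes u: "u \<in> H1" shows "L12 (sq_mod u)"
proof -
  note [measurable] = memL2_measurable[OF H1_memL2[OF u]]
  have m: "sq_mod u \<in> borel_measurable borel" unfolding sq_mod_def[abs_def] by measurable
  have "integrable lborel (\<lambda>x. complex_of_real ((cmod (u x))\<^sup>2))"
    unfolding complex_of_real_integrable_eq by (rule memL2_integrable[OF H1_memL2[OF u]])
  then have "integrable lborel (sq_mod u)" unfolding sq_mod_def[abs_def] .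
  moreover have "(\<lambda>x. (cmod (sq_mod u x))\<^sup>2) = (\<lambda>x. cmod (u x) ^ 4)"
    by (simp add: sq_mod_def fun_eq_iff norm_power power_mult[symmetric])
  then have "memL2 (sq_mod u)" using H1_L4(1)[OF u] m by (simp add: memL2_def)
  ultimately show ?thesis by (simp add: L12_def)
qed

lemma sq_mod_Lp_norm: "(Lp_norm 2 (sq_mod u))\<^sup>2 = Lp_norm 4 u ^ 4"
  unfolding Lp_norm_2_square Lp_norm_4_power by (simp add: sq_mod_def norm_power power_mult[symmetric])

lemma J_denom_interaction:
  assumes u: "u \<in> H1"
  shows "J_denom lam1 lam2 u = Re (interaction lam1 lam2 (sq_mod u) (sq_mod u))"
proof -
  have c: "cnj (sq_mod u x) = sq_mod u x" for x by (simp add: sq_mod_def)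
  show ?thesis
    unfolding interaction_dipole_conv[OF sq_mod_L12[OF u] sq_mod_L12[OF u]] integral_mult_cnj_self sq_mod_Lp_norm
    unfolding c J_denom_def dipole_energy_def by simp
qed

lemma energy_eq: "energy lam1 lam2 u = ((grad_norm u)\<^sup>2 - J_denom lam1 lam2 u) / 2"
  unfolding energy_def J_denom_def by (simp add: field_simps)

subsection \<open>Continuity\<close>

text \<open>Pointwise the difference of the squares is at most |d| (2 |w| + |d|). The squared L2
  norm of |d| |w| is the integral of |d|^2 |w|^2, which Cauchy-Schwarz controls by the L2 norms of
  |d|^2 and |w|^2.\<close>

lemma sq_mod_diff_bound:
  assumes u: "u \<in> H1" and w: "w \<in> H1"
  defines "d \<equiv> \<lambda>x. u x - w x"
  shows "Lp_norm 2 (\<lambda>x. sq_mod u x - sq_mod w x)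
    \<le> 2 * sqrt (Lp_norm 2 (sq_mod d) * Lp_norm 2 (sq_mod w)) + Lp_norm 2 (sq_mod d)"
proof -
  have d: "d \<in> H1" unfolding d_def by (rule H1_diff[OF u w])
  note [measurable] = memL2_measurable[OF H1_memL2[OF d]] memL2_measurable[OF H1_memL2[OF w]]
    memL2_measurable[OF H1_memL2[OF u]]
  have S: "memL2 (sq_mod d)" "memL2 (sq_mod w)" "memL2 (sq_mod u)"
    using sq_mod_L12 u w d by (simp_all add: L12_def)
  define p where "p x = complex_of_real (cmod (d x) * cmod (w x))" for x
  have pm[measurable]: "p \<in> borel_measurable borel" unfolding p_def by measurable
  have p2: "(cmod (p x))\<^sup>2 = cmod (sq_mod d x) * cmod (sq_mod w x)" for x
    by (simp add: p_def sq_mod_def norm_mult norm_power power_mult_distrib)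
  have pint: "integrable lborel (\<lambda>x. cmod (sq_mod d x) * cmod (sq_mod w x))"
    using integrable_norm[OF memL2_integrable_mult[OF S(1,2)]] by (simp add: norm_mult)
  have pL: "memL2 p" unfolding memL2_def p2 using pint pm by simp
  have pn: "Lp_norm 2 p \<le> sqrt (Lp_norm 2 (sq_mod d) * Lp_norm 2 (sq_mod w))"
    unfolding Lp_norm_2[of p] p2 by (rule real_sqrt_le_mono) (rule memL2_Cauchy_Schwarz_norm[OF S(1,2)])
  define q where "q x = 2 * p x + sq_mod d x" for x
  have q: "memL2 q" unfolding q_def by (intro memL2_add memL2_cmult pL S(1))
  have "(Lp_norm 2 (\<lambda>x. sq_mod u x - sq_mod w x))\<^sup>2 \<le> (Lp_norm 2 q)\<^sup>2"
    unfolding Lp_norm_2_square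
  proof (rule integral_mono[OF memL2_integrable[OF memL2_diff[OF S(3,2)]] memL2_integrable[OF q]])
    fix x
    have "cmod (u x) \<le> cmod (w x) + cmod (d x)" "cmod (w x) \<le> cmod (u x) + cmod (d x)"
      using norm_triangle_ineq[of "w x" "d x"] norm_triangle_ineq4[of "u x" "d x"] by (simp_all add: d_def)
    then have "\<bar>cmod (u x) - cmod (w x)\<bar> \<le> cmod (d x)" "cmod (u x) + cmod (w x) \<le> 2 * cmod (w x) + cmod (d x)" by linarith+
    then have "\<bar>cmod (u x) - cmod (w x)\<bar> * (cmod (u x) + cmod (w x)) \<le> cmod (d x) * (2 * cmod (w x) + cmod (d x))"
      by (intro mult_mono) auto
    moreover have "\<bar>(cmod (u x))\<^sup>2 - (cmod (w x))\<^sup>2\<bar> = \<bar>cmod (u x) - cmod (w x)\<bar> * (cmod (u x) + cmod (w x))"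
      by (simp add: power2_eq_square square_diff_square_factored abs_mult)
    ultimately have le: "\<bar>(cmod (u x))\<^sup>2 - (cmod (w x))\<^sup>2\<bar> \<le> 2 * (cmod (d x) * cmod (w x)) + (cmod (d x))\<^sup>2"
      by (simp add: power2_eq_square algebra_simps)
    have "cmod (sq_mod u x - sq_mod w x) = \<bar>(cmod (u x))\<^sup>2 - (cmod (w x))\<^sup>2\<bar>"
      unfolding sq_mod_def of_real_diff[symmetric] norm_of_real ..
    moreover have "q x = complex_of_real (2 * (cmod (d x) * cmod (w x)) + (cmod (d x))\<^sup>2)"
      by (simp add: q_def p_def sq_mod_def)
    then have "cmod (q x) = 2 * (cmod (d x) * cmod (w x)) + (cmod (d x))\<^sup>2"
      by (simp only: norm_of_real) simp
    ultimately show "(cmod (sq_mod u x - sq_mod w x))\<^sup>2 \<le> (cmod (q x))\<^sup>2"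
      using le by (intro power_mono) simp_all
  qed
  then have "Lp_norm 2 (\<lambda>x. sq_mod u x - sq_mod w x) \<le> Lp_norm 2 q"
    by (rule power2_le_imp_le) simp
  also have "\<dots> \<le> Lp_norm 2 (\<lambda>x. 2 * p x) + Lp_norm 2 (sq_mod d)"
    unfolding q_def by (rule Lp_norm_2_triangle[OF memL2_cmult[OF pL] S(1)])
  also have "Lp_norm 2 (\<lambda>x. 2 * p x) = 2 * Lp_norm 2 p" by (simp add: Lp_norm_2_cmult)
  finally show ?thesis using pn by linarith
qed

lemma H1_norm_bounds: "Lp_norm 2 u \<le> H1_norm u" "grad_norm u \<le> H1_norm u" "0 \<le> H1_norm u"
  by (simp_all add: H1_norm_def real_le_rsqrt)

lemma sq_mod_Lp_norm_le:
  assumes u: "u \<in> H1" shows "Lp_norm 2 (sq_mod u) \<le> 6 * (H1_norm u)\<^sup>2"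
proof -
  have "(Lp_norm 2 (sq_mod u))\<^sup>2 \<le> 32 * Lp_norm 2 u * grad_norm u ^ 3"
    unfolding sq_mod_Lp_norm Lp_norm_4_power by (rule H1_L4(2)[OF u])
  also have "\<dots> \<le> 32 * H1_norm u * H1_norm u ^ 3"
    using H1_norm_bounds[of u] by (intro mult_mono power_mono mult_nonneg_nonneg) auto
  \<comment> \<open>The constant 6 comes from 32 <= 6^2.\<close>
  also have "\<dots> \<le> (6 * (H1_norm u)\<^sup>2)\<^sup>2"
  proof -
    have "0 \<le> H1_norm u ^ 4" by simp
    then show ?thesis by (simp add: power2_eq_square power3_eq_cube power4_eq_xxxx)
  qed
  finally show ?thesis by (rule power2_le_imp_le) simp
qed

text \<open>For a Hermitian form the difference of its values at f and at k is the real part of its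
  value at the pair f - k, f + k. The first entry is small by \<open>sq_mod_diff_bound\<close>, the
  second stays bounded.\<close>

lemma J_denom_tendsto:
  assumes g: "\<forall>\<^sub>F s in F. g s \<in> H1" and w: "w \<in> H1" and lim: "((\<lambda>s. H1_norm (\<lambda>x. g s x - w x)) \<longlongrightarrow> 0) F"
  shows "((\<lambda>s. J_denom lam1 lam2 (g s)) \<longlongrightarrow> J_denom lam1 lam2 w) F"
proof -
  define C where "C = \<bar>lam1\<bar> + \<bar>lam2\<bar> * (8 / 3 * pi)"
  have C: "0 \<le> C" by (simp add: C_def)
  define L where "L = Lp_norm 2 (sq_mod w)"
  have L0: "0 \<le> L" by (simp add: L_def)
  define h where "h s = 6 * (H1_norm (\<lambda>x. g s x - w x))\<^sup>2" for s
  define e where "e s = 2 * sqrt (h s * L) + h s" for s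
  have h: "(h \<longlongrightarrow> 0) F"
    unfolding h_def using tendsto_mult[OF tendsto_const tendsto_power[OF lim, of 2], of 6] by simp
  have e: "(e \<longlongrightarrow> 0) F"
  proof -
    have "(e \<longlongrightarrow> 2 * sqrt (0 * L) + 0) F" unfolding e_def by (intro tendsto_intros h)
    then show ?thesis by simp
  qed
  have "\<forall>\<^sub>F s in F. norm (J_denom lam1 lam2 (g s) - J_denom lam1 lam2 w) \<le> C * (e s * (2 * L + e s))"
    using g
  proof eventually_elim
    case (elim s)
    let ?f = "sq_mod (g s)" and ?k = "sq_mod w"
    have X: "L12 ?f" "L12 ?k" by (rule sq_mod_L12[OF elim], rule sq_mod_L12[OF w])
    have dif: "Lp_norm 2 (\<lambda>x. ?f x - ?k x) \<le> e s"
    proof -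
      have le: "Lp_norm 2 (sq_mod (\<lambda>x. g s x - w x)) \<le> h s"
        unfolding h_def by (rule sq_mod_Lp_norm_le[OF H1_diff[OF elim w]])
      have "Lp_norm 2 (\<lambda>x. ?f x - ?k x) \<le> 2 * sqrt (Lp_norm 2 (sq_mod (\<lambda>x. g s x - w x)) * L) + Lp_norm 2 (sq_mod (\<lambda>x. g s x - w x))"
        unfolding L_def by (rule sq_mod_diff_bound[OF elim w])
      also have "\<dots> \<le> e s" unfolding e_def
        by (intro add_mono mult_left_mono real_sqrt_le_mono mult_right_mono le L0) auto
      finally show ?thesis .
    qed
    have sum: "Lp_norm 2 (\<lambda>x. ?f x + ?k x) \<le> 2 * L + e s"
    proof -
      have "Lp_norm 2 (\<lambda>x. ?f x + ?k x) \<le> Lp_norm 2 ?f + L"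
        unfolding L_def using X by (intro Lp_norm_2_triangle) (simp_all add: L12_def)
      moreover have "Lp_norm 2 ?f \<le> L + e s"
        using Lp_norm_2_reverse_triangle[of ?f ?k] X dif unfolding L_def by (simp add: L12_def)
      ultimately show ?thesis by linarith
    qed
    have "interaction lam1 lam2 (\<lambda>x. ?f x - ?k x) (\<lambda>x. ?f x + ?k x)
       = interaction lam1 lam2 ?f (\<lambda>x. ?f x + ?k x) - interaction lam1 lam2 ?k (\<lambda>x. ?f x + ?k x)"
      using interaction_add_left[OF X(1) L12_cmult[OF X(2), of "-1"] L12_add[OF X], of lam1 lam2]
      unfolding interaction_cmult_left by simp
    moreover have "interaction lam1 lam2 z (\<lambda>x. ?f x + ?k x) = interaction lam1 lam2 z ?f + interaction lam1 lam2 z ?k" if "L12 z" for z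
      using interaction_add_left[OF X that, of lam1 lam2] interaction_cnj[of lam1 lam2] by (metis complex_cnj_add)
    ultimately have "interaction lam1 lam2 (\<lambda>x. ?f x - ?k x) (\<lambda>x. ?f x + ?k x)
       = interaction lam1 lam2 ?f ?f + interaction lam1 lam2 ?f ?k - (cnj (interaction lam1 lam2 ?f ?k) + interaction lam1 lam2 ?k ?k)"
      using X interaction_cnj[of lam1 lam2 ?k ?f] by simp
    then have "Re (interaction lam1 lam2 (\<lambda>x. ?f x - ?k x) (\<lambda>x. ?f x + ?k x)) = J_denom lam1 lam2 (g s) - J_denom lam1 lam2 w"
      unfolding J_denom_interaction[OF elim] J_denom_interaction[OF w] by simp
    then have "norm (J_denom lam1 lam2 (g s) - J_denom lam1 lam2 w) \<le> cmod (interaction lam1 lam2 (\<lambda>x. ?f x - ?k x) (\<lambda>x. ?f x + ?k x))"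
      using abs_Re_le_cmod by (metis real_norm_def)
    also have "\<dots> \<le> C * (Lp_norm 2 (\<lambda>x. ?f x - ?k x) * Lp_norm 2 (\<lambda>x. ?f x + ?k x))"
      unfolding C_def by (rule interaction_bound[OF L12_diff[OF X] L12_add[OF X]])
    also have "\<dots> \<le> C * (e s * (2 * L + e s))"
      using order_trans[OF Lp_norm_2_nonneg dif] by (intro mult_left_mono mult_mono dif sum C) auto
    finally show ?case .
  qed
  moreover have "((\<lambda>s. C * (e s * (2 * L + e s))) \<longlongrightarrow> 0) F"
  proof -
    have "((\<lambda>s. C * (e s * (2 * L + e s))) \<longlongrightarrow> C * (0 * (2 * L + 0))) F" by (intro tendsto_intros e)
    then show ?thesis by simp
  qed
  ultimately show ?thesis by (rule LIM_zero_cancel[OF Lim_null_comparison])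
qed

lemma grad_norm_tendsto:
  assumes g: "\<forall>\<^sub>F s in F. g s \<in> H1" and w: "w \<in> H1" and lim: "((\<lambda>s. H1_norm (\<lambda>x. g s x - w x)) \<longlongrightarrow> 0) F"
  shows "((\<lambda>s. grad_norm (g s)) \<longlongrightarrow> grad_norm w) F"
proof (rule LIM_zero_cancel, rule Lim_null_comparison[OF _ lim])
  show "\<forall>\<^sub>F s in F. norm (grad_norm (g s) - grad_norm w) \<le> H1_norm (\<lambda>x. g s x - w x)"
    using g
  proof eventually_elim
    case (elim s)
    show ?case using grad_norm_reverse_triangle[OF elim w] H1_norm_bounds(2)[of "\<lambda>x. g s x - w x"] by simp
  qed
qed

text \<open>By \<open>H1_L4\<close> a vanishing gradient forces u = 0 almost everywhere.\<close>

lemma grad_norm_pos: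
  assumes u: "u \<in> H1" and "Lp_norm 2 u \<noteq> 0" shows "grad_norm u > 0"
proof (rule ccontr)
  assume "\<not> grad_norm u > 0"
  then have "grad_norm u = 0" using grad_norm_nonneg[of u] by linarith
  then have "(\<integral>x. cmod (u x) ^ 4 \<partial>lborel) \<le> 0" using H1_L4(2)[OF u] by simp
  moreover have "0 \<le> (\<integral>x. cmod (u x) ^ 4 \<partial>lborel)" by (rule Bochner_Integration.integral_nonneg) simp
  ultimately have "(\<integral>x. cmod (u x) ^ 4 \<partial>lborel) = 0" by linarith
  then have "AE x in lborel. cmod (u x) ^ 4 = 0"
    using integral_nonneg_eq_0_iff_AE[OF H1_L4(1)[OF u]] by simp
  then have "AE x in lborel. u x = 0" by eventually_elim simp
  then have "Lp_norm 2 u = 0" by (simp add: Lp_norm_2_eq_0_iff[OF H1_memL2[OF u]])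
  then show False using assms(2) by simp
qed

subsection \<open>Mass preserving dilations\<close>

definition dilate :: "real \<Rightarrow> (real^3 \<Rightarrow> complex) \<Rightarrow> real^3 \<Rightarrow> complex" where
  "dilate t u x = complex_of_real (sqrt t ^ 3) * u (t *\<^sub>R x)"

lemma memL2_scaled: "memL2 f \<Longrightarrow> t > 0 \<Longrightarrow> memL2 (\<lambda>x. f (t *\<^sub>R x))"
  using memL2_affine[of f t 0] by simp

lemma dilate_weak_partial:
  assumes "has_weak_partial i u g" "t > 0"
  shows "has_weak_partial i (dilate t u) (\<lambda>x. complex_of_real t * dilate t g x)"
  using has_weak_partial_cmult[OF has_weak_partial_scaled[OF assms], of "complex_of_real (sqrt t ^ 3)"]
  unfolding dilate_def by (simp only: mult.left_commute)

lemma dilate_memL2: "memL2 f \<Longrightarrow> t > 0 \<Longrightarrow> memL2 (dilate t f)"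
  unfolding dilate_def by (intro memL2_cmult memL2_scaled)

lemma dilate_H1:
  assumes "u \<in> H1" "t > 0" shows "dilate t u \<in> H1"
  by (rule H1I[OF dilate_memL2[OF H1_memL2[OF assms(1)] assms(2)]
      memL2_cmult[OF dilate_memL2[OF H1_weak_partial(2)[OF assms(1)] assms(2)]]
      dilate_weak_partial[OF H1_weak_partial(1)[OF assms(1)] assms(2)]])

lemma dilate_Lp_norm:
  assumes "t > 0" shows "Lp_norm 2 (dilate t u) = Lp_norm 2 u"
proof -
  have "Lp_norm 2 (\<lambda>x. u (0 + t *\<^sub>R x)) = sqrt (1 / \<bar>t\<bar> ^ 3) * Lp_norm 2 u"
    by (rule Lp_norm_2_affine) (use assms in simp)
  then have "Lp_norm 2 (\<lambda>x. u (t *\<^sub>R x)) = 1 / sqrt t ^ 3 * Lp_norm 2 u"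
    using assms by (simp add: real_sqrt_divide real_sqrt_power)
  then show ?thesis unfolding dilate_def Lp_norm_2_cmult using assms by (simp add: norm_power)
qed

lemma dilate_grad_norm:
  assumes "u \<in> H1" "t > 0" shows "grad_norm (dilate t u) = t * grad_norm u"
proof -
  have "grad_norm (dilate t u) = L2_set (\<lambda>i. t * Lp_norm 2 (weak_partial i u)) UNIV"
    unfolding grad_norm_eq[OF dilate_weak_partial[OF H1_weak_partial(1)[OF assms(1)] assms(2)]]
      Lp_norm_2_cmult dilate_Lp_norm[OF assms(2)] using assms(2) by simp
  also have "\<dots> = t * grad_norm u"
    unfolding grad_norm_L2_set by (rule L2_set_right_distrib[symmetric]) (use assms(2) in simp)
  finally show ?thesis .
qed

text \<open>The density becomes t^3 times |u|^2 at t x, and its transform is the old one at \<xi> /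
  t. As the symbol ignores the factor t, the substitution gives t^3 in the dipolar part, the same
  power as in the local part.\<close>

lemma dilate_J_denom:
  assumes u: "u \<in> H1" and t: "t > 0" shows "J_denom lam1 lam2 (dilate t u) = t ^ 3 * J_denom lam1 lam2 u"
proof -
  let ?f = "sq_mod u" and ?h = "sq_mod (dilate t u)"
  have h: "?h x = complex_of_real (t ^ 3) * ?f (t *\<^sub>R x)" for x
  proof -
    have "(sqrt t ^ 3)\<^sup>2 = ((sqrt t)\<^sup>2) ^ 3" by (simp only: power_mult[symmetric] mult.commute)
    also have "\<dots> = t ^ 3" using t by simp
    finally have "(sqrt t ^ 3)\<^sup>2 = t ^ 3" .
    then show ?thesis unfolding sq_mod_def dilate_def norm_mult norm_of_real power_mult_distrib by simp
  qed
  have Fh: "fourier ?h \<xi> = fourier ?f ((1 / t) *\<^sub>R \<xi>)" for \<xi>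
  proof -
    let ?k = "\<lambda>y. exp (- \<i> * complex_of_real (y \<bullet> ((1 / t) *\<^sub>R \<xi>))) * ?f y"
    have "fourier ?h \<xi> = (\<integral>x. complex_of_real (t ^ 3) * ?k (0 + t *\<^sub>R x) \<partial>lborel)"
      unfolding fourier_def[of ?h]
    proof (rule Bochner_Integration.integral_cong[OF refl])
      fix x
      have "(0 + t *\<^sub>R x) \<bullet> ((1 / t) *\<^sub>R \<xi>) = x \<bullet> \<xi>" using t by simp
      then show "exp (- \<i> * complex_of_real (x \<bullet> \<xi>)) * ?h x = complex_of_real (t ^ 3) * ?k (0 + t *\<^sub>R x)"
        unfolding h by (simp only: mult_ac add_0_left)
    qed
    also have "\<dots> = complex_of_real (t ^ 3) * (\<integral>x. ?k (0 + t *\<^sub>R x) \<partial>lborel)" by (rule integral_mult_right_zero)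
    also have "(\<integral>x. ?k (0 + t *\<^sub>R x) \<partial>lborel) = (1 / \<bar>t\<bar> ^ 3) *\<^sub>R (\<integral>y. ?k y \<partial>lborel)"
      by (rule integral_affine3) (use t in simp)
    also have "(\<integral>y. ?k y \<partial>lborel) = fourier ?f ((1 / t) *\<^sub>R \<xi>)" unfolding fourier_def ..
    finally show ?thesis using t by (simp add: scaleR_conv_of_real)
  qed
  have 1: "(\<integral>x. ?h x * cnj (?h x) \<partial>lborel) = complex_of_real (t ^ 3) * (\<integral>x. ?f x * cnj (?f x) \<partial>lborel)"
  proof -
    let ?k = "\<lambda>x. ?f x * cnj (?f x)"
    have "(\<integral>x. ?h x * cnj (?h x) \<partial>lborel) = (\<integral>x. complex_of_real (t ^ 3 * t ^ 3) * ?k (0 + t *\<^sub>R x) \<partial>lborel)"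
      unfolding h by (intro Bochner_Integration.integral_cong) simp_all
    also have "\<dots> = complex_of_real (t ^ 3 * t ^ 3) * (\<integral>x. ?k (0 + t *\<^sub>R x) \<partial>lborel)" by (rule integral_mult_right_zero)
    also have "(\<integral>x. ?k (0 + t *\<^sub>R x) \<partial>lborel) = (1 / \<bar>t\<bar> ^ 3) *\<^sub>R (\<integral>y. ?k y \<partial>lborel)"
      by (rule integral_affine3) (use t in simp)
    finally have "(\<integral>x. ?h x * cnj (?h x) \<partial>lborel) = complex_of_real (t ^ 3 * t ^ 3 * (1 / t ^ 3)) * (\<integral>y. ?k y \<partial>lborel)"
      using t by (simp only: scaleR_conv_of_real of_real_mult mult.assoc abs_of_pos)
    moreover have "t ^ 3 * t ^ 3 * (1 / t ^ 3) = t ^ 3"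
    proof -
      have pp: "p * p * (1 / p) = p" if "p \<noteq> 0" for p :: real using that by simp
      have "t ^ 3 \<noteq> 0" using t by simp
      then show ?thesis by (rule pp)
    qed
    ultimately show ?thesis by (simp only:)
  qed
  have 2: "(\<integral>\<xi>. complex_of_real (dipole_symbol \<xi>) * (fourier ?h \<xi> * cnj (fourier ?h \<xi>)) \<partial>lborel)
      = complex_of_real (t ^ 3) * (\<integral>\<xi>. complex_of_real (dipole_symbol \<xi>) * (fourier ?f \<xi> * cnj (fourier ?f \<xi>)) \<partial>lborel)"
  proof -
    let ?k = "\<lambda>\<xi>. complex_of_real (dipole_symbol \<xi>) * (fourier ?f \<xi> * cnj (fourier ?f \<xi>))"
    have "(\<integral>\<xi>. complex_of_real (dipole_symbol \<xi>) * (fourier ?h \<xi> * cnj (fourier ?h \<xi>)) \<partial>lborel)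
        = (\<integral>\<xi>. ?k (0 + (1 / t) *\<^sub>R \<xi>) \<partial>lborel)"
      unfolding Fh using dipole_symbol_scale[of "1 / t"] t by (intro Bochner_Integration.integral_cong) simp_all
    also have "\<dots> = (1 / \<bar>1 / t\<bar> ^ 3) *\<^sub>R (\<integral>\<xi>. ?k \<xi> \<partial>lborel)"
      by (rule integral_affine3) (use t in simp)
    finally show ?thesis using t by (simp add: scaleR_conv_of_real power_divide)
  qed
  have "interaction lam1 lam2 ?h ?h = complex_of_real (t ^ 3) * interaction lam1 lam2 ?f ?f"
    unfolding interaction_def 1 2 by (simp add: algebra_simps)
  then have "Re (interaction lam1 lam2 ?h ?h) = t ^ 3 * Re (interaction lam1 lam2 ?f ?f)"
    by (simp del: of_real_power)
  then show ?thesis unfolding J_denom_interaction[OF u] J_denom_interaction[OF dilate_H1[OF u t]] .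
qed

lemma dilate_energy:
  assumes "u \<in> H1" "t > 0"
  shows "energy lam1 lam2 (dilate t u) = (t\<^sup>2 * (grad_norm u)\<^sup>2 - t ^ 3 * J_denom lam1 lam2 u) / 2"
  unfolding energy_eq dilate_J_denom[OF assms] dilate_grad_norm[OF assms] by (simp add: power_mult_distrib)

text \<open>The extra scalar \<open>a n\<close> is 1 for the function itself and \<open>t n\<close>
  for its derivatives.\<close>

lemma L2_tendsto_dilate:
  assumes f: "memL2 f" and t: "t \<longlonglongrightarrow> t0" "\<And>n. t n > 0" "t0 > 0" and a: "a \<longlonglongrightarrow> a0"
  shows "L2_tendsto (\<lambda>n x. complex_of_real (a n) * dilate (t n) f x) (\<lambda>x. complex_of_real a0 * dilate t0 f x)"
proof -
  have tn: "t n \<noteq> 0" "t0 \<noteq> 0" for n using t(2)[of n] t(3) by simp_all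
  have 1: "L2_tendsto (\<lambda>n x. f (0 + t n *\<^sub>R x)) (\<lambda>x. f (0 + t0 *\<^sub>R x))"
    by (rule L2_tendsto_affine[OF f tendsto_const t(1) tn])
  have lim: "(\<lambda>n. a n * sqrt (t n) ^ 3) \<longlonglongrightarrow> a0 * sqrt t0 ^ 3" by (intro tendsto_intros a t(1))
  then obtain C where C: "\<And>n. \<bar>a n * sqrt (t n) ^ 3\<bar> \<le> C"
    using convergent_imp_Bseq[of "\<lambda>n. a n * sqrt (t n) ^ 3"] unfolding convergent_def Bseq_def real_norm_def by blast
  have "L2_tendsto (\<lambda>n x. complex_of_real (a n * sqrt (t n) ^ 3) * f (0 + t n *\<^sub>R x)) (\<lambda>x. complex_of_real (a0 * sqrt t0 ^ 3) * f (0 + t0 *\<^sub>R x))"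
    by (rule L2_tendsto_mult_bounded[where C=C, OF 1 _ C lim]) simp
  then show ?thesis unfolding dilate_def by (simp add: mult.assoc)
qed

lemma dilate_H1_norm_tendsto:
  assumes u: "u \<in> H1" and t: "t \<longlonglongrightarrow> t0" "\<And>n. t n > 0" "t0 > 0"
  shows "(\<lambda>n. H1_norm (\<lambda>x. dilate (t n) u x - dilate t0 u x)) \<longlonglongrightarrow> 0"
proof -
  let ?g = "\<lambda>i n x. complex_of_real (t n) * dilate (t n) (weak_partial i u) x - complex_of_real t0 * dilate t0 (weak_partial i u) x"
  have "(\<lambda>n. Lp_norm 2 (\<lambda>x. complex_of_real 1 * dilate (t n) u x - complex_of_real 1 * dilate t0 u x)) \<longlonglongrightarrow> 0"
    using L2_tendsto_dilate[OF H1_memL2[OF u] t tendsto_const[of 1]] unfolding L2_tendsto_def by blast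
  then have 1: "(\<lambda>n. Lp_norm 2 (\<lambda>x. dilate (t n) u x - dilate t0 u x)) \<longlonglongrightarrow> 0" by simp
  have 2: "(\<lambda>n. Lp_norm 2 (?g i n)) \<longlonglongrightarrow> 0" for i
    using L2_tendsto_dilate[OF H1_weak_partial(2)[OF u] t t(1)] unfolding L2_tendsto_def by blast
  have g: "grad_norm (\<lambda>x. dilate (t n) u x - dilate t0 u x) = L2_set (\<lambda>i. Lp_norm 2 (?g i n)) UNIV" for n
    by (rule grad_norm_eq[OF has_weak_partial_diff[OF dilate_weak_partial[OF H1_weak_partial(1)[OF u] t(2)]
          dilate_weak_partial[OF H1_weak_partial(1)[OF u] t(3)]]])
  have "(\<lambda>n. sqrt ((Lp_norm 2 (\<lambda>x. dilate (t n) u x - dilate t0 u x))\<^sup>2 + (L2_set (\<lambda>i. Lp_norm 2 (?g i n)) UNIV)\<^sup>2))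
     \<longlonglongrightarrow> sqrt (0\<^sup>2 + (sqrt (\<Sum>i\<in>(UNIV :: 3 set). 0\<^sup>2))\<^sup>2)"
    unfolding L2_set_def by (intro tendsto_intros 1 2)
  then show ?thesis unfolding H1_norm_def g by simp
qed

lemma dilate_path:
  assumes u: "u \<in> H1" and a: "a > 0" and b: "b > 0"
  shows "H1_path (\<lambda>s. dilate (a + s * (b - a)) u)"
  unfolding H1_path_def
proof (intro ballI conjI)
  have pos: "a + s * (b - a) > 0" if "s \<in> {0..1}" for s
  proof -
    have "a + s * (b - a) = (1 - s) * a + s * b" by (simp add: algebra_simps)
    moreover have "(1 - s) * a \<ge> 0" "s * b \<ge> 0" using that a b by simp_all
    moreover have "(1 - s) * a > 0 \<or> s * b > 0" using that a b by (cases "s = 0") auto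
    ultimately show ?thesis by linarith
  qed
  fix t :: real assume t: "t \<in> {0..1}"
  show "dilate (a + t * (b - a)) u \<in> H1" by (rule dilate_H1[OF u pos[OF t]])
  show "((\<lambda>s. H1_norm (\<lambda>x. dilate (a + s * (b - a)) u x - dilate (a + t * (b - a)) u x)) \<longlongrightarrow> 0) (at t within {0..1})"
    unfolding tendsto_at_iff_sequentially
  proof (intro allI impI)
    fix X assume X: "\<forall>i. X i \<in> {0..1} - {t}" "X \<longlonglongrightarrow> t"
    have "(\<lambda>n. a + X n * (b - a)) \<longlonglongrightarrow> a + t * (b - a)" by (intro tendsto_intros X(2))
    moreover have "a + X n * (b - a) > 0" for n by (rule pos) (use X(1) in blast)
    ultimately show "((\<lambda>s. H1_norm (\<lambda>x. dilate (a + s * (b - a)) u x - dilate (a + t * (b - a)) u x)) \<circ> X) \<longlonglongrightarrow> 0"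
      unfolding o_def by (rule dilate_H1_norm_tendsto[OF u _ _ pos[OF t]])
  qed
qed

section \<open>The Euler-Lagrange equation and the virial identity\<close>

lemma interaction_Re_sym: "Re (interaction lam1 lam2 g f) = Re (interaction lam1 lam2 f g)"
  by (subst interaction_cnj) simp

lemma interaction_Re_linear:
  assumes "L12 f" "L12 h" "L12 g"
  shows "Re (interaction lam1 lam2 (\<lambda>x. f x + h x) g) = Re (interaction lam1 lam2 f g) + Re (interaction lam1 lam2 h g)"
    "Re (interaction lam1 lam2 g (\<lambda>x. f x + h x)) = Re (interaction lam1 lam2 g f) + Re (interaction lam1 lam2 g h)"
    "Re (interaction lam1 lam2 (\<lambda>x. complex_of_real r * f x) g) = r * Re (interaction lam1 lam2 f g)"
    "Re (interaction lam1 lam2 g (\<lambda>x. complex_of_real r * f x)) = r * Re (interaction lam1 lam2 g f)"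
proof -
  show 1: "Re (interaction lam1 lam2 (\<lambda>x. f x + h x) g) = Re (interaction lam1 lam2 f g) + Re (interaction lam1 lam2 h g)"
    using interaction_add_left[OF assms] by simp
  show 2: "Re (interaction lam1 lam2 (\<lambda>x. complex_of_real r * f x) g) = r * Re (interaction lam1 lam2 f g)"
    unfolding interaction_cmult_left by simp
  show "Re (interaction lam1 lam2 g (\<lambda>x. f x + h x)) = Re (interaction lam1 lam2 g f) + Re (interaction lam1 lam2 g h)"
    unfolding interaction_Re_sym[of lam1 lam2 g] by (rule 1)
  show "Re (interaction lam1 lam2 g (\<lambda>x. complex_of_real r * f x)) = r * Re (interaction lam1 lam2 g f)"
    unfolding interaction_Re_sym[of lam1 lam2 g] by (rule 2)
qed

text \<open>Two increments are needed because |v + e \<phi>|^2 has a first order part 2 e Re v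
  \<phi> and a second order part e^2 \<phi>^2.\<close>

lemma interaction_expand:
  fixes \<alpha> \<beta> lam1 lam2 :: real
  assumes f: "L12 f" and p: "L12 p" and q: "L12 q"
  defines "F \<equiv> \<lambda>x. f x + (complex_of_real \<alpha> * p x + complex_of_real \<beta> * q x)"
    and "I \<equiv> \<lambda>f g. Re (interaction lam1 lam2 f g)"
  shows "I F F = I f f + 2 * \<alpha> * I f p + 2 * \<beta> * I f q + \<alpha>\<^sup>2 * I p p + 2 * \<alpha> * \<beta> * I p q + \<beta>\<^sup>2 * I q q"
proof -
  let ?p = "\<lambda>x. complex_of_real \<alpha> * p x" and ?q = "\<lambda>x. complex_of_real \<beta> * q x"
  have p': "L12 ?p" and q': "L12 ?q" by (rule L12_cmult[OF p], rule L12_cmult[OF q])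
  have pq: "L12 (\<lambda>x. ?p x + ?q x)" by (rule L12_add[OF p' q'])
  have F: "L12 F" unfolding F_def by (rule L12_add[OF f pq])
  have R: "I g F = I g f + (\<alpha> * I g p + \<beta> * I g q)" if g: "L12 g" for g
    unfolding I_def F_def
    by (simp only: interaction_Re_linear(2)[OF f pq g] interaction_Re_linear(2)[OF p' q' g]
        interaction_Re_linear(4)[OF p p g] interaction_Re_linear(4)[OF q q g])
  have "I F F = I f F + (\<alpha> * I p F + \<beta> * I q F)"
    using R[OF F] interaction_Re_sym[of lam1 lam2] unfolding I_def by metis
  also have "\<dots> = I f f + (\<alpha> * I f p + \<beta> * I f q) + (\<alpha> * (I p f + (\<alpha> * I p p + \<beta> * I p q)) + \<beta> * (I q f + (\<alpha> * I q p + \<beta> * I q q)))"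
    by (simp only: R[OF f] R[OF p] R[OF q])
  also have "I p f = I f p" unfolding I_def by (rule interaction_Re_sym)
  also have "I q f = I f q" unfolding I_def by (rule interaction_Re_sym)
  also have "I q p = I p q" unfolding I_def by (rule interaction_Re_sym)
  finally show ?thesis by (simp add: algebra_simps power2_eq_square)
qed

section \<open>Expansion of the functionals along v + e \<phi>, and the first order
  conditions\<close>

lemma cmod_add_real_square:
  "(cmod (z + complex_of_real e * complex_of_real r))\<^sup>2 = (cmod z)\<^sup>2 + 2 * e * (Re z * r) + e\<^sup>2 * r\<^sup>2"
  unfolding cmod_power2 by (simp add: power2_eq_square algebra_simps)

lemma integrable_Re_mult:
  assumes "memL2 v" "memL2 (\<lambda>x. complex_of_real (\<psi> x))"
  shows "integrable lborel (\<lambda>x. Re (v x) * \<psi> x)"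
  using integrable_Re[OF memL2_integrable_mult[OF assms]] by simp

lemma Lp_norm_2_perturb:
  assumes v: "memL2 v" and \<psi>: "memL2 (\<lambda>x. complex_of_real (\<psi> x))"
  shows "(Lp_norm 2 (\<lambda>x. v x + complex_of_real e * complex_of_real (\<psi> x)))\<^sup>2
    = (Lp_norm 2 v)\<^sup>2 + 2 * e * (\<integral>x. Re (v x) * \<psi> x \<partial>lborel) + e\<^sup>2 * (Lp_norm 2 (\<lambda>x. complex_of_real (\<psi> x)))\<^sup>2"
proof -
  have i: "integrable lborel (\<lambda>x. (\<psi> x)\<^sup>2)" using memL2_integrable[OF \<psi>] by simp
  have "(\<integral>x. (cmod (v x))\<^sup>2 + 2 * e * (Re (v x) * \<psi> x) + e\<^sup>2 * (\<psi> x)\<^sup>2 \<partial>lborel)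
     = (\<integral>x. (cmod (v x))\<^sup>2 \<partial>lborel) + 2 * e * (\<integral>x. Re (v x) * \<psi> x \<partial>lborel) + e\<^sup>2 * (\<integral>x. (\<psi> x)\<^sup>2 \<partial>lborel)"
    using memL2_integrable[OF v] integrable_Re_mult[OF v \<psi>] i by simp
  then show ?thesis unfolding Lp_norm_2_square cmod_add_real_square by simp
qed

lemma test_product_L12:
  assumes v: "memL2 v" and \<phi>: "test_function \<phi>"
  shows "L12 (\<lambda>x. complex_of_real (\<phi> x) * v x)" "L12 (\<lambda>x. complex_of_real (Re (v x) * \<phi> x))"
proof -
  obtain M R where M: "\<And>x. \<bar>\<phi> x\<bar> \<le> M * indicator (cball 0 R) x" "M \<ge> 0"
    using test_function_bounded[OF \<phi>] by blast
  have bd: "\<bar>\<phi> x\<bar> \<le> M" for x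
  proof -
    have "M * indicator (cball 0 R) x \<le> M" using M(2) by (simp add: indicator_def)
    then show ?thesis using M(1)[of x] by linarith
  qed
  note [measurable] = test_function_measurable[OF \<phi>] memL2_measurable[OF v]
  show "L12 (\<lambda>x. complex_of_real (\<phi> x) * v x)" unfolding L12_def
  proof
    show "integrable lborel (\<lambda>x. complex_of_real (\<phi> x) * v x)"
      by (rule memL2_integrable_mult[OF test_function_memL2[OF \<phi>] v])
    show "memL2 (\<lambda>x. complex_of_real (\<phi> x) * v x)"
    proof (rule memL2_bound[OF v])
      show "(\<lambda>x. complex_of_real (\<phi> x) * v x) \<in> borel_measurable borel" by measurable
      show "AE x in lborel. cmod (complex_of_real (\<phi> x) * v x) \<le> M * cmod (v x)"
        unfolding norm_mult norm_of_real by (intro AE_I2 mult_right_mono bd) simp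
    qed
  qed
  show "L12 (\<lambda>x. complex_of_real (Re (v x) * \<phi> x))" unfolding L12_def
  proof
    show "integrable lborel (\<lambda>x. complex_of_real (Re (v x) * \<phi> x))"
      unfolding complex_of_real_integrable_eq by (rule integrable_Re_mult[OF v test_function_memL2[OF \<phi>]])
    show "memL2 (\<lambda>x. complex_of_real (Re (v x) * \<phi> x))"
    proof (rule memL2_bound[OF v])
      show "(\<lambda>x. complex_of_real (Re (v x) * \<phi> x)) \<in> borel_measurable borel" by measurable
      show "AE x in lborel. cmod (complex_of_real (Re (v x) * \<phi> x)) \<le> M * cmod (v x)"
      proof (rule AE_I2)
        fix x
        have "\<bar>Re (v x)\<bar> * \<bar>\<phi> x\<bar> \<le> cmod (v x) * M"
          by (intro mult_mono abs_Re_le_cmod bd) auto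
        then show "cmod (complex_of_real (Re (v x) * \<phi> x)) \<le> M * cmod (v x)"
          by (simp only: norm_of_real abs_mult mult.commute)
      qed
    qed
  qed
qed

text \<open>With A, c, V for the squared gradient norm, the squared norm and the denominator, this
  is the stationarity of log J, that is 3 a / A + b / c = 4 n / V, cleared of fractions. Minimality
  is used in the squared form J(v)^2 V(e)^2 <= A(e)^3 c(e): both sides are polynomials in e that
  agree at e = 0, so no root has to be differentiated.\<close>

lemma Euler_Lagrange:
  assumes v: "v \<in> H1" and pos: "J_denom lam1 lam2 v > 0"
    and min: "\<And>w. w \<in> H1 \<Longrightarrow> J_denom lam1 lam2 w > 0 \<Longrightarrow> J lam1 lam2 v \<le> J lam1 lam2 w"
    and \<phi>: "test_function \<phi>" and gv: "grad_norm v > 0"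
  defines "a \<equiv> \<Sum>i\<in>UNIV. \<integral>x. Re (weak_partial i v x) * partial_deriv i \<phi> x \<partial>lborel"
    and "b \<equiv> \<integral>x. Re (v x) * \<phi> x \<partial>lborel"
    and "n \<equiv> Re (interaction lam1 lam2 (sq_mod v) (\<lambda>x. complex_of_real (Re (v x) * \<phi> x)))"
  shows "J_denom lam1 lam2 v * (3 * a * (Lp_norm 2 v)\<^sup>2 + (grad_norm v)\<^sup>2 * b) = 4 * (grad_norm v)\<^sup>2 * (Lp_norm 2 v)\<^sup>2 * n"
proof -
  define A where "A = (grad_norm v)\<^sup>2"
  define c where "c = (Lp_norm 2 v)\<^sup>2"
  define V where "V = J_denom lam1 lam2 v"
  define u where "u e x = v x + complex_of_real e * complex_of_real (\<phi> x)" for e x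
  define f where "f = sq_mod v"
  define p where "p x = complex_of_real (Re (v x) * \<phi> x)" for x
  define q where "q x = complex_of_real ((\<phi> x)\<^sup>2)" for x
  note vL = H1_memL2[OF v]
  have uH: "u e \<in> H1" for e unfolding u_def by (rule H1_add[OF v H1_cmult[OF test_function_H1[OF \<phi>]]])
  have fX: "L12 f" unfolding f_def by (rule sq_mod_L12[OF v])
  have pX: "L12 p" unfolding p_def by (rule test_product_L12(2)[OF vL \<phi>])
  have qX: "L12 q"
    using test_product_L12(1)[OF test_function_memL2[OF \<phi>] \<phi>] by (simp add: q_def[abs_def] power2_eq_square)
  define c2 where "c2 = (Lp_norm 2 (\<lambda>x. complex_of_real (\<phi> x)))\<^sup>2"
  have ce: "(Lp_norm 2 (u e))\<^sup>2 = c + 2 * e * b + e\<^sup>2 * c2" for e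
    unfolding u_def c_def b_def c2_def by (rule Lp_norm_2_perturb[OF vL test_function_memL2[OF \<phi>]])
  define a2 where "a2 = (\<Sum>i\<in>UNIV. (Lp_norm 2 (\<lambda>x. complex_of_real (partial_deriv i \<phi> x)))\<^sup>2)"
  have Ae: "(grad_norm (u e))\<^sup>2 = A + 2 * e * a + e\<^sup>2 * a2" for e
  proof -
    have "grad_norm (u e) = L2_set (\<lambda>i. Lp_norm 2 (\<lambda>x. weak_partial i v x + complex_of_real e * complex_of_real (partial_deriv i \<phi> x))) UNIV"
      unfolding u_def
      by (rule grad_norm_eq[OF has_weak_partial_add[OF H1_weak_partial(1)[OF v] has_weak_partial_cmult[OF has_weak_partial_test_function[OF \<phi>]]]])
    then have "(grad_norm (u e))\<^sup>2 = (\<Sum>i\<in>UNIV. (Lp_norm 2 (\<lambda>x. weak_partial i v x + complex_of_real e * complex_of_real (partial_deriv i \<phi> x)))\<^sup>2)"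
      by (simp add: L2_set_def sum_nonneg)
    also have "\<dots> = (\<Sum>i\<in>UNIV. (Lp_norm 2 (weak_partial i v))\<^sup>2 + 2 * e * (\<integral>x. Re (weak_partial i v x) * partial_deriv i \<phi> x \<partial>lborel)
        + e\<^sup>2 * (Lp_norm 2 (\<lambda>x. complex_of_real (partial_deriv i \<phi> x)))\<^sup>2)"
      by (intro sum.cong refl Lp_norm_2_perturb H1_weak_partial(2)[OF v] test_function_memL2 test_function_partial_deriv \<phi>)
    also have "\<dots> = A + 2 * e * a + e\<^sup>2 * a2"
      unfolding a_def a2_def A_def grad_norm_L2_set L2_set_def
      by (simp add: sum.distrib sum_distrib_left sum_nonneg)
    finally show ?thesis .
  qed
  define k2 where "k2 = 2 * Re (interaction lam1 lam2 f q) + 4 * Re (interaction lam1 lam2 p p)"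
  define k3 where "k3 = 4 * Re (interaction lam1 lam2 p q)"
  define k4 where "k4 = Re (interaction lam1 lam2 q q)"
  have Ve: "J_denom lam1 lam2 (u e) = V + 4 * e * n + e\<^sup>2 * k2 + e ^ 3 * k3 + e ^ 4 * k4" for e
  proof -
    have s: "sq_mod (u e) = (\<lambda>x. f x + (complex_of_real (2 * e) * p x + complex_of_real (e\<^sup>2) * q x))"
      unfolding sq_mod_def u_def f_def p_def q_def cmod_add_real_square by (simp add: fun_eq_iff add.assoc)
    show ?thesis
      unfolding J_denom_interaction[OF uH] s interaction_expand[OF fX pX qX]
      unfolding V_def J_denom_interaction[OF v] n_def k2_def k3_def k4_def f_def[symmetric] p_def[symmetric, abs_def]
      by (simp add: power2_eq_square power3_eq_cube power4_eq_xxxx algebra_simps)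
  qed
  have Vpos: "V > 0" using pos by (simp add: V_def)
  have J2: "(J lam1 lam2 v)\<^sup>2 * V\<^sup>2 = A ^ 3 * c"
  proof -
    have "J lam1 lam2 v * V = grad_norm v ^ 3 * Lp_norm 2 v" unfolding J_def V_def using pos by simp
    then have "(J lam1 lam2 v * V)\<^sup>2 = (grad_norm v ^ 3 * Lp_norm 2 v)\<^sup>2" by simp
    then show ?thesis unfolding A_def c_def by (simp add: power_mult_distrib power_mult[symmetric])
  qed
  let ?F = "\<lambda>e. (A + 2 * e * a + e\<^sup>2 * a2) ^ 3 * (c + 2 * e * b + e\<^sup>2 * c2)
      - (J lam1 lam2 v)\<^sup>2 * (V + 4 * e * n + e\<^sup>2 * k2 + e ^ 3 * k3 + e ^ 4 * k4)\<^sup>2"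
  have F0: "?F 0 = 0" using J2 by simp
  have deriv: "(?F has_real_derivative (3 * A\<^sup>2 * (2 * a) * c + A ^ 3 * (2 * b) - (J lam1 lam2 v)\<^sup>2 * (2 * V * (4 * n)))) (at 0)"
    by (auto intro!: derivative_eq_intros simp: algebra_simps)
  \<comment> \<open>Minimality compares only with positive denominators, so e is kept in a
    neighbourhood of 0 where this polynomial is positive.\<close>
  have "((\<lambda>e. V + 4 * e * n + e\<^sup>2 * k2 + e ^ 3 * k3 + e ^ 4 * k4) \<longlongrightarrow> V + 4 * 0 * n + 0\<^sup>2 * k2 + 0 ^ 3 * k3 + 0 ^ 4 * k4) (nhds 0)"
    by (intro tendsto_intros filterlim_ident)
  then have "\<forall>\<^sub>F e in nhds 0. V + 4 * e * n + e\<^sup>2 * k2 + e ^ 3 * k3 + e ^ 4 * k4 > 0"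
    by (rule order_tendstoD) (use Vpos in simp)
  then obtain d where d: "d > 0" "\<And>e. dist e 0 < d \<Longrightarrow> V + 4 * e * n + e\<^sup>2 * k2 + e ^ 3 * k3 + e ^ 4 * k4 > 0"
    unfolding eventually_nhds_metric by blast
  have "3 * A\<^sup>2 * (2 * a) * c + A ^ 3 * (2 * b) - (J lam1 lam2 v)\<^sup>2 * (2 * V * (4 * n)) = 0"
  proof (rule DERIV_local_min[OF deriv d(1)], intro allI impI)
    fix e :: real assume "\<bar>0 - e\<bar> < d"
    then have "J_denom lam1 lam2 (u e) > 0" unfolding Ve by (intro d(2)) (simp add: dist_norm)
    from min[OF uH this] have "J lam1 lam2 v * J_denom lam1 lam2 (u e) \<le> grad_norm (u e) ^ 3 * Lp_norm 2 (u e)"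
      unfolding J_def[of lam1 lam2 "u e"] using \<open>J_denom lam1 lam2 (u e) > 0\<close> by (simp add: pos_le_divide_eq)
    moreover have "0 \<le> J lam1 lam2 v * J_denom lam1 lam2 (u e)"
      using \<open>J_denom lam1 lam2 (u e) > 0\<close> pos by (simp add: J_def)
    ultimately have "(J lam1 lam2 v * J_denom lam1 lam2 (u e))\<^sup>2 \<le> (grad_norm (u e) ^ 3 * Lp_norm 2 (u e))\<^sup>2"
      by (rule power_mono)
    also have "\<dots> = ((grad_norm (u e))\<^sup>2) ^ 3 * (Lp_norm 2 (u e))\<^sup>2"
      by (simp add: power_mult_distrib power_mult[symmetric])
    finally show "?F 0 \<le> ?F e" unfolding F0 Ae ce Ve power_mult_distrib by simp
  qed
  \<comment> \<open>Multiplying by V^2 makes J(v)^2 appear only as J(v)^2 V^2, which is A^3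
    c.\<close>
  then have "V * (V * (6 * A\<^sup>2 * a * c + 2 * A ^ 3 * b)) = 8 * n * V * ((J lam1 lam2 v)\<^sup>2 * V\<^sup>2)"
    by (simp add: algebra_simps power2_eq_square)
  then have "V * (6 * A\<^sup>2 * a * c + 2 * A ^ 3 * b) = 8 * n * (A ^ 3 * c)"
    unfolding J2 using Vpos by simp
  moreover have "A > 0" using gv by (simp add: A_def)
  ultimately have "V * (3 * a * c + A * b) = 4 * A * c * n"
  proof -
    have "2 * A\<^sup>2 * (V * (3 * a * c + A * b)) = V * (6 * A\<^sup>2 * a * c + 2 * A ^ 3 * b)"
      by (simp add: algebra_simps power2_eq_square power3_eq_cube)
    also have "\<dots> = 8 * n * (A ^ 3 * c)" by fact
    also have "\<dots> = 2 * A\<^sup>2 * (4 * A * c * n)" by (simp add: algebra_simps power2_eq_square power3_eq_cube)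
    finally show ?thesis using \<open>A > 0\<close> by simp
  qed
  then show ?thesis unfolding A_def c_def V_def .
qed

text \<open>The real part of the weak equation, in the quantities of \<open>Euler_Lagrange\<close>.
  As v is real almost everywhere, \<phi> v agrees with the conjugate of Re v \<phi>, so the two
  nonlinear terms combine into the interaction with that function.\<close>

lemma weak_solution_test:
  assumes sol: "weak_solution lam1 lam2 \<mu> v" and re: "AE x in lborel. v x \<in> \<real>" and \<phi>: "test_function \<phi>"
  shows "1 / 2 * (\<Sum>i\<in>UNIV. \<integral>x. Re (weak_partial i v x) * partial_deriv i \<phi> x \<partial>lborel)
    - Re (interaction lam1 lam2 (sq_mod v) (\<lambda>x. complex_of_real (Re (v x) * \<phi> x)))
    + \<mu> * (\<integral>x. Re (v x) * \<phi> x \<partial>lborel) = 0"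
proof -
  have v: "v \<in> H1" using sol unfolding weak_solution_def by blast
  note vL = H1_memL2[OF v]
  let ?f = "sq_mod v" and ?h = "dipole_conv (sq_mod v)"
  let ?p = "\<lambda>x. complex_of_real (Re (v x) * \<phi> x)" and ?r = "\<lambda>x. complex_of_real (\<phi> x) * v x"
  have fX: "L12 ?f" by (rule sq_mod_L12[OF v])
  have pX: "L12 ?p" by (rule test_product_L12(2)[OF vL \<phi>])
  have rX: "L12 ?r" by (rule test_product_L12(1)[OF vL \<phi>])
  have hL: "memL2 ?h" by (rule dipole_conv_memL2[OF fX])
  have rp: "AE x in lborel. ?r x = cnj (?p x)" using re
  proof eventually_elim
    case (elim x)
    then have "v x = complex_of_real (Re (v x))" by (simp add: complex_is_Real_iff complex_eq_iff)
    then show ?case by (metis complex_cnj_complex_of_real mult.commute of_real_mult)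
  qed
  have m: "memL2 ?f" "memL2 ?r" "memL2 ?p" using fX rX pX by (simp_all add: L12_def)
  have fr: "(\<integral>x. k x * ?r x \<partial>lborel) = (\<integral>x. k x * cnj (?p x) \<partial>lborel)" if k: "memL2 k" for k
  proof (rule integral_cong_AE)
    show "(\<lambda>x. k x * ?r x) \<in> borel_measurable lborel" by (rule borel_measurable_integrable[OF memL2_integrable_mult[OF k m(2)]])
    show "(\<lambda>x. k x * cnj (?p x)) \<in> borel_measurable lborel" by (rule borel_measurable_integrable[OF memL2_integrable_mult[OF k memL2_cnj[OF m(3)]]])
    show "AE x in lborel. k x * ?r x = k x * cnj (?p x)" using rp by eventually_elim simp
  qed
  have i: "integrable lborel (\<lambda>x. ?f x * ?r x)" "integrable lborel (\<lambda>x. ?h x * ?r x)" "integrable lborel ?r"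
    using memL2_integrable_mult[OF m(1,2)] memL2_integrable_mult[OF hL m(2)] rX by (simp_all add: L12_def)
  have "(\<integral>x. \<phi> x *\<^sub>R (complex_of_real lam1 * sq_mod v x * v x + complex_of_real lam2 * ?h x * v x + complex_of_real \<mu> * v x) \<partial>lborel)
      = (\<integral>x. complex_of_real lam1 * (?f x * ?r x) + complex_of_real lam2 * (?h x * ?r x) + complex_of_real \<mu> * ?r x \<partial>lborel)"
    by (intro Bochner_Integration.integral_cong) (simp_all add: scaleR_conv_of_real algebra_simps)
  also have "\<dots> = complex_of_real lam1 * (\<integral>x. ?f x * ?r x \<partial>lborel) + complex_of_real lam2 * (\<integral>x. ?h x * ?r x \<partial>lborel) + complex_of_real \<mu> * (\<integral>x. ?r x \<partial>lborel)"
    using i by simp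
  also have "\<dots> = - interaction lam1 lam2 ?f ?p + complex_of_real \<mu> * (\<integral>x. ?r x \<partial>lborel)"
    unfolding interaction_dipole_conv[OF fX pX] fr[OF m(1)] fr[OF hL] by simp
  finally have N: "(\<integral>x. \<phi> x *\<^sub>R (complex_of_real lam1 * sq_mod v x * v x + complex_of_real lam2 * ?h x * v x + complex_of_real \<mu> * v x) \<partial>lborel)
      = - interaction lam1 lam2 ?f ?p + complex_of_real \<mu> * (\<integral>x. ?r x \<partial>lborel)" .
  have r: "Re (\<integral>x. ?r x \<partial>lborel) = (\<integral>x. Re (v x) * \<phi> x \<partial>lborel)"
    using integral_Re[OF i(3)] by (simp add: mult.commute)
  have g: "Re (\<integral>x. partial_deriv i \<phi> x *\<^sub>R weak_partial i v x \<partial>lborel) = (\<integral>x. Re (weak_partial i v x) * partial_deriv i \<phi> x \<partial>lborel)" for i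
  proof -
    have "integrable lborel (\<lambda>x. partial_deriv i \<phi> x *\<^sub>R weak_partial i v x)"
      by (rule locally_integrable_test[OF test_function_partial_deriv[OF \<phi>] memL2_locally_integrable[OF H1_weak_partial(2)[OF v]]])
    from integral_Re[OF this] show ?thesis by (simp add: mult.commute)
  qed
  have "1 / 2 * (\<Sum>i\<in>UNIV. \<integral>x. partial_deriv i \<phi> x *\<^sub>R weak_partial i v x \<partial>lborel)
      + (- interaction lam1 lam2 ?f ?p + complex_of_real \<mu> * (\<integral>x. ?r x \<partial>lborel)) = 0"
    using sol \<phi> unfolding weak_solution_def N[symmetric] by blast
  then have "Re (1 / 2 * (\<Sum>i\<in>UNIV. \<integral>x. partial_deriv i \<phi> x *\<^sub>R weak_partial i v x \<partial>lborel)
      + (- interaction lam1 lam2 ?f ?p + complex_of_real \<mu> * (\<integral>x. ?r x \<partial>lborel))) = 0" by simp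
  moreover have half: "Re (1 / 2 * z) = 1 / 2 * Re z" for z by simp
  ultimately show ?thesis
    unfolding plus_complex.sel uminus_complex.sel half Re_sum g r[symmetric] by simp
qed

text \<open>Serves to replace v, which is real only almost everywhere, by the real function Re
  v.\<close>

lemma has_weak_partial_cong_AE:
  assumes u: "has_weak_partial i u g" and w: "w \<in> borel_measurable borel" and uw: "AE x in lborel. u x = w x"
  shows "has_weak_partial i w g"
proof -
  have l: "locally_integrable u" "locally_integrable g" using u unfolding has_weak_partial_def by blast+
  note [measurable] = w locally_integrable_measurable[OF l(1)]
  have lw: "locally_integrable w" unfolding locally_integrable_def set_integrable_def
  proof (intro allI impI)
    fix C :: "(real^3) set" assume C: "compact C"
    have [measurable]: "C \<in> sets borel" by (rule borel_compact[OF C])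
    show "integrable lborel (\<lambda>x. indicat_real C x *\<^sub>R w x)"
    proof (rule Bochner_Integration.integrable_cong_AE_imp[OF locally_integrableD[OF l(1) C]])
      show "AE x in lborel. indicat_real C x *\<^sub>R u x = indicat_real C x *\<^sub>R w x" using uw by eventually_elim simp
    qed measurable
  qed
  have "(\<integral>x. partial_deriv i \<phi> x *\<^sub>R w x \<partial>lborel) = - (\<integral>x. \<phi> x *\<^sub>R g x \<partial>lborel)" if \<phi>: "test_function \<phi>" for \<phi>
  proof -
    note [measurable] = test_function_measurable[OF test_function_partial_deriv[OF \<phi>]]
    have "(\<integral>x. partial_deriv i \<phi> x *\<^sub>R w x \<partial>lborel) = (\<integral>x. partial_deriv i \<phi> x *\<^sub>R u x \<partial>lborel)"
    proof (rule integral_cong_AE)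
      show "AE x in lborel. partial_deriv i \<phi> x *\<^sub>R w x = partial_deriv i \<phi> x *\<^sub>R u x" using uw by eventually_elim simp
    qed measurable
    then show ?thesis using u \<phi> unfolding has_weak_partial_def by simp
  qed
  then show ?thesis using l lw unfolding has_weak_partial_def by blast
qed

text \<open>
  Eigenfunctions of the Laplacian for different eigenvalues are orthogonal. A positive eigenfunction
  in \<open>H\<^sup>1\<close> is impossible, since its dilate by two is a positive eigenfunction for another eigenvalue.
\<close>

lemma no_positive_eigenfunction:
  assumes v: "v \<in> H1" and pos: "AE x in lborel. v x \<in> \<real> \<and> Re (v x) > 0" and gv: "grad_norm v > 0"
    and eq: "\<And>\<phi>. test_function \<phi> \<Longrightarrow>
      \<alpha> * (\<Sum>i\<in>UNIV. \<integral>x. Re (weak_partial i v x) * partial_deriv i \<phi> x \<partial>lborel) = \<beta> * (\<integral>x. Re (v x) * \<phi> x \<partial>lborel)"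
  shows "\<alpha> = (0 :: real)"
proof -
  define w where "w x = Re (v x)" for x
  define g where "g i x = Re (weak_partial i v x)" for i x
  note [measurable] = memL2_measurable[OF H1_memL2[OF v]] memL2_measurable[OF H1_weak_partial(2)[OF v]]
  have vw: "AE x in lborel. v x = complex_of_real (w x)"
    using pos by eventually_elim (simp add: w_def complex_is_Real_iff complex_eq_iff)
  have wm: "(\<lambda>x. complex_of_real (w x)) \<in> borel_measurable borel" unfolding w_def by measurable
  have wL: "memL2 (\<lambda>x. complex_of_real (w x))" by (rule memL2_cong_AE[OF H1_memL2[OF v] wm vw])
  have wg': "has_weak_partial i (\<lambda>x. complex_of_real (w x)) (\<lambda>x. complex_of_real (g i x))" for i
    unfolding w_def g_def by (rule has_weak_partial_Re[OF H1_weak_partial(1)[OF v]])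
  have gg: "AE x in lborel. weak_partial i v x = complex_of_real (g i x)" for i
    by (rule has_weak_partial_unique[OF has_weak_partial_cong_AE[OF H1_weak_partial(1)[OF v] wm vw] wg'])
  have gm: "(\<lambda>x. complex_of_real (g i x)) \<in> borel_measurable borel" for i unfolding g_def by measurable
  have gL: "memL2 (\<lambda>x. complex_of_real (g i x))" for i
    by (rule memL2_cong_AE[OF H1_weak_partial(2)[OF v] gm gg])
  have ip: "(\<integral>x. complex_of_real (k x) * complex_of_real (l x) \<partial>lborel) = complex_of_real (\<integral>x. k x * l x \<partial>lborel)" for k l :: "real^3 \<Rightarrow> real"
    unfolding of_real_mult[symmetric] by (rule integral_complex_of_real)
  \<comment> \<open>Density of test functions extends the equation to all real members of
    \<open>H1\<close>, in particular to the dilates of w.\<close>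
  have ext: "\<alpha> * (\<Sum>i\<in>UNIV. \<integral>x. g i x * h i x \<partial>lborel) = \<beta> * (\<integral>x. w x * z x \<partial>lborel)"
    if z: "memL2 (\<lambda>x. complex_of_real (z x))" and h: "\<And>i. memL2 (\<lambda>x. complex_of_real (h i x))"
      and zh: "\<And>i. has_weak_partial i (\<lambda>x. complex_of_real (z x)) (\<lambda>x. complex_of_real (h i x))" for z h
  proof -
    obtain \<phi> where \<phi>: "\<And>n. test_function (\<phi> n)"
      "L2_tendsto (\<lambda>n x. complex_of_real (\<phi> n x)) (\<lambda>x. complex_of_real (z x))"
      "\<And>i. L2_tendsto (\<lambda>n x. complex_of_real (partial_deriv i (\<phi> n) x)) (\<lambda>x. complex_of_real (h i x))"
      using test_function_dense[OF z h zh] by blast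
    have 1: "(\<lambda>n. \<integral>x. w x * \<phi> n x \<partial>lborel) \<longlonglongrightarrow> (\<integral>x. w x * z x \<partial>lborel)"
      using L2_tendsto_integral_mult[OF L2_tendsto_const[OF wL] \<phi>(2)] unfolding ip tendsto_of_real_iff .
    have 2: "(\<lambda>n. \<integral>x. g i x * partial_deriv i (\<phi> n) x \<partial>lborel) \<longlonglongrightarrow> (\<integral>x. g i x * h i x \<partial>lborel)" for i
      using L2_tendsto_integral_mult[OF L2_tendsto_const[OF gL] \<phi>(3)] unfolding ip tendsto_of_real_iff .
    have 3: "(\<lambda>n. \<alpha> * (\<Sum>i\<in>UNIV. \<integral>x. g i x * partial_deriv i (\<phi> n) x \<partial>lborel)) \<longlonglongrightarrow> \<alpha> * (\<Sum>i\<in>UNIV. \<integral>x. g i x * h i x \<partial>lborel)"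
      by (intro tendsto_mult tendsto_const tendsto_sum 2)
    have 4: "(\<lambda>n. \<beta> * (\<integral>x. w x * \<phi> n x \<partial>lborel)) \<longlonglongrightarrow> \<beta> * (\<integral>x. w x * z x \<partial>lborel)"
      by (intro tendsto_mult tendsto_const 1)
    show ?thesis
      by (rule LIMSEQ_unique[OF 3]) (use 4 in \<open>simp only: eq[OF \<phi>(1), folded w_def g_def]\<close>)
  qed
  define G where "G = (\<Sum>i\<in>UNIV. \<integral>x. g i x * g i (2 *\<^sub>R x) \<partial>lborel)"
  define B where "B = (\<integral>x. w x * w (2 *\<^sub>R x) \<partial>lborel)"
  have sc: "memL2 (\<lambda>x. complex_of_real (w (s *\<^sub>R x)))" "memL2 (\<lambda>x. complex_of_real (s * g i (s *\<^sub>R x)))"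
    "has_weak_partial i (\<lambda>x. complex_of_real (w (s *\<^sub>R x))) (\<lambda>x. complex_of_real (s * g i (s *\<^sub>R x)))" if s: "s > 0" for s i
    using memL2_scaled[OF wL s] memL2_cmult[OF memL2_scaled[OF gL s], of "complex_of_real s"] has_weak_partial_scaled[OF wg' s]
    by simp_all
  have e2: "\<alpha> * (2 * G) = \<beta> * B"
  proof -
    have "(\<Sum>i\<in>UNIV. \<integral>x. g i x * (2 * g i (2 *\<^sub>R x)) \<partial>lborel) = 2 * G"
      unfolding G_def sum_distrib_left mult.left_commute[of _ 2] integral_mult_right_zero ..
    then show ?thesis using ext[OF sc(1) sc(2) sc(3), of 2] unfolding B_def by simp
  qed
  \<comment> \<open>The substitution x = 2 y expresses pairings with the dilate by 1/2 through
    pairings with the dilate by 2, so that both tests involve the same G and B.\<close>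
  have half: "(\<integral>x. k x * k ((1 / 2) *\<^sub>R x) \<partial>lborel) = 8 * (\<integral>x. k x * k (2 *\<^sub>R x) \<partial>lborel)" for k :: "real^3 \<Rightarrow> real"
  proof -
    have "(\<integral>x. (\<lambda>x. k x * k ((1 / 2) *\<^sub>R x)) (0 + 2 *\<^sub>R x) \<partial>lborel) = (1 / \<bar>2\<bar> ^ 3) *\<^sub>R (\<integral>x. k x * k ((1 / 2) *\<^sub>R x) \<partial>lborel)"
      by (rule integral_affine3) simp
    then show ?thesis by (simp add: mult.commute)
  qed
  have e3: "\<alpha> * (4 * G) = \<beta> * (8 * B)"
  proof -
    have "(\<Sum>i\<in>UNIV. \<integral>x. g i x * (1 / 2 * g i ((1 / 2) *\<^sub>R x)) \<partial>lborel) = 4 * G"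
      unfolding G_def sum_distrib_left mult.left_commute[of _ "1 / 2"] integral_mult_right_zero half by simp
    then show ?thesis using ext[OF sc(1) sc(2) sc(3), of "1 / 2"] half[of w] unfolding B_def by simp
  qed
  \<comment> \<open>The two tests read 2 \<alpha> G = \<beta> B and 4 \<alpha> G = 8 \<beta>
    B.\<close>
  have "\<beta> * B = 0" using e2 e3 by linarith
  moreover have "B \<noteq> 0"
  proof
    assume B0: "B = 0"
    have "AE x in lborel. w x > 0" using pos by eventually_elim (simp add: w_def)
    moreover from this have "AE x in lborel. w (2 *\<^sub>R x) > 0"
      using AE_affine3[of 2 "\<lambda>x. w x > 0" 0] by simp
    ultimately have p: "AE x in lborel. w x * w (2 *\<^sub>R x) > 0" by eventually_elim simp
    have "integrable lborel (\<lambda>x. complex_of_real (w x) * complex_of_real (w (2 *\<^sub>R x)))"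
      by (rule memL2_integrable_mult[OF wL sc(1)]) simp
    then have int: "integrable lborel (\<lambda>x. w x * w (2 *\<^sub>R x))"
      unfolding of_real_mult[symmetric] complex_of_real_integrable_eq .
    have "AE x in lborel. 0 \<le> w x * w (2 *\<^sub>R x)" using p by eventually_elim simp
    from integral_nonneg_eq_0_iff_AE[OF int this] have "AE x in lborel. w x * w (2 *\<^sub>R x) = 0" using B0 by (simp add: B_def)
    with p have "AE x in (lborel :: (real^3) measure). False" by eventually_elim simp
    then show False using AE_iff_null_sets[of UNIV "lborel :: (real^3) measure"] by (simp add: null_sets_def)
  qed
  ultimately have \<beta>: "\<beta> = 0" by simp
  \<comment> \<open>With \<beta> = 0, testing with w itself leaves \<alpha> times the squared
    gradient norm.\<close>
  have "\<alpha> * (\<Sum>i\<in>UNIV. \<integral>x. g i x * g i x \<partial>lborel) = 0" using ext[OF wL gL wg'] \<beta> by simp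
  moreover have "(\<Sum>i\<in>UNIV. \<integral>x. g i x * g i x \<partial>lborel) = (grad_norm v)\<^sup>2"
  proof -
    have "(Lp_norm 2 (weak_partial i v))\<^sup>2 = (\<integral>x. g i x * g i x \<partial>lborel)" for i
    proof -
      have "Lp_norm 2 (weak_partial i v) = Lp_norm 2 (\<lambda>x. complex_of_real (g i x))"
        by (rule Lp_norm_2_cong_AE[OF _ gm gg]) measurable
      then have "(Lp_norm 2 (weak_partial i v))\<^sup>2 = (Lp_norm 2 (\<lambda>x. complex_of_real (g i x)))\<^sup>2" by simp
      also have "\<dots> = (\<integral>x. g i x * g i x \<partial>lborel)" unfolding Lp_norm_2_square by (simp add: power2_eq_square)
      finally show ?thesis .
    qed
    then show ?thesis unfolding grad_norm_L2_set L2_set_def by (simp add: sum_nonneg)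
  qed
  ultimately show ?thesis using gv by simp
qed

text \<open>Eliminating the nonlinear term between the two first order conditions gives the
  eigenvalue equation with \<alpha> = c (3 V - 2 A) and \<beta> = A (4 c \<mu> - V).\<close>

lemma minimizer_virial:
  assumes v: "v \<in> H1" and v0: "Lp_norm 2 v \<noteq> 0" and real_pos: "AE x in lborel. v x \<in> \<real> \<and> Re (v x) > 0"
    and pos: "J_denom lam1 lam2 v > 0"
    and min: "\<And>w. w \<in> H1 \<Longrightarrow> J_denom lam1 lam2 w > 0 \<Longrightarrow> J lam1 lam2 v \<le> J lam1 lam2 w"
    and sol: "weak_solution lam1 lam2 \<mu> v"
  shows "2 * (grad_norm v)\<^sup>2 = 3 * J_denom lam1 lam2 v"
proof -
  define A c V where "A = (grad_norm v)\<^sup>2" and "c = (Lp_norm 2 v)\<^sup>2" and "V = J_denom lam1 lam2 v"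
  have gv: "grad_norm v > 0" by (rule grad_norm_pos[OF v v0])
  have re: "AE x in lborel. v x \<in> \<real>" using real_pos by eventually_elim simp
  have "3 * V * c - 2 * A * c = 0"
  proof (rule no_positive_eigenfunction[OF v real_pos gv])
    fix \<phi> assume \<phi>: "test_function \<phi>"
    let ?a = "\<Sum>i\<in>UNIV. \<integral>x. Re (weak_partial i v x) * partial_deriv i \<phi> x \<partial>lborel"
    let ?b = "\<integral>x. Re (v x) * \<phi> x \<partial>lborel"
    let ?n = "Re (interaction lam1 lam2 (sq_mod v) (\<lambda>x. complex_of_real (Re (v x) * \<phi> x)))"
    have EL: "V * (3 * ?a * c + A * ?b) = 4 * A * c * ?n"
      unfolding A_def c_def V_def by (rule Euler_Lagrange[OF v pos min \<phi> gv])
    have n: "?n = 1 / 2 * ?a + \<mu> * ?b" using weak_solution_test[OF sol re \<phi>] by linarith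
    have alg: "(3 * V * c - 2 * A * c) * a = (4 * A * c * \<mu> - V * A) * b"
      if "V * (3 * a * c + A * b) = 4 * A * c * (1 / 2 * a + \<mu> * b)" for a b :: real
      using that by (simp add: algebra_simps)
    show "(3 * V * c - 2 * A * c) * ?a = (4 * A * c * \<mu> - V * A) * ?b"
      by (rule alg) (use EL in \<open>simp only: n\<close>)
  qed
  then have "c * (3 * V - 2 * A) = 0" by (simp add: algebra_simps)
  moreover have "c \<noteq> 0" using v0 by (simp add: c_def)
  ultimately show ?thesis unfolding A_def V_def by simp
qed

section \<open>The mountain pass level\<close>

lemma dilation_mp_path:
  assumes u: "u \<in> H1" and a: "a > 0" and b: "b > 0"
    and start: "(a * grad_norm u)\<^sup>2 \<le> k" and stop: "energy lam1 lam2 (dilate b u) < 0"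
  shows "(\<lambda>s. dilate (a + s * (b - a)) u) \<in> mp_paths lam1 lam2 k ((Lp_norm 2 u)\<^sup>2)"
proof -
  have pos: "a + s * (b - a) > 0" if "s \<in> {0..1}" for s
  proof -
    have "a + s * (b - a) = (1 - s) * a + s * b" by (simp add: algebra_simps)
    moreover have "(1 - s) * a \<ge> 0" "s * b \<ge> 0" using that a b by simp_all
    moreover have "(1 - s) * a > 0 \<or> s * b > 0" using that a b by (cases "s = 0") auto
    ultimately show ?thesis by linarith
  qed
  have sph: "dilate (a + s * (b - a)) u \<in> sphere_H1 ((Lp_norm 2 u)\<^sup>2)" if "s \<in> {0..1}" for s
    unfolding sphere_H1_def using dilate_H1[OF u pos[OF that]] dilate_Lp_norm[OF pos[OF that]] by simp
  have "dilate (a + 0 * (b - a)) u \<in> small_grad k ((Lp_norm 2 u)\<^sup>2)"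
    unfolding small_grad_def using sph[of 0] start dilate_grad_norm[OF u a] by simp
  then show ?thesis
    unfolding mp_paths_def using dilate_path[OF u a b] sph stop by simp
qed

text \<open>For 2 A = 3 V the gap is V / 2 times 1 - 3 t^2 + 2 t^3, and this cubic is (t - 1)^2 (2 t
  + 1).\<close>

lemma dilation_profile_max:
  fixes A V t :: real
  assumes "2 * A = 3 * V" "0 \<le> V" "0 \<le> t" shows "t\<^sup>2 * A - t ^ 3 * V \<le> A - V"
proof -
  have "A - V - (t\<^sup>2 * A - t ^ 3 * V) = V / 2 * ((t - 1)\<^sup>2 * (2 * t + 1))"
    using assms(1) by (simp add: power2_eq_square power3_eq_cube) algebra
  moreover have "0 \<le> V / 2 * ((t - 1)\<^sup>2 * (2 * t + 1))" using assms(2,3) by simp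
  ultimately show ?thesis by linarith
qed

text \<open>For t >= 0 the profile is largest at t = 2 A / (3 V), which here lies before t = 1.
  Extracting the factor t - 1 from the gap leaves a cofactor that is nonnegative because A <= 3 V /
  2.\<close>

lemma dilation_profile_decreasing:
  fixes A V t :: real
  assumes "2 * A < 3 * V" "0 \<le> A" "1 \<le> t" shows "t\<^sup>2 * A - t ^ 3 * V \<le> A - V"
proof -
  have V: "V \<ge> 0" using assms(1,2) by linarith
  have "A - V - (t\<^sup>2 * A - t ^ 3 * V) = (t - 1) * ((t\<^sup>2 + t + 1) * V - (t + 1) * A)"
    by (simp add: algebra_simps power2_eq_square power3_eq_cube)
  moreover have "(t + 1) * A \<le> (t\<^sup>2 + t + 1) * V"
  proof -
    have "(t + 1) * A \<le> (t + 1) * (3 / 2 * V)" using assms by (intro mult_left_mono) auto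
    also have "\<dots> \<le> (t\<^sup>2 + t + 1) * V"
    proof -
      have "(t\<^sup>2 + t + 1) * V - (t + 1) * (3 / 2 * V) = V / 2 * ((2 * t + 1) * (t - 1))"
        by (simp add: algebra_simps power2_eq_square)
      moreover have "0 \<le> V / 2 * ((2 * t + 1) * (t - 1))" using V assms(3) by simp
      ultimately show ?thesis by linarith
    qed
    finally show ?thesis .
  qed
  then have "0 \<le> (t - 1) * ((t\<^sup>2 + t + 1) * V - (t + 1) * A)" using assms(3) by simp
  ultimately show ?thesis by linarith
qed

lemma dilation_energy_negative:
  assumes u: "u \<in> H1" and V: "J_denom lam1 lam2 u > 0"
  obtains t where "t > 1" "energy lam1 lam2 (dilate t u) < 0"
proof -
  define A W where "A = (grad_norm u)\<^sup>2" and "W = J_denom lam1 lam2 u"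
  \<comment> \<open>The energy changes sign at t = A / W; the summand 2 also secures t > 1.\<close>
  define t where "t = A / W + 2"
  have A: "A \<ge> 0" by (simp add: A_def)
  have W: "W > 0" using V by (simp add: W_def)
  have "A / W \<ge> 0" using A W by simp
  then have t: "t > 1" unfolding t_def by linarith
  have "A < t * W" using W by (simp add: t_def distrib_right)
  then have "t\<^sup>2 * A < t\<^sup>2 * (t * W)" using t by simp
  then have "t\<^sup>2 * A - t ^ 3 * W < 0" by (simp add: power2_eq_square power3_eq_cube)
  then have "energy lam1 lam2 (dilate t u) < 0"
    using dilate_energy[OF u, of t lam1 lam2] t unfolding A_def W_def by simp
  then show thesis using that t by blast
qed

theorem theorem1p2:
  fixes lam1 lam2 \<mu> k c :: real and v :: "real^3 \<Rightarrow> complex"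
  assumes "unstable_regime lam1 lam2"
    and "v \<in> H1" and "\<not> (AE x in lborel. v x = 0)"
    and "AE x in lborel. v x \<in> \<real> \<and> Re (v x) > 0"
    and "is_arg_min (J lam1 lam2) (\<lambda>w. w \<in> H1 \<and> J_denom lam1 lam2 w > 0) v"
    and "\<mu> > 0" and "weak_solution lam1 lam2 \<mu> v"
    and "c = (Lp_norm 2 v)\<^sup>2"
    and "k > 0" and "mp_geometry lam1 lam2 k c"
  shows "ereal (energy lam1 lam2 v) = mp_level lam1 lam2 k c"
proof -
  let ?E = "energy lam1 lam2" and ?V = "J_denom lam1 lam2"
  have vH: "v \<in> H1" by fact
  have v0: "Lp_norm 2 v \<noteq> 0" using assms(3) Lp_norm_2_eq_0_iff[OF H1_memL2[OF vH]] by simp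
  have pos: "?V v > 0" and min: "\<And>w. w \<in> H1 \<Longrightarrow> ?V w > 0 \<Longrightarrow> J lam1 lam2 v \<le> J lam1 lam2 w"
    using assms(5) unfolding is_arg_min_def by (auto simp: not_less)
  have vir: "2 * (grad_norm v)\<^sup>2 = 3 * ?V v"
    by (rule minimizer_virial[OF vH v0 assms(4) pos min assms(7)])
  have gv: "grad_norm v > 0" by (rule grad_norm_pos[OF vH v0])
  have c0: "c > 0" using v0 assms(8) by simp
  have upper: "mp_level lam1 lam2 k c \<le> ereal (?E v)"
  proof -
    \<comment> \<open>The second entry of the minimum brings the squared gradient norm at the start
      below k; the entry 1 keeps a below b.\<close>
    define a where "a = min 1 (sqrt k / grad_norm v)"
    have a: "a > 0" using gv \<open>k > 0\<close> by (simp add: a_def)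
    have "a * grad_norm v \<le> sqrt k / grad_norm v * grad_norm v"
      unfolding a_def by (rule mult_right_mono) (use gv in simp_all)
    then have "a * grad_norm v \<le> sqrt k" using gv by simp
    then have "(a * grad_norm v)\<^sup>2 \<le> (sqrt k)\<^sup>2" using a gv by (intro power_mono) simp_all
    then have start: "(a * grad_norm v)\<^sup>2 \<le> k" using \<open>k > 0\<close> by simp
    obtain b where b: "b > 1" "?E (dilate b v) < 0" using dilation_energy_negative[OF vH pos] by blast
    let ?g = "\<lambda>s. dilate (a + s * (b - a)) v"
    have path: "?g \<in> mp_paths lam1 lam2 k c"
      unfolding assms(8) by (rule dilation_mp_path[OF vH a _ start b(2)]) (use b in simp)
    have "(SUP t\<in>{0..1}. ereal (?E (?g t))) \<le> ereal (?E v)"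
    proof (rule SUP_least)
      fix s :: real assume s: "s \<in> {0..1}"
      have ab: "b - a \<ge> 0" using b(1) by (simp add: a_def)
      have t: "a + s * (b - a) > 0" using a ab s by (simp add: add_pos_nonneg)
      show "ereal (?E (?g s)) \<le> ereal (?E v)"
        unfolding dilate_energy[OF vH t] energy_eq[of _ _ v] ereal_less_eq
        using dilation_profile_max[OF vir, of "a + s * (b - a)"] t pos by (intro divide_right_mono) simp_all
    qed
    then show ?thesis unfolding mp_level_def by (rule INF_lower2[OF path])
  qed
  have lower: "ereal (?E v) \<le> mp_level lam1 lam2 k c"
    unfolding mp_level_def
  proof (rule INF_greatest)
    fix g assume g: "g \<in> mp_paths lam1 lam2 k c"
    then have gpath: "H1_path g" and gS: "\<And>t. t \<in> {0..1} \<Longrightarrow> g t \<in> sphere_H1 c"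
      and g0: "g 0 \<in> small_grad k c" and g1: "?E (g 1) < 0"
      unfolding mp_paths_def by auto
    have gH: "g t \<in> H1" "(Lp_norm 2 (g t))\<^sup>2 = c" if "t \<in> {0..1}" for t
      using gS[OF that] by (simp_all add: sphere_H1_def)
    define P where "P t = 2 * (grad_norm (g t))\<^sup>2 - 3 * ?V (g t)" for t
    have contP: "continuous_on {0..1} P"
      unfolding continuous_on_def
    proof
      fix t :: real assume t: "t \<in> {0..1}"
      have ev: "\<forall>\<^sub>F s in at t within {0..1}. g s \<in> H1"
        unfolding eventually_at_filter by (rule always_eventually) (use gH(1) in blast)
      have lim: "((\<lambda>s. H1_norm (\<lambda>x. g s x - g t x)) \<longlongrightarrow> 0) (at t within {0..1})"
        using gpath t unfolding H1_path_def by blast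
      show "(P \<longlongrightarrow> P t) (at t within {0..1})"
        unfolding P_def
        by (intro tendsto_intros grad_norm_tendsto[OF ev gH(1)[OF t] lim] J_denom_tendsto[OF ev gH(1)[OF t] lim])
    qed
    have P1: "P 1 < 0"
    proof -
      have "(grad_norm (g 1))\<^sup>2 < ?V (g 1)" using g1 unfolding energy_eq by simp
      moreover have "0 \<le> (grad_norm (g 1))\<^sup>2" by simp
      ultimately show ?thesis unfolding P_def by linarith
    qed
    have P0: "P 0 \<ge> 0"
    proof (rule ccontr)
      assume "\<not> P 0 \<ge> 0"
      then have neg: "2 * (grad_norm (g 0))\<^sup>2 < 3 * ?V (g 0)" by (simp add: P_def)
      have u: "g 0 \<in> H1" "(Lp_norm 2 (g 0))\<^sup>2 = c" using gH[of 0] by simp_all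
      have "0 \<le> (grad_norm (g 0))\<^sup>2" by simp
      then have V0: "?V (g 0) > 0" using neg by linarith
      obtain b where b: "b > 1" "?E (dilate b (g 0)) < 0" using dilation_energy_negative[OF u(1) V0] by blast
      \<comment> \<open>Dilation from factor 1 onwards keeps the starting point \<open>g 0\<close>,
        so the condition on the start of the path is inherited from g.\<close>
      let ?h = "\<lambda>s. dilate (1 + s * (b - 1)) (g 0)"
      have "?h \<in> mp_paths lam1 lam2 k ((Lp_norm 2 (g 0))\<^sup>2)"
        by (rule dilation_mp_path[OF u(1) _ _ _ b(2)]) (use b g0 in \<open>simp_all add: small_grad_def\<close>)
      then have h: "?h \<in> mp_paths lam1 lam2 k c" unfolding u(2) .
      have "(SUP t\<in>{0..1}. ereal (?E (?h t))) \<le> ereal (?E (g 0))"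
      proof (rule SUP_least)
        fix s :: real assume s: "s \<in> {0..1}"
        have t: "1 \<le> 1 + s * (b - 1)" using s b(1) by simp
        then have t0: "1 + s * (b - 1) > 0" by linarith
        show "ereal (?E (?h s)) \<le> ereal (?E (g 0))"
          unfolding dilate_energy[OF u(1) t0] energy_eq[of _ _ "g 0"] ereal_less_eq
          using dilation_profile_decreasing[OF neg _ t] by (intro divide_right_mono) simp_all
      qed
      then have "mp_level lam1 lam2 k c \<le> ereal (?E (g 0))"
        unfolding mp_level_def by (rule INF_lower2[OF h])
      also have "\<dots> \<le> (SUP g\<in>mp_paths lam1 lam2 k c. ereal (?E (g 0)))" by (rule SUP_upper[OF g])
      also have "\<dots> < mp_level lam1 lam2 k c" using assms(10) unfolding mp_geometry_def by simp
      finally show False by simp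
    qed
    obtain t where t: "t \<in> {0..1}" "P t = 0"
      using IVT2'[of P 1 0 0] P0 P1 contP by auto
    let ?u = "g t"
    have u: "?u \<in> H1" "(Lp_norm 2 ?u)\<^sup>2 = c" by (rule gH[OF t(1)])+
    then have u0: "Lp_norm 2 ?u \<noteq> 0" using c0 by auto
    have gu: "grad_norm ?u > 0" by (rule grad_norm_pos[OF u(1) u0])
    have uvir: "2 * (grad_norm ?u)\<^sup>2 = 3 * ?V ?u" using t(2) by (simp add: P_def)
    \<comment> \<open>On the set \<open>P t = 0\<close> the denominator is two thirds of the squared
      gradient norm, so \<open>g t\<close> competes with v in the minimization of
      \<open>J\<close>.\<close>
    have upos: "?V ?u > 0" using uvir gu by (smt (verit) zero_less_power)
    have Lc: "Lp_norm 2 ?u = Lp_norm 2 v"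
      using u(2) assms(8) Lp_norm_2_nonneg[of ?u] Lp_norm_2_nonneg[of v] by (simp add: power2_eq_iff_nonneg)
    have Jvir: "J lam1 lam2 w = 3 / 2 * grad_norm w * Lp_norm 2 w"
      if "2 * (grad_norm w)\<^sup>2 = 3 * ?V w" "grad_norm w > 0" for w
    proof -
      have V: "?V w = 2 / 3 * (grad_norm w)\<^sup>2" using that(1) by simp
      show ?thesis unfolding J_def V using that(2) by (simp add: power2_eq_square power3_eq_cube)
    qed
    have "J lam1 lam2 v \<le> J lam1 lam2 ?u" by (rule min[OF u(1) upos])
    then have "grad_norm v \<le> grad_norm ?u"
      unfolding Jvir[OF vir gv] Jvir[OF uvir gu] Lc using v0 Lp_norm_2_nonneg[of v] by (simp add: less_le)
    then have sq: "(grad_norm v)\<^sup>2 \<le> (grad_norm ?u)\<^sup>2" using gv by (intro power_mono) simp_all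
    have Evir: "?E w = (grad_norm w)\<^sup>2 / 6" if "2 * (grad_norm w)\<^sup>2 = 3 * ?V w" for w
      unfolding energy_eq using that by simp
    have "?E v \<le> ?E ?u" unfolding Evir[OF vir] Evir[OF uvir] using sq by simp
    then have "ereal (?E v) \<le> ereal (?E ?u)" by simp
    also have "\<dots> \<le> (SUP t\<in>{0..1}. ereal (?E (g t)))" by (rule SUP_upper[OF t(1)])
    finally show "ereal (?E v) \<le> (SUP t\<in>{0..1}. ereal (?E (g t)))" .
  qed
  show ?thesis by (rule antisym[OF lower upper])
qed

end
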